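(* Let $\xi$ be a countable successor ordinal, $\xi-1$ its predecessor, and $(\beta_n)_{n=1}^\infty$ a nondecreasing sequence of ordinals with $\beta_n<\omega^\xi$ for all $n$ and $\sup_n\beta_n=\omega^\xi$. Let $\mathcal{F}_0$ be a regular family containing $\mathcal{S}_0$ with $\alpha_0=\iota(\mathcal{F}_0)<\omega^{\omega^\xi}$, and $(\theta_n)_{n=1}^\infty$ a nonincreasing null sequence in $(0,1)$. Using the standard Schreier families, for $\varepsilon>0$ and $m\in\mathbb{N}$ let $$\gamma(\varepsilon,m)=\max\{\ell(\alpha_0)+\beta_{n_s}+\dots+\beta_{n_1}: s,n_1,\dots,n_s\in\mathbb{N},\ \varepsilon\theta_{n_1}\theta_{n_2}\cdots\theta_{n_s}>\theta_m\}\quad(\max\emptyset=0).$$ If there exists $\varepsilon>0$ such that for all $\beta<\omega^\xi$ there exists $m\in\mathbb{N}$ with $\gamma(\varepsilon,m)+2+\beta<\beta_m$, then $I_b(T(\mathcal{F}_0,(\theta_n,\mathcal{S}_{\beta_n})_{n=1}^\infty))=\omega^{\omega^\xi\cdot2}$. Otherwise, $I_b(T(\mathcal{F}_0,(\theta_n,\mathcal{S}_{\beta_n})_{n=1}^\infty))=\omega^{\omega^\xi}$.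
   Context: Regular family: hereditary, spreading, compact subset of $[\mathbb{N}]^{<\infty}\subseteq2^{\mathbb{N}}$. $\iota(\mathcal{F})$: ordinal $\beta$ with $\mathcal{F}^{(\beta)}=\{\emptyset\}$ (iterated Cantor–Bendixson derived sets). $\ell(\eta)$: leading exponent of the Cantor normal form of $\eta$ ($\ell(0)=0$). $\mathcal{M}[\mathcal{N}]=\{\bigcup_{i=1}^kF_i:F_i\in\mathcal{N},F_1<\dots<F_k,\{\min F_i\}\in\mathcal{M}\}$ ($E<F$ means $\max E<\min F$). Standard Schreier families: $\mathcal{S}_0=\{\{n\}\}\cup\{\emptyset\}$, $\mathcal{S}_1=\{F:|F|\le\min F\}$, $\mathcal{S}_{\beta+1}=\mathcal{S}_1[\mathcal{S}_\beta]$, and for countable limit $\beta$, $\mathcal{S}_\beta=\{F:F\in\mathcal{S}_{\hat\beta_n}\text{ for some }n\le\min F\}$, where, fixing for each countable limit ordinal $\lambda$ a sequence $(\zeta_n)\uparrow\lambda$, for $\beta=\omega^{\beta_1}m_1+\dots+\omega^{\beta_k}m_k$ in Cantor normal form, $\hat\beta_n=\omega^{\beta_1}m_1+\dots+\omega^{\beta_k}(m_k-1)+\omega^{\beta_k-1}n$ if $\beta_k$ is a successor and $\hat\beta_n=\omega^{\beta_1}m_1+\dots+\omega^{\beta_k}(m_k-1)+\omega^{\zeta_n}$ if $\beta_k$ is a limit with sequence $(\zeta_n)$. $T(\mathcal{F}_0,(\theta_n,\mathcal{G}_n))$: completion of $c_{00}$ under the norm implicitly defined by $\|x\|=\max\{\|x\|_{\mathcal{F}_0},\sup_n\sup\theta_n\sum_i\|E_ix\|\}$,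 $\|\sum a_ke_k\|_{\mathcal{F}}=\sup_{F\in\mathcal{F}}\sum_{k\in F}|a_k|$, $Ex$ the restriction of $x$ to $E$, inner sup over $E_1<\dots<E_k$ with $\{\min E_i\}\in\mathcal{G}_n$. $I_b(E)=\sup_KI_b(E,K)$, $I_b(E,K)$ the supremum of orders of $\ell^1$-$K$ block trees (trees on the unit sphere, closed under initial segments, whose nodes are finite block bases of the unit vector basis with $\|\sum a_ix_i\|\ge K^{-1}\sum|a_i|$); order = least $\beta$ with $D^\beta(T)=\emptyset$, $D$ removing nodes without proper extensions, iterated transfinitely. *)

theory Defs
  imports Complex_Main "HOL-Library.Sublist"
begin

text \<open>Every countable ordinal is represented by a Brouwer tree: OZ is 0, OS a is a+1,
  OL f is the supremum of the (arbitrary) sequence f. Ordinals are compared by the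
  standard inductive order; equality of ordinals is oeq (mutual ole).\<close>

datatype bord = OZ | OS bord | OL "nat \<Rightarrow> bord"

inductive ole :: "bord \<Rightarrow> bord \<Rightarrow> bool" where
  ole_zero: "ole OZ x"
| ole_succ: "ole x y \<Longrightarrow> ole (OS x) (OS y)"
| ole_cocone: "ole x (f n) \<Longrightarrow> ole x (OL f)"
| ole_limiting: "(\<And>n. ole (f n) x) \<Longrightarrow> ole (OL f) x"
| ole_trans: "ole x y \<Longrightarrow> ole y z \<Longrightarrow> ole x z"

definition olt :: "bord \<Rightarrow> bord \<Rightarrow> bool" where
  "olt x y \<longleftrightarrow> ole (OS x) y"

definition oeq :: "bord \<Rightarrow> bord \<Rightarrow> bool" where
  "oeq x y \<longleftrightarrow> ole x y \<and> ole y x"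

definition is_succ_ord :: "bord \<Rightarrow> bool" where
  "is_succ_ord a \<longleftrightarrow> (\<exists>b. oeq a (OS b))"

definition is_limit_ord :: "bord \<Rightarrow> bool" where
  "is_limit_ord a \<longleftrightarrow> \<not> oeq a OZ \<and> \<not> is_succ_ord a"

primrec nat_ord :: "nat \<Rightarrow> bord" where
  "nat_ord 0 = OZ"
| "nat_ord (Suc n) = OS (nat_ord n)"

definition omega :: bord where
  "omega = OL nat_ord"

primrec oadd :: "bord \<Rightarrow> bord \<Rightarrow> bord" where
  "oadd a OZ = a"
| "oadd a (OS b) = OS (oadd a b)"
| "oadd a (OL f) = OL (\<lambda>n. oadd a (f n))"

primrec omul :: "bord \<Rightarrow> bord \<Rightarrow> bord" where
  "omul a OZ = OZ"
| "omul a (OS b) = oadd (omul a b) a"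
| "omul a (OL f) = OL (\<lambda>n. omul a (f n))"

primrec opow :: "bord \<Rightarrow> bord" \<comment> \<open>opow b = omega ^ b\<close> where
  "opow OZ = OS OZ"
| "opow (OS b) = OL (\<lambda>n. omul (opow b) (nat_ord n))"
| "opow (OL f) = OL (\<lambda>n. opow (f n))"

definition two_ord :: bord where
  "two_ord = OS (OS OZ)"

definition lead_exp :: "bord \<Rightarrow> bord" where
  "lead_exp \<eta> = (if oeq \<eta> OZ then OZ
     else (SOME \<delta>. ole (opow \<delta>) \<eta> \<and> olt \<eta> (opow (OS \<delta>))))"

text \<open>Here the natural numbers of the paper are the positive integers {1,2,...}.\<close>

definition fin_pos_sets :: "nat set set" where
  "fin_pos_sets = {F. finite F \<and> 0 \<notin> F}"

definition hereditary :: "nat set set \<Rightarrow> bool" where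
  "hereditary \<F> \<longleftrightarrow> (\<forall>F\<in>\<F>. \<forall>G. G \<subseteq> F \<longrightarrow> G \<in> \<F>)"

definition spreading :: "nat set set \<Rightarrow> bool" where
  "spreading \<F> \<longleftrightarrow> (\<forall>F\<in>\<F>. \<forall>g. strict_mono_on F g \<and> (\<forall>x\<in>F. x \<le> g x) \<longrightarrow> g ` F \<in> \<F>)"

text \<open>Compactness in 2^N (product topology; equivalently closedness, since 2^N is compact):
  a set A lies in the closure of F iff every initial segment of A agrees with that of a member.\<close>
definition compact_family :: "nat set set \<Rightarrow> bool" where
  "compact_family \<F> \<longleftrightarrow>
     (\<forall>A. (\<forall>k. \<exists>F\<in>\<F>. F \<inter> {..<k} = A \<inter> {..<k}) \<longrightarrow> A \<in> \<F>)"

definition regular_family :: "nat set set \<Rightarrow> bool" where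
  "regular_family \<F> \<longleftrightarrow> \<F> \<subseteq> fin_pos_sets \<and> hereditary \<F> \<and> spreading \<F> \<and> compact_family \<F>"

definition cb_deriv :: "nat set set \<Rightarrow> nat set set" where
  "cb_deriv \<F> = {A\<in>\<F>. \<forall>k. \<exists>F\<in>\<F>. F \<noteq> A \<and> F \<inter> {..<k} = A \<inter> {..<k}}"

primrec cb_iter :: "bord \<Rightarrow> nat set set \<Rightarrow> nat set set" where
  "cb_iter OZ \<F> = \<F>"
| "cb_iter (OS b) \<F> = cb_deriv (cb_iter b \<F>)"
| "cb_iter (OL f) \<F> = (\<Inter>n. cb_iter (f n) \<F>)"

definition cb_index :: "nat set set \<Rightarrow> bord" where
  "cb_index \<F> = (SOME \<beta>. cb_iter \<beta> \<F> = {{}})"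

definition schreier0 :: "nat set set" where
  "schreier0 = {{}} \<union> {{n} | n. n \<ge> 1}"

definition schreier1 :: "nat set set" where
  "schreier1 = {F \<in> fin_pos_sets. card F \<le> Min F \<or> F = {}}"

definition fam_comp :: "nat set set \<Rightarrow> nat set set \<Rightarrow> nat set set" where
  "fam_comp \<M> \<N> = {\<Union>(set Fs) | Fs.
      (\<forall>F\<in>set Fs. F \<in> \<N> \<and> F \<noteq> {}) \<and>
      (\<forall>i j. i < j \<and> j < length Fs \<longrightarrow> Max (Fs ! i) < Min (Fs ! j)) \<and>
      Min ` set Fs \<in> \<M>}"

definition fund_seqs :: "(bord \<Rightarrow> nat \<Rightarrow> bord) \<Rightarrow> bool" where
  "fund_seqs fs \<longleftrightarrow>
     (\<forall>l. is_limit_ord l \<longrightarrow>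
        (\<forall>n. olt (fs l n) (fs l (Suc n))) \<and> (\<forall>n. olt (fs l n) l) \<and>
        (\<forall>\<alpha>. olt \<alpha> l \<longrightarrow> (\<exists>n. olt \<alpha> (fs l n)))) \<and>
     (\<forall>l l'. oeq l l' \<longrightarrow> (\<forall>n. oeq (fs l n) (fs l' n)))"

text \<open>The standard Schreier families S_beta w.r.t. the fundamental sequences fs.
  For a limit beta, the Cantor normal form is beta = omega^eta * (mu + 1) with eta the last
  exponent (eta > 0) and omega^eta * mu = omega^beta1 m1 + ... + omega^betak (mk - 1);
  then hat beta_n = omega^eta * mu + omega^(eta-1) n (eta successor) or
  omega^eta * mu + omega^(zeta_n) (eta limit, zeta = fs eta).\<close>
definition schreier_system :: "(bord \<Rightarrow> nat \<Rightarrow> bord) \<Rightarrow> (bord \<Rightarrow> nat set set) \<Rightarrow> bool" where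
  "schreier_system fs S \<longleftrightarrow>
     (\<forall>a b. oeq a b \<longrightarrow> S a = S b) \<and>
     S OZ = schreier0 \<and>
     (\<forall>b. S (OS b) = fam_comp schreier1 (S b)) \<and>
     (\<forall>a \<eta> \<mu>. oeq a (omul (opow \<eta>) (OS \<mu>)) \<and> \<not> oeq \<eta> OZ \<longrightarrow>
        (\<forall>\<eta>'. oeq \<eta> (OS \<eta>') \<longrightarrow>
           S a = {F. F = {} \<or> (\<exists>n\<ge>1. n \<le> Min F \<and>
                    F \<in> S (oadd (omul (opow \<eta>) \<mu>) (omul (opow \<eta>') (nat_ord n))))}) \<and>
        (is_limit_ord \<eta> \<longrightarrow>
           S a = {F. F = {} \<or> (\<exists>n\<ge>1. n \<le> Min F \<and>
                    F \<in> S (oadd (omul (opow \<eta>) \<mu>) (opow (fs \<eta> n))))}))"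

definition c00 :: "(nat \<Rightarrow> real) set" where
  "c00 = {x. finite {n. x n \<noteq> 0} \<and> x 0 = 0}"

definition restr :: "nat set \<Rightarrow> (nat \<Rightarrow> real) \<Rightarrow> (nat \<Rightarrow> real)" where
  "restr E x = (\<lambda>n. if n \<in> E then x n else 0)"

definition supp :: "(nat \<Rightarrow> real) \<Rightarrow> nat set" where
  "supp x = {n. x n \<noteq> 0}"

definition fam_norm :: "nat set set \<Rightarrow> (nat \<Rightarrow> real) \<Rightarrow> real" where
  "fam_norm \<F> x = Sup {(\<Sum>k\<in>F. \<bar>x k\<bar>) | F. F \<in> \<F>}"

definition admissible :: "nat set set \<Rightarrow> nat set list \<Rightarrow> bool" where
  "admissible \<G> Es \<longleftrightarrow>
     (\<forall>E\<in>set Es. finite E \<and> E \<noteq> {}) \<and>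
     (\<forall>i j. i < j \<and> j < length Es \<longrightarrow> Max (Es ! i) < Min (Es ! j)) \<and>
     Min ` set Es \<in> \<G>"

text \<open>Standard iterative construction of the implicitly defined norm of
  T(F0, (theta_n, G_n)_n): |x|_0 = norm_F0 x,
  |x|_(k+1) = max(norm_F0 x, sup_n sup theta_n sum_i |E_i x|_k), norm = sup_k |x|_k.\<close>
primrec tnorm_iter :: "nat set set \<Rightarrow> (nat \<Rightarrow> real) \<Rightarrow> (nat \<Rightarrow> nat set set) \<Rightarrow> nat
    \<Rightarrow> (nat \<Rightarrow> real) \<Rightarrow> real" where
  "tnorm_iter F0 \<theta> G 0 x = fam_norm F0 x"
| "tnorm_iter F0 \<theta> G (Suc k) x = max (fam_norm F0 x)
     (Sup {\<theta> n * (\<Sum>E\<leftarrow>Es. tnorm_iter F0 \<theta> G k (restr E x)) | n Es.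
            n \<ge> 1 \<and> admissible (G n) Es})"

definition tnorm :: "nat set set \<Rightarrow> (nat \<Rightarrow> real) \<Rightarrow> (nat \<Rightarrow> nat set set)
    \<Rightarrow> (nat \<Rightarrow> real) \<Rightarrow> real" where
  "tnorm F0 \<theta> G x = (SUP k. tnorm_iter F0 \<theta> G k x)"

definition l1_block_seq :: "((nat \<Rightarrow> real) \<Rightarrow> real) \<Rightarrow> real \<Rightarrow> (nat \<Rightarrow> real) list \<Rightarrow> bool" where
  "l1_block_seq N K xs \<longleftrightarrow>
     (\<forall>x\<in>set xs. x \<in> c00 \<and> N x = 1) \<and>
     (\<forall>i j. i < j \<and> j < length xs \<longrightarrow> (\<forall>p\<in>supp (xs ! i). \<forall>q\<in>supp (xs ! j). p < q)) \<and>
     (\<forall>a :: nat \<Rightarrow> real. N (\<lambda>t. \<Sum>i<length xs. a i * (xs ! i) t) \<ge> (\<Sum>i<length xs. \<bar>a i\<bar>) / K)"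

definition l1_block_tree :: "((nat \<Rightarrow> real) \<Rightarrow> real) \<Rightarrow> real \<Rightarrow> (nat \<Rightarrow> real) list set \<Rightarrow> bool" where
  "l1_block_tree N K T \<longleftrightarrow>
     (\<forall>xs\<in>T. xs \<noteq> [] \<and> l1_block_seq N K xs) \<and>
     (\<forall>xs\<in>T. \<forall>ys. ys \<noteq> [] \<and> prefix ys xs \<longrightarrow> ys \<in> T)"

definition tree_deriv :: "'a list set \<Rightarrow> 'a list set" where
  "tree_deriv T = {t\<in>T. \<exists>u\<in>T. strict_prefix t u}"

primrec tree_deriv_iter :: "bord \<Rightarrow> 'a list set \<Rightarrow> 'a list set" where
  "tree_deriv_iter OZ T = T"
| "tree_deriv_iter (OS b) T = tree_deriv (tree_deriv_iter b T)"
| "tree_deriv_iter (OL f) T = (\<Inter>n. tree_deriv_iter (f n) T)"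

definition tree_order :: "'a list set \<Rightarrow> bord \<Rightarrow> bool" where
  "tree_order T \<beta> \<longleftrightarrow> tree_deriv_iter \<beta> T = {} \<and> (\<forall>\<gamma>. olt \<gamma> \<beta> \<longrightarrow> tree_deriv_iter \<gamma> T \<noteq> {})"

text \<open>I_b(E) = alpha, where I_b(E) = sup_K sup { o(T) : T an l1-K block tree }:
  every such tree has an (ordinal) order at most alpha, and every alpha' < alpha is
  exceeded by the order of some l1-K block tree.\<close>
definition Ib_is :: "((nat \<Rightarrow> real) \<Rightarrow> real) \<Rightarrow> bord \<Rightarrow> bool" where
  "Ib_is N \<alpha> \<longleftrightarrow>
     (\<forall>K\<ge>1. \<forall>T. l1_block_tree N K T \<longrightarrow> (\<exists>\<beta>. tree_order T \<beta> \<and> ole \<beta> \<alpha>)) \<and>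
     (\<forall>\<alpha>'. olt \<alpha>' \<alpha> \<longrightarrow> (\<exists>K\<ge>1. \<exists>T \<beta>. l1_block_tree N K T \<and> tree_order T \<beta> \<and> olt \<alpha>' \<beta>))"

definition gamma_term :: "bord \<Rightarrow> (nat \<Rightarrow> bord) \<Rightarrow> nat list \<Rightarrow> bord" where
  "gamma_term l \<beta> ns = foldl (\<lambda>acc n. oadd acc (\<beta> n)) l (rev ns)"

definition gamma_set :: "bord \<Rightarrow> (nat \<Rightarrow> bord) \<Rightarrow> (nat \<Rightarrow> real) \<Rightarrow> real \<Rightarrow> nat \<Rightarrow> bord set" where
  "gamma_set l \<beta> \<theta> \<epsilon> m = {gamma_term l \<beta> ns | ns.
      ns \<noteq> [] \<and> (\<forall>n\<in>set ns. n \<ge> 1) \<and> \<epsilon> * (\<Prod>n\<leftarrow>ns. \<theta> n) > \<theta> m}"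

definition gamma :: "bord \<Rightarrow> (nat \<Rightarrow> bord) \<Rightarrow> (nat \<Rightarrow> real) \<Rightarrow> real \<Rightarrow> nat \<Rightarrow> bord" where
  "gamma l \<beta> \<theta> \<epsilon> m = (SOME g.
      (gamma_set l \<beta> \<theta> \<epsilon> m = {} \<and> oeq g OZ) \<or>
      (g \<in> gamma_set l \<beta> \<theta> \<epsilon> m \<and> (\<forall>h\<in>gamma_set l \<beta> \<theta> \<epsilon> m. ole h g)))"

end

theory Submission
  imports Defs
begin

text \<open>Let \<open>N\<close> be the norm. For the upper bounds, a deep enough block tree admits averages of its blocks
  on which a prescribed family of small rank carries almost no mass; iterating this produces blocks
  that are small for \<open>\<F>\<^sub>0\<close> and for the first \<open>p\<close> of the families \<open>\<S>\<^bsub>\<beta>\<^sub>n\<^esub>\<close>. Cutting a norming tree at the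
  nodes of weight below a fixed \<open>\<tau>\<close> then shows that a further average has norm less than \<open>1/K\<close>, where
  a cut node with large index \<open>m\<close> is dealt with by a family \<open>\<O>\<close> through which \<open>\<S>\<^bsub>\<beta>\<^sub>m\<^esub>\<close> factors up to \<open>\<epsilon>\<close>.
  One may always take \<open>\<O> = \<S>\<^bsub>\<beta>\<^sub>m\<^esub>\<close>. If the condition on \<open>\<gamma>\<close> fails and \<open>\<xi> = \<zeta> + 1\<close>, the exact factorization
  \<open>\<S>\<^bsub>\<omega>\<^sup>\<zeta>k + \<alpha>\<^esub> = \<S>\<^sub>\<alpha>[\<S>\<^bsub>\<omega>\<^sup>\<zeta>k\<^esub>]\<close> compares \<open>\<S>\<^bsub>\<beta>\<^sub>m\<^esub>\<close> with a product of weights \<open>\<theta>\<^sub>n\<^sub>1\<dots>\<theta>\<^sub>n\<^sub>s\<close> of at least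
  \<open>\<theta>\<^sub>m/\<epsilon>\<close> and leaves an \<open>\<O> = \<S>\<^sub>\<alpha>\<close> with \<open>\<alpha>\<close> bounded below \<open>\<omega>\<^sup>\<xi>\<close>.

  For the lower bounds, the unit vectors indexed by \<open>\<S>\<^bsub>\<beta>\<^sub>n\<^esub>\<close> form a block tree with constant \<open>1/\<theta>\<^sub>n\<close>. If
  the condition on \<open>\<gamma>\<close> holds, the part of \<open>N\<close> coming from products of weights above \<open>\<theta>\<^sub>m/\<epsilon>\<close> lives on a
  family of rank below \<open>\<omega>\<close> to the power \<open>\<gamma>(\<epsilon>, m) + 1\<close>, so averages over \<open>\<S>\<^bsub>\<beta>\<^sub>m\<^esub>\<close> divided by \<open>\<theta>\<^sub>m\<close> have
  norm at most about \<open>1 + 1/\<epsilon>\<close> and still generate a block tree with that constant, of order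
  arbitrarily close to \<open>\<omega>\<^sup>\<omega>\<^sup>\<xi>\<close>. Composing such trees with \<open>\<S>\<^bsub>\<beta>\<^sub>n\<^esub>\<close> multiplies the orders.\<close>

section \<open>Countable ordinals\<close>

text \<open>Averaging can make only finitely many families negligible at a time, while the norm
  involves all of them. The order of choices resolves this: since the weights tend to 0, the blocks
  built so far are harmless for all m beyond some M, so the next block needs to be averaged only for
  p < m \<le> M. Then for each m > p at most one block fails. A block costs rank
  \<open>\<omega>^\<eta>\<close>, the final average over blocks multiplies this by
  \<open>\<omega>^g\<close> with g < \<open>\<omega>^\<xi>\<close>. Thus \<eta> =
  \<open>\<omega>^\<xi>\<close> leads to the exponent \<open>\<omega>^\<xi> * 2\<close>, and \<eta>
  < \<open>\<omega>^\<xi>\<close> to \<open>\<omega>^\<xi>\<close>. Schreier families are not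
  monotone in the index. For \<xi> = \<zeta> + 1 every ordinal below \<open>\<omega>^\<xi>\<close>
  is \<open>\<omega>^\<zeta> * k\<close> plus a remainder, and splitting off multiples of
  \<open>\<omega>^\<zeta>\<close> is exact on all sets. Ordinal addition does not commute, but the
  coefficients of \<open>\<omega>^\<zeta>\<close> add up, so comparing a word of indices with
  \<open>\<beta> m\<close> becomes a comparison of natural numbers. Ranks are handled by explicit
  rank functions (upper bounds) and by clocks (lower bounds), because both multiply under
  composition.\<close>

primrec blt :: "(bord \<Rightarrow> bool) \<Rightarrow> bord \<Rightarrow> bool" where
  "blt p OZ = False"
| "blt p (OS y) = p y"
| "blt p (OL f) = (\<exists>n. blt p (f n))"

text \<open>The rule \<open>ole_trans\<close> makes inversion of \<open>ole\<close> useless; the recursive version \<open>ble\<close>, in which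
  \<open>blt (ble x)\<close> plays the role of strict inequality, does not have this defect.\<close>

primrec ble :: "bord \<Rightarrow> bord \<Rightarrow> bool" where
  "ble OZ = (\<lambda>y. True)"
| "ble (OS x) = blt (ble x)"
| "ble (OL f) = (\<lambda>y. \<forall>n. ble (f n) y)"

lemma ble_cocone: "ble x (f n) \<Longrightarrow> ble x (OL f)"
  by (induction x) auto

lemma ble_refl: "ble x x"
  by (induction x) (auto intro: ble_cocone)

text \<open>The assumption \<open>T\<close> is the induction hypothesis for \<open>x\<close> in
  \<open>ble_trans\<close>. With \<open>x\<close> fixed the induction runs over \<open>y\<close>,
  and over \<open>z\<close> when \<open>y\<close> is a successor.\<close>

lemma blt_ble_trans:
  assumes T: "\<And>y z. ble x y \<Longrightarrow> ble y z \<Longrightarrow> ble x z"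
  shows "blt (ble x) y \<Longrightarrow> ble y z \<Longrightarrow> blt (ble x) z"
proof (induction y arbitrary: z)
  case (OS y)
  from OS.prems(2) have "blt (ble y) z" by simp
  then show ?case
    by (induction z) (use T OS.prems(1) in auto)
qed auto

lemma ble_trans: "ble x y \<Longrightarrow> ble y z \<Longrightarrow> ble x z"
proof (induction x arbitrary: y z)
  case (OS x)
  then show ?case using blt_ble_trans[of x y z] by (metis ble.simps(2))
next
  case (OL f)
  then show ?case by simp (meson rangeI)
qed auto

lemma ole_iff_ble: "ole x y \<longleftrightarrow> ble x y"
proof
  show "ole x y \<Longrightarrow> ble x y"
    by (induction rule: ole.induct) (auto intro: ble_cocone ble_trans)
  show "ble x y \<Longrightarrow> ole x y"
  proof (induction x arbitrary: y)
    case (OS x)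
    from OS.prems have "blt (ble x) y" by simp
    then show ?case
      by (induction y) (use OS.IH in \<open>auto intro: ole.intros\<close>)
  qed (auto intro: ole.intros)
qed

lemma ole_refl [simp]: "ole x x"
  by (simp add: ole_iff_ble ble_refl)

lemma olt_OZ [simp]: "\<not> olt x OZ"
  by (simp add: olt_def ole_iff_ble)

lemma olt_OS [simp]: "olt x (OS y) \<longleftrightarrow> ole x y"
  by (simp add: olt_def ole_iff_ble)

lemma olt_OL [simp]: "olt x (OL f) \<longleftrightarrow> (\<exists>n. olt x (f n))"
  by (simp add: olt_def ole_iff_ble)

lemma ole_OL [simp]: "ole (OL f) y \<longleftrightarrow> (\<forall>n. ole (f n) y)"
  by (simp add: ole_iff_ble)

lemma ole_OS_self: "ole x (OS x)"
proof (induction x)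
  case (OL f)
  have "ole (f n) (OS (OL f))" for n
    by (meson OL ole.intros ole_refl ole_trans rangeI)
  then show ?case by simp
qed (auto intro: ole.intros)

lemma ole_total: "ole x y \<or> olt y x"
proof (induction x arbitrary: y)
  case (OS x)
  have "olt x y \<or> ole y x"
  proof (induction y)
    case (OS y)
    show ?case using \<open>\<And>y. ole x y \<or> olt y x\<close>[of y] by (auto simp: olt_def intro: ole_succ)
  qed (auto intro: ole.intros)
  then show ?case by (auto simp: olt_def intro: ole_succ)
next
  case (OL f)
  then show ?case by simp (meson rangeI)
qed (auto intro: ole.intros)

lemma olt_imp_ole: "olt x y \<Longrightarrow> ole x y"
  unfolding olt_def using ole_OS_self ole_trans by blast

lemma ole_olt_trans: "ole x y \<Longrightarrow> olt y z \<Longrightarrow> olt x z"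
  unfolding olt_def using ole_succ ole_trans by blast

lemma olt_ole_trans: "olt x y \<Longrightarrow> ole y z \<Longrightarrow> olt x z"
  unfolding olt_def using ole_trans by blast

text \<open>Accessibility is proved for everything below a tree: a strict predecessor of an ordinal
  below \<open>OL f\<close> lies below some \<open>f n\<close> without having to be one of
  them.\<close>

lemma wfP_olt: "wfP olt"
proof -
  have "Wellfounded.accp olt x" if "ole x y" for x y
    using that
  proof (induction y arbitrary: x rule: bord.induct)
    case OZ
    show ?case by (rule accpI) (metis OZ olt_ole_trans olt_OZ)
  next
    case (OS y)
    show ?case by (rule accpI) (metis OS olt_ole_trans olt_OS)
  next
    case (OL f)
    show ?case
    proof (rule accpI)
      fix z assume "olt z x"
      then obtain n where "olt z (f n)"
        by (metis OL.prems olt_ole_trans olt_OL)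
      then show "Wellfounded.accp olt z"
        using OL.IH olt_imp_ole by blast
    qed
  qed
  then show ?thesis
    unfolding wfp_iff_accp using ole_refl by blast
qed

lemma olt_irrefl [simp]: "\<not> olt x x"
  using wfP_olt by (metis wfp_iff_ex_minimal[THEN iffD1, rule_format, of olt "{x}"] singletonD singletonI insert_not_empty)

lemma not_ole: "\<not> ole x y \<longleftrightarrow> olt y x"
  using ole_total ole_olt_trans olt_irrefl by blast

lemma oeq_equivp: "equivp oeq"
  by (rule equivpI) (auto simp: reflp_def symp_def transp_def oeq_def intro: ole_trans)

\<comment> \<open>In the quotient \<open>oeq\<close> becomes equality, so rewriting,
  \<open>LEAST\<close>, \<open>Max\<close> and well-founded induction apply to countable ordinals
  directly.\<close>
quotient_type cord = bord / oeq
  by (rule oeq_equivp)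

instantiation cord :: wellorder
begin

lift_definition less_eq_cord :: "cord \<Rightarrow> cord \<Rightarrow> bool" is ole
  by (auto simp: oeq_def intro: ole_trans)

lift_definition less_cord :: "cord \<Rightarrow> cord \<Rightarrow> bool" is olt
  by (meson oeq_def ole_olt_trans olt_ole_trans)

instance
proof
  fix x y z :: cord
  show "x < y \<longleftrightarrow> x \<le> y \<and> \<not> y \<le> x"
    by transfer (auto simp: not_ole olt_imp_ole)
  show "x \<le> x" by transfer simp
  show "x \<le> y \<Longrightarrow> y \<le> z \<Longrightarrow> x \<le> z" by transfer (rule ole_trans)
  show "x \<le> y \<Longrightarrow> y \<le> x \<Longrightarrow> x = y" by transfer (simp add: oeq_def)
  show "x \<le> y \<or> y \<le> x" by transfer (use not_ole olt_imp_ole in blast)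
next
  fix P :: "cord \<Rightarrow> bool" and a :: cord
  assume step: "\<And>x. (\<And>y. y < x \<Longrightarrow> P y) \<Longrightarrow> P x"
  have "P (abs_cord b)" for b
    using wfP_olt
  proof (induction b rule: wfp_induct_rule)
    case (less b)
    show ?case
    proof (rule step)
      fix y assume "y < abs_cord b"
      then show "P y" using less
        by (metis Quotient3_abs_rep Quotient3_cord less_cord.abs_eq)
    qed
  qed
  then show "P a" by (metis Quotient3_abs_rep Quotient3_cord)
qed

end

lemma oeq_iff: "oeq a b \<longleftrightarrow> abs_cord a = abs_cord b"
  by (simp add: cord.abs_eq_iff)

lemma olt_iff: "olt a b \<longleftrightarrow> abs_cord a < abs_cord b"
  by (simp add: less_cord.abs_eq)

lemma ole_iff: "ole a b \<longleftrightarrow> abs_cord a \<le> abs_cord b"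
  by (simp add: less_eq_cord.abs_eq)

lemma abs_rep_cord [simp]: "abs_cord (rep_cord x) = x"
  using Quotient3_abs_rep Quotient3_cord by fastforce

definition csup :: "(nat \<Rightarrow> cord) \<Rightarrow> cord" where
  "csup f = abs_cord (OL (\<lambda>n. rep_cord (f n)))"

definition csuc :: "cord \<Rightarrow> cord" where
  "csuc a = abs_cord (OS (rep_cord a))"

lemma csup_le_iff [simp]: "csup f \<le> y \<longleftrightarrow> (\<forall>n. f n \<le> y)"
proof -
  have "ole (OL (\<lambda>n. rep_cord (f n))) (rep_cord y) \<longleftrightarrow> (\<forall>n. ole (rep_cord (f n)) (rep_cord y))" by simp
  then show ?thesis unfolding csup_def ole_iff by simp
qed

lemma less_csup_iff [simp]: "y < csup f \<longleftrightarrow> (\<exists>n. y < f n)"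
  by (metis csup_le_iff linorder_not_less)

lemma less_csuc_iff [simp]: "x < csuc y \<longleftrightarrow> x \<le> y"
proof -
  have "olt (rep_cord x) (OS (rep_cord y)) \<longleftrightarrow> ole (rep_cord x) (rep_cord y)" by simp
  then show ?thesis unfolding csuc_def olt_iff ole_iff by simp
qed

lemma csuc_le_iff [simp]: "csuc x \<le> y \<longleftrightarrow> x < y"
  by (metis less_csuc_iff linorder_not_less)

lemma csuc_inject [simp]: "csuc x = csuc y \<longleftrightarrow> x = y"
  by (metis csuc_le_iff less_csuc_iff order_antisym order_refl)

lemma le_csup: "f n \<le> csup f"
  using csup_le_iff by blast

lemma abs_cord_OS: "abs_cord (OS a) = csuc (abs_cord a)"
proof (rule antisym)
  show "abs_cord (OS a) \<le> csuc (abs_cord a)"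
    by (metis abs_rep_cord csuc_def ole_iff ole_succ order_refl)
  show "csuc (abs_cord a) \<le> abs_cord (OS a)"
    by (metis csuc_le_iff olt_OS olt_iff ole_refl)
qed

lemma abs_cord_OL: "abs_cord (OL f) = csup (\<lambda>n. abs_cord (f n))"
proof -
  have "abs_cord (OL f) \<le> y \<longleftrightarrow> (\<forall>n. abs_cord (f n) \<le> y)" for y
  proof -
    have "ole (OL f) (rep_cord y) \<longleftrightarrow> (\<forall>n. ole (f n) (rep_cord y))" by simp
    then show ?thesis unfolding ole_iff by simp
  qed
  then show ?thesis by (meson csup_le_iff order_antisym order_refl)
qed

section \<open>Ordinal arithmetic on the quotient\<close>

instantiation cord :: "{plus,times,zero,one}"
begin
definition zero_cord :: cord where "zero_cord = abs_cord OZ"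
definition one_cord :: cord where "one_cord = csuc 0"
definition plus_cord :: "cord \<Rightarrow> cord \<Rightarrow> cord" where
  "plus_cord a b = abs_cord (oadd (rep_cord a) (rep_cord b))"
definition times_cord :: "cord \<Rightarrow> cord \<Rightarrow> cord" where
  "times_cord a b = abs_cord (omul (rep_cord a) (rep_cord b))"
instance ..
end

definition cpow :: "cord \<Rightarrow> cord" where
  "cpow a = abs_cord (opow (rep_cord a))"

lemma cord_zero_le [simp]: "(0::cord) \<le> x"
  by (metis abs_rep_cord ole_iff ole_zero zero_cord_def)

lemma cord_not_less_zero [simp]: "\<not> x < (0::cord)"
  by (simp add: linorder_not_less)

lemma cord_le_zero [simp]: "x \<le> (0::cord) \<longleftrightarrow> x = 0"
  by (metis cord_zero_le order_antisym order_refl)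

lemma cord_pos_iff: "0 < (x::cord) \<longleftrightarrow> x \<noteq> 0"
  by (metis cord_zero_le order_le_less less_irrefl)

text \<open>The sequence in the last case need not increase and its supremum may be attained;
  \<open>less_cpow_ex\<close> has to separate that situation.\<close>

lemma cord_induct [case_names zero suc sup]:
  assumes "P 0" "\<And>x. P x \<Longrightarrow> P (csuc x)" "\<And>f. (\<And>n. P (f n)) \<Longrightarrow> P (csup f)"
  shows "P (x::cord)"
proof -
  have "P (abs_cord b)" for b
    by (induction b) (use assms in \<open>auto simp: abs_cord_OS abs_cord_OL zero_cord_def\<close>)
  then show ?thesis by (metis abs_rep_cord)
qed

lemma oadd_left: "abs_cord a = abs_cord a' \<Longrightarrow> abs_cord (oadd a b) = abs_cord (oadd a' b)"
  by (induction b) (auto simp: abs_cord_OS abs_cord_OL)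

lemma oadd_mono: "ole b b' \<Longrightarrow> ole (oadd a b) (oadd a b')"
proof (induction rule: ole.induct)
  case (ole_zero x)
  show ?case
  proof (induction x)
    case (OL f)
    then show ?case by (metis oadd.simps(3) ole_cocone rangeI)
  qed (auto intro: ole_trans ole_OS_self)
qed (auto intro: ole.intros)

lemma oadd_cong: "abs_cord a = abs_cord a' \<Longrightarrow> abs_cord b = abs_cord b' \<Longrightarrow>
    abs_cord (oadd a b) = abs_cord (oadd a' b')"
  by (metis antisym oadd_left oadd_mono ole_iff order_refl)

lemma abs_oadd: "abs_cord (oadd a b) = abs_cord a + abs_cord b"
  unfolding plus_cord_def by (rule oadd_cong) auto

lemma cord_add_zero [simp]: "(x::cord) + 0 = x"
  by (metis abs_oadd abs_rep_cord oadd.simps(1) zero_cord_def)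

lemma cord_add_suc [simp]: "(x::cord) + csuc y = csuc (x + y)"
  by (metis abs_cord_OS abs_oadd abs_rep_cord oadd.simps(2))

lemma cord_add_sup [simp]: "(x::cord) + csup f = csup (\<lambda>n. x + f n)"
proof -
  have "x + csup f = abs_cord (oadd (rep_cord x) (OL (\<lambda>n. rep_cord (f n))))"
    by (simp add: abs_oadd abs_cord_OL del: oadd.simps)
  then show ?thesis by (simp add: abs_cord_OL abs_oadd)
qed

lemma cord_zero_add [simp]: "0 + (x::cord) = x"
  by (induction x rule: cord_induct) auto

lemma cord_add_le_mono_right: "y \<le> z \<Longrightarrow> (x::cord) + y \<le> x + z"
  by (metis abs_oadd abs_rep_cord oadd_mono ole_iff)

lemma cord_add_less_mono_right: "y < z \<Longrightarrow> (x::cord) + y < x + z"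
  by (metis cord_add_le_mono_right cord_add_suc csuc_le_iff)

lemma cord_add_less_cancel [simp]: "(x::cord) + y < x + z \<longleftrightarrow> y < z"
  by (metis cord_add_le_mono_right cord_add_less_mono_right linorder_not_less)

lemma cord_add_le_cancel [simp]: "(x::cord) + y \<le> x + z \<longleftrightarrow> y \<le> z"
  by (metis cord_add_less_cancel linorder_not_less)

lemma cord_add_left_cancel [simp]: "(x::cord) + y = x + z \<longleftrightarrow> y = z"
  by (metis cord_add_le_cancel order_antisym order_refl)

lemma csup_mono: "(\<And>n. f n \<le> g n) \<Longrightarrow> csup f \<le> csup g"
  by (meson csup_le_iff le_csup order_trans)

lemma csuc_le_mono [simp]: "csuc x \<le> csuc y \<longleftrightarrow> x \<le> y"
  by (metis csuc_le_iff less_csuc_iff)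

lemma cord_add_le_mono_left: "x \<le> y \<Longrightarrow> x + z \<le> y + (z::cord)"
  by (induction z rule: cord_induct) (auto intro: csup_mono simp del: csup_le_iff)

lemma cord_add_mono: "x \<le> y \<Longrightarrow> z \<le> w \<Longrightarrow> x + z \<le> y + (w::cord)"
  by (meson cord_add_le_mono_left cord_add_le_mono_right order_trans)

lemma cord_add_assoc: "(x + y) + z = x + (y + z :: cord)"
  by (induction z rule: cord_induct) auto

lemma cord_le_add1 [simp]: "(x::cord) \<le> x + y"
  using cord_add_le_mono_right[of 0 y x] by simp

lemma cord_le_add2 [simp]: "(y::cord) \<le> x + y"
  using cord_add_le_mono_left[of 0 x y] by simp

text \<open>Left subtraction. The least \<open>z\<close> with y \<le> x + z gives equality by
  continuity on the right: if x + v < y for all v < w, then x + w \<le> y.\<close>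

lemma cord_le_ex_add: "(x::cord) \<le> y \<Longrightarrow> \<exists>z. y = x + z"
proof -
  assume "x \<le> y"
  define z where "z = (LEAST z. y \<le> x + z)"
  have z: "y \<le> x + z" unfolding z_def by (rule LeastI[of _ y]) simp
  have "x + z \<le> y"
  proof (rule ccontr)
    assume *: "\<not> x + z \<le> y"
    have less: "x + w < y" if "w < z" for w
      using that not_less_Least unfolding z_def by (metis linorder_not_less)
    have "x + w \<le> y" if "\<And>v. v < w \<Longrightarrow> x + v < y" for w
      using that
    proof (induction w rule: cord_induct)
      case (suc w) then show ?case by (simp)
    next
      case (sup f)
      have "x + f n \<le> y" for n
        by (rule sup.IH) (use sup.prems less_csup_iff in blast)
      then show ?case by simp
    qed (use \<open>x \<le> y\<close> in auto)
    then show False using * less by blast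
  qed
  then show ?thesis using z by (intro exI[of _ z]) simp
qed

lemma cord_add_sup_split: "w < x + (y::cord) \<Longrightarrow> w < x \<or> (\<exists>z<y. w = x + z)"
  by (metis cord_add_less_cancel cord_le_ex_add linorder_not_less)

lemma omul_left: "abs_cord a = abs_cord a' \<Longrightarrow> abs_cord (omul a b) = abs_cord (omul a' b)"
  by (induction b) (auto simp: abs_cord_OS abs_cord_OL abs_oadd)

lemma omul_mono: "ole b b' \<Longrightarrow> ole (omul a b) (omul a b')"
proof (induction rule: ole.induct)
  case (ole_succ x y)
  then show ?case by (simp add: ole_iff abs_oadd cord_add_le_mono_left)
qed (auto intro: ole.intros)

lemma omul_cong: "abs_cord a = abs_cord a' \<Longrightarrow> abs_cord b = abs_cord b' \<Longrightarrow>
    abs_cord (omul a b) = abs_cord (omul a' b')"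
  by (metis antisym omul_left omul_mono ole_iff order_refl)

lemma abs_omul: "abs_cord (omul a b) = abs_cord a * abs_cord b"
  unfolding times_cord_def by (rule omul_cong) auto

lemma cord_mul_zero [simp]: "(x::cord) * 0 = 0"
  by (metis abs_omul abs_rep_cord omul.simps(1) zero_cord_def)

lemma cord_mul_suc [simp]: "(x::cord) * csuc y = x * y + x"
  by (metis abs_cord_OS abs_oadd abs_omul abs_rep_cord omul.simps(2))

lemma cord_mul_sup [simp]: "(x::cord) * csup f = csup (\<lambda>n. x * f n)"
proof -
  have "x * csup f = abs_cord (omul (rep_cord x) (OL (\<lambda>n. rep_cord (f n))))"
    by (simp add: abs_omul abs_cord_OL del: omul.simps)
  then show ?thesis by (simp add: abs_cord_OL abs_omul)
qed

lemma cord_mul_one [simp]: "(x::cord) * 1 = x"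
  by (simp add: one_cord_def)

lemma cord_one_mul [simp]: "1 * (x::cord) = x"
  by (induction x rule: cord_induct) (auto simp: one_cord_def)

lemma cord_mul_le_mono_right: "y \<le> z \<Longrightarrow> (x::cord) * y \<le> x * z"
  by (metis abs_omul abs_rep_cord omul_mono ole_iff)

lemma cord_mul_le_mono_left: "x \<le> y \<Longrightarrow> x * z \<le> y * (z::cord)"
  by (induction z rule: cord_induct)
    (auto intro: csup_mono cord_add_mono simp del: csup_le_iff)

lemma cord_mul_less_mono: "y < z \<Longrightarrow> 0 < x \<Longrightarrow> (x::cord) * y < x * z"
proof -
  assume "y < z" "0 < x"
  then have "x * y < x * csuc y"
    using cord_add_less_mono_right[of 0 x "x * y"] by simp
  also have "x * csuc y \<le> x * z"
    using \<open>y < z\<close> by (intro cord_mul_le_mono_right) simp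
  finally show ?thesis .
qed

lemma cord_distrib: "(x::cord) * (y + z) = x * y + x * z"
  by (induction z rule: cord_induct) (auto simp: cord_add_assoc)

lemma cord_mul_assoc: "(x * y) * z = x * (y * z :: cord)"
  by (induction z rule: cord_induct) (auto simp: cord_distrib)

instance cord :: "{monoid_add, monoid_mult}"
  by standard (auto simp: cord_add_assoc cord_mul_assoc)

lemma cord_mul_division: "w < x * (y::cord) \<Longrightarrow> \<exists>z<y. \<exists>r<x. w = x * z + r"
proof (induction y rule: cord_induct)
  case (suc y)
  then have "w < x * y + x" by simp
  then consider "w < x * y" | r where "r < x" "w = x * y + r"
    using cord_add_sup_split by blast
  then show ?case
  proof cases
    case 1
    then show ?thesis using suc.IH by (meson less_csuc_iff less_imp_le)
  next
    case 2
    then show ?thesis by (metis less_csuc_iff order_refl)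
  qed
next
  case (sup f)
  then show ?case by (metis cord_mul_sup less_csup_iff)
qed simp

abbreviation cnat :: "nat \<Rightarrow> cord" where "cnat \<equiv> \<lambda>n. abs_cord (nat_ord n)"

lemma cnat_0 [simp]: "cnat 0 = 0" by (simp add: zero_cord_def)
lemma cnat_Suc: "cnat (Suc n) = csuc (cnat n)" by (simp add: abs_cord_OS)

definition comega :: cord where "comega = csup cnat"

lemma csuc_eq: "csuc x = x + 1"
  by (simp add: one_cord_def)

lemma cnat_add: "cnat (m + n) = cnat m + cnat n"
  by (induction n) (simp_all add: abs_cord_OS zero_cord_def[symmetric])

lemma cnat_mono: "m \<le> n \<Longrightarrow> cnat m \<le> cnat n"
  by (metis cnat_add cord_le_add1 le_Suc_ex)

lemma cnat_less_iff [simp]: "cnat m < cnat n \<longleftrightarrow> m < n"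
  by (metis cnat_Suc cnat_mono csuc_le_iff linorder_not_less not_less_eq_eq less_Suc_eq_le)

lemma less_cnat_ex: "x < cnat n \<Longrightarrow> \<exists>m<n. x = cnat m"
proof (induction n)
  case (Suc n)
  then have "x \<le> cnat n" by (simp add: abs_cord_OS)
  then show ?case using Suc.IH by (metis less_Suc_eq order_le_less)
qed (simp add: zero_cord_def[symmetric])

section \<open>Powers of omega\<close>

lemma ble_opow_cong: "abs_cord (opow (OS b)) = abs_cord (opow b) * comega"
  by (simp add: abs_cord_OL abs_omul comega_def)

lemma cnat_Suc0: "cnat (Suc 0) = 1"
  by (simp add: cnat_Suc one_cord_def del: nat_ord.simps)

lemma cpos_mul_comega: "x \<le> x * comega"
proof -
  have "x * cnat (Suc 0) \<le> x * comega"
    unfolding comega_def by (rule cord_mul_le_mono_right) (rule le_csup)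
  then show ?thesis by (simp only: cnat_Suc0 cord_mul_one)
qed

lemma opow_mono: "ole a b \<Longrightarrow> ole (opow a) (opow b)"
proof (induction rule: ole.induct)
  case (ole_zero x)
  show ?case
  proof (induction x)
    case (OS x)
    then show ?case using cpos_mul_comega
      by (metis ble_opow_cong ole_iff order_trans)
  next
    case (OL f)
    then show ?case by (metis opow.simps(3) ole_cocone rangeI)
  qed simp
next
  case (ole_succ x y)
  then show ?case by (metis ble_opow_cong cord_mul_le_mono_left ole_iff)
qed (auto intro: ole.intros)

lemma abs_opow: "abs_cord (opow a) = cpow (abs_cord a)"
  unfolding cpow_def by (metis abs_rep_cord antisym ole_iff opow_mono order_refl)

lemma cpow_zero [simp]: "cpow 0 = 1"
proof -
  have "cpow 0 = abs_cord (opow OZ)" by (simp add: abs_opow zero_cord_def del: opow.simps)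
  then show ?thesis by (simp add: abs_cord_OS one_cord_def zero_cord_def)
qed

lemma cpow_suc [simp]: "cpow (csuc a) = cpow a * comega"
  by (metis abs_cord_OS abs_opow abs_rep_cord ble_opow_cong)

lemma cpow_sup [simp]: "cpow (csup f) = csup (\<lambda>n. cpow (f n))"
proof -
  have "cpow (csup f) = abs_cord (opow (OL (\<lambda>n. rep_cord (f n))))"
    by (simp add: abs_cord_OL abs_opow del: opow.simps)
  then show ?thesis by (simp add: abs_cord_OL abs_opow)
qed

lemma cpow_le_mono: "a \<le> b \<Longrightarrow> cpow a \<le> cpow b"
  by (metis abs_opow abs_rep_cord ole_iff opow_mono)

lemma cpow_add: "cpow (a + b) = cpow a * cpow b"
  by (induction b rule: cord_induct) (auto simp: cord_mul_assoc)

lemma cord_one_le: "1 \<le> (x::cord) \<longleftrightarrow> x \<noteq> 0"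
  by (metis cord_pos_iff csuc_le_iff one_cord_def)

lemma cpow_pos [simp]: "0 < cpow a"
  by (metis cord_one_le cord_pos_iff cord_zero_le cpow_le_mono cpow_zero)

lemma cnat_less_comega: "cnat n < comega"
  by (metis cnat_less_iff comega_def less_csup_iff lessI)

lemma less_comega_ex: "x < comega \<Longrightarrow> \<exists>n. x = cnat n"
  unfolding comega_def by (metis less_cnat_ex less_csup_iff)

lemma cpow_less_mono: "a < b \<Longrightarrow> cpow a < cpow b"
proof -
  assume "a < b"
  have "cpow a * cnat 1 < cpow a * comega"
    by (rule cord_mul_less_mono[OF cnat_less_comega cpow_pos])
  then have "cpow a < cpow (csuc a)"
    by (simp only: One_nat_def cnat_Suc0 cord_mul_one cpow_suc)
  also have "cpow (csuc a) \<le> cpow b" using \<open>a < b\<close> by (intro cpow_le_mono) simp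
  finally show ?thesis .
qed

lemma cpow_less_iff [simp]: "cpow a < cpow b \<longleftrightarrow> a < b"
  by (metis cpow_le_mono cpow_less_mono linorder_not_less)

lemma cpow_le_iff [simp]: "cpow a \<le> cpow b \<longleftrightarrow> a \<le> b"
  by (metis cpow_less_iff linorder_not_less)

lemma le_cpow: "a \<le> cpow a"
proof (induction a rule: cord_induct)
  case (suc a)
  then show ?case by (metis cpow_less_iff csuc_le_iff less_csuc_iff order_le_less_trans order_refl)
next
  case (sup f)
  then show ?case by (metis cpow_sup csup_mono)
qed simp

text \<open>Treats successor and limit exponents alike. At a successor it unfolds the multiplication
  by \<omega>; at a supremum either a strictly smaller exponent works with c = 1, or the supremum is
  attained and the induction hypothesis applies.\<close>

lemma less_cpow_ex:
  assumes "r < cpow \<eta>" "\<eta> \<noteq> 0"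
  shows "\<exists>\<eta>'<\<eta>. \<exists>c. r < cpow \<eta>' * cnat c"
  using assms
proof (induction \<eta> rule: cord_induct)
  case (suc x)
  then have "r < csup (\<lambda>n. cpow x * cnat n)" by (simp add: comega_def)
  then show ?case by (metis less_csuc_iff less_csup_iff order_refl)
next
  case (sup f)
  then obtain n where n: "r < cpow (f n)" by auto
  show ?case
  proof (cases "\<exists>m. f n < f m")
    case True
    then obtain m where "f n < f m" by blast
    then show ?thesis using n
      by (metis One_nat_def cnat_Suc0 cord_mul_one less_csup_iff)
  next
    case False
    then have "csup f = f n" by (metis csup_le_iff le_csup linorder_not_less order_antisym)
    then show ?thesis using sup n by metis
  qed
qed simp

lemma cpow_mul_cnat_less: "a < b \<Longrightarrow> cpow a * cnat n < cpow b"
proof -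
  assume "a < b"
  have "cpow a * cnat n < cpow (csuc a)"
    by (simp add: cord_mul_less_mono cnat_less_comega)
  also have "\<dots> \<le> cpow b" using \<open>a < b\<close> by (intro cpow_le_mono) simp
  finally show ?thesis .
qed

lemma cnat_mul_comega: "cnat n * comega \<le> comega"
proof -
  have "\<exists>k. cnat n * cnat m = cnat k" for m
  proof (induction m)
    case (Suc m)
    then show ?case by (metis cnat_Suc cnat_add cord_mul_suc)
  qed (metis cnat_0 cord_mul_zero)
  then have "cnat n * cnat m \<le> comega" for m
    by (metis cnat_less_comega less_imp_le)
  then show ?thesis by (simp add: comega_def)
qed

lemma cpow_one: "cpow 1 = comega"
  by (simp add: one_cord_def) (simp add: one_cord_def[symmetric])

text \<open>Finite left factors disappear because \<open>n * \<omega>\<close> is at most \<omega>,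
  and \<omega> splits off on the left of a power with nonzero exponent. This lets
  \<open>weighted_family\<close> forget coefficients.\<close>

lemma cnat_mul_cpow: "b \<noteq> 0 \<Longrightarrow> cnat n * cpow b \<le> cpow b"
proof -
  assume "b \<noteq> 0"
  then obtain b' where b: "b = 1 + b'" by (metis cord_le_ex_add cord_one_le)
  show ?thesis
    by (simp add: b cpow_add cpow_one cord_mul_assoc[symmetric] cord_mul_le_mono_left cnat_mul_comega)
qed

text \<open>Additive indecomposability: both summands lie below finite multiples of one smaller
  power, hence so does the sum.\<close>

lemma add_less_cpow: "a < cpow b \<Longrightarrow> c < cpow b \<Longrightarrow> a + c < cpow b"
proof (cases "b = 0")
  case True
  assume "a < cpow b" "c < cpow b"
  then have "a = 0" "c = 0" using True by (simp_all add: one_cord_def)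
  then show ?thesis by simp
next
  case False
  assume a: "a < cpow b" and c: "c < cpow b"
  obtain b1 m where 1: "b1 < b" "a < cpow b1 * cnat m" using less_cpow_ex[OF a False] by blast
  obtain b2 k where 2: "b2 < b" "c < cpow b2 * cnat k" using less_cpow_ex[OF c False] by blast
  define d where "d = max b1 b2"
  have "cpow b1 * cnat m \<le> cpow d * cnat m" "cpow b2 * cnat k \<le> cpow d * cnat k"
    by (simp_all add: d_def cord_mul_le_mono_left)
  then have "a + c \<le> cpow d * cnat m + cpow d * cnat k"
    using 1 2 by (intro cord_add_mono) auto
  also have "\<dots> = cpow d * cnat (m + k)" by (simp add: cnat_add cord_distrib)
  also have "\<dots> < cpow b" using 1 2 by (intro cpow_mul_cnat_less) (simp add: d_def)
  finally show ?thesis .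
qed

lemma abs_two: "abs_cord two_ord = 1 + 1"
  by (simp add: two_ord_def abs_cord_OS one_cord_def zero_cord_def[symmetric])

lemma cord_mul_two: "x * abs_cord two_ord = x + x"
  by (simp add: abs_two cord_distrib)

lemma is_succ_iff: "is_succ_ord a \<longleftrightarrow> (\<exists>b. abs_cord a = csuc b)"
  unfolding is_succ_ord_def oeq_iff abs_cord_OS by (metis abs_rep_cord)

lemma is_limit_iff: "is_limit_ord a \<longleftrightarrow> abs_cord a \<noteq> 0 \<and> (\<nexists>b. abs_cord a = csuc b)"
  unfolding is_limit_ord_def is_succ_iff oeq_iff zero_cord_def by simp

text \<open>A property that passes from a supremum to some term of the sequence can begin to hold
  only at a successor. Applied to a < \<open>cpow d\<close>, this produces the leading exponent of
  \<open>a\<close>.\<close>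

lemma cord_Least_csuc:
  fixes P :: "cord \<Rightarrow> bool"
  assumes "P a"
    and zero: "\<not> P 0" and sup: "\<And>f. P (csup f) \<Longrightarrow> \<exists>n. P (f n)"
  shows "\<exists>b. P (csuc b) \<and> \<not> P b"
proof (rule ccontr)
  assume no: "\<not> ?thesis"
  have "\<not> P x" for x
    by (induction x rule: cord_induct) (use no zero sup in blast)+
  then show False using \<open>P a\<close> by blast
qed

lemma cpow_bracket: "a \<noteq> 0 \<Longrightarrow> \<exists>d. cpow d \<le> a \<and> a < cpow (csuc d)"
proof -
  assume "a \<noteq> 0"
  have "a < cpow (csuc a)" by (metis le_cpow cpow_less_iff less_csuc_iff order_le_less_trans order_refl)
  then have "\<exists>b. a < cpow (csuc b) \<and> \<not> a < cpow b"
    by (rule cord_Least_csuc) (use \<open>a \<noteq> 0\<close> in \<open>auto simp: one_cord_def simp del: cpow_suc\<close>)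
  then show ?thesis using linorder_not_less by blast
qed

lemma abs_cord_OZ [simp]: "abs_cord OZ = 0"
  by (simp add: zero_cord_def)

section \<open>Ranks of trees of lists\<close>

text \<open>For trees closed under nonempty initial segments this says that \<open>t\<close>
  survives \<open>s\<close> derivations, phrased with one-node extensions. The clauses for zero,
  successors and limits collapse into one.\<close>

inductive rk :: "'a list set \<Rightarrow> cord \<Rightarrow> 'a list \<Rightarrow> bool" for T where
  "t \<in> T \<Longrightarrow> (\<And>s'. s' < s \<Longrightarrow> \<exists>x. rk T s' (t @ [x])) \<Longrightarrow> rk T s t"

lemma rk_iff: "rk T s t \<longleftrightarrow> t \<in> T \<and> (\<forall>s'<s. \<exists>x. rk T s' (t @ [x]))"
proof
  show "rk T s t \<Longrightarrow> t \<in> T \<and> (\<forall>s'<s. \<exists>x. rk T s' (t @ [x]))"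
    by (erule rk.cases) simp
  assume *: "t \<in> T \<and> (\<forall>s'<s. \<exists>x. rk T s' (t @ [x]))"
  show "rk T s t"
    by (rule rk.intros[OF *[THEN conjunct1]]) (rule *[THEN conjunct2, rule_format])
qed

lemma rk_mem: "rk T s t \<Longrightarrow> t \<in> T"
  by (drule rk_iff[THEN iffD1]) simp

lemma rk_ext: "rk T s t \<Longrightarrow> s' < s \<Longrightarrow> \<exists>x. rk T s' (t @ [x])"
  by (drule rk_iff[THEN iffD1]) simp

lemma rk_antimono: "rk T s t \<Longrightarrow> s' \<le> s \<Longrightarrow> rk T s' t"
  by (rule rk.intros[OF rk_mem]) (auto intro: rk_ext order_less_le_trans)

text \<open>A certificate for ranks: \<open>P s t\<close> reads as a position \<open>t\<close> with
  \<open>s\<close> left to run. \<open>rk T\<close> is itself a clock, and by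
  \<open>clock_imp_rk\<close> the largest one inside \<open>T\<close>, so lower bounds for orders of
  trees are proved by exhibiting clocks.\<close>

definition clock :: "(cord \<Rightarrow> 'a list \<Rightarrow> bool) \<Rightarrow> bool" where
  "clock P \<longleftrightarrow> (\<forall>s t s'. P s t \<longrightarrow> s' < s \<longrightarrow> (\<exists>x. P s' (t @ [x])))"

lemma clockD: "clock P \<Longrightarrow> P s t \<Longrightarrow> s' < s \<Longrightarrow> \<exists>x. P s' (t @ [x])"
  unfolding clock_def by blast

lemma clock_rk [intro]: "clock (rk T)"
  unfolding clock_def using rk_ext by blast

lemma clock_imp_rk:
  assumes "clock P" and T: "\<And>s t. P s t \<Longrightarrow> t \<in> T"
  shows "P s t \<Longrightarrow> rk T s t"
proof (induction s arbitrary: t rule: less_induct)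
  case (less s)
  show ?case
    by (rule rk.intros[OF T[OF less.prems]]) (use less clockD[OF assms(1)] in blast)
qed

lemma rk_subset: "rk T s t \<Longrightarrow> T \<subseteq> T' \<Longrightarrow> rk T' s t"
  by (rule clock_imp_rk[of "rk T"]) (auto dest: rk_mem)

text \<open>A derivation asks for any proper extension, \<open>rk\<close> for an extension by one
  node; they agree because ranks pass down to nonempty initial segments
  (\<open>down\<close>).\<close>

lemma tree_deriv_iter_rk:
  assumes ne: "\<forall>xs\<in>T. xs \<noteq> []" and cl: "\<forall>xs\<in>T. \<forall>ys. ys \<noteq> [] \<and> prefix ys xs \<longrightarrow> ys \<in> T"
  shows "t \<in> tree_deriv_iter b T \<longleftrightarrow> rk T (abs_cord b) t"
proof (induction b arbitrary: t)
  case OZ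
  have "t \<in> T \<longleftrightarrow> rk T 0 t" by (auto intro: rk.intros dest: rk_mem)
  then show ?case by (simp add: zero_cord_def[symmetric])
next
  case (OS b)
  have down: "rk T s ys" if "rk T s xs" "ys \<noteq> []" "prefix ys xs" for s xs ys
  proof -
    have 1: "rk T s (butlast us)" if "rk T s us" "butlast us \<noteq> []" for us s
    proof -
      from that have us: "us = butlast us @ [last us]" by (metis append_butlast_last_id butlast.simps(1))
      show ?thesis
      proof (rule rk.intros)
        show "butlast us \<in> T"
          using cl rk_mem[OF that(1)] that(2) by (metis us prefixI)
        show "\<exists>x. rk T s' (butlast us @ [x])" if "s' < s" for s'
          by (metis us \<open>rk T s us\<close> rk_antimono less_imp_le that)
      qed
    qed
    from that(3) obtain zs where "xs = ys @ zs" by (auto simp: prefix_def)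
    with that(1) show ?thesis
    proof (induction zs arbitrary: xs rule: rev_induct)
      case (snoc z zs)
      then show ?case using 1[of s xs] that(2) by (simp add: butlast_append)
    qed simp
  qed
  show ?case
  proof
    assume "t \<in> tree_deriv_iter (OS b) T"
    then obtain u where t: "rk T (abs_cord b) t" and u: "rk T (abs_cord b) u" "strict_prefix t u"
      by (auto simp: tree_deriv_def OS)
    from u(2) obtain x zs where "u = t @ x # zs" by (rule strict_prefixE')
    then have "rk T (abs_cord b) (t @ [x])" using down[OF u(1), of "t @ [x]"] by simp
    then have "\<exists>x. rk T s' (t @ [x])" if "s' < csuc (abs_cord b)" for s'
      using that rk_antimono by (metis less_csuc_iff)
    then show "rk T (abs_cord (OS b)) t"
      using rk_mem[OF t] by (intro rk.intros) (simp_all add: abs_cord_OS)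
  next
    assume r: "rk T (abs_cord (OS b)) t"
    then have "rk T (csuc (abs_cord b)) t" by (simp add: abs_cord_OS)
    then obtain x where "rk T (abs_cord b) (t @ [x])"
      by (metis rk_ext less_csuc_iff order_refl)
    moreover have "strict_prefix t (t @ [x])" by (simp add: strict_prefix_def)
    moreover have "rk T (abs_cord b) t"
      using rk_antimono[OF \<open>rk T (csuc (abs_cord b)) t\<close>] by (metis csuc_le_iff less_csuc_iff less_imp_le order_refl)
    ultimately show "t \<in> tree_deriv_iter (OS b) T"
      by (auto simp: tree_deriv_def OS)
  qed
next
  case (OL f)
  show ?case
  proof
    assume "t \<in> tree_deriv_iter (OL f) T"
    then have *: "rk T (abs_cord (f n)) t" for n using OL by auto
    show "rk T (abs_cord (OL f)) t"
      by (rule rk.intros[OF rk_mem[OF *]]) (auto simp: abs_cord_OL intro: rk_ext[OF *])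
  next
    assume "rk T (abs_cord (OL f)) t"
    then have "rk T (abs_cord (f n)) t" for n
      by (rule rk_antimono) (simp add: abs_cord_OL le_csup[of "\<lambda>n. abs_cord (f n)"])
    then show "t \<in> tree_deriv_iter (OL f) T" using OL by auto
  qed
qed

text \<open>Lexicographic product of clocks with the invariant s \<le> L * \<tau> + \<rho>. While
  the inner clock \<open>R\<close> runs, only \<rho> decreases; for a value below L * \<tau>,
  division by \<open>L\<close> supplies the next outer value and a fresh inner clock.\<close>

lemma clock_compose:
  fixes Q :: "cord \<Rightarrow> 'a list \<Rightarrow> bool"
  assumes Q: "\<And>\<tau> t \<tau>' \<rho>. Q \<tau> t \<Longrightarrow> \<tau>' < \<tau> \<Longrightarrow> \<rho> < L \<Longrightarrow>
      \<exists>x R. clock R \<and> R \<rho> (t @ [x]) \<and> (\<forall>\<rho> s. R \<rho> s \<longrightarrow> Q \<tau>' s)"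
  obtains P where "clock P" "\<And>\<tau> t. Q \<tau> t \<Longrightarrow> P (L * \<tau>) t" "\<And>s t. P s t \<Longrightarrow> \<exists>\<tau>. Q \<tau> t"
proof
  define P where "P \<equiv> \<lambda>s t. \<exists>\<tau> \<rho> R. s \<le> L * \<tau> + \<rho> \<and> clock R \<and> R \<rho> t \<and> (\<forall>\<rho> s. R \<rho> s \<longrightarrow> Q \<tau> s)"
  show "P (L * \<tau>) t" if "Q \<tau> t" for \<tau> t
    unfolding P_def
    by (rule exI[of _ \<tau>], rule exI[of _ 0], rule exI[of _ "\<lambda>\<rho> s. \<rho> = 0 \<and> s = t"])
       (use that in \<open>auto simp: clock_def\<close>)
  show "\<exists>\<tau>. Q \<tau> t" if "P s t" for s t
    using that unfolding P_def by blast
  show "clock P"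
    unfolding clock_def
  proof (intro allI impI)
    fix s t s' assume "P s t" "s' < (s::cord)"
    then obtain \<tau> \<rho> R where *: "s' < L * \<tau> + \<rho>" "clock R" "R \<rho> t" "\<forall>\<rho> s. R \<rho> s \<longrightarrow> Q \<tau> s"
      unfolding P_def by (metis order_less_le_trans)
    from cord_add_sup_split[OF *(1)] show "\<exists>x. P s' (t @ [x])"
    proof
      assume "s' < L * \<tau>"
      then obtain \<tau>' r where "\<tau>' < \<tau>" "r < L" "s' = L * \<tau>' + r" using cord_mul_division by blast
      then show ?thesis using Q[of \<tau> t \<tau>' r] * unfolding P_def by (metis order_refl)
    next
      assume "\<exists>z<\<rho>. s' = L * \<tau> + z"
      then obtain z where "z < \<rho>" "s' = L * \<tau> + z" by blast
      then show ?thesis using clockD[OF *(2,3)] *(2,4) unfolding P_def by (metis order_refl)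
    qed
  qed
qed

section \<open>Averaging over trees\<close>

text \<open>A rank function for end extensions. Its value at the empty set plays the part of the
  Cantor-Bendixson index, but it can be written down explicitly for unions, for compositions and for
  the auxiliary families met while averaging.\<close>

definition famrk :: "nat set set \<Rightarrow> (nat set \<Rightarrow> cord) \<Rightarrow> bool" where
  "famrk F \<rho> \<longleftrightarrow> (\<forall>A n. finite A \<and> (\<forall>a\<in>A. a < n) \<and> insert n A \<in> F \<longrightarrow> A \<in> F \<and> \<rho> (insert n A) < \<rho> A)"

lemma famrkD:
  assumes "famrk F \<rho>" "finite A" "\<forall>a\<in>A. a < n" "insert n A \<in> F"
  shows "A \<in> F" "\<rho> (insert n A) < \<rho> A"
  using assms unfolding famrk_def by blast+

lemma famrk_initial:
  assumes F: "famrk F \<rho>" and "finite B" "finite C" "\<forall>b\<in>B. \<forall>c\<in>C. b < c" "B \<union> C \<in> F"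
  shows "B \<in> F \<and> \<rho> (B \<union> C) \<le> \<rho> B"
  using assms(3-5)
proof (induction C rule: finite_linorder_max_induct)
  case (insert n C)
  have "insert n (B \<union> C) \<in> F" "finite (B \<union> C)" "\<forall>a\<in>B \<union> C. a < n"
    using insert assms(2) by auto
  from famrkD[OF F this(2,3,1)] insert show ?case by fastforce
qed simp

lemma finite_below_cpow:
  assumes "finite X" "\<forall>r\<in>X. r < cpow \<eta>" "\<eta> \<noteq> 0"
  shows "\<exists>\<eta>'<\<eta>. \<exists>c. \<forall>r\<in>X. r < cpow \<eta>' * cnat c"
  using assms
proof (induction X rule: finite_induct)
  case empty
  then show ?case by (metis cord_pos_iff empty_iff)
next
  case (insert r X)
  then obtain \<eta>1 c1 where 1: "\<eta>1 < \<eta>" "\<forall>r\<in>X. r < cpow \<eta>1 * cnat c1" by auto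
  obtain \<eta>2 c2 where 2: "\<eta>2 < \<eta>" "r < cpow \<eta>2 * cnat c2"
    using insert.prems less_cpow_ex by blast
  have le: "cpow a * cnat c \<le> cpow (max \<eta>1 \<eta>2) * cnat (max c1 c2)"
    if "a \<le> max \<eta>1 \<eta>2" "c \<le> max c1 c2" for a c
    using that by (meson cnat_mono cord_mul_le_mono_left cord_mul_le_mono_right cpow_le_iff order_trans)
  show ?case
    by (rule exI[of _ "max \<eta>1 \<eta>2"], intro conjI exI[of _ "max c1 c2"])
       (use 1 2 le[of \<eta>1 c1] le[of \<eta>2 c2] in \<open>auto intro: order_less_le_trans\<close>)
qed

lemma cpow_mul_cnat_le: "a < b \<Longrightarrow> cpow a * cnat n \<le> cpow b"
  by (simp add: cpow_mul_cnat_less less_imp_le)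

text \<open>With the clock \<open>\<omega>\<^sup>\<eta>\<close> one can average away every family of rank below \<open>\<omega>\<^sup>\<eta>\<close>:
  for \<open>\<eta>' < \<eta>\<close> with all ranks below \<open>\<omega>\<^sup>\<eta>\<^sup>' \<cdot> c\<close>, run many stages with clock \<open>\<omega>\<^sup>\<eta>\<^sup>'\<close>. A set of the
  family gets a nonnegligible mass from a stage only if there its rank drops below
  a multiple of \<open>\<omega>\<^sup>\<eta>\<^sup>'\<close>, which happens at most \<open>c\<close> times.\<close>

proposition averaging:
  fixes P :: "cord \<Rightarrow> 'a list \<Rightarrow> bool" and q :: "'a \<Rightarrow> nat"
  assumes P: "clock P" and down: "\<And>s s' t. P s t \<Longrightarrow> s' \<le> s \<Longrightarrow> P s' t"
    and q: "\<And>s t. P s t \<Longrightarrow> sorted_wrt (<) (map q t)"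
  shows "finite Z \<Longrightarrow> (\<And>F \<rho>. (F, \<rho>) \<in> Z \<Longrightarrow> famrk F \<rho> \<and> \<rho> {} < cpow \<eta>) \<Longrightarrow> 0 < \<delta> \<Longrightarrow>
    P (s + cpow \<eta>) t \<Longrightarrow> \<exists>xs w. P s (t @ xs) \<and> xs \<noteq> [] \<and> (\<forall>i. 0 \<le> w i) \<and> sum w (q ` set xs) = 1 \<and>
      (\<forall>F \<rho> E. (F, \<rho>) \<in> Z \<longrightarrow> E \<in> F \<longrightarrow> E \<subseteq> q ` set xs \<longrightarrow> sum w E \<le> (\<delta>::real))"
proof (induction \<eta> arbitrary: Z \<delta> s t rule: less_induct)
  case (less \<eta>)
  show ?case
  proof (cases "\<eta> = 0")
    \<comment> \<open>A rank below \<open>cpow 0\<close>, that is 1, at the empty set means that the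
      family contains no singleton, so one further node may carry all the mass.\<close>
    case True
    then have "P (s + 1) t" using less.prems by simp
    moreover have "s < s + 1" by (simp add: csuc_eq[symmetric])
    ultimately obtain x where x: "P s (t @ [x])" using clockD[OF P] by blast
    have "E = {}" if "(F, \<rho>) \<in> Z" "E \<in> F" "E \<subseteq> {q x}" for F \<rho> E
    proof (rule ccontr)
      assume "E \<noteq> {}"
      then have "insert (q x) {} \<in> F" using that by (metis subset_singletonD)
      then have "\<rho> {q x} < \<rho> {}" using famrkD(2)[of F \<rho> "{}" "q x"] less.prems(2)[OF that(1)] by simp
      moreover have "\<rho> {} = 0" using less.prems(2)[OF that(1)] True by (simp add: one_cord_def)
      ultimately show False by simp
    qed
    then show ?thesis using x less.prems(3)
      by (intro exI[of _ "[x]"] exI[of _ "\<lambda>_. 1"]) fastforce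
  next
    case False
    have "\<forall>r\<in>(\<lambda>(F, \<rho>). \<rho> {}) ` Z. r < cpow \<eta>" using less.prems(2) by auto
    then obtain \<eta>' c where \<eta>': "\<eta>' < \<eta>" and c: "\<forall>r\<in>(\<lambda>(F, \<rho>). \<rho> {}) ` Z. r < cpow \<eta>' * cnat c"
      using finite_below_cpow[of "(\<lambda>(F, \<rho>). \<rho> {}) ` Z" \<eta>] less.prems(1) False by auto
    have cZ: "\<rho> {} < cpow \<eta>' * cnat c" if "(F, \<rho>) \<in> Z" for F \<rho> using c that by force
    \<comment> \<open>Number of stages: after division of all weights by \<open>n\<close>, the at
      most \<open>c\<close> drops of the quotient contribute c / n \<le> \<delta> / 2.\<close>
    define n where "n = nat \<lceil>2 * real c / \<delta>\<rceil> + 1"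
    have n: "n > 0" "real c / real n \<le> \<delta> / 2"
    proof -
      show "n > 0" by (simp add: n_def)
      have "2 * real c / \<delta> \<le> real n" unfolding n_def by linarith
      then have "2 * real c \<le> real n * \<delta>" using less.prems(3) by (simp add: divide_le_eq)
      then show "real c / real n \<le> \<delta> / 2" using \<open>n > 0\<close> by (simp add: field_simps)
    qed
    \<comment> \<open>Quotient and remainder of a rank on division by \<open>cpow \<eta>'\<close>;
      the quotient is a natural number of size at most \<open>c\<close>.\<close>
    define dv where "dv r = (LEAST k. r < cpow \<eta>' * cnat (Suc k))" for r
    define rm where "rm r = (SOME z. r = cpow \<eta>' * cnat (dv r) + z)" for r
    have dv: "r = cpow \<eta>' * cnat (dv r) + rm r \<and> rm r < cpow \<eta>' \<and> dv r \<le> c"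
      if "r < cpow \<eta>' * cnat c" for r
    proof -
      obtain z k where z: "z < cpow \<eta>'" "r = cpow \<eta>' * cnat k + z" "k < c"
        using cord_mul_division[OF \<open>r < cpow \<eta>' * cnat c\<close>] less_cnat_ex by metis
      have "r < cpow \<eta>' * cnat (Suc k)" using z by (simp add: abs_cord_OS)
      then have le: "dv r \<le> k" unfolding dv_def by (rule Least_le)
      have "r < cpow \<eta>' * cnat (Suc (dv r))"
        unfolding dv_def by (rule LeastI) fact
      have "k \<le> dv r"
      proof (rule ccontr)
        assume "\<not> k \<le> dv r"
        then have "cpow \<eta>' * cnat (Suc (dv r)) \<le> cpow \<eta>' * cnat k"
          by (intro cord_mul_le_mono_right cnat_mono) simp
        also have "\<dots> \<le> r" using z by simp
        finally show False using \<open>r < cpow \<eta>' * cnat (Suc (dv r))\<close> by (simp add: leD)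
      qed
      with le have k: "dv r = k" by simp
      have "r = cpow \<eta>' * cnat (dv r) + rm r"
        unfolding rm_def by (rule someI[of _ z]) (simp only: k z(2)[symmetric])
      then show ?thesis using k z by simp
    qed
    have dv_mono: "dv r \<le> dv r'" if "r \<le> r'" "r' < cpow \<eta>' * cnat c" for r r'
    proof -
      have "r' < cpow \<eta>' * cnat (Suc (dv r'))" using dv[OF that(2)]
        by (metis cnat_Suc cord_add_less_cancel cord_mul_suc)
      then show ?thesis using that(1) unfolding dv_def[of r] by (intro Least_le) simp
    qed
    have rho: "\<rho> E < cpow \<eta>' * cnat c" if "(F, \<rho>) \<in> Z" "E \<in> F" "finite E" for F \<rho> E
      using famrk_initial[of F \<rho> "{}" E] less.prems(2)[OF that(1)] cZ[OF that(1)] that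
      by (auto intro: order_le_less_trans)
    \<comment> \<open>Potential argument: the mass of \<open>E\<close> plus the quotient of its rank
      is at most \<open>c\<close> at the start and grows by at most \<delta> / 2 per stage.\<close>
    have "\<exists>xs w. P (s + cpow \<eta>' * cnat (n - k)) (t @ xs) \<and> (\<forall>i. 0 \<le> w i) \<and> sum w (q ` set xs) = real k \<and>
        (\<forall>F \<rho> E. (F, \<rho>) \<in> Z \<longrightarrow> E \<in> F \<longrightarrow> E \<subseteq> q ` set xs \<longrightarrow>
          sum w E + real (dv (\<rho> E)) \<le> real c + k * (\<delta> / 2))" if "k \<le> n" for k
      using that
    proof (induction k)
      case 0
      have "P (s + cpow \<eta>' * cnat n) t"
        by (rule down[OF less.prems(4)]) (use \<eta>' in \<open>simp add: cpow_mul_cnat_le\<close>)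
      moreover have "dv (\<rho> {}) \<le> c" if "(F, \<rho>) \<in> Z" for F \<rho>
        using dv cZ[OF that] by blast
      ultimately show ?case by (intro exI[of _ "[]"] exI[of _ "\<lambda>_. 0"]) auto
    next
      case (Suc k)
      then obtain xs w where xs: "P (s + cpow \<eta>' * cnat (n - k)) (t @ xs)" and w: "\<forall>i. 0 \<le> w i"
        and w1: "sum w (q ` set xs) = real k"
        and wE: "\<And>F \<rho> E. (F, \<rho>) \<in> Z \<Longrightarrow> E \<in> F \<Longrightarrow> E \<subseteq> q ` set xs \<Longrightarrow>
          sum w E + real (dv (\<rho> E)) \<le> real c + k * (\<delta> / 2)"
        by auto
      define A where "A = q ` set xs"
      have [simp]: "finite A" by (simp add: A_def)
      have "n - k = Suc (n - Suc k)" using Suc.prems by simp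
      then have P': "P ((s + cpow \<eta>' * cnat (n - Suc k)) + cpow \<eta>') (t @ xs)"
        using xs by (simp only: cnat_Suc cord_mul_suc cord_add_assoc)
      \<comment> \<open>For each initial part \<open>B\<close> on the old points, the continuations
        that leave the quotient unchanged form a family ranked by the remainders, hence below
        \<open>cpow \<eta>'\<close>. There are finitely many of these, so the induction hypothesis
        treats them all at once.\<close>
      define fam where "fam = (\<lambda>((F, \<rho>), B). ({C. B \<union> C \<in> F \<and> finite C \<and> (\<forall>a\<in>A. \<forall>c\<in>C. a < c) \<and>
          dv (\<rho> (B \<union> C)) = dv (\<rho> B)}, \<lambda>C. rm (\<rho> (B \<union> C))))"
      define Z' where "Z' = fam ` (SIGMA (F, \<rho>):Z. {B. B \<subseteq> A \<and> B \<in> F})"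
      have fin: "finite Z'"
        unfolding Z'_def using less.prems(1)
        by (intro finite_imageI finite_SigmaI) (auto intro: finite_subset[of _ "Pow A"])
      have Z': "famrk F' \<rho>' \<and> \<rho>' {} < cpow \<eta>'" if "(F', \<rho>') \<in> Z'" for F' \<rho>'
      proof -
        from that obtain F \<rho> B where B: "(F, \<rho>) \<in> Z" "B \<subseteq> A" "B \<in> F"
          and F': "F' = {C. B \<union> C \<in> F \<and> finite C \<and> (\<forall>a\<in>A. \<forall>c\<in>C. a < c) \<and> dv (\<rho> (B \<union> C)) = dv (\<rho> B)}"
          and \<rho>': "\<rho>' = (\<lambda>C. rm (\<rho> (B \<union> C)))"
          by (auto simp: Z'_def fam_def)
        have finB: "finite B" using B(2) finite_subset by (metis \<open>finite A\<close>)
        have "\<rho>' {} < cpow \<eta>'" using dv[OF rho[OF B(1,3) finB]] by (simp add: \<rho>')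
        moreover have "famrk F' \<rho>'"
          unfolding famrk_def
        proof (intro allI impI)
          fix C m assume C: "finite C \<and> (\<forall>a\<in>C. a < m) \<and> insert m C \<in> F'"
          define D where "D = B \<union> C"
          have D: "finite D" "\<forall>a\<in>D. a < m" "insert m D \<in> F"
            using C B(2) finB by (auto simp: F' D_def)
          have eq: "dv (\<rho> (insert m D)) = dv (\<rho> B)" using C by (auto simp: F' D_def)
          from famrkD[of F \<rho>, OF _ D] less.prems(2)[OF B(1)]
          have D': "D \<in> F" "\<rho> (insert m D) < \<rho> D" by auto
          have "\<rho> D \<le> \<rho> B"
            using famrk_initial[of F \<rho> B C] less.prems(2)[OF B(1)] C B(2) D'(1) finB
            by (auto simp: D_def F')
          then have "dv (\<rho> D) \<le> dv (\<rho> B)" by (rule dv_mono) (rule rho[OF B(1,3) finB])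
          moreover have "dv (\<rho> (insert m D)) \<le> dv (\<rho> D)"
            using D' by (intro dv_mono rho[OF B(1) _ D(1)]) auto
          ultimately have eq2: "dv (\<rho> D) = dv (\<rho> B)" using eq by simp
          have "rm (\<rho> (insert m D)) < rm (\<rho> D)"
            using D'(2) dv[OF rho[OF B(1) D(3)]] dv[OF rho[OF B(1) D'(1) D(1)]] D(1) eq eq2
            by (metis cord_add_less_cancel finite.insertI)
          then show "C \<in> F' \<and> \<rho>' (insert m C) < \<rho>' C"
            using C D'(1) eq2 by (auto simp: F' \<rho>' D_def)
        qed
        ultimately show ?thesis by simp
      qed
      have d2: "0 < \<delta> / 2" using less.prems(3) by simp
      obtain ys v where ys: "P (s + cpow \<eta>' * cnat (n - Suc k)) ((t @ xs) @ ys)" and v: "\<forall>i. 0 \<le> v i"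
        and v1: "sum v (q ` set ys) = 1"
        and vE: "\<And>F \<rho> E. (F, \<rho>) \<in> Z' \<Longrightarrow> E \<in> F \<Longrightarrow> E \<subseteq> q ` set ys \<Longrightarrow> sum v E \<le> \<delta> / 2"
        using less.IH[OF \<eta>' fin Z' d2 P'] by blast
      define A' where "A' = q ` set ys"
      have [simp]: "finite A'" by (simp add: A'_def)
      have AA': "a < a'" if "a \<in> A" "a' \<in> A'" for a a'
        using q[OF ys] that by (auto simp: A_def A'_def sorted_wrt_append)
      then have disj: "A \<inter> A' = {}" by fastforce
      define u where "u i = (if i \<in> A then w i else v i)" for i
      have uA: "sum u B = sum w B" if "B \<subseteq> A" for B
        using that by (intro sum.cong) (auto simp: u_def)
      have uA': "sum u B = sum v B" if "B \<subseteq> A'" for B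
        using that disj by (intro sum.cong) (auto simp: u_def)
      have "sum u (A \<union> A') = real (Suc k)"
        using sum.union_disjoint[of A A' u] disj uA[of A] uA'[of A'] w1 v1 by (simp add: A_def A'_def)
      moreover have "sum u E + real (dv (\<rho> E)) \<le> real c + real (Suc k) * (\<delta> / 2)"
        if E: "(F, \<rho>) \<in> Z" "E \<in> F" "E \<subseteq> A \<union> A'" for F \<rho> E
      proof -
        define B where "B = E \<inter> A"
        define C where "C = E \<inter> A'"
        have BC: "E = B \<union> C" "finite B" "finite C" "\<forall>b\<in>B. \<forall>c\<in>C. b < c"
          using E AA' by (auto simp: B_def C_def)
        have B: "B \<in> F" "\<rho> E \<le> \<rho> B"
          using famrk_initial[of F \<rho> B C] BC E less.prems(2)[OF E(1)] by auto
        have "dv (\<rho> E) \<le> dv (\<rho> B)"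
          using B BC by (intro dv_mono rho[OF E(1)]) auto
        have sumE: "sum u E = sum w B + sum v C"
        proof -
          have "B \<inter> C = {}" using disj by (auto simp: B_def C_def)
          then have "sum u E = sum u B + sum u C"
            unfolding BC(1) using BC(2,3) by (rule sum.union_disjoint[rotated 2])
          then show ?thesis using uA[of B] uA'[of C] by (simp add: B_def C_def)
        qed
        have wB: "sum w B + real (dv (\<rho> B)) \<le> real c + k * (\<delta> / 2)"
          by (rule wE[OF E(1) B(1)]) (auto simp: B_def A_def)
        have k1: "real (Suc k) * (\<delta> / 2) = real k * (\<delta> / 2) + \<delta> / 2"
          by (simp add: distrib_right)
        show ?thesis
        proof (cases "dv (\<rho> E) = dv (\<rho> B)")
          case True
          let ?F = "{C. B \<union> C \<in> F \<and> finite C \<and> (\<forall>a\<in>A. \<forall>c\<in>C. a < c) \<and> dv (\<rho> (B \<union> C)) = dv (\<rho> B)}"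
          have 1: "fam ((F, \<rho>), B) = (?F, \<lambda>C. rm (\<rho> (B \<union> C)))" by (simp add: fam_def)
          have 2: "((F, \<rho>), B) \<in> (SIGMA (F, \<rho>):Z. {B. B \<subseteq> A \<and> B \<in> F})"
            using E(1) B(1) by (auto simp: B_def)
          have in_Z': "(?F, \<lambda>C. rm (\<rho> (B \<union> C))) \<in> Z'"
            unfolding Z'_def by (subst 1[symmetric]) (rule imageI[OF 2])
          have "B \<union> C \<in> F" "dv (\<rho> (B \<union> C)) = dv (\<rho> B)"
            using E(2) True by (simp_all only: BC(1)[symmetric])
          moreover have "\<forall>a\<in>A. \<forall>c\<in>C. a < c" using AA' unfolding C_def by blast
          ultimately have "C \<in> ?F" using BC(3) by blast
          then have "sum v C \<le> \<delta> / 2" by (rule vE[OF in_Z']) (auto simp: C_def A'_def)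
          then show ?thesis using wB sumE True k1 by linarith
        next
          case False
          \<comment> \<open>Here the stage may put its whole mass 1 on \<open>E\<close>, but the
            quotient falls by at least 1.\<close>
          have "sum v C \<le> sum v A'" by (rule sum_mono2) (auto simp: C_def v)
          moreover have "real (dv (\<rho> E)) + 1 \<le> real (dv (\<rho> B))"
            using False \<open>dv (\<rho> E) \<le> dv (\<rho> B)\<close> by linarith
          ultimately show ?thesis using wB sumE v1 d2 k1 unfolding A'_def by linarith
        qed
      qed
      ultimately show ?case using ys w v
        by (intro exI[of _ "xs @ ys"] exI[of _ u])
           (auto simp: u_def A_def A'_def image_Un)
    qed
    from this[of n] obtain xs w where xs: "P s (t @ xs)" and w: "\<forall>i. 0 \<le> w i"
        and w1: "sum w (q ` set xs) = real n"
        and wE: "\<And>F \<rho> E. (F, \<rho>) \<in> Z \<Longrightarrow> E \<in> F \<Longrightarrow> E \<subseteq> q ` set xs \<Longrightarrow>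
          sum w E + real (dv (\<rho> E)) \<le> real c + n * (\<delta> / 2)"
      by (auto simp del: times_divide_eq_right)
    have "sum (\<lambda>i. w i / n) E \<le> \<delta>" if "(F, \<rho>) \<in> Z" "E \<in> F" "E \<subseteq> q ` set xs" for F \<rho> E
    proof -
      have "sum w E \<le> real c + n * (\<delta> / 2)" using wE[OF that] by simp
      then have "sum w E / n \<le> real c / n + \<delta> / 2" using n(1) by (simp add: field_simps)
      then show ?thesis using n(2) unfolding sum_divide_distrib[symmetric] by linarith
    qed
    moreover have "xs \<noteq> []" using w1 n(1) by auto
    ultimately show ?thesis using xs w w1 n(1)
      by (intro exI[of _ xs] exI[of _ "\<lambda>i. w i / n"]) (auto simp: sum_divide_distrib[symmetric])
  qed
qed

section \<open>Regular families and their ranks\<close>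

lemma hereditaryD: "hereditary F \<Longrightarrow> A \<in> F \<Longrightarrow> B \<subseteq> A \<Longrightarrow> B \<in> F"
  unfolding hereditary_def by blast

lemma spreadingD: "spreading F \<Longrightarrow> A \<in> F \<Longrightarrow> strict_mono_on A g \<Longrightarrow> (\<And>x. x \<in> A \<Longrightarrow> x \<le> g x) \<Longrightarrow> g ` A \<in> F"
  unfolding spreading_def by blast

text \<open>Spreading for sets indexed by \<open>J\<close>: \<open>u\<close> factors as
  \<open>g\<close> after \<open>f\<close> with \<open>g\<close> increasing on the image of
  \<open>f\<close>. Typically \<open>f\<close> reads off the minimum of an interval and
  \<open>u\<close> a later point attached to it, such as the end of a block.\<close>

lemma spread_image:
  fixes f u :: "'b \<Rightarrow> nat"
  assumes F: "hereditary F" "spreading F" and A: "A \<in> F" "f ` J \<subseteq> A"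
    and less: "\<And>i j. i \<in> J \<Longrightarrow> j \<in> J \<Longrightarrow> f i < f j \<Longrightarrow> u i < u j"
    and eq: "\<And>i j. i \<in> J \<Longrightarrow> j \<in> J \<Longrightarrow> f i = f j \<Longrightarrow> u i = u j"
    and le: "\<And>i. i \<in> J \<Longrightarrow> f i \<le> u i"
  shows "u ` J \<in> F"
proof -
  define g where "g x = u (SOME i. i \<in> J \<and> f i = x)" for x
  have g: "g (f i) = u i" if "i \<in> J" for i
  proof -
    have "(SOME j. j \<in> J \<and> f j = f i) \<in> J \<and> f (SOME j. j \<in> J \<and> f j = f i) = f i"
      by (rule someI[of _ i]) (simp add: that)
    then show ?thesis unfolding g_def using eq that by blast
  qed
  have "g ` (f ` J) \<in> F"
  proof (rule spreadingD[OF F(2) hereditaryD[OF F(1) A]])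
    show "strict_mono_on (f ` J) g"
      by (rule strict_mono_onI) (use g less in auto)
  qed (use g le in auto)
  also have "g ` (f ` J) = u ` J" using g by (auto simp: image_image)
  finally show ?thesis .
qed

text \<open>In a spreading family one end extension of \<open>A\<close> yields infinitely many,
  since its last point can be pushed beyond any \<open>k\<close>; these converge to
  \<open>A\<close>.\<close>

lemma cb_deriv_iff:
  assumes F: "F \<subseteq> fin_pos_sets" "hereditary F" "spreading F"
  shows "A \<in> cb_deriv F \<longleftrightarrow> A \<in> F \<and> (\<exists>n. (\<forall>a\<in>A. a < n) \<and> insert n A \<in> F)"
proof
  assume A: "A \<in> cb_deriv F"
  then have AF: "A \<in> F" by (simp add: cb_deriv_def)
  then have "finite A" using F(1) by (auto simp: fin_pos_sets_def)
  then obtain k where k: "A \<subseteq> {..<k}" by (metis finite_nat_set_iff_bounded lessThan_iff subsetI)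
  from A obtain B where B: "B \<in> F" "B \<noteq> A" "B \<inter> {..<k} = A \<inter> {..<k}"
    unfolding cb_deriv_def by blast
  then have "A \<subseteq> B" using k by auto
  then obtain n where n: "n \<in> B" "n \<notin> A" using B(2) by blast
  then have "k \<le> n" using B(3) by (metis Int_iff lessThan_iff linorder_not_le)
  then have "\<forall>a\<in>A. a < n" using k by auto
  moreover have "insert n A \<in> F" using F(2) B(1) by (rule hereditaryD) (use n \<open>A \<subseteq> B\<close> in auto)
  ultimately show "A \<in> F \<and> (\<exists>n. (\<forall>a\<in>A. a < n) \<and> insert n A \<in> F)" using AF by blast
next
  assume "A \<in> F \<and> (\<exists>n. (\<forall>a\<in>A. a < n) \<and> insert n A \<in> F)"
  then obtain n where n: "A \<in> F" "\<forall>a\<in>A. a < n" "insert n A \<in> F" by blast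
  have "\<exists>B\<in>F. B \<noteq> A \<and> B \<inter> {..<k} = A \<inter> {..<k}" for k
  proof -
    have "(\<lambda>x. if x = n then max n k else x) ` insert n A \<in> F"
      by (rule spreadingD[OF F(3) n(3)], rule strict_mono_onI) (use n(2) in auto)
    moreover have "(\<lambda>x. if x = n then max n k else x) ` insert n A = insert (max n k) A"
      using n(2) by force
    ultimately have "insert (max n k) A \<in> F" by simp
    moreover have "max n k \<notin> A" using n(2) by (metis linorder_not_less max.cobounded1)
    then have "insert (max n k) A \<noteq> A" by blast
    moreover have "insert (max n k) A \<inter> {..<k} = A \<inter> {..<k}" by auto
    ultimately show ?thesis by (intro bexI[of _ "insert (max n k) A"] conjI)
  qed
  then show "A \<in> cb_deriv F" using n(1) by (simp add: cb_deriv_def)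
qed

lemma cb_deriv_regular:
  assumes F: "F \<subseteq> fin_pos_sets" "hereditary F" "spreading F"
  shows "hereditary (cb_deriv F)" "spreading (cb_deriv F)"
proof -
  show "hereditary (cb_deriv F)"
    unfolding hereditary_def
  proof (intro ballI allI impI)
    fix A B assume "A \<in> cb_deriv F" "B \<subseteq> A"
    then obtain n where "A \<in> F" "\<forall>a\<in>A. a < n" "insert n A \<in> F" using cb_deriv_iff[OF F] by blast
    then show "B \<in> cb_deriv F" using \<open>B \<subseteq> A\<close> hereditaryD[OF F(2)]
      unfolding cb_deriv_iff[OF F] by (meson insert_mono subsetD)
  qed
  show "spreading (cb_deriv F)"
    unfolding spreading_def
  proof (intro ballI allI impI)
    fix A g assume A: "A \<in> cb_deriv F" and g: "strict_mono_on A g \<and> (\<forall>x\<in>A. x \<le> g x)"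
    then obtain n where n: "A \<in> F" "\<forall>a\<in>A. a < n" "insert n A \<in> F" using cb_deriv_iff[OF F] by blast
    have "finite A" using n(1) F(1) by (auto simp: fin_pos_sets_def)
    then obtain m where m: "\<forall>a\<in>insert n (g ` A). a < m"
      by (metis finite_imageI finite_insert finite_nat_set_iff_bounded)
    have "(g(n := m)) ` insert n A \<in> F"
      by (rule spreadingD[OF F(3) n(3)], rule strict_mono_onI)
         (use n(2) g m in \<open>auto simp: strict_mono_on_def less_imp_le\<close>)
    also have "(g(n := m)) ` insert n A = insert m (g ` A)"
      using n(2) by (auto simp: image_def)
    finally have "insert m (g ` A) \<in> F" .
    moreover have "g ` A \<in> F" using spreadingD[OF F(3) n(1)] g by blast
    ultimately show "g ` A \<in> cb_deriv F" using m unfolding cb_deriv_iff[OF F] by blast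
  qed
qed

lemma cb_iter_regular:
  assumes F: "F \<subseteq> fin_pos_sets" "hereditary F" "spreading F"
  shows "cb_iter b F \<subseteq> F \<and> hereditary (cb_iter b F) \<and> spreading (cb_iter b F)"
proof (induction b)
  case (OS b)
  then have "cb_iter b F \<subseteq> fin_pos_sets" using F(1) by blast
  with OS show ?case using cb_deriv_regular[of "cb_iter b F"] by (auto simp: cb_deriv_def)
next
  case (OL f)
  then have *: "hereditary (cb_iter (f n) F)" "spreading (cb_iter (f n) F)" "cb_iter (f n) F \<subseteq> F" for n
    by auto
  have "hereditary (cb_iter (OL f) F)"
    using * unfolding hereditary_def by (simp add: Ball_def) blast
  moreover have "spreading (cb_iter (OL f) F)"
    using * unfolding spreading_def by simp
  ultimately show ?case using *(3) by auto
qed (use F in auto)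

text \<open>End extension is well-founded: the union of an infinite chain would belong to
  \<open>F\<close> by compactness although it is infinite. The recursive rank then describes all the
  derived sets: \<open>A\<close> survives exactly up to its own rank.\<close>

lemma regular_rank_exists:
  assumes R: "regular_family F" and ne: "{} \<in> F"
  shows "\<exists>\<rho>. famrk F \<rho> \<and> \<rho> {} = abs_cord (cb_index F)"
proof -
  have F: "F \<subseteq> fin_pos_sets" "hereditary F" "spreading F" "compact_family F"
    using R by (auto simp: regular_family_def)
  define rel where "rel = {(insert n A, A) | n A. A \<in> F \<and> (\<forall>a\<in>A. a < n) \<and> insert n A \<in> F}"
  have wf: "wf rel"
    unfolding wf_iff_no_infinite_down_chain
  proof
    assume "\<exists>f. \<forall>i. (f (Suc i), f i) \<in> rel"
    then obtain f where f: "\<And>i. (f (Suc i), f i) \<in> rel" by blast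
    then have "\<exists>n. f (Suc i) = insert n (f i) \<and> (\<forall>a\<in>f i. a < n)" for i
      unfolding rel_def by blast
    then obtain n where n: "\<And>i. f (Suc i) = insert (n i) (f i)" "\<And>i a. a \<in> f i \<Longrightarrow> a < n i"
      by metis
    have fF: "f i \<in> F" for i using f[of i] by (auto simp: rel_def)
    have "n i < n (Suc i)" for i using n by blast
    then have mono: "strict_mono n" by (simp add: strict_mono_Suc_iff)
    define U where "U = (\<Union>i. f i)"
    have sub: "f i \<subseteq> f (i + j)" for i j
    proof (induction j)
      case (Suc j)
      then show ?case using n(1)[of "i + j"] by auto
    qed simp
    have tail: "f (i + j) \<inter> {..<i} \<subseteq> f i" for i j
    proof (induction j)
      case (Suc j)
      have "i \<le> n (i + j)" using strict_mono_imp_increasing[OF mono, of "i + j"] by simp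
      then show ?case using Suc n(1)[of "i + j"] by auto
    qed simp
    have "f k \<inter> {..<k} = U \<inter> {..<k}" for k
    proof -
      have "f i \<inter> {..<k} \<subseteq> f k" for i
        using sub[of i "k - i"] tail[of k "i - k"] by (cases "i \<le> k") auto
      then show ?thesis unfolding U_def by blast
    qed
    then have "\<forall>k. \<exists>B\<in>F. B \<inter> {..<k} = U \<inter> {..<k}" using fF by metis
    then have "U \<in> F" using F(4)[unfolded compact_family_def, rule_format, of U] by simp
    then have "finite U" using F(1) by (auto simp: fin_pos_sets_def)
    moreover have "range n \<subseteq> U" using n(1) unfolding U_def by (metis UN_I UNIV_I image_subsetI insertI1)
    ultimately have "finite (range n)" by (rule rev_finite_subset)
    then show False using mono finite_imageD[of n UNIV] strict_mono_imp_inj_on infinite_UNIV_nat by blast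
  qed
  define r where "r = wfrec rel (\<lambda>r A. csup (\<lambda>n. if (insert n A, A) \<in> rel then csuc (r (insert n A)) else 0))"
  have "r A = csup (\<lambda>n. if (insert n A, A) \<in> rel then csuc (r (insert n A)) else 0)" for A
    unfolding r_def by (subst wfrec[OF wf]) (simp add: cut_apply cong: if_cong)
  then have r_rel: "c < r A \<longleftrightarrow> (\<exists>n. (insert n A, A) \<in> rel \<and> c \<le> r (insert n A))" for c A
    by (smt (verit) less_csup_iff less_csuc_iff cord_not_less_zero)
  have rel_iff: "(insert n A, A) \<in> rel \<longleftrightarrow> A \<in> F \<and> (\<forall>a\<in>A. a < n) \<and> insert n A \<in> F" for n A
  proof
    assume "(insert n A, A) \<in> rel"
    then obtain m where m: "insert n A = insert m A" "A \<in> F" "\<forall>a\<in>A. a < m" "insert n A \<in> F"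
      unfolding rel_def by auto
    then have "m = n" by (metis insertE insertI1 less_irrefl)
    then show "A \<in> F \<and> (\<forall>a\<in>A. a < n) \<and> insert n A \<in> F" using m by blast
  qed (auto simp: rel_def)
  have r: "c < r A \<longleftrightarrow> (\<exists>n. A \<in> F \<and> (\<forall>a\<in>A. a < n) \<and> insert n A \<in> F \<and> c \<le> r (insert n A))" for c A
    unfolding r_rel rel_iff by simp
  have iter: "A \<in> cb_iter b F \<longleftrightarrow> A \<in> F \<and> abs_cord b \<le> r A" for A b
  proof (induction b arbitrary: A)
    case (OS b)
    have "cb_iter b F \<subseteq> fin_pos_sets" "hereditary (cb_iter b F)" "spreading (cb_iter b F)"
      using cb_iter_regular[OF F(1-3), of b] F(1) by auto
    then have "A \<in> cb_iter (OS b) F \<longleftrightarrow> A \<in> F \<and> abs_cord b \<le> r A \<and> abs_cord b < r A"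
      using cb_deriv_iff[of "cb_iter b F" A] OS r[of "abs_cord b" A] by auto
    then show ?case by (auto simp: abs_cord_OS)
  qed (auto simp: zero_cord_def[symmetric] abs_cord_OL)
  have rk: "famrk F r"
    unfolding famrk_def using r F(2) hereditaryD by (metis order_refl subset_insertI)
  \<comment> \<open>Strictness matters: only the empty set survives at the rank of the empty set, so
    \<open>cb_iter b F = {{}}\<close> determines \<open>b\<close> up to \<open>oeq\<close> and the
    choice in \<open>cb_index\<close> is harmless.\<close>
  have less: "r A < r {}" if "A \<in> F" "A \<noteq> {}" for A
  proof -
    have fin: "finite A" using that F(1) by (auto simp: fin_pos_sets_def)
    define m where "m = Max A"
    define B where "B = A - {m}"
    have "m \<in> A" using fin that by (simp add: m_def)
    then have A: "A = insert m B" "finite B" using fin by (auto simp: B_def)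
    have m: "\<forall>a\<in>B. a < m" using fin by (auto simp: B_def m_def order_less_le)
    then have "B \<in> F" "r A < r B" using famrkD[OF rk A(2), of m] that A(1) by auto
    moreover have "r B \<le> r {}" using famrk_initial[OF rk, of "{}" B] A(2) \<open>B \<in> F\<close> by auto
    ultimately show ?thesis by simp
  qed
  have "cb_iter b F = {{}} \<longleftrightarrow> abs_cord b = r {}" for b
  proof
    assume b: "cb_iter b F = {{}}"
    then have "abs_cord b \<le> r {}" using iter[of "{}" b] by simp
    moreover have "\<not> abs_cord b < r {}"
      using r[of "abs_cord b" "{}"] iter[of _ b] b by (metis insert_not_empty singletonD)
    ultimately show "abs_cord b = r {}" by simp
  next
    assume b: "abs_cord b = r {}"
    have "A \<in> cb_iter b F \<longleftrightarrow> A = {}" for A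
      using iter[of A b] less[of A] ne b by (cases "A = {}") auto
    then show "cb_iter b F = {{}}" by blast
  qed
  moreover from this have "\<exists>b. cb_iter b F = {{}}" using abs_rep_cord by blast
  then have "cb_iter (cb_index F) F = {{}}" unfolding cb_index_def by (rule someI_ex)
  ultimately show ?thesis using rk by metis
qed

text \<open>Regularity together with an upper bound for the index; the rank function takes the place
  of compactness.\<close>

definition rkfam :: "nat set set \<Rightarrow> cord \<Rightarrow> bool" where
  "rkfam F b \<longleftrightarrow> F \<subseteq> fin_pos_sets \<and> hereditary F \<and> spreading F \<and> {} \<in> F \<and> (\<exists>\<rho>. famrk F \<rho> \<and> \<rho> {} \<le> b)"

lemma rkfamD:
  assumes "rkfam F b"
  shows "F \<subseteq> fin_pos_sets" "hereditary F" "spreading F" "{} \<in> F" "\<exists>\<rho>. famrk F \<rho> \<and> \<rho> {} \<le> b"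
  using assms unfolding rkfam_def by auto

lemma rkfam_finite: "rkfam F b \<Longrightarrow> A \<in> F \<Longrightarrow> finite A"
  unfolding rkfam_def fin_pos_sets_def by blast

lemma rkfam_mono: "rkfam F b \<Longrightarrow> b \<le> c \<Longrightarrow> rkfam F c"
  unfolding rkfam_def using order_trans by blast

lemma rkfam_Un:
  assumes "rkfam F b" "rkfam G b"
  shows "rkfam (F \<union> G) b"
proof -
  obtain \<rho> \<sigma> where \<rho>: "famrk F \<rho>" "\<rho> {} \<le> b" and \<sigma>: "famrk G \<sigma>" "\<sigma> {} \<le> b"
    using assms rkfamD(5) by meson
  \<comment> \<open>Outside a family its rank counts as 0. An end extension lowers each rank that it
    keeps and sends the other to 0; positivity of \<open>\<tau> A\<close> secures strictness in the
    latter case.\<close>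
  define \<tau> where "\<tau> A = max (if A \<in> F then \<rho> A else 0) (if A \<in> G then \<sigma> A else 0)" for A
  have "famrk (F \<union> G) \<tau>"
    unfolding famrk_def
  proof (intro allI impI)
    fix A n assume A: "finite A \<and> (\<forall>a\<in>A. a < n) \<and> insert n A \<in> F \<union> G"
    have 1: "A \<in> F \<and> \<rho> (insert n A) < \<rho> A" if "insert n A \<in> F"
      using famrkD[OF \<rho>(1), of A n] A that by blast
    have 2: "A \<in> G \<and> \<sigma> (insert n A) < \<sigma> A" if "insert n A \<in> G"
      using famrkD[OF \<sigma>(1), of A n] A that by blast
    have "0 < \<tau> A"
    proof (cases "insert n A \<in> F")
      case True
      then have "\<rho> A \<noteq> 0" "A \<in> F" using 1 by auto
      then show ?thesis by (simp add: \<tau>_def less_max_iff_disj cord_pos_iff)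
    next
      case False
      then have "\<sigma> A \<noteq> 0" "A \<in> G" using 2 A by auto
      then show ?thesis by (simp add: \<tau>_def less_max_iff_disj cord_pos_iff)
    qed
    moreover have "\<rho> (insert n A) < \<tau> A" if "insert n A \<in> F"
      using 1[OF that] by (simp add: \<tau>_def less_max_iff_disj)
    moreover have "\<sigma> (insert n A) < \<tau> A" if "insert n A \<in> G"
      using 2[OF that] by (simp add: \<tau>_def less_max_iff_disj)
    ultimately have "\<tau> (insert n A) < \<tau> A"
      unfolding \<tau>_def[of "insert n A"] by auto
    then show "A \<in> F \<union> G \<and> \<tau> (insert n A) < \<tau> A" using A 1 2 by auto
  qed
  moreover have "\<tau> {} \<le> b" using \<rho>(2) \<sigma>(2) by (simp add: \<tau>_def)
  moreover have "hereditary (F \<union> G)"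
    unfolding hereditary_def
    using hereditaryD[OF rkfamD(2)[OF assms(1)]] hereditaryD[OF rkfamD(2)[OF assms(2)]] by blast
  moreover have "spreading (F \<union> G)"
    unfolding spreading_def
  proof (intro ballI allI impI)
    fix A g assume "A \<in> F \<union> G" and g: "strict_mono_on A g \<and> (\<forall>x\<in>A. x \<le> g x)"
    then show "g ` A \<in> F \<union> G"
      using spreadingD[OF rkfamD(3)[OF assms(1)], of A g] spreadingD[OF rkfamD(3)[OF assms(2)], of A g]
      by blast
  qed
  ultimately show ?thesis
    using rkfamD(1,4)[OF assms(1)] rkfamD(1)[OF assms(2)] unfolding rkfam_def by blast
qed

lemma rkfam_UNION:
  assumes "finite I" "rkfam F b" "\<And>i. i \<in> I \<Longrightarrow> rkfam (G i) b"
  shows "rkfam (F \<union> (\<Union>i\<in>I. G i)) b"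
  using assms(1,3)
proof (induction I rule: finite_induct)
  case (insert i I)
  have "F \<union> (\<Union>j\<in>insert i I. G j) = (F \<union> (\<Union>j\<in>I. G j)) \<union> G i" by blast
  then show ?case using insert rkfam_Un by simp
qed (use assms(2) in simp)

section \<open>Successive sets and composition of families\<close>

definition succ_sets :: "nat set set \<Rightarrow> bool" where
  "succ_sets \<F> \<longleftrightarrow> finite \<F> \<and> (\<forall>E\<in>\<F>. finite E \<and> E \<noteq> {}) \<and>
    (\<forall>E\<in>\<F>. \<forall>F\<in>\<F>. E \<noteq> F \<longrightarrow> Max E < Min F \<or> Max F < Min E)"

lemma succ_setsD:
  assumes "succ_sets \<F>" "E \<in> \<F>"
  shows "finite E" "E \<noteq> {}" "Min E \<in> E" "Max E \<in> E" "Min E \<le> Max E"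
  using assms unfolding succ_sets_def by auto

lemma succ_sets_less:
  assumes "succ_sets \<F>" "E \<in> \<F>" "F \<in> \<F>" "x \<in> E" "y \<in> F" "x \<le> y" "E \<noteq> F"
  shows "Max E < Min F"
proof -
  have "\<not> Max F < Min E"
    using assms succ_setsD[OF assms(1,2)] succ_setsD[OF assms(1,3)]
    by (meson Max_ge Min_le leD order_le_less_trans order_trans)
  then show ?thesis using assms unfolding succ_sets_def by blast
qed

lemma succ_sets_Min_less:
  assumes "succ_sets \<F>" "E \<in> \<F>" "F \<in> \<F>" "Min E < Min F"
  shows "Max E < Min F"
  using assms succ_sets_less[OF assms(1-3), of "Min E" "Min F"] succ_setsD
  by (metis less_imp_le order_less_irrefl)

lemma succ_sets_Min_eq:
  assumes "succ_sets \<F>" "E \<in> \<F>" "F \<in> \<F>" "Min E = Min F"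
  shows "E = F"
  using succ_sets_less[OF assms(1-3), of "Min E" "Min F"] succ_setsD[OF assms(1,2)] assms(4)
    succ_setsD[OF assms(1,3)] by (metis leD order_refl)

lemma succ_sets_inj: "succ_sets \<F> \<Longrightarrow> inj_on Min \<F>"
  using succ_sets_Min_eq by (meson inj_onI)

lemma succ_sets_subset: "succ_sets \<F> \<Longrightarrow> \<G> \<subseteq> \<F> \<Longrightarrow> succ_sets \<G>"
  unfolding succ_sets_def by (meson finite_subset subsetD)

lemma succ_sets_disjoint: "succ_sets \<F> \<Longrightarrow> E \<in> \<F> \<Longrightarrow> F \<in> \<F> \<Longrightarrow> x \<in> E \<Longrightarrow> x \<in> F \<Longrightarrow> E = F"
  using succ_sets_less[of \<F> E F x x] succ_setsD by (metis Max_ge Min_le leD order_refl order_trans)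

text \<open>Enumeration by minima. Together with \<open>list_succ_sets\<close> it trades the lists
  in composition and admissibility for unordered sets, whose sums and unions need no
  indices.\<close>

lemma succ_sets_list:
  assumes "succ_sets \<F>"
  shows "\<exists>Fs. set Fs = \<F> \<and> distinct Fs \<and> (\<forall>i j. i < j \<and> j < length Fs \<longrightarrow> Max (Fs ! i) < Min (Fs ! j))"
proof -
  define sl where "sl = sorted_list_of_set (Min ` \<F>)"
  define Fs where "Fs = map (the_inv_into \<F> Min) sl"
  have fin: "finite \<F>" using assms by (simp add: succ_sets_def)
  have inv: "the_inv_into \<F> Min m \<in> \<F> \<and> Min (the_inv_into \<F> Min m) = m" if "m \<in> Min ` \<F>" for m
    using that by (meson f_the_inv_into_f order_refl succ_sets_inj[OF assms] the_inv_into_into)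
  have sl: "set sl = Min ` \<F>" "sorted_wrt (<) sl" "distinct sl"
    using fin by (auto simp: sl_def)
  have "set Fs = \<F>"
    using sl(1) by (simp add: Fs_def image_image the_inv_into_f_f[OF succ_sets_inj[OF assms]])
  moreover have "distinct Fs"
    unfolding Fs_def distinct_map using sl inv by (metis inj_onI)
  moreover have "Max (Fs ! i) < Min (Fs ! j)" if "i < j" "j < length Fs" for i j
  proof -
    have len: "i < length sl" "j < length sl" using that by (simp_all add: Fs_def)
    then have m: "sl ! i \<in> Min ` \<F>" "sl ! j \<in> Min ` \<F>" using sl(1) nth_mem by blast+
    have "sl ! i < sl ! j" using sl(2) that(1) len by (simp add: sorted_wrt_iff_nth_less)
    then show ?thesis
      using inv[OF m(1)] inv[OF m(2)] len
        succ_sets_Min_less[OF assms, of "the_inv_into \<F> Min (sl ! i)" "the_inv_into \<F> Min (sl ! j)"]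
      by (simp add: Fs_def)
  qed
  ultimately show ?thesis by blast
qed

lemma list_succ_sets:
  assumes "\<forall>F\<in>set Fs. finite F \<and> F \<noteq> {}" "\<forall>i j. i < j \<and> j < length Fs \<longrightarrow> Max (Fs ! i) < Min (Fs ! j)"
  shows "succ_sets (set Fs)" "distinct Fs"
proof -
  show "distinct Fs"
    unfolding distinct_conv_nth
  proof (intro allI impI)
    have ne: "Fs ! i \<noteq> Fs ! j" if "i < j" "j < length Fs" for i j
    proof
      assume eq: "Fs ! i = Fs ! j"
      have "finite (Fs ! j)" "Fs ! j \<noteq> {}" using assms(1) that nth_mem by blast+
      then have "Min (Fs ! j) \<le> Max (Fs ! j)" by simp
      then show False using assms(2) that eq by (metis leD)
    qed
    fix i j assume "i < length Fs" "j < length Fs" "i \<noteq> j"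
    then show "Fs ! i \<noteq> Fs ! j" using ne[of i j] ne[of j i] by (metis linorder_neqE_nat)
  qed
  show "succ_sets (set Fs)"
    unfolding succ_sets_def
  proof (intro conjI ballI impI)
    fix E F assume "E \<in> set Fs" "F \<in> set Fs" "E \<noteq> F"
    then obtain i j where "i < length Fs" "j < length Fs" "E = Fs ! i" "F = Fs ! j" "i \<noteq> j"
      by (metis in_set_conv_nth)
    then show "Max E < Min F \<or> Max F < Min E" using assms(2) by (metis linorder_neqE_nat)
  qed (use assms in auto)
qed

lemma fam_comp_iff:
  assumes "N \<subseteq> fin_pos_sets"
  shows "A \<in> fam_comp M N \<longleftrightarrow> (\<exists>\<F>. succ_sets \<F> \<and> \<F> \<subseteq> N \<and> Min ` \<F> \<in> M \<and> A = \<Union>\<F>)"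
proof
  assume "A \<in> fam_comp M N"
  then obtain Fs where Fs: "A = \<Union>(set Fs)" "\<forall>F\<in>set Fs. F \<in> N \<and> F \<noteq> {}"
      "\<forall>i j. i < j \<and> j < length Fs \<longrightarrow> Max (Fs ! i) < Min (Fs ! j)" "Min ` set Fs \<in> M"
    unfolding fam_comp_def by blast
  moreover have "\<forall>F\<in>set Fs. finite F \<and> F \<noteq> {}" using Fs(2) assms by (auto simp: fin_pos_sets_def)
  ultimately show "\<exists>\<F>. succ_sets \<F> \<and> \<F> \<subseteq> N \<and> Min ` \<F> \<in> M \<and> A = \<Union>\<F>"
    using list_succ_sets[of Fs] by blast
next
  assume "\<exists>\<F>. succ_sets \<F> \<and> \<F> \<subseteq> N \<and> Min ` \<F> \<in> M \<and> A = \<Union>\<F>"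
  then obtain \<F> where F: "succ_sets \<F>" "\<F> \<subseteq> N" "Min ` \<F> \<in> M" "A = \<Union>\<F>" by blast
  then show "A \<in> fam_comp M N"
    using succ_sets_list[OF F(1)] succ_setsD(2)[OF F(1)] unfolding fam_comp_def by blast
qed

lemma fam_compE:
  assumes "A \<in> fam_comp M N" "N \<subseteq> fin_pos_sets"
  obtains \<F> where "succ_sets \<F>" "\<F> \<subseteq> N" "Min ` \<F> \<in> M" "A = \<Union>\<F>"
  using fam_comp_iff[OF assms(2), of A M] assms(1) by metis

lemma fam_comp_fin_pos: "N \<subseteq> fin_pos_sets \<Longrightarrow> fam_comp M N \<subseteq> fin_pos_sets"
proof
  fix A assume N: "N \<subseteq> fin_pos_sets" and "A \<in> fam_comp M N"
  then obtain \<F> where F: "succ_sets \<F>" "\<F> \<subseteq> N" "A = \<Union>\<F>" using fam_compE by metis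
  then have "finite \<F>" by (simp add: succ_sets_def)
  with F show "A \<in> fin_pos_sets" using N by (auto simp: fin_pos_sets_def)
qed

text \<open>Cutting the pieces down to \<open>B\<close> moves their minima to the right in the same
  order, so spreading of \<open>M\<close> keeps the new minima in \<open>M\<close>.\<close>

lemma fam_comp_hereditary:
  assumes N: "N \<subseteq> fin_pos_sets" "hereditary N" and M: "hereditary M" "spreading M"
  shows "hereditary (fam_comp M N)"
  unfolding hereditary_def
proof (intro ballI allI impI)
  fix A B assume "A \<in> fam_comp M N" and BA: "B \<subseteq> A"
  then obtain \<F> where F: "succ_sets \<F>" "\<F> \<subseteq> N" "Min ` \<F> \<in> M" "A = \<Union>\<F>"
    using fam_compE[OF _ N(1)] by metis
  define J where "J = {F\<in>\<F>. F \<inter> B \<noteq> {}}"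
  define \<G> where "\<G> = (\<lambda>F. F \<inter> B) ` J"
  have J: "F \<in> \<F>" "finite (F \<inter> B)" "F \<inter> B \<noteq> {}" "Min F \<le> Min (F \<inter> B)" "Max (F \<inter> B) \<le> Max F"
    "Min (F \<inter> B) \<le> Max (F \<inter> B)" if "F \<in> J" for F
  proof -
    show fin: "F \<in> \<F>" "finite (F \<inter> B)" "F \<inter> B \<noteq> {}"
      using that succ_setsD(1)[OF F(1)] by (auto simp: J_def)
    show "Min F \<le> Min (F \<inter> B)" "Max (F \<inter> B) \<le> Max F"
      using fin succ_setsD(1)[OF F(1)] by (auto intro!: Min_antimono Max_mono)
    show "Min (F \<inter> B) \<le> Max (F \<inter> B)" using fin by (meson Max_ge Min_in)
  qed
  have lt: "Max (E \<inter> B) < Min (F \<inter> B)" if "E \<in> J" "F \<in> J" "Min E < Min F" for E F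
  proof -
    have "Max E < Min F" using succ_sets_Min_less[OF F(1) _ _ that(3)] J that by blast
    then show ?thesis using J(5)[OF that(1)] J(4)[OF that(2)] by linarith
  qed
  have "succ_sets \<G>"
    unfolding succ_sets_def
  proof (intro conjI ballI impI)
    show "finite \<G>" using F(1) by (auto simp: \<G>_def J_def succ_sets_def)
    fix E' F' assume "E' \<in> \<G>" "F' \<in> \<G>" "E' \<noteq> F'"
    then obtain E F0 where EF: "E \<in> J" "F0 \<in> J" "E' = E \<inter> B" "F' = F0 \<inter> B" "E \<noteq> F0"
      by (auto simp: \<G>_def)
    then have "Min E \<noteq> Min F0" using succ_sets_Min_eq[OF F(1) J(1) J(1)] by blast
    then show "Max E' < Min F' \<or> Max F' < Min E'" using lt[OF EF(1,2)] lt[OF EF(2,1)] EF(3,4)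
      by (metis linorder_neqE_nat)
  qed (use J in \<open>auto simp: \<G>_def\<close>)
  moreover have "\<G> \<subseteq> N" using J(1) F(2) hereditaryD[OF N(2)] unfolding \<G>_def by (meson Int_lower1 image_subsetI subsetD)
  moreover have "(\<lambda>F. Min (F \<inter> B)) ` J \<in> M"
  proof (rule spread_image[OF M F(3), of Min])
    fix E F' assume *: "E \<in> J" "F' \<in> J"
    show "Min E < Min F' \<Longrightarrow> Min (E \<inter> B) < Min (F' \<inter> B)"
      using lt[OF *] J(6)[OF *(1)] by linarith
    show "Min E = Min F' \<Longrightarrow> Min (E \<inter> B) = Min (F' \<inter> B)"
      using succ_sets_Min_eq[OF F(1) J(1)[OF *(1)] J(1)[OF *(2)]] by simp
  qed (use J in auto)
  then have "Min ` \<G> \<in> M" by (simp add: \<G>_def image_image)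
  moreover have "B = \<Union>\<G>" using BA F(4) by (auto simp: \<G>_def J_def)
  ultimately show "B \<in> fam_comp M N" using fam_comp_iff[OF N(1)] by blast
qed

lemma strict_mono_on_Min_Max:
  fixes g :: "nat \<Rightarrow> nat"
  assumes "strict_mono_on F g" "finite F" "F \<noteq> {}"
  shows "Min (g ` F) = g (Min F)" "Max (g ` F) = g (Max F)"
proof -
  have le: "g x \<le> g y" if "x \<in> F" "y \<in> F" "x \<le> y" for x y
    using strict_mono_onD[OF assms(1) that(1,2)] that(3) by (cases "x = y") auto
  have in_F: "Min F \<in> F" "Max F \<in> F" using assms(2,3) by simp_all
  show "Min (g ` F) = g (Min F)"
  proof (rule Min_eqI)
    show "g (Min F) \<le> y" if "y \<in> g ` F" for y
      using that le[OF in_F(1)] Min_le[OF assms(2)] by blast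
  qed (use assms(2) in_F in blast)+
  show "Max (g ` F) = g (Max F)"
  proof (rule Max_eqI)
    show "y \<le> g (Max F)" if "y \<in> g ` F" for y
      using that le[OF _ in_F(2)] Max_ge[OF assms(2)] by blast
  qed (use assms(2) in_F in blast)+
qed

lemma fam_comp_spreading:
  assumes N: "N \<subseteq> fin_pos_sets" "spreading N" and M: "spreading M"
  shows "spreading (fam_comp M N)"
  unfolding spreading_def
proof (intro ballI allI impI)
  fix A g assume "A \<in> fam_comp M N" and g: "strict_mono_on A g \<and> (\<forall>x\<in>A. x \<le> g x)"
  then obtain \<F> where F: "succ_sets \<F>" "\<F> \<subseteq> N" "Min ` \<F> \<in> M" "A = \<Union>\<F>"
    using fam_compE[OF _ N(1)] by metis
  have gF: "strict_mono_on F g" "\<And>x. x \<in> F \<Longrightarrow> x \<le> g x" if "F \<in> \<F>" for F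
    using that g F(4) by (auto intro: strict_mono_onI dest: strict_mono_onD)
  have mm: "Min (g ` E) = g (Min E)" "Max (g ` E) = g (Max E)" if "E \<in> \<F>" for E
    using strict_mono_on_Min_Max[OF gF(1)] that succ_setsD[OF F(1) that] by auto
  have "succ_sets ((`) g ` \<F>)"
    unfolding succ_sets_def
  proof (intro conjI ballI impI)
    fix E' F' assume "E' \<in> (`) g ` \<F>" "F' \<in> (`) g ` \<F>" "E' \<noteq> F'"
    then obtain E F0 where EF: "E \<in> \<F>" "F0 \<in> \<F>" "E \<noteq> F0" "E' = g ` E" "F' = g ` F0" by blast
    have lt: "g (Max E1) < g (Min E2)" if "E1 \<in> \<F>" "E2 \<in> \<F>" "Max E1 < Min E2" for E1 E2
    proof (rule strict_mono_onD[OF conjunct1[OF g] _ _ that(3)])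
      show "Max E1 \<in> A" "Min E2 \<in> A" using that(1,2) succ_setsD[OF F(1)] F(4) by blast+
    qed
    have "Max E < Min F0 \<or> Max F0 < Min E" using F(1) EF(1-3) unfolding succ_sets_def by blast
    then show "Max E' < Min F' \<or> Max F' < Min E'"
      using lt EF mm by metis
  qed (use F(1) in \<open>auto simp: succ_sets_def\<close>)
  moreover have "(`) g ` \<F> \<subseteq> N"
    using F(2) gF spreadingD[OF N(2)] by blast
  moreover have "Min ` ((`) g ` \<F>) = g ` (Min ` \<F>)" using mm(1) by (auto simp: image_image)
  moreover have "g ` (Min ` \<F>) \<in> M"
  proof (rule spreadingD[OF M F(3)])
    have sub: "Min ` \<F> \<subseteq> A" using succ_setsD(3)[OF F(1)] F(4) by blast
    then show "strict_mono_on (Min ` \<F>) g" 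
      using strict_mono_onD[OF conjunct1[OF g]] by (intro strict_mono_onI) blast
    show "\<And>x. x \<in> Min ` \<F> \<Longrightarrow> x \<le> g x" using sub g by blast
  qed
  moreover have "g ` A = \<Union>((`) g ` \<F>)" using F(4) by blast
  ultimately show "g ` A \<in> fam_comp M N" unfolding fam_comp_iff[OF N(1)] by metis
qed

lemma famrk_less_empty:
  assumes "famrk F \<rho>" "A \<in> F" "finite A" "A \<noteq> {}"
  shows "\<rho> A < \<rho> {}"
proof -
  define B where "B = A - {Max A}"
  have "Max A \<in> A" using assms(3,4) by simp
  then have A: "A = insert (Max A) B" "finite B" using assms(3) by (auto simp: B_def)
  have lt: "\<forall>b\<in>B. b < Max A" using assms by (auto simp: B_def order_less_le)
  have "insert (Max A) B \<in> F" using A(1) assms(2) by simp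
  note B = famrkD[OF assms(1) A(2) lt this]
  have "\<rho> B \<le> \<rho> {}" using famrk_initial[OF assms(1), of "{}" B] A(2) B(1) by auto
  moreover have "\<rho> A < \<rho> B" using B(2) A(1) by metis
  ultimately show ?thesis by simp
qed

text \<open>The rank of \<open>A\<close> is read lexicographically: \<nu> times the outer rank of
  the minima, plus the inner rank of the piece containing Max A. A new largest point extends the
  last piece or opens another one; in the second case the outer rank drops and the inner rank
  restarts below \<nu>.\<close>

lemma rkfam_fam_comp:
  assumes N: "rkfam N \<nu>" and M: "rkfam M \<mu>"
  shows "rkfam (fam_comp M N) (\<nu> * \<mu>)"
proof -
  obtain \<rho> where \<rho>: "famrk N \<rho>" "\<rho> {} \<le> \<nu>" using rkfamD(5)[OF N] by blast
  obtain \<sigma> where \<sigma>: "famrk M \<sigma>" "\<sigma> {} \<le> \<mu>" using rkfamD(5)[OF M] by blast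
  define dec where "dec A \<F> \<longleftrightarrow> succ_sets \<F> \<and> \<F> \<subseteq> N \<and> Min ` \<F> \<in> M \<and> A = \<Union>\<F>" for A \<F>
  have dec: "A \<in> fam_comp M N \<longleftrightarrow> (\<exists>\<F>. dec A \<F>)" for A
    unfolding dec_def by (rule fam_comp_iff[OF rkfamD(1)[OF N]])
  \<comment> \<open>Decompositions are not unique, hence the maximum over the finitely many of them.
    The empty set has no last piece, which the conditional accounts for.\<close>
  define val where "val A = (\<lambda>(\<F>, G). \<nu> * \<sigma> (Min ` \<F>) + (if A = {} then 0 else \<rho> G)) `
     {(\<F>, G). dec A \<F> \<and> (A = {} \<and> G = {} \<or> G \<in> \<F> \<and> Max A \<in> G)}" for A
  define \<tau> where "\<tau> A = Max (val A)" for A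
  have fin: "finite (val A)" if "finite A" for A
    unfolding val_def
    by (rule finite_imageI, rule finite_subset[of _ "Pow (Pow A) \<times> Pow A"]) (use that in \<open>auto simp: dec_def\<close>)
  have fam: "famrk (fam_comp M N) \<tau>"
    unfolding famrk_def
  proof (intro allI impI)
    fix A n assume A: "finite A \<and> (\<forall>a\<in>A. a < n) \<and> insert n A \<in> fam_comp M N"
    have maxn: "Max (insert n A) = n"
      using A by (intro Max_eqI) (auto simp: less_imp_le)
    \<comment> \<open>Removing \<open>n\<close> from any decomposition of \<open>insert n A\<close>
      gives one of \<open>A\<close> with a larger value, so the maxima compare strictly.\<close>
    have key: "\<exists>w\<in>val A. v < w" if v: "v \<in> val (insert n A)" for v
    proof -
      from v obtain \<F> G where F: "dec (insert n A) \<F>" and G: "G \<in> \<F>" "n \<in> G"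
        and veq: "v = \<nu> * \<sigma> (Min ` \<F>) + \<rho> G"
        unfolding val_def maxn by auto
      have S: "succ_sets \<F>" "\<F> \<subseteq> N" "Min ` \<F> \<in> M" "insert n A = \<Union>\<F>"
        using F by (auto simp: dec_def)
      have nA: "n \<notin> A" using A by blast
      have nF: "n \<notin> E" if "E \<in> \<F>" "E \<noteq> G" for E
        using succ_sets_disjoint[OF S(1) that(1) G(1) _ G(2)] that(2) by blast
      have other: "E \<subseteq> A" if "E \<in> \<F>" "E \<noteq> G" for E
      proof
        fix x assume "x \<in> E"
        then have "x \<in> insert n A" "x \<noteq> n" using S(4) that(1) nF[OF that] by auto
        then show "x \<in> A" by blast
      qed
      have finG: "finite G" using succ_setsD(1)[OF S(1) G(1)] .
      have GA: "G - {n} \<subseteq> A" using S(4) G(1) by blast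
      have lt: "\<forall>a\<in>G - {n}. a < n" using GA A by blast
      have insG: "insert n (G - {n}) = G" using G(2) by blast
      show ?thesis
      proof (cases "G = {n}")
        case True
        define \<G> where "\<G> = \<F> - {G}"
        have AG: "A = \<Union>\<G>"
        proof
          show "\<Union>\<G> \<subseteq> A" using other by (auto simp: \<G>_def)
          show "A \<subseteq> \<Union>\<G>"
          proof
            fix a assume a: "a \<in> A"
            then obtain E where "E \<in> \<F>" "a \<in> E" using S(4) by blast
            moreover have "E \<noteq> G" using \<open>a \<in> E\<close> True a nA by auto
            ultimately show "a \<in> \<Union>\<G>" by (auto simp: \<G>_def)
          qed
        qed
        have "\<F> = insert {n} \<G>" using G(1) True by (auto simp: \<G>_def)
        then have Min: "Min ` \<F> = insert n (Min ` \<G>)" by simp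
        have "Min E \<in> A" if "E \<in> \<G>" for E
          using succ_setsD(3)[OF S(1), of E] other[of E] that by (auto simp: \<G>_def)
        then have lt': "\<forall>a\<in>Min ` \<G>. a < n" using A by blast
        have finG': "finite (Min ` \<G>)" using S(1) by (simp add: succ_sets_def \<G>_def)
        note M1 = famrkD[OF \<sigma>(1) finG' lt', unfolded Min[symmetric], OF S(3)]
        have dG: "dec A \<G>"
          unfolding dec_def
        proof (intro conjI)
          show "succ_sets \<G>" using succ_sets_subset[OF S(1)] by (auto simp: \<G>_def)
        qed (use AG S(2) M1(1) in \<open>auto simp: \<G>_def\<close>)
        have "\<rho> G < \<rho> {}"
          using famrk_less_empty[OF \<rho>(1)] G(1) S(2) finG G(2) by blast
        then have v: "v < \<nu> * \<sigma> (Min ` \<F>) + \<nu>"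
          unfolding veq using \<rho>(2) by simp
        also have "\<dots> = \<nu> * csuc (\<sigma> (Min ` \<F>))" by simp
        also have "\<dots> \<le> \<nu> * \<sigma> (Min ` \<G>)"
          using M1(2) by (intro cord_mul_le_mono_right) simp
        finally have less: "v < \<nu> * \<sigma> (Min ` \<G>)" .
        show ?thesis
        proof (cases "A = {}")
          case True
          then have "(\<G>, {}) \<in> {(\<F>, G). dec A \<F> \<and> (A = {} \<and> G = {} \<or> G \<in> \<F> \<and> Max A \<in> G)}" using dG by simp
          then have "\<nu> * \<sigma> (Min ` \<G>) \<in> val A" unfolding val_def using True by (auto intro!: image_eqI)
          then show ?thesis using less by blast
        next
          case False
          then have "Max A \<in> A" using A by simp
          then obtain H where "H \<in> \<G>" "Max A \<in> H" using AG by blast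
          then have "(\<G>, H) \<in> {(\<F>, G). dec A \<F> \<and> (A = {} \<and> G = {} \<or> G \<in> \<F> \<and> Max A \<in> G)}" using dG by simp
          then have "\<nu> * \<sigma> (Min ` \<G>) + \<rho> H \<in> val A" unfolding val_def using False by (auto intro!: image_eqI)
          moreover have "v < \<nu> * \<sigma> (Min ` \<G>) + \<rho> H" using less cord_le_add1 order_less_le_trans by blast
          ultimately show ?thesis by blast
        qed
      next
        case False
        define H where "H = G - {n}"
        have H: "H \<noteq> {}" "finite H" "H \<subseteq> A" using False G(2) GA finG by (auto simp: H_def)
        have GH: "G = insert n H" using insG by (simp add: H_def)
        have "Min H \<in> H" using H by simp
        then have "Min H < n" using lt by (simp add: H_def)
        then have MinH: "Min H = Min G" unfolding GH using Min_insert[OF H(2,1), of n] by simp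
        define \<G> where "\<G> = insert H (\<F> - {G})"
        have H_lt: "Max E < Min H" if "E \<in> \<F>" "E \<noteq> G" for E
        proof -
          have "Max E \<le> n" using other[OF that] succ_setsD(4)[OF S(1) that(1)] A by (auto intro: less_imp_le)
          then show ?thesis using succ_sets_less[OF S(1) that(1) G(1) succ_setsD(4)[OF S(1) that(1)] G(2)] that(2)
            by (simp add: MinH)
        qed
        have "succ_sets \<G>"
          unfolding succ_sets_def
        proof (intro conjI ballI impI)
          show "finite \<G>" using S(1) by (simp add: \<G>_def succ_sets_def)
          fix E F assume EF: "E \<in> \<G>" "F \<in> \<G>" "E \<noteq> F"
          then consider "E \<in> \<F> - {G}" "F \<in> \<F> - {G}" | "E = H" "F \<in> \<F> - {G}" | "F = H" "E \<in> \<F> - {G}"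
            by (auto simp: \<G>_def)
          then show "Max E < Min F \<or> Max F < Min E"
          proof cases
            case 1
            then show ?thesis using S(1) EF(3) unfolding succ_sets_def by blast
          qed (use H_lt in auto)
        qed (use H S(1) in \<open>auto simp: \<G>_def succ_sets_def\<close>)
        moreover have "H \<in> N \<and> \<rho> G < \<rho> H"
          using famrkD[OF \<rho>(1) H(2), of n] lt S(2) G(1) unfolding GH by (auto simp: H_def)
        moreover have MinG: "Min ` \<G> = Min ` \<F>"
        proof -
          have "\<F> = insert G (\<F> - {G})" using G(1) by blast
          then have "Min ` \<F> = insert (Min G) (Min ` (\<F> - {G}))" by (metis image_insert)
          then show ?thesis by (simp add: \<G>_def MinH)
        qed
        moreover have AG: "A = \<Union>\<G>"
        proof
          show "\<Union>\<G> \<subseteq> A" using other H by (auto simp: \<G>_def)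
          show "A \<subseteq> \<Union>\<G>" using S(4) nA GH by (auto simp: \<G>_def)
        qed
        ultimately have dG: "dec A \<G>" and less: "\<rho> G < \<rho> H" using S by (auto simp: dec_def \<G>_def)
        have Ane: "A \<noteq> {}" using H by blast
        then have "Max A \<in> A" "\<forall>a\<in>A. a \<le> Max A" using A by auto
        have "Max A \<in> H"
        proof (rule ccontr)
          assume "Max A \<notin> H"
          then obtain E where E: "E \<in> \<F>" "E \<noteq> G" "Max A \<in> E" using \<open>Max A \<in> A\<close> AG by (auto simp: \<G>_def)
          obtain h where "h \<in> H" using H by blast
          have "Max A \<le> Max E" using E succ_setsD(1)[OF S(1) E(1)] by simp
          also have "\<dots> < Min H" using H_lt E by blast
          also have "\<dots> \<le> h" using H \<open>h \<in> H\<close> by simp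
          finally show False using \<open>\<forall>a\<in>A. a \<le> Max A\<close> \<open>h \<in> H\<close> H(3) by (meson leD subsetD)
        qed
        then have "(\<G>, H) \<in> {(\<F>, G). dec A \<F> \<and> (A = {} \<and> G = {} \<or> G \<in> \<F> \<and> Max A \<in> G)}"
          using dG by (simp add: \<G>_def)
        then have "\<nu> * \<sigma> (Min ` \<G>) + \<rho> H \<in> val A" unfolding val_def using Ane by (auto intro!: image_eqI)
        moreover have "v < \<nu> * \<sigma> (Min ` \<G>) + \<rho> H" unfolding veq MinG using less by simp
        ultimately show ?thesis by blast
      qed
    qed
    have "val (insert n A) \<noteq> {}"
    proof -
      obtain \<F> where F: "dec (insert n A) \<F>" using A dec by blast
      then obtain G where "G \<in> \<F>" "n \<in> G" unfolding dec_def by blast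
      then show ?thesis unfolding val_def maxn using F by auto
    qed
    then have "\<tau> (insert n A) \<in> val (insert n A)" unfolding \<tau>_def using fin[of "insert n A"] A by simp
    then obtain w where "w \<in> val A" "\<tau> (insert n A) < w" using key by blast
    then have "\<tau> (insert n A) < \<tau> A" unfolding \<tau>_def[of A] using fin[of A] A
      by (meson Max_ge order_less_le_trans)
    moreover have "A \<in> fam_comp M N" using \<open>w \<in> val A\<close> dec unfolding val_def by auto
    ultimately show "A \<in> fam_comp M N \<and> \<tau> (insert n A) < \<tau> A" by simp
  qed
  have dec0: "dec {} \<F> \<longleftrightarrow> \<F> = {}" for \<F>
    using rkfamD(4)[OF M] by (auto simp: dec_def succ_sets_def)
  have "{(\<F>, G). dec {} \<F> \<and> ({} = {} \<and> G = {} \<or> G \<in> \<F> \<and> Max {} \<in> G)} = {({}, {})}"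
    unfolding dec0 by auto
  then have "val {} = {\<nu> * \<sigma> {}}" unfolding val_def by simp
  then have "\<tau> {} \<le> \<nu> * \<mu>" using \<sigma>(2) by (simp add: \<tau>_def cord_mul_le_mono_right)
  moreover have "{} \<in> fam_comp M N" using dec dec0 by blast
  ultimately show ?thesis
    unfolding rkfam_def
    using fam fam_comp_fin_pos[OF rkfamD(1)[OF N]] fam_comp_hereditary[OF rkfamD(1,2)[OF N] rkfamD(2,3)[OF M]]
      fam_comp_spreading[OF rkfamD(1,3)[OF N] rkfamD(3)[OF M]] by blast
qed

lemma rkfam_schreier0: "rkfam schreier0 1"
proof -
  have "famrk schreier0 (\<lambda>A. if A = {} then 1 else 0)"
    unfolding famrk_def
  proof (intro allI impI)
    fix A n assume A: "finite A \<and> (\<forall>a\<in>A. a < n) \<and> insert n A \<in> schreier0"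
    then have "A = {}" unfolding schreier0_def by (auto simp: insert_eq_iff)
    then show "A \<in> schreier0 \<and> (if insert n A = {} then 1 else 0) < (if A = {} then 1 else (0::cord))"
      by (simp add: schreier0_def one_cord_def)
  qed
  moreover have "hereditary schreier0" unfolding hereditary_def schreier0_def by (auto simp: subset_singleton_iff)
  moreover have "spreading schreier0" unfolding spreading_def schreier0_def by fastforce
  ultimately show ?thesis unfolding rkfam_def
    by (intro conjI exI[of _ "\<lambda>A. if A = {} then 1 else 0"]) (auto simp: schreier0_def fin_pos_sets_def)
qed

lemma rkfam_schreier1: "rkfam schreier1 comega"
proof -
  \<comment> \<open>Once the minimum is known, the rank counts how many points may still be added;
    only the choice of the first point costs \<omega>.\<close>
  define \<rho> where "\<rho> A = (if A = {} then comega else cnat (Min A - card A))" for A :: "nat set"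
  have "famrk schreier1 \<rho>"
    unfolding famrk_def
  proof (intro allI impI)
    fix A n assume A: "finite A \<and> (\<forall>a\<in>A. a < n) \<and> insert n A \<in> schreier1"
    show "A \<in> schreier1 \<and> \<rho> (insert n A) < \<rho> A"
    proof (cases "A = {}")
      case True
      then show ?thesis by (simp add: schreier1_def \<rho>_def cnat_less_comega fin_pos_sets_def)
    next
      case False
      then have "Min A \<in> A" using A by simp
      then have "Min A < n" using A by blast
      then have "Min (insert n A) = Min A" using A False by simp
      moreover have "card (insert n A) = Suc (card A)" using A by auto
      ultimately have "Suc (card A) \<le> Min A" "A \<in> fin_pos_sets"
        using A by (auto simp: schreier1_def fin_pos_sets_def simp del: Min_insert Min_ge_iff)
      then show ?thesis
        using False \<open>Min (insert n A) = Min A\<close> \<open>card (insert n A) = Suc (card A)\<close>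
        by (simp add: schreier1_def \<rho>_def diff_less_mono2 del: Min_ge_iff)
    qed
  qed
  moreover have "hereditary schreier1"
    unfolding hereditary_def
  proof (intro ballI allI impI)
    fix A B assume A: "A \<in> schreier1" "B \<subseteq> A"
    then have fin: "finite A" "finite B" by (auto simp: schreier1_def fin_pos_sets_def dest: finite_subset)
    show "B \<in> schreier1"
    proof (cases "B = {}")
      case False
      then have "card B \<le> card A" "Min A \<le> Min B" using A fin by (auto intro: card_mono Min_antimono)
      then show ?thesis using A False fin by (auto simp: schreier1_def fin_pos_sets_def)
    qed (simp add: schreier1_def fin_pos_sets_def)
  qed
  moreover have "spreading schreier1"
    unfolding spreading_def
  proof (intro ballI allI impI)
    fix A g assume A: "A \<in> schreier1" and g: "strict_mono_on A g \<and> (\<forall>x\<in>A. x \<le> g x)"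
    have fin: "finite A" "0 \<notin> A" using A by (auto simp: schreier1_def fin_pos_sets_def)
    show "g ` A \<in> schreier1"
    proof (cases "A = {}")
      case False
      have "card (g ` A) \<le> card A" by (rule card_image_le[OF fin(1)])
      also have "\<dots> \<le> Min A" using A False by (simp add: schreier1_def)
      also have "\<dots> \<le> g (Min A)" using g fin False by simp
      also have "\<dots> = Min (g ` A)" using strict_mono_on_Min_Max(1)[of A g] g fin False by simp
      finally show ?thesis using fin False g by (auto simp: schreier1_def fin_pos_sets_def)
    qed (simp add: schreier1_def fin_pos_sets_def)
  qed
  ultimately show ?thesis unfolding rkfam_def
    by (intro conjI exI[of _ \<rho>]) (auto simp: schreier1_def fin_pos_sets_def \<rho>_def)
qed

section \<open>The standard Schreier families\<close>

text \<open>\<open>hat \<eta> n\<close> is the paper's \<open>\<omega>\<^sup>\<eta>\<^sup>-\<^sup>1n\<close>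
  or \<open>\<omega>\<^bsup>\<zeta>\<^sub>n\<^esup>\<close>.\<close>

locale schreier_families =
  fixes Sc :: "cord \<Rightarrow> nat set set" and hat :: "cord \<Rightarrow> nat \<Rightarrow> cord"
  assumes Sc_zero: "Sc 0 = schreier0"
    and Sc_suc: "\<And>c. Sc (csuc c) = fam_comp schreier1 (Sc c)"
    and Sc_limit: "\<And>\<eta> \<mu>. \<eta> \<noteq> 0 \<Longrightarrow> Sc (cpow \<eta> * csuc \<mu>) =
        {F. F = {} \<or> (\<exists>n\<ge>1. n \<le> Min F \<and> F \<in> Sc (cpow \<eta> * \<mu> + hat \<eta> n))}"
    and hat_less: "\<And>\<eta> n. \<eta> \<noteq> 0 \<Longrightarrow> hat \<eta> n < cpow \<eta>"
    and hat_cofinal: "\<And>\<eta> x. \<eta> \<noteq> 0 \<Longrightarrow> x < cpow \<eta> \<Longrightarrow> \<exists>n\<ge>1. x < hat \<eta> n"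

text \<open>\<open>S\<close> respects \<open>oeq\<close>, so it descends to the quotient. The
  clauses for successor and limit exponents merge by recording that \<open>hat \<eta> n\<close> lies
  below \<open>cpow \<eta>\<close> and is cofinal in it.\<close>

lemma schreier_system_cord:
  assumes S: "schreier_system fs S" and fs: "fund_seqs fs"
  obtains Sc hat where "schreier_families Sc hat" "\<And>b. S b = Sc (abs_cord b)"
proof -
  define Sc where "Sc c = S (rep_cord c)" for c
  define hat where "hat \<eta> n = (if \<exists>e. \<eta> = csuc e then cpow (SOME e. \<eta> = csuc e) * cnat n
     else cpow (abs_cord (fs (rep_cord \<eta>) n)))" for \<eta> n
  have hat_suc: "hat (csuc e) n = cpow e * cnat n" for e n
    by (simp add: hat_def)
  have S_eq: "S b = Sc (abs_cord b)" for b
    using S unfolding schreier_system_def Sc_def by (metis abs_rep_cord oeq_iff)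
  have lim: "Sc (cpow \<eta> * csuc \<mu>) = {F. F = {} \<or> (\<exists>n\<ge>1. n \<le> Min F \<and> F \<in> Sc (cpow \<eta> * \<mu> + hat \<eta> n))}"
    if "\<eta> \<noteq> 0" for \<eta> \<mu>
  proof -
    define a where "a = omul (opow (rep_cord \<eta>)) (OS (rep_cord \<mu>))"
    have abs_a: "abs_cord a = cpow \<eta> * csuc \<mu>"
      by (simp add: a_def abs_omul abs_opow abs_cord_OS del: omul.simps)
    have 0: "\<not> oeq (rep_cord \<eta>) OZ" using that by (simp add: oeq_iff)
    have 1: "oeq a (omul (opow (rep_cord \<eta>)) (OS (rep_cord \<mu>))) \<and> \<not> oeq (rep_cord \<eta>) OZ"
      using 0 by (simp add: a_def oeq_iff)
    show ?thesis
    proof (cases "\<exists>e. \<eta> = csuc e")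
      case True
      then obtain e where e: "\<eta> = csuc e" by blast
      then have "oeq (rep_cord \<eta>) (OS (rep_cord e))" by (simp add: oeq_iff abs_cord_OS)
      then have "S a = {F. F = {} \<or> (\<exists>n\<ge>1. n \<le> Min F \<and>
                    F \<in> S (oadd (omul (opow (rep_cord \<eta>)) (rep_cord \<mu>)) (omul (opow (rep_cord e)) (nat_ord n))))}"
        using S 1 unfolding schreier_system_def by blast
      then show ?thesis
        by (simp add: S_eq abs_a abs_oadd abs_omul abs_opow e hat_suc)
    next
      case False
      then have "is_limit_ord (rep_cord \<eta>)" using that by (simp add: is_limit_iff)
      then have "S a = {F. F = {} \<or> (\<exists>n\<ge>1. n \<le> Min F \<and>
                    F \<in> S (oadd (omul (opow (rep_cord \<eta>)) (rep_cord \<mu>)) (opow (fs (rep_cord \<eta>) n))))}"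
        using S 1 unfolding schreier_system_def by blast
      then show ?thesis using False
        by (simp add: S_eq abs_a abs_oadd abs_omul abs_opow hat_def)
    qed
  qed
  have hat_props: "hat \<eta> n < cpow \<eta> \<and> (x < cpow \<eta> \<longrightarrow> (\<exists>n\<ge>1. x < hat \<eta> n))" if "\<eta> \<noteq> 0" for \<eta> n x
  proof (cases "\<exists>e. \<eta> = csuc e")
    case True
    then obtain e where e: "\<eta> = csuc e" by blast
    have "\<exists>n\<ge>1. x < cpow e * cnat n" if x: "x < cpow (csuc e)"
    proof -
      obtain n where "x < cpow e * cnat n" using x by (auto simp: comega_def)
      then have "x < cpow e * cnat (Suc n)"
        by (rule order_less_le_trans) (intro cord_mul_le_mono_right cnat_mono, simp)
      then show ?thesis by (metis One_nat_def Suc_le_mono le0)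
    qed
    then show ?thesis using cpow_mul_cnat_less[of e "csuc e" n] unfolding e hat_suc by simp
  next
    case False
    then have hat: "hat \<eta> n = cpow (abs_cord (fs (rep_cord \<eta>) n))" for n by (simp add: hat_def)
    have "is_limit_ord (rep_cord \<eta>)" using that False by (simp add: is_limit_iff)
    then have f: "\<And>n. olt (fs (rep_cord \<eta>) n) (fs (rep_cord \<eta>) (Suc n))"
        "\<And>n. olt (fs (rep_cord \<eta>) n) (rep_cord \<eta>)"
        "\<And>\<alpha>. olt \<alpha> (rep_cord \<eta>) \<Longrightarrow> \<exists>n. olt \<alpha> (fs (rep_cord \<eta>) n)"
      using fs unfolding fund_seqs_def by blast+
    have "\<exists>n\<ge>1. x < hat \<eta> n" if x: "x < cpow \<eta>"
    proof -
      obtain \<eta>' c where e: "\<eta>' < \<eta>" "x < cpow \<eta>' * cnat c"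
        using less_cpow_ex[OF x \<open>\<eta> \<noteq> 0\<close>] by blast
      then have "olt (rep_cord \<eta>') (rep_cord \<eta>)" by (simp add: olt_iff)
      then obtain n where "olt (rep_cord \<eta>') (fs (rep_cord \<eta>) n)" using f(3) by blast
      \<comment> \<open>The index is raised by one because the limit clause only admits n \<ge>
        1.\<close>
      then have "olt (rep_cord \<eta>') (fs (rep_cord \<eta>) (Suc n))" using f(1) olt_imp_ole olt_ole_trans by blast
      then have "cpow \<eta>' * cnat c \<le> hat \<eta> (Suc n)" unfolding hat
        by (intro cpow_mul_cnat_le) (simp add: olt_iff)
      then show ?thesis using e(2) by (metis One_nat_def Suc_le_mono le0 order_less_le_trans)
    qed
    then show ?thesis using f(2)[of n] by (simp add: hat olt_iff)
  qed
  have "schreier_families Sc hat"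
  proof
    show "Sc 0 = schreier0" using S S_eq[of OZ] by (simp add: schreier_system_def)
    show "Sc (csuc c) = fam_comp schreier1 (Sc c)" for c
      using S S_eq[of "OS (rep_cord c)"] unfolding schreier_system_def by (simp add: Sc_def abs_cord_OS)
  qed (use lim hat_props in auto)
  then show ?thesis using S_eq that by blast
qed

text \<open>Peels off the leading term \<open>cpow d * cnat k\<close> and recurses on the remainder.
  The last exponent \<eta> of the remainder is at most \<open>d\<close>, so the leading term is
  again \<open>cpow \<eta>\<close> times an ordinal.\<close>

lemma cord_last_exponent: "c \<noteq> 0 \<Longrightarrow> \<exists>\<eta> \<mu>. c = cpow \<eta> * csuc \<mu>"
proof (induction c rule: less_induct)
  case (less c)
  obtain d where d: "cpow d \<le> c" "c < cpow (csuc d)" using cpow_bracket[OF less.prems] by blast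
  then obtain z r where z: "z < comega" "r < cpow d" "c = cpow d * z + r"
    using cord_mul_division[of c "cpow d" comega] by auto
  obtain k where k: "z = cnat k" using less_comega_ex[OF z(1)] by blast
  have "k \<noteq> 0" using d(1) z k by (metis cnat_0 cord_mul_zero cord_zero_add leD)
  then obtain j where j: "k = Suc j" using not0_implies_Suc by blast
  show ?case
  proof (cases "r = 0")
    case True
    then show ?thesis using z k j by (metis cnat_Suc cord_add_zero)
  next
    case False
    have "r < c" using z(2) d(1) by simp
    then obtain \<eta> \<mu> where r: "r = cpow \<eta> * csuc \<mu>" using less.IH False by blast
    have "cpow \<eta> \<le> r" unfolding r by simp
    then have "cpow \<eta> < cpow d" using z(2) by (rule order_le_less_trans)
    then have "\<eta> \<le> d" by simp
    then obtain e where e: "d = \<eta> + e" using cord_le_ex_add by blast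
    have "c = cpow \<eta> * csuc (cpow e * z + \<mu>)"
      using z(3) by (simp add: r e cpow_add cord_mul_assoc cord_distrib cord_add_assoc)
    then show ?thesis by blast
  qed
qed

text \<open>The three clauses by which the Schreier families are defined; a last exponent 0 in the
  normal form means a successor.\<close>

lemma cord_cases:
  obtains "c = 0" | b where "c = csuc b" | \<eta> \<mu> where "\<eta> \<noteq> 0" "c = cpow \<eta> * csuc \<mu>"
proof (cases "c = 0")
  case False
  then obtain \<eta> \<mu> where c: "c = cpow \<eta> * csuc \<mu>" using cord_last_exponent by blast
  show ?thesis
  proof (cases "\<eta> = 0")
    case True
    then have "c = csuc \<mu>" using c by (simp del: cord_mul_suc)
    then show ?thesis using that by blast
  qed (use c that in blast)
qed (use that in blast)

context schreier_families
begin

lemma hat_sum_less: "\<eta> \<noteq> 0 \<Longrightarrow> cpow \<eta> * \<mu> + hat \<eta> n < cpow \<eta> * csuc \<mu>"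
  using hat_less[of \<eta> n] by simp

text \<open>At a limit the empty set gets the rank \<open>cpow c\<close>, and any other set the
  maximum of its ranks in the families \<open>Sc (cn n)\<close> with n \<le> Min A. These are
  finitely many, and end extension keeps the minimum, so the maximum decreases.\<close>

lemma rkfam_Sc: "rkfam (Sc c) (cpow c)"
proof (induction c rule: less_induct)
  case (less c)
  show ?case
  proof (cases c rule: cord_cases)
    case 1
    then show ?thesis by (simp add: Sc_zero rkfam_schreier0)
  next
    case (2 b)
    then have "rkfam (Sc b) (cpow b)" using less by simp
    then show ?thesis using rkfam_fam_comp[OF _ rkfam_schreier1] by (simp add: 2 Sc_suc)
  next
    case (3 \<eta> \<mu>)
    define cn where "cn n = cpow \<eta> * \<mu> + hat \<eta> n" for n
    have cn: "cn n < c" for n unfolding cn_def 3 by (rule hat_sum_less[OF 3(1)])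
    have Sc: "Sc c = {F. F = {} \<or> (\<exists>n\<ge>1. n \<le> Min F \<and> F \<in> Sc (cn n))}"
      unfolding 3(2) cn_def by (rule Sc_limit[OF 3(1)])
    have IH: "rkfam (Sc (cn n)) (cpow (cn n))" for n using less cn by blast
    then have "\<exists>\<rho>. famrk (Sc (cn n)) \<rho> \<and> \<rho> {} \<le> cpow (cn n)" for n using rkfamD(5) by blast
    then obtain \<rho> where \<rho>: "\<And>n. famrk (Sc (cn n)) (\<rho> n)" "\<And>n. \<rho> n {} \<le> cpow (cn n)" by metis
    define I where "I A = {n. 1 \<le> n \<and> n \<le> Min A \<and> A \<in> Sc (cn n)}" for A
    define \<tau> where "\<tau> A = (if A = {} then cpow c else Max ((\<lambda>n. \<rho> n A) ` I A))" for A
    have finI: "finite (I A)" for A by (rule finite_subset[of _ "{..Min A}"]) (auto simp: I_def)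
    have "famrk (Sc c) \<tau>"
      unfolding famrk_def
    proof (intro allI impI)
      fix A n assume A: "finite A \<and> (\<forall>a\<in>A. a < n) \<and> insert n A \<in> Sc c"
      then have ne: "I (insert n A) \<noteq> {}" by (auto simp: Sc I_def)
      then have Max_in: "Max ((\<lambda>k. \<rho> k (insert n A)) ` I (insert n A)) \<in> (\<lambda>k. \<rho> k (insert n A)) ` I (insert n A)"
        using finI by (intro Max_in) auto
      then obtain k where k: "k \<in> I (insert n A)" "\<tau> (insert n A) = \<rho> k (insert n A)"
        by (auto simp: \<tau>_def)
      have kA: "A \<in> Sc (cn k)" "\<rho> k (insert n A) < \<rho> k A"
        using famrkD[OF \<rho>(1), of A n k] A k(1) by (auto simp: I_def)
      show "A \<in> Sc c \<and> \<tau> (insert n A) < \<tau> A"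
      proof (cases "A = {}")
        case True
        have "\<rho> k {} < cpow c" using \<rho>(2)[of k] cn[of k] cpow_less_iff order_le_less_trans by blast
        then show ?thesis using kA(2) True k(2) by (simp add: Sc \<tau>_def)
      next
        case False
        then have "Min A \<in> A" using A by simp
        then have "Min (insert n A) = Min A" using A False by (simp add: less_imp_le)
        then have kI: "k \<in> I A" using k(1) kA(1) by (simp add: I_def)
        then have "\<rho> k A \<le> \<tau> A" using finI False by (auto simp: \<tau>_def)
        then show ?thesis using kA(2) k(2) kI False by (auto simp: I_def Sc)
      qed
    qed
    moreover have "hereditary (Sc c)"
      unfolding hereditary_def
    proof (intro ballI allI impI)
      fix A B assume A: "A \<in> Sc c" "B \<subseteq> A"
      show "B \<in> Sc c"
      proof (cases "B = {}")
        case False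
        then obtain n where n: "1 \<le> n" "n \<le> Min A" "A \<in> Sc (cn n)" using A by (auto simp: Sc)
        then have "Min A \<le> Min B" using False A rkfam_finite[OF IH] by (auto intro: Min_antimono)
        then show ?thesis using n A(2) hereditaryD[OF rkfamD(2)[OF IH[of n]]] by (auto simp: Sc)
      qed (simp add: Sc)
    qed
    moreover have "spreading (Sc c)"
      unfolding spreading_def
    proof (intro ballI allI impI)
      fix A g assume A: "A \<in> Sc c" and g: "strict_mono_on A g \<and> (\<forall>x\<in>A. x \<le> g x)"
      show "g ` A \<in> Sc c"
      proof (cases "A = {}")
        case False
        then obtain n where n: "1 \<le> n" "n \<le> Min A" "A \<in> Sc (cn n)" using A by (auto simp: Sc)
        then have fin: "finite A" using rkfam_finite[OF IH] by blast
        then have "Min A \<le> Min (g ` A)" using strict_mono_on_Min_Max(1)[of A g] g False by simp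
        moreover have "g ` A \<in> Sc (cn n)" using spreadingD[OF rkfamD(3)[OF IH[of n]] n(3)] g by blast
        ultimately show ?thesis using n(1,2) by (auto simp: Sc)
      qed (simp add: Sc)
    qed
    moreover have "Sc c \<subseteq> fin_pos_sets" using rkfamD(1)[OF IH] by (auto simp: Sc fin_pos_sets_def)
    ultimately show ?thesis unfolding rkfam_def by (intro conjI exI[of _ \<tau>]) (auto simp: Sc \<tau>_def)
  qed
qed

lemmas Sc_fin_pos = rkfamD(1)[OF rkfam_Sc]
  and Sc_hereditary = rkfamD(2)[OF rkfam_Sc]
  and Sc_spreading = rkfamD(3)[OF rkfam_Sc]
  and Sc_empty = rkfamD(4)[OF rkfam_Sc]

end

section \<open>Algebra of composition and the exact factorization\<close>

lemma fam_comp_schreier0: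
  assumes "N \<subseteq> fin_pos_sets" "{} \<in> N"
  shows "fam_comp schreier0 N = N"
proof (intro set_eqI iffI)
  fix A assume "A \<in> fam_comp schreier0 N"
  then obtain \<F> where F: "succ_sets \<F>" "\<F> \<subseteq> N" "Min ` \<F> \<in> schreier0" "A = \<Union>\<F>"
    using fam_compE[OF _ assms(1)] by metis
  show "A \<in> N"
  proof (cases "\<F> = {}")
    case False
    then obtain G where G: "G \<in> \<F>" by blast
    have "\<F> = {G}"
    proof -
      have "E = G" if "E \<in> \<F>" for E
      proof -
        have "Min E = Min G" using F(3) that G by (auto simp: schreier0_def) (metis imageI singletonD)
        then show ?thesis by (rule succ_sets_Min_eq[OF F(1) that G])
      qed
      then show ?thesis using G by blast
    qed
    then show ?thesis using F by auto
  qed (use F assms in simp)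
next
  fix A assume A: "A \<in> N"
  show "A \<in> fam_comp schreier0 N"
  proof (cases "A = {}")
    case True
    then show ?thesis unfolding fam_comp_iff[OF assms(1)]
      by (intro exI[of _ "{}"]) (auto simp: succ_sets_def schreier0_def)
  next
    case False
    have "finite A" "0 \<notin> A" using A assms(1) by (auto simp: fin_pos_sets_def)
    then have "Min A \<ge> 1" using False Min_in[of A] by (metis One_nat_def Suc_leI neq0_conv)
    then show ?thesis unfolding fam_comp_iff[OF assms(1)]
      using False \<open>finite A\<close> A by (intro exI[of _ "{A}"]) (auto simp: succ_sets_def schreier0_def)
  qed
qed

lemma Union_Min:
  assumes "succ_sets \<F>" "\<F> \<noteq> {}"
  shows "Min (\<Union>\<F>) = Min (Min ` \<F>)"
proof (rule Min_eqI)
  have fin: "finite \<F>" using assms by (simp add: succ_sets_def)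
  show "finite (\<Union>\<F>)" using fin succ_setsD(1)[OF assms(1)] by blast
  have "Min (Min ` \<F>) \<in> Min ` \<F>" using fin assms by simp
  then obtain E where "E \<in> \<F>" "Min (Min ` \<F>) = Min E" by blast
  then show "Min (Min ` \<F>) \<in> \<Union>\<F>" using succ_setsD(3)[OF assms(1)] by (metis UnionI)
  fix y assume "y \<in> \<Union>\<F>"
  then obtain E where E: "E \<in> \<F>" "y \<in> E" by blast
  then have "Min (Min ` \<F>) \<le> Min E" using fin by simp
  also have "\<dots> \<le> y" using E succ_setsD(1)[OF assms(1)] by simp
  finally show "Min (Min ` \<F>) \<le> y" .
qed

text \<open>The decomposition of the set of minima is pulled back: two intervals are grouped when
  their minima lie in the same piece. A factorization of families thus becomes a two-step splitting
  of admissible sequences.\<close>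

lemma succ_sets_group:
  assumes F: "succ_sets \<F>" and M: "Min ` \<F> \<in> fam_comp M N" and N: "N \<subseteq> fin_pos_sets"
  obtains \<U> where "succ_sets \<U>" "Min ` \<U> \<in> M" "\<And>E. E \<in> \<F> \<Longrightarrow> \<exists>U\<in>\<U>. E \<subseteq> U"
    "\<And>U. U \<in> \<U> \<Longrightarrow> Min ` {E\<in>\<F>. E \<subseteq> U} \<in> N \<and> U = \<Union>{E\<in>\<F>. E \<subseteq> U}"
proof -
  obtain \<G> where G: "succ_sets \<G>" "\<G> \<subseteq> N" "Min ` \<G> \<in> M" "Min ` \<F> = \<Union>\<G>"
    using fam_compE[OF M N] by metis
  define fib where "fib G = {E \<in> \<F>. Min E \<in> G}" for G
  define U where "U G = \<Union>(fib G)" for G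
  have fib: "Min ` fib G = G" "succ_sets (fib G)" "fib G \<noteq> {}" if "G \<in> \<G>" for G
  proof -
    show 1: "Min ` fib G = G" using G(4) that by (auto simp: fib_def)
    show "succ_sets (fib G)" using succ_sets_subset[OF F] by (auto simp: fib_def)
    show "fib G \<noteq> {}" using 1 succ_setsD(2)[OF G(1) that] by auto
  qed
  have MinU: "Min (U G) = Min G" if "G \<in> \<G>" for G
    using Union_Min[OF fib(2,3)[OF that]] fib(1)[OF that] by (simp add: U_def)
  have U: "finite (U G)" "U G \<noteq> {}" if "G \<in> \<G>" for G
    using fib[OF that] succ_setsD[OF fib(2)[OF that]] by (auto simp: U_def succ_sets_def)
  have lt: "Max (U G) < Min (U H)" if GH: "G \<in> \<G>" "H \<in> \<G>" "Max G < Min H" for G H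
  proof -
    have "Max (U G) \<in> U G" using U[OF GH(1)] by simp
    then obtain E where E: "E \<in> \<F>" "Min E \<in> G" "Max (U G) \<in> E" by (auto simp: U_def fib_def)
    have "Min H \<in> Min ` \<F>" using G(4) succ_setsD(3)[OF G(1) GH(2)] GH(2) by blast
    then obtain E' where E': "E' \<in> \<F>" "Min E' = Min H" by auto
    have "Min E \<le> Max G" using E(2) succ_setsD(1)[OF G(1) GH(1)] by simp
    then have "Min E < Min E'" using GH(3) E'(2) by simp
    then have "Max E < Min E'" by (rule succ_sets_Min_less[OF F E(1) E'(1)])
    moreover have "Max (U G) \<le> Max E" using E succ_setsD(1)[OF F E(1)] by simp
    ultimately show ?thesis using E'(2) MinU[OF GH(2)] by simp
  qed
  have sub: "{E\<in>\<F>. E \<subseteq> U G} = fib G" for G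
  proof -
    have "E \<in> fib G" if E: "E \<in> \<F>" "E \<subseteq> U G" for E
    proof -
      obtain E' where "E' \<in> fib G" "Min E \<in> E'"
        using succ_setsD(3)[OF F E(1)] E(2) by (auto simp: U_def)
      then show ?thesis
        using succ_sets_disjoint[OF F E(1) _ succ_setsD(3)[OF F E(1)], of E'] by (auto simp: fib_def)
    qed
    then show ?thesis by (auto simp: U_def fib_def)
  qed
  have "succ_sets (U ` \<G>)"
    unfolding succ_sets_def
  proof (intro conjI ballI impI)
    fix X Y assume "X \<in> U ` \<G>" "Y \<in> U ` \<G>" "X \<noteq> Y"
    then obtain G' H where GH: "G' \<in> \<G>" "H \<in> \<G>" "X = U G'" "Y = U H" "G' \<noteq> H" by blast
    then have "Max G' < Min H \<or> Max H < Min G'" using G(1) unfolding succ_sets_def by blast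
    then show "Max X < Min Y \<or> Max Y < Min X" using lt GH by blast
  qed (use G(1) U in \<open>auto simp: succ_sets_def\<close>)
  moreover have "Min ` U ` \<G> = Min ` \<G>" using MinU by (auto simp: image_image)
  moreover have "\<exists>U'\<in>U ` \<G>. E \<subseteq> U'" if "E \<in> \<F>" for E
  proof -
    obtain G' where "G' \<in> \<G>" "Min E \<in> G'" using G(4) \<open>E \<in> \<F>\<close> by auto
    then show ?thesis using \<open>E \<in> \<F>\<close> by (auto simp: U_def fib_def)
  qed
  moreover have "Min ` {E\<in>\<F>. E \<subseteq> U'} \<in> N \<and> U' = \<Union>{E\<in>\<F>. E \<subseteq> U'}" if "U' \<in> U ` \<G>" for U'
  proof -
    obtain G' where G': "G' \<in> \<G>" "U' = U G'" using \<open>U' \<in> U ` \<G>\<close> by blast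
    then show ?thesis using fib(1)[OF G'(1)] G(2) unfolding G'(2) sub by (auto simp: U_def)
  qed
  ultimately show ?thesis using that[of "U ` \<G>"] G(3) by simp
qed

text \<open>One inclusion is \<open>succ_sets_group\<close>. For the other, the pieces of all pieces
  are collected; their minima decompose along the same groups, whose own minima are
  unchanged.\<close>

lemma fam_comp_assoc:
  assumes N: "N \<subseteq> fin_pos_sets" and P: "P \<subseteq> fin_pos_sets"
  shows "fam_comp (fam_comp M N) P = fam_comp M (fam_comp N P)"
proof (intro set_eqI iffI)
  note NP = fam_comp_fin_pos[OF P, of N]
  fix A assume "A \<in> fam_comp (fam_comp M N) P"
  then obtain \<F> where F: "succ_sets \<F>" "\<F> \<subseteq> P" "Min ` \<F> \<in> fam_comp M N" "A = \<Union>\<F>"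
    using fam_compE[OF _ P] by metis
  obtain \<U> where U: "succ_sets \<U>" "Min ` \<U> \<in> M" "\<And>E. E \<in> \<F> \<Longrightarrow> \<exists>U\<in>\<U>. E \<subseteq> U"
    "\<And>U. U \<in> \<U> \<Longrightarrow> Min ` {E\<in>\<F>. E \<subseteq> U} \<in> N \<and> U = \<Union>{E\<in>\<F>. E \<subseteq> U}"
    using succ_sets_group[OF F(1,3) N] by blast
  have "U \<in> fam_comp N P" if "U \<in> \<U>" for U
    unfolding fam_comp_iff[OF P]
    using U(4)[OF that] F(2) succ_sets_subset[OF F(1), of "{E\<in>\<F>. E \<subseteq> U}"]
    by (intro exI[of _ "{E\<in>\<F>. E \<subseteq> U}"]) blast
  moreover have "A = \<Union>\<U>"
  proof
    show "A \<subseteq> \<Union>\<U>" using U(3) F(4) by blast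
    show "\<Union>\<U> \<subseteq> A"
    proof
      fix k assume "k \<in> \<Union>\<U>"
      then obtain U' where "U' \<in> \<U>" "k \<in> U'" by blast
      then have "k \<in> \<Union>{E\<in>\<F>. E \<subseteq> U'}" using U(4) by blast
      then show "k \<in> A" using F(4) by blast
    qed
  qed
  ultimately show "A \<in> fam_comp M (fam_comp N P)"
    unfolding fam_comp_iff[OF NP] using U(1,2) by blast
next
  note NP = fam_comp_fin_pos[OF P, of N]
  fix A assume "A \<in> fam_comp M (fam_comp N P)"
  then obtain \<G> where G: "succ_sets \<G>" "\<G> \<subseteq> fam_comp N P" "Min ` \<G> \<in> M" "A = \<Union>\<G>"
    using fam_compE[OF _ NP] by metis
  have "\<exists>\<F>. succ_sets \<F> \<and> \<F> \<subseteq> P \<and> Min ` \<F> \<in> N \<and> G = \<Union>\<F>" if "G \<in> \<G>" for G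
    using G(2) that fam_comp_iff[OF P] by blast
  then obtain dc where dc: "\<And>G. G \<in> \<G> \<Longrightarrow> succ_sets (dc G)" "\<And>G. G \<in> \<G> \<Longrightarrow> dc G \<subseteq> P"
      "\<And>G. G \<in> \<G> \<Longrightarrow> Min ` dc G \<in> N" "\<And>G. G \<in> \<G> \<Longrightarrow> G = \<Union>(dc G)" by metis
  define \<F> where "\<F> = (\<Union>G\<in>\<G>. dc G)"
  have lt: "Max E < Min E'" if "G \<in> \<G>" "H \<in> \<G>" "Max G < Min H" "E \<in> dc G" "E' \<in> dc H" for G H E E'
  proof -
    have "Max E \<in> G" "Min E' \<in> H"
      using succ_setsD(4)[OF dc(1)[OF that(1)] that(4)] dc(4)[OF that(1)] that(4)
        succ_setsD(3)[OF dc(1)[OF that(2)] that(5)] dc(4)[OF that(2)] that(5) by blast+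
    then have "Max E \<le> Max G" "Min H \<le> Min E'"
      using succ_setsD(1)[OF G(1)] that(1,2) by auto
    then show ?thesis using that(3) by simp
  qed
  have "succ_sets \<F>"
    unfolding succ_sets_def
  proof (intro conjI ballI impI)
    show "finite \<F>" using G(1) dc(1) by (auto simp: succ_sets_def \<F>_def)
    fix E E' assume "E \<in> \<F>" "E' \<in> \<F>" "E \<noteq> E'"
    then obtain G' H where GH: "G' \<in> \<G>" "H \<in> \<G>" "E \<in> dc G'" "E' \<in> dc H" by (auto simp: \<F>_def)
    show "Max E < Min E' \<or> Max E' < Min E"
    proof (cases "G' = H")
      case True
      then show ?thesis using dc(1)[OF GH(1)] GH \<open>E \<noteq> E'\<close> unfolding succ_sets_def by blast
    next
      case False
      then have "Max G' < Min H \<or> Max H < Min G'" using G(1) GH unfolding succ_sets_def by blast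
      then show ?thesis using lt GH by blast
    qed
  next
    fix E assume "E \<in> \<F>"
    then obtain G' where "G' \<in> \<G>" "E \<in> dc G'" by (auto simp: \<F>_def)
    then show "finite E" "E \<noteq> {}" using succ_setsD[OF dc(1)] by blast+
  qed
  moreover have "Min ` \<F> \<in> fam_comp M N"
  proof -
    define B where "B G = Min ` dc G" for G
    have ne: "dc G \<noteq> {}" if "G \<in> \<G>" for G using dc(4)[OF that] succ_setsD(2)[OF G(1) that] by auto
    have MinB: "Min (B G) = Min G" if "G \<in> \<G>" for G
      using Union_Min[OF dc(1)[OF that] ne[OF that]] dc(4)[OF that] by (simp add: B_def)
    have Bsub: "B G \<subseteq> G" if "G \<in> \<G>" for G
      using succ_setsD(3)[OF dc(1)[OF that]] dc(4)[OF that] by (auto simp: B_def)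
    have B: "finite (B G)" "B G \<noteq> {}" "Max (B G) \<le> Max G" if "G \<in> \<G>" for G
    proof -
      show 1: "finite (B G)" "B G \<noteq> {}" using dc(1)[OF that] ne[OF that] by (auto simp: B_def succ_sets_def)
      show "Max (B G) \<le> Max G" using Bsub[OF that] 1 succ_setsD(1)[OF G(1) that] by (intro Max_mono) auto
    qed
    have "succ_sets (B ` \<G>)"
      unfolding succ_sets_def
    proof (intro conjI ballI impI)
      fix X Y assume "X \<in> B ` \<G>" "Y \<in> B ` \<G>" "X \<noteq> Y"
      then obtain G' H where GH: "G' \<in> \<G>" "H \<in> \<G>" "X = B G'" "Y = B H" "G' \<noteq> H" by blast
      then have "Max G' < Min H \<or> Max H < Min G'" using G(1) unfolding succ_sets_def by blast
      then show "Max X < Min Y \<or> Max Y < Min X"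
        using MinB[OF GH(1)] MinB[OF GH(2)] B(3)[OF GH(1)] B(3)[OF GH(2)] GH(3,4) by auto
    qed (use G(1) B in \<open>auto simp: succ_sets_def\<close>)
    moreover have "B ` \<G> \<subseteq> N" using dc(3) by (auto simp: B_def)
    moreover have "Min ` B ` \<G> = Min ` \<G>" using MinB by (auto simp: image_image)
    moreover have "Min ` \<F> = \<Union>(B ` \<G>)" by (auto simp: \<F>_def B_def)
    ultimately show ?thesis unfolding fam_comp_iff[OF N] using G(3) by metis
  qed
  moreover have "\<F> \<subseteq> P" using dc(2) by (auto simp: \<F>_def)
  moreover have "A = \<Union>\<F>"
  proof -
    have "\<Union>\<F> = (\<Union>G\<in>\<G>. \<Union>(dc G))" by (auto simp: \<F>_def)
    also have "\<dots> = (\<Union>G\<in>\<G>. G)" using dc(4) by (intro SUP_cong) auto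
    finally show ?thesis using G(4) by simp
  qed
  ultimately show "A \<in> fam_comp (fam_comp M N) P" unfolding fam_comp_iff[OF P] by metis
qed

text \<open>All exponents of \<alpha> are at most \<zeta>, so the normal form of the sum ends with
  the last term of \<alpha>, and both sides are built by the same successor and limit steps. At
  limits the condition n \<le> Min F agrees because a union of intervals has the same minimum as its
  set of minima.\<close>

lemma (in schreier_families) Sc_add:
  assumes "\<alpha> < cpow (csuc \<zeta>)"
  shows "Sc (cpow \<zeta> * \<kappa> + \<alpha>) = fam_comp (Sc \<alpha>) (Sc (cpow \<zeta> * \<kappa>))"
  using assms
proof (induction \<alpha> rule: less_induct)
  case (less \<alpha>)
  define \<beta> where "\<beta> = cpow \<zeta> * \<kappa>"
  show ?case
  proof (cases \<alpha> rule: cord_cases)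
    case 1
    then show ?thesis using fam_comp_schreier0[OF Sc_fin_pos Sc_empty] by (simp add: Sc_zero)
  next
    case (2 b)
    then have "b < \<alpha>" by simp
    then have "Sc (\<beta> + b) = fam_comp (Sc b) (Sc \<beta>)" using less by (simp add: \<beta>_def)
    then show ?thesis using fam_comp_assoc[OF Sc_fin_pos Sc_fin_pos]
      by (simp add: 2 Sc_suc \<beta>_def)
  next
    case (3 \<eta> \<mu>)
    have "cpow \<eta> \<le> \<alpha>" unfolding 3(2) by simp
    then have "cpow \<eta> < cpow (csuc \<zeta>)" using less.prems by (rule order_le_less_trans)
    then have "\<eta> < csuc \<zeta>" by (simp only: cpow_less_iff)
    then obtain e where e: "\<zeta> = \<eta> + e" using cord_le_ex_add by auto
    have \<beta>: "\<beta> = cpow \<eta> * (cpow e * \<kappa>)" by (simp add: \<beta>_def e cpow_add cord_mul_assoc)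
    define cn where "cn n = cpow \<eta> * \<mu> + hat \<eta> n" for n
    have cn: "cn n < \<alpha>" for n unfolding cn_def 3 by (rule hat_sum_less[OF 3(1)])
    have IH: "Sc (\<beta> + cn n) = fam_comp (Sc (cn n)) (Sc \<beta>)" for n
      unfolding \<beta>_def using less cn[of n] by (meson order_less_trans)
    have "\<beta> + \<alpha> = cpow \<eta> * csuc (cpow e * \<kappa> + \<mu>)"
      by (simp add: \<beta> 3(2) cord_distrib cord_add_assoc)
    then have "Sc (\<beta> + \<alpha>) = {F. F = {} \<or> (\<exists>n\<ge>1. n \<le> Min F \<and> F \<in> Sc (\<beta> + cn n))}"
      using Sc_limit[OF 3(1), of "cpow e * \<kappa> + \<mu>"] by (simp add: \<beta> cn_def cord_distrib cord_add_assoc)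
    then have L: "F \<in> Sc (\<beta> + \<alpha>) \<longleftrightarrow> F = {} \<or> (\<exists>n\<ge>1. n \<le> Min F \<and> F \<in> fam_comp (Sc (cn n)) (Sc \<beta>))" for F
      by (simp add: IH)
    have \<alpha>: "F \<in> Sc \<alpha> \<longleftrightarrow> F = {} \<or> (\<exists>n\<ge>1. n \<le> Min F \<and> F \<in> Sc (cn n))" for F
      using Sc_limit[OF 3(1), of \<mu>] by (simp add: 3(2) cn_def)
    have "F \<in> Sc (\<beta> + \<alpha>) \<longleftrightarrow> F \<in> fam_comp (Sc \<alpha>) (Sc \<beta>)" for F
    proof (cases "F = {}")
      case True
      have "{} \<in> fam_comp (Sc \<alpha>) (Sc \<beta>)" unfolding fam_comp_iff[OF Sc_fin_pos]
        by (intro exI[of _ "{}"]) (simp add: succ_sets_def Sc_empty)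
      then show ?thesis using True Sc_empty by simp
    next
      case False
      show ?thesis
      proof
        assume "F \<in> Sc (\<beta> + \<alpha>)"
        then obtain n where n: "1 \<le> n" "n \<le> Min F" "F \<in> fam_comp (Sc (cn n)) (Sc \<beta>)" using L False by blast
        then obtain \<F> where F: "succ_sets \<F>" "\<F> \<subseteq> Sc \<beta>" "Min ` \<F> \<in> Sc (cn n)" "F = \<Union>\<F>"
          using fam_compE[OF _ Sc_fin_pos] by metis
        have "\<F> \<noteq> {}" using F(4) False by blast
        then have "n \<le> Min (Min ` \<F>)" using n(2) F(4) Union_Min[OF F(1)] by simp
        then have "Min ` \<F> \<in> Sc \<alpha>" using \<alpha> n(1) F(3) by blast
        then show "F \<in> fam_comp (Sc \<alpha>) (Sc \<beta>)" using F fam_comp_iff[OF Sc_fin_pos] by metis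
      next
        assume "F \<in> fam_comp (Sc \<alpha>) (Sc \<beta>)"
        then obtain \<F> where F: "succ_sets \<F>" "\<F> \<subseteq> Sc \<beta>" "Min ` \<F> \<in> Sc \<alpha>" "F = \<Union>\<F>"
          using fam_compE[OF _ Sc_fin_pos] by metis
        have "\<F> \<noteq> {}" using F(4) False by blast
        then obtain n where n: "1 \<le> n" "n \<le> Min (Min ` \<F>)" "Min ` \<F> \<in> Sc (cn n)" using F(3) \<alpha> by auto
        then have "n \<le> Min F" using F(4) Union_Min[OF F(1) \<open>\<F> \<noteq> {}\<close>] by simp
        moreover have "F \<in> fam_comp (Sc (cn n)) (Sc \<beta>)" using F n(3) fam_comp_iff[OF Sc_fin_pos] by metis
        ultimately show "F \<in> Sc (\<beta> + \<alpha>)" using L n(1) by blast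
      qed
    qed
    then show ?thesis unfolding \<beta>_def by blast
  qed
qed

section \<open>Lower bounds for the ranks of the Schreier families\<close>

definition ltree :: "nat set set \<Rightarrow> nat \<Rightarrow> nat list set" where
  "ltree F m = {t. sorted_wrt (<) t \<and> set t \<in> F \<and> (\<forall>x\<in>set t. m < x)}"

lemma succ_sets_insert:
  assumes "succ_sets \<F>" "finite A" "A \<noteq> {}" "\<And>E. E \<in> \<F> \<Longrightarrow> Max E < Min A"
  shows "succ_sets (insert A \<F>)"
  unfolding succ_sets_def
proof (intro conjI ballI impI)
  fix E F assume "E \<in> insert A \<F>" "F \<in> insert A \<F>" "E \<noteq> F"
  then consider "E \<in> \<F>" "F \<in> \<F>" | "E = A" "F \<in> \<F>" | "F = A" "E \<in> \<F>" by blast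
  then show "Max E < Min F \<or> Max F < Min E"
  proof cases
    case 1
    then show ?thesis using assms(1) \<open>E \<noteq> F\<close> unfolding succ_sets_def by blast
  qed (use assms(4) in auto)
qed (use assms in \<open>auto simp: succ_sets_def\<close>)

context schreier_families
begin

text \<open>Restriction to points beyond \<open>m\<close> loses no rank, and this freedom drives the
  induction: starting beyond \<open>k\<close> allows \<open>k\<close> pieces at a successor,
  starting beyond \<open>n\<close> allows the family with index \<open>n\<close> at a limit.\<close>

lemma rk_Sc: "rk (ltree (Sc c) m) (cpow c) []"
proof (induction c arbitrary: m rule: less_induct)
  case (less c)
  have nil: "[] \<in> ltree (Sc c) m" by (simp add: ltree_def Sc_empty)
  have "\<exists>x. rk (ltree (Sc c) m) s [x]" if s: "s < cpow c" for s
  proof (cases c rule: cord_cases)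
    case 1
    then have "s = 0" using s by (simp add: one_cord_def)
    moreover have "[Suc m] \<in> ltree (Sc c) m" by (simp add: 1 ltree_def Sc_zero schreier0_def)
    ultimately show ?thesis using rk.intros[of "[Suc m]" _ 0] by auto
  next
    case (2 b)
    obtain k where k: "s < cpow b * cnat k" using s by (auto simp: 2 comega_def)
    \<comment> \<open>Outer state: \<open>j\<close> pieces may still be opened. All points exceed
      \<open>k\<close>, so the minima of at most \<open>k\<close> pieces form a set of
      \<open>schreier1\<close>.\<close>
    define Q where "Q \<tau> t \<longleftrightarrow> (\<exists>j \<F>. \<tau> = cnat j \<and> sorted_wrt (<) t \<and> succ_sets \<F> \<and> \<F> \<subseteq> Sc b \<and>
       card \<F> + j \<le> k \<and> set t = \<Union>\<F> \<and> (\<forall>x\<in>set t. max m k < x))" for \<tau> t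
    have step: "\<exists>x R. clock R \<and> R \<rho> (t @ [x]) \<and> (\<forall>\<rho> s. R \<rho> s \<longrightarrow> Q \<tau>' s)"
      if Qt: "Q \<tau> t" and less': "\<tau>' < \<tau>" "\<rho> < cpow b" for \<tau> t \<tau>' \<rho>
    proof -
      from Qt obtain j \<F> where *: "\<tau> = cnat j" "sorted_wrt (<) t" "succ_sets \<F>" "\<F> \<subseteq> Sc b"
        "card \<F> + j \<le> k" "set t = \<Union>\<F>" "\<forall>x\<in>set t. max m k < x"
        unfolding Q_def by blast
      obtain j' where j': "j' < j" "\<tau>' = cnat j'" using less_cnat_ex less'(1) *(1) by blast
      define m' where "m' = Max (insert (max m k) (set t))"
      have m': "x \<le> m'" if "x \<in> set t" for x using that by (simp add: m'_def)
      have m'': "max m k \<le> m'" unfolding m'_def by (rule Max_ge) simp_all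
      have "b < c" by (simp add: 2)
      then obtain x where x: "rk (ltree (Sc b) m') \<rho> [x]"
        using rk_ext[OF less.IH less'(2)] by fastforce
      define R where "R \<rho> s \<longleftrightarrow> (\<exists>u. s = t @ u \<and> u \<noteq> [] \<and> rk (ltree (Sc b) m') \<rho> u)" for \<rho> s
      have "clock R"
        unfolding clock_def
      proof (intro allI impI)
        fix s v s' assume "R s v" "s' < s"
        then obtain u where "v = t @ u" "u \<noteq> []" "rk (ltree (Sc b) m') s u" unfolding R_def by blast
        then show "\<exists>x. R s' (v @ [x])" using rk_ext[OF _ \<open>s' < s\<close>] unfolding R_def by fastforce
      qed
      moreover have "R \<rho> (t @ [x])" unfolding R_def using x by blast
      moreover have "Q \<tau>' v" if "R s v" for s v
      proof -
        from that obtain u where u: "v = t @ u" "u \<noteq> []" "u \<in> ltree (Sc b) m'"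
          unfolding R_def using rk_mem by blast
        have u': "sorted_wrt (<) u" "set u \<in> Sc b" "\<forall>x\<in>set u. m' < x" using u(3) by (auto simp: ltree_def)
        have "Max E < Min (set u)" if "E \<in> \<F>" for E
        proof -
          have "Max E \<in> set t" using succ_setsD(4)[OF *(3) that] *(6) that by blast
          then have "Max E \<le> m'" by (rule m')
          also have "m' < Min (set u)" using u' u(2) by simp
          finally show ?thesis .
        qed
        then have "succ_sets (insert (set u) \<F>)"
          using *(3) u(2) by (intro succ_sets_insert) auto
        moreover have "card (insert (set u) \<F>) \<le> Suc (card \<F>)" by (rule card_insert_le_m1) simp_all
        moreover have "\<forall>x\<in>set v. max m k < x"
          using *(7) u' m'' u(1) by (auto intro: order_le_less_trans)
        moreover have "sorted_wrt (<) v"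
          using *(2) u' m' u(1) by (auto simp: sorted_wrt_append intro: order_le_less_trans)
        ultimately show "Q \<tau>' v"
          unfolding Q_def using j' *(4,5,6) u'(2) u(1)
          by (intro exI[of _ j'] exI[of _ "insert (set u) \<F>"]) auto
      qed
      ultimately show ?thesis by blast
    qed
    obtain P where P: "clock P" "\<And>\<tau> t. Q \<tau> t \<Longrightarrow> P (cpow b * \<tau>) t" "\<And>s t. P s t \<Longrightarrow> \<exists>\<tau>. Q \<tau> t"
      using clock_compose[of Q "cpow b"] step by metis
    have "t \<in> ltree (Sc c) m" if "P s t" for s t
    proof -
      from P(3)[OF that] obtain j \<F> where *: "sorted_wrt (<) t" "succ_sets \<F>" "\<F> \<subseteq> Sc b"
        "card \<F> + j \<le> k" "set t = \<Union>\<F>" "\<forall>x\<in>set t. max m k < x"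
        unfolding Q_def by blast
      have fin: "finite \<F>" using *(2) by (simp add: succ_sets_def)
      have gt: "k < Min E" if "E \<in> \<F>" for E
        using succ_setsD(3)[OF *(2) that] *(5,6) that by auto
      have "card (Min ` \<F>) \<le> k" using card_image_le[OF fin, of Min] *(4) by linarith
      moreover have "k \<le> Min (Min ` \<F>)" if "\<F> \<noteq> {}"
        using that fin gt by (auto intro: less_imp_le)
      moreover have "Min ` \<F> \<in> fin_pos_sets"
        using fin gt by (fastforce simp: fin_pos_sets_def)
      ultimately have "Min ` \<F> \<in> schreier1"
        unfolding schreier1_def by (cases "\<F> = {}") auto
      then have "set t \<in> Sc c" unfolding 2 Sc_suc fam_comp_iff[OF Sc_fin_pos] using * by blast
      then show ?thesis using * by (simp add: ltree_def)
    qed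
    moreover have "P (cpow b * cnat k) []"
      by (rule P(2)) (auto simp: Q_def succ_sets_def intro!: exI[of _ k] exI[of _ "{}"])
    ultimately have "rk (ltree (Sc c) m) (cpow b * cnat k) []"
      using clock_imp_rk[OF P(1)] by blast
    then show ?thesis using rk_ext[OF _ k] by fastforce
  next
    case (3 \<eta> \<mu>)
    define cn where "cn n = cpow \<eta> * \<mu> + hat \<eta> n" for n
    have cn: "cn n < c" for n unfolding cn_def 3 by (rule hat_sum_less[OF 3(1)])
    have Sc: "Sc c = {F. F = {} \<or> (\<exists>n\<ge>1. n \<le> Min F \<and> F \<in> Sc (cn n))}"
      unfolding 3(2) cn_def by (rule Sc_limit[OF 3(1)])
    have "c \<noteq> 0" using cn[of 0] by auto
    then obtain e k where e: "e < c" "s < cpow e * cnat k" using less_cpow_ex[OF s] by blast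
    have "\<exists>n\<ge>1. e < cn n"
    proof -
      have "e < cpow \<eta> * \<mu> + cpow \<eta>" using e(1) 3(2) by simp
      from cord_add_sup_split[OF this] show ?thesis
      proof
        assume "e < cpow \<eta> * \<mu>"
        then have "e < cn 1" unfolding cn_def using cord_le_add1 order_less_le_trans by blast
        then show ?thesis by blast
      next
        assume "\<exists>z<cpow \<eta>. e = cpow \<eta> * \<mu> + z"
        then show ?thesis unfolding cn_def using hat_cofinal[OF 3(1)] by auto
      qed
    qed
    then obtain n where n: "n \<ge> 1" "e < cn n" by blast
    have "s < cpow (cn n)" using e(2) cpow_mul_cnat_le[OF n(2)] by (rule order_less_le_trans)
    then obtain x where "rk (ltree (Sc (cn n)) (max m n)) s [x]"
      using rk_ext[OF less.IH[OF cn]] by fastforce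
    moreover have "ltree (Sc (cn n)) (max m n) \<subseteq> ltree (Sc c) m"
    proof
      fix t assume t: "t \<in> ltree (Sc (cn n)) (max m n)"
      have "set t \<in> Sc c"
      proof (cases "t = []")
        case False
        then have "n \<le> Min (set t)" using t by (auto simp: ltree_def intro: less_imp_le)
        then show ?thesis using t n(1) by (auto simp: Sc ltree_def)
      qed (simp add: Sc_empty)
      then show "t \<in> ltree (Sc c) m" using t by (auto simp: ltree_def)
    qed
    ultimately show ?thesis using rk_subset by blast
  qed
  then show ?case using nil by (intro rk.intros) auto
qed

end

section \<open>The norm\<close>

definition l1norm :: "(nat \<Rightarrow> real) \<Rightarrow> real" where
  "l1norm x = (\<Sum>n\<in>supp x. \<bar>x n\<bar>)"

lemma c00_finite: "x \<in> c00 \<Longrightarrow> finite (supp x)"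
  by (simp add: c00_def supp_def)

lemma supp_restr: "supp (restr E x) = supp x \<inter> E"
  by (auto simp: supp_def restr_def)

lemma restr_c00 [simp]: "x \<in> c00 \<Longrightarrow> restr E x \<in> c00"
  by (auto simp: c00_def restr_def elim: rev_finite_subset)

lemma restr_restr: "restr E (restr F x) = restr (E \<inter> F) x"
  by (auto simp: restr_def)

lemma lincomb_c00: "finite I \<Longrightarrow> (\<And>i. i \<in> I \<Longrightarrow> x i \<in> c00) \<Longrightarrow> (\<lambda>t. \<Sum>i\<in>I. a i * x i t) \<in> c00"
proof -
  assume I: "finite I" and x: "\<And>i. i \<in> I \<Longrightarrow> x i \<in> c00"
  have "{n. (\<Sum>i\<in>I. a i * x i n) \<noteq> 0} \<subseteq> (\<Union>i\<in>I. supp (x i))"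
  proof
    fix n assume "n \<in> {n. (\<Sum>i\<in>I. a i * x i n) \<noteq> 0}"
    then obtain i where "i \<in> I" "a i * x i n \<noteq> 0" using sum.neutral by (metis (mono_tags, lifting) mem_Collect_eq)
    then show "n \<in> (\<Union>i\<in>I. supp (x i))" by (auto simp: supp_def)
  qed
  then have "finite {n. (\<Sum>i\<in>I. a i * x i n) \<noteq> 0}"
    by (rule finite_subset) (use I x c00_finite in blast)
  moreover have "(\<Sum>i\<in>I. a i * x i 0) = 0" using x by (intro sum.neutral) (auto simp: c00_def)
  ultimately show ?thesis by (simp add: c00_def)
qed

lemma restr_lincomb: "restr E (\<lambda>t. \<Sum>i\<in>I. a i * x i t) = (\<lambda>t. \<Sum>i\<in>I. a i * restr E (x i) t)"
  by (auto simp: restr_def)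

lemma l1norm_nonneg [simp]: "0 \<le> l1norm x"
  by (simp add: l1norm_def sum_nonneg)

lemma l1norm_eq: "finite A \<Longrightarrow> supp x \<subseteq> A \<Longrightarrow> l1norm x = (\<Sum>n\<in>A. \<bar>x n\<bar>)"
  unfolding l1norm_def by (rule sum.mono_neutral_left) (auto simp: supp_def)

lemma sum_le_l1norm: "x \<in> c00 \<Longrightarrow> finite A \<Longrightarrow> (\<Sum>n\<in>A. \<bar>x n\<bar>) \<le> l1norm x"
proof -
  assume x: "x \<in> c00" and A: "finite A"
  have "(\<Sum>n\<in>A. \<bar>x n\<bar>) \<le> (\<Sum>n\<in>A \<union> supp x. \<bar>x n\<bar>)"
    by (rule sum_mono2) (use A c00_finite[OF x] in auto)
  also have "\<dots> = l1norm x" using l1norm_eq[of "A \<union> supp x" x] A c00_finite[OF x] by simp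
  finally show ?thesis .
qed

definition adm :: "nat set set \<Rightarrow> nat set set \<Rightarrow> bool" where
  "adm G \<E> \<longleftrightarrow> succ_sets \<E> \<and> Min ` \<E> \<in> G"

lemma adm_finite: "adm G \<E> \<Longrightarrow> finite \<E>"
  by (simp add: adm_def succ_sets_def)

lemma admissible_sums:
  "{\<theta> n * (\<Sum>E\<leftarrow>Es. f E) | n Es. n \<ge> (1::nat) \<and> admissible (G n) Es} =
   {\<theta> n * (\<Sum>E\<in>\<E>. f E :: real) | n \<E>. n \<ge> 1 \<and> adm (G n) \<E>}"
proof (intro set_eqI iffI)
  fix v assume "v \<in> {\<theta> n * (\<Sum>E\<leftarrow>Es. f E) | n Es. n \<ge> (1::nat) \<and> admissible (G n) Es}"
  then obtain n Es where *: "v = \<theta> n * (\<Sum>E\<leftarrow>Es. f E)" "n \<ge> 1" "admissible (G n) Es" by blast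
  have a: "\<forall>E\<in>set Es. finite E \<and> E \<noteq> {}" "Min ` set Es \<in> G n"
    "\<forall>i j. i < j \<and> j < length Es \<longrightarrow> Max (Es ! i) < Min (Es ! j)"
    using *(3) unfolding admissible_def by blast+
  then have "succ_sets (set Es)" "distinct Es" "Min ` set Es \<in> G n"
    using list_succ_sets[OF a(1,3)] by blast+
  then show "v \<in> {\<theta> n * (\<Sum>E\<in>\<E>. f E) | n \<E>. n \<ge> 1 \<and> adm (G n) \<E>}"
  proof -
    have "v = \<theta> n * (\<Sum>E\<in>set Es. f E)"
      using *(1) \<open>distinct Es\<close> by (simp only: sum_list_distinct_conv_sum_set)
    moreover have "adm (G n) (set Es)"
      using \<open>succ_sets (set Es)\<close> \<open>Min ` set Es \<in> G n\<close> by (simp add: adm_def)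
    ultimately show ?thesis using *(2) by blast
  qed
next
  fix v assume "v \<in> {\<theta> n * (\<Sum>E\<in>\<E>. f E) | n \<E>. n \<ge> 1 \<and> adm (G n) \<E>}"
  then obtain n \<E> where *: "v = \<theta> n * (\<Sum>E\<in>\<E>. f E)" "n \<ge> 1" "succ_sets \<E>" "Min ` \<E> \<in> G n"
    by (auto simp: adm_def)
  obtain Es where Es: "set Es = \<E>" "distinct Es" "\<forall>i j. i < j \<and> j < length Es \<longrightarrow> Max (Es ! i) < Min (Es ! j)"
    using succ_sets_list[OF *(3)] by blast
  have "admissible (G n) Es"
    unfolding admissible_def using Es(1,3) *(4) succ_setsD(1,2)[OF *(3)] by metis
  then show "v \<in> {\<theta> n * (\<Sum>E\<leftarrow>Es. f E) | n Es. n \<ge> (1::nat) \<and> admissible (G n) Es}"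
  proof -
    have "v = \<theta> n * (\<Sum>E\<leftarrow>Es. f E)"
      using *(1) Es(1,2) by (simp only: sum_list_distinct_conv_sum_set)
    then show ?thesis using *(2) \<open>admissible (G n) Es\<close> by blast
  qed
qed

lemma sum_disjoint_le:
  assumes \<E>: "succ_sets \<E>" and A: "finite A" and f: "\<And>n. n \<in> A \<Longrightarrow> 0 \<le> (f n :: real)"
  shows "(\<Sum>E\<in>\<E>. \<Sum>n\<in>A \<inter> E. f n) \<le> (\<Sum>n\<in>A. f n)"
proof -
  have "(\<Sum>E\<in>\<E>. \<Sum>n\<in>A \<inter> E. f n) = (\<Sum>n\<in>(\<Union>E\<in>\<E>. A \<inter> E). f n)"
    by (rule sum.UNION_disjoint[symmetric])
       (use \<E> A succ_sets_disjoint[OF \<E>] in \<open>auto simp: succ_sets_def\<close>)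
  also have "\<dots> \<le> (\<Sum>n\<in>A. f n)" by (rule sum_mono2) (use A f in auto)
  finally show ?thesis .
qed

lemma sum_l1norm_restr_le:
  assumes "succ_sets \<E>" "x \<in> c00"
  shows "(\<Sum>E\<in>\<E>. l1norm (restr E x)) \<le> l1norm x"
proof -
  have "l1norm (restr E x) = (\<Sum>n\<in>supp x \<inter> E. \<bar>x n\<bar>)" for E
    unfolding l1norm_def supp_restr by (intro sum.cong) (auto simp: restr_def)
  then show ?thesis
    using sum_disjoint_le[OF assms(1) c00_finite[OF assms(2)], of "\<lambda>n. \<bar>x n\<bar>"] by (simp add: l1norm_def)
qed

lemma fam_norm_bdd: "F \<subseteq> fin_pos_sets \<Longrightarrow> x \<in> c00 \<Longrightarrow> bdd_above {(\<Sum>k\<in>A. \<bar>x k\<bar>) | A. A \<in> F}"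
  by (rule bdd_aboveI[of _ "l1norm x"]) (auto simp: fin_pos_sets_def intro!: sum_le_l1norm)

lemma fam_norm_upper: "F \<subseteq> fin_pos_sets \<Longrightarrow> x \<in> c00 \<Longrightarrow> A \<in> F \<Longrightarrow> (\<Sum>k\<in>A. \<bar>x k\<bar>) \<le> fam_norm F x"
  unfolding fam_norm_def by (rule cSup_upper[OF _ fam_norm_bdd]) auto

lemma fam_norm_least: "{} \<in> F \<Longrightarrow> (\<And>A. A \<in> F \<Longrightarrow> (\<Sum>k\<in>A. \<bar>x k\<bar>) \<le> B) \<Longrightarrow> fam_norm F x \<le> B"
  unfolding fam_norm_def by (rule cSup_least) auto

lemma fam_norm_attained:
  assumes F: "F \<subseteq> fin_pos_sets" "hereditary F" "{} \<in> F" and x: "x \<in> c00"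
  shows "\<exists>A\<in>F. A \<subseteq> supp x \<and> fam_norm F x = (\<Sum>k\<in>A. \<bar>x k\<bar>)"
proof -
  define V where "V = (\<lambda>A. \<Sum>k\<in>A. \<bar>x k\<bar>) ` {A\<in>F. A \<subseteq> supp x}"
  have fin: "finite V" unfolding V_def using c00_finite[OF x] by (intro finite_imageI) simp
  have "V \<noteq> {}" using F(3) by (auto simp: V_def)
  then have "Max V \<in> V" using fin by simp
  then obtain A where A: "A \<in> F" "A \<subseteq> supp x" "Max V = (\<Sum>k\<in>A. \<bar>x k\<bar>)" by (auto simp: V_def)
  have "fam_norm F x \<le> Max V"
  proof (rule fam_norm_least[OF F(3)])
    fix B assume "B \<in> F"
    then have "B \<inter> supp x \<in> F" "finite B" using hereditaryD[OF F(2)] F(1) by (auto simp: fin_pos_sets_def)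
    have "(\<Sum>k\<in>B. \<bar>x k\<bar>) = (\<Sum>k\<in>B \<inter> supp x. \<bar>x k\<bar>)"
      by (rule sum.mono_neutral_right) (use \<open>finite B\<close> in \<open>auto simp: supp_def\<close>)
    also have "\<dots> \<le> Max V" using fin \<open>B \<inter> supp x \<in> F\<close> by (intro Max_ge) (auto simp: V_def)
    finally show "(\<Sum>k\<in>B. \<bar>x k\<bar>) \<le> Max V" .
  qed
  then show ?thesis using A fam_norm_upper[OF F(1) x A(1)] by (intro bexI[of _ A]) auto
qed

locale tsirelson =
  fixes F0 :: "nat set set" and \<theta> :: "nat \<Rightarrow> real" and G :: "nat \<Rightarrow> nat set set"
  assumes F0: "F0 \<subseteq> fin_pos_sets" "hereditary F0" "spreading F0" "schreier0 \<subseteq> F0"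
    and G: "\<And>n. n \<ge> 1 \<Longrightarrow> G n \<subseteq> fin_pos_sets" "\<And>n. n \<ge> 1 \<Longrightarrow> hereditary (G n)"
      "\<And>n. n \<ge> 1 \<Longrightarrow> spreading (G n)" "\<And>n. n \<ge> 1 \<Longrightarrow> {} \<in> G n"
    and \<theta>: "\<And>n. n \<ge> 1 \<Longrightarrow> 0 < \<theta> n" "\<And>n. n \<ge> 1 \<Longrightarrow> \<theta> n < 1"
begin

abbreviation "Nk \<equiv> tnorm_iter F0 \<theta> G"
abbreviation "N \<equiv> tnorm F0 \<theta> G"

lemma F0_empty: "{} \<in> F0" and F0_single: "n \<ge> 1 \<Longrightarrow> {n} \<in> F0"
  using F0(4) by (auto simp: schreier0_def)

definition nsums :: "nat \<Rightarrow> (nat \<Rightarrow> real) \<Rightarrow> real set" where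
  "nsums k x = {\<theta> n * (\<Sum>E\<in>\<E>. Nk k (restr E x)) | n \<E>. n \<ge> 1 \<and> adm (G n) \<E>}"

lemma Nk_Suc: "Nk (Suc k) x = max (fam_norm F0 x) (Sup (nsums k x))"
  by (simp only: nsums_def tnorm_iter.simps(2) admissible_sums)

declare tnorm_iter.simps(2) [simp del]

lemma sums_zero: "0 \<in> nsums k x"
  unfolding nsums_def using G(4)[of 1] by (auto simp: adm_def succ_sets_def intro!: exI[of _ 1] exI[of _ "{}"])

lemma nsums_nonempty: "nsums k x \<noteq> {}"
  using sums_zero by blast

lemma fam_norm_nonneg: "x \<in> c00 \<Longrightarrow> 0 \<le> fam_norm F0 x"
  using fam_norm_upper[OF F0(1) _ F0_empty] by fastforce

lemma fam_norm_le_l1: "x \<in> c00 \<Longrightarrow> fam_norm F0 x \<le> l1norm x"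
  by (rule fam_norm_least[OF F0_empty]) (use F0(1) in \<open>auto simp: fin_pos_sets_def intro!: sum_le_l1norm\<close>)

text \<open>The claims are proved together because a supremum of reals says nothing until its set is
  known to be bounded, and boundedness of the sums at stage \<open>k\<close> rests on the l1 bound
  at that stage.\<close>

lemma Nk_bounds: "x \<in> c00 \<Longrightarrow> 0 \<le> Nk k x \<and> Nk k x \<le> l1norm x \<and> bdd_above (nsums k x)"
proof (induction k arbitrary: x)
  have bdd: "v \<le> l1norm x" if v: "v \<in> nsums k x" and x: "x \<in> c00"
    and IH: "\<And>x. x \<in> c00 \<Longrightarrow> Nk k x \<le> l1norm x" "\<And>x. x \<in> c00 \<Longrightarrow> 0 \<le> Nk k x" for k x v
  proof -
    from v obtain n \<E> where v: "v = \<theta> n * (\<Sum>E\<in>\<E>. Nk k (restr E x))" and n: "n \<ge> 1" "adm (G n) \<E>"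
      unfolding nsums_def by blast
    have "v \<le> (\<Sum>E\<in>\<E>. Nk k (restr E x))"
      unfolding v using \<theta>[OF n(1)] IH(2) x by (intro mult_left_le_one_le sum_nonneg) auto
    also have "\<dots> \<le> (\<Sum>E\<in>\<E>. l1norm (restr E x))" using IH(1) x by (intro sum_mono) simp
    also have "\<dots> \<le> l1norm x" using n(2) x by (intro sum_l1norm_restr_le) (auto simp: adm_def)
    finally show ?thesis .
  qed
  {
    case 0
    have 1: "0 \<le> Nk 0 x" "Nk 0 x \<le> l1norm x" if "x \<in> c00" for x
      using fam_norm_nonneg[OF that] fam_norm_le_l1[OF that] by simp_all
    then show ?case using bdd[of _ 0 x] 0 by (auto intro!: bdd_aboveI[of _ "l1norm x"])
  next
    case (Suc k)
    have 1: "0 \<le> Nk (Suc k) x" "Nk (Suc k) x \<le> l1norm x" if "x \<in> c00" for x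
    proof -
      show "0 \<le> Nk (Suc k) x" unfolding Nk_Suc using fam_norm_nonneg[OF that] by simp
      have "Sup (nsums k x) \<le> l1norm x"
        by (rule cSup_least[OF nsums_nonempty]) (use bdd[of _ k x] Suc.IH that in blast)
      then show "Nk (Suc k) x \<le> l1norm x" unfolding Nk_Suc using fam_norm_le_l1[OF that] by simp
    qed
    then show ?case using bdd[of _ "Suc k" x] Suc.prems by (auto intro!: bdd_aboveI[of _ "l1norm x"])
  }
qed

lemmas Nk_nonneg = Nk_bounds[THEN conjunct1]
  and Nk_le_l1 = Nk_bounds[THEN conjunct2, THEN conjunct1]

lemma Nk_Suc_le:
  assumes "fam_norm F0 x \<le> B"
    "\<And>n \<E>. n \<ge> 1 \<Longrightarrow> adm (G n) \<E> \<Longrightarrow> \<theta> n * (\<Sum>E\<in>\<E>. Nk k (restr E x)) \<le> B"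
  shows "Nk (Suc k) x \<le> B"
proof -
  have "Sup (nsums k x) \<le> B"
    by (rule cSup_least[OF nsums_nonempty]) (use assms(2) in \<open>auto simp: nsums_def\<close>)
  then show ?thesis using assms(1) by (simp add: Nk_Suc)
qed

lemma Nk_Suc_ge_fam: "fam_norm F0 x \<le> Nk (Suc k) x"
  by (simp add: Nk_Suc)

lemma Nk_Suc_ge:
  assumes "x \<in> c00" "n \<ge> 1" "adm (G n) \<E>"
  shows "\<theta> n * (\<Sum>E\<in>\<E>. Nk k (restr E x)) \<le> Nk (Suc k) x"
proof -
  have "\<theta> n * (\<Sum>E\<in>\<E>. Nk k (restr E x)) \<le> Sup (nsums k x)"
    using Nk_bounds[OF assms(1), of k] assms(2,3) by (intro cSup_upper) (auto simp: nsums_def)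
  then show ?thesis by (simp add: Nk_Suc)
qed

lemma Nk_mono: "x \<in> c00 \<Longrightarrow> Nk k x \<le> Nk (Suc k) x"
proof (induction k arbitrary: x)
  case (Suc k)
  show ?case
  proof (rule Nk_Suc_le[OF Nk_Suc_ge_fam])
    fix n \<E> assume n: "n \<ge> 1" "adm (G n) \<E>"
    have "\<theta> n * (\<Sum>E\<in>\<E>. Nk k (restr E x)) \<le> \<theta> n * (\<Sum>E\<in>\<E>. Nk (Suc k) (restr E x))"
      using Suc \<theta>[OF n(1)] by (intro mult_left_mono sum_mono) auto
    also have "\<dots> \<le> Nk (Suc (Suc k)) x" by (rule Nk_Suc_ge[OF Suc.prems n])
    finally show "\<theta> n * (\<Sum>E\<in>\<E>. Nk k (restr E x)) \<le> Nk (Suc (Suc k)) x" .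
  qed
qed (simp add: Nk_Suc)

text \<open>The supremum over the stages is the limit of an increasing bounded sequence, so
  inequalities between finite sums, such as \<open>N_adm\<close>, pass from \<open>Nk\<close> to
  \<open>N\<close>.\<close>

lemma Nk_tendsto: "x \<in> c00 \<Longrightarrow> (\<lambda>k. Nk k x) \<longlonglongrightarrow> N x"
  unfolding tnorm_def
  by (rule LIMSEQ_incseq_SUP) (use Nk_bounds Nk_mono in \<open>auto intro!: bdd_aboveI[of _ "l1norm x"] incseq_SucI\<close>)

lemma Nk_le_N: "x \<in> c00 \<Longrightarrow> Nk k x \<le> N x"
  unfolding tnorm_def by (rule cSUP_upper) (use Nk_bounds in \<open>auto intro!: bdd_aboveI[of _ "l1norm x"]\<close>)

lemma N_least: "(\<And>k. Nk k x \<le> B) \<Longrightarrow> N x \<le> B"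
  unfolding tnorm_def by (rule cSUP_least) auto

lemma N_nonneg: "x \<in> c00 \<Longrightarrow> 0 \<le> N x"
  using Nk_nonneg[of x 0] Nk_le_N[of x 0] by linarith

lemma N_le_l1: "x \<in> c00 \<Longrightarrow> N x \<le> l1norm x"
  by (rule N_least) (rule Nk_le_l1)

lemma N_ge_fam: "x \<in> c00 \<Longrightarrow> fam_norm F0 x \<le> N x"
  using Nk_le_N[of x 0] by simp

lemma N_ge_coord: "x \<in> c00 \<Longrightarrow> n \<ge> 1 \<Longrightarrow> \<bar>x n\<bar> \<le> N x"
  using fam_norm_upper[OF F0(1) _ F0_single, of x n] N_ge_fam[of x] by simp

lemma N_adm:
  assumes "x \<in> c00" "n \<ge> 1" "adm (G n) \<E>"
  shows "\<theta> n * (\<Sum>E\<in>\<E>. N (restr E x)) \<le> N x"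
proof (rule LIMSEQ_le_const2)
  show "(\<lambda>k. \<theta> n * (\<Sum>E\<in>\<E>. Nk k (restr E x))) \<longlonglongrightarrow> \<theta> n * (\<Sum>E\<in>\<E>. N (restr E x))"
    using assms(1) by (intro tendsto_intros Nk_tendsto) simp
  show "\<exists>m. \<forall>k\<ge>m. \<theta> n * (\<Sum>E\<in>\<E>. Nk k (restr E x)) \<le> N x"
    using Nk_Suc_ge[OF assms] Nk_le_N[OF assms(1)] order_trans by blast
qed

lemma Nk_restr: "x \<in> c00 \<Longrightarrow> Nk k (restr A x) \<le> Nk k x"
proof (induction k arbitrary: x)
  have fam: "fam_norm F0 (restr A x) \<le> fam_norm F0 x" if x: "x \<in> c00" for x
  proof (rule fam_norm_least[OF F0_empty])
    fix B assume "B \<in> F0"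
    have "(\<Sum>k\<in>B. \<bar>restr A x k\<bar>) \<le> (\<Sum>k\<in>B. \<bar>x k\<bar>)" by (intro sum_mono) (simp add: restr_def)
    also have "\<dots> \<le> fam_norm F0 x" by (rule fam_norm_upper[OF F0(1) x \<open>B \<in> F0\<close>])
    finally show "(\<Sum>k\<in>B. \<bar>restr A x k\<bar>) \<le> fam_norm F0 x" .
  qed
  {
    case 0
    then show ?case using fam by simp
  next
    case (Suc k)
    show ?case
    proof (rule Nk_Suc_le)
      show "fam_norm F0 (restr A x) \<le> Nk (Suc k) x" using fam[OF Suc.prems] Nk_Suc_ge_fam order_trans by blast
      fix n \<E> assume n: "n \<ge> 1" "adm (G n) \<E>"
      have "Nk k (restr E (restr A x)) \<le> Nk k (restr E x)" for E
        using Suc.IH[of "restr E x"] Suc.prems by (simp add: restr_restr Int_commute)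
      then have "\<theta> n * (\<Sum>E\<in>\<E>. Nk k (restr E (restr A x))) \<le> \<theta> n * (\<Sum>E\<in>\<E>. Nk k (restr E x))"
        using \<theta>[OF n(1)] by (intro mult_left_mono sum_mono) auto
      also have "\<dots> \<le> Nk (Suc k) x" by (rule Nk_Suc_ge[OF Suc.prems n])
      finally show "\<theta> n * (\<Sum>E\<in>\<E>. Nk k (restr E (restr A x))) \<le> Nk (Suc k) x" .
    qed
  }
qed

lemma N_restr: "x \<in> c00 \<Longrightarrow> N (restr A x) \<le> N x"
  using Nk_restr Nk_le_N by (meson N_least order_trans)

text \<open>Triangle inequality and homogeneity in one statement, so that the induction over the
  stages is done once.\<close>

lemma Nk_lincomb:
  assumes "finite I" "\<And>i. i \<in> I \<Longrightarrow> x i \<in> c00"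
  shows "Nk k (\<lambda>t. \<Sum>i\<in>I. a i * x i t) \<le> (\<Sum>i\<in>I. \<bar>a i\<bar> * Nk k (x i))"
  using assms(2)
proof (induction k arbitrary: x)
  have fam: "fam_norm F0 (\<lambda>t. \<Sum>i\<in>I. a i * x i t) \<le> (\<Sum>i\<in>I. \<bar>a i\<bar> * fam_norm F0 (x i))"
    if x: "\<And>i. i \<in> I \<Longrightarrow> x i \<in> c00" for x
  proof (rule fam_norm_least[OF F0_empty])
    fix B assume B: "B \<in> F0"
    have "(\<Sum>k\<in>B. \<bar>\<Sum>i\<in>I. a i * x i k\<bar>) \<le> (\<Sum>k\<in>B. \<Sum>i\<in>I. \<bar>a i\<bar> * \<bar>x i k\<bar>)"
      by (intro sum_mono order_trans[OF sum_abs]) (simp add: abs_mult)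
    also have "\<dots> = (\<Sum>i\<in>I. \<bar>a i\<bar> * (\<Sum>k\<in>B. \<bar>x i k\<bar>))"
      by (subst sum.swap) (simp add: sum_distrib_left)
    also have "\<dots> \<le> (\<Sum>i\<in>I. \<bar>a i\<bar> * fam_norm F0 (x i))"
      using fam_norm_upper[OF F0(1) x B] by (intro sum_mono mult_left_mono) auto
    finally show "(\<Sum>k\<in>B. \<bar>\<Sum>i\<in>I. a i * x i k\<bar>) \<le> (\<Sum>i\<in>I. \<bar>a i\<bar> * fam_norm F0 (x i))" .
  qed
  {
    case 0
    then show ?case using fam by simp
  next
    case (Suc k)
    show ?case
    proof (rule Nk_Suc_le)
      show "fam_norm F0 (\<lambda>t. \<Sum>i\<in>I. a i * x i t) \<le> (\<Sum>i\<in>I. \<bar>a i\<bar> * Nk (Suc k) (x i))"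
        by (rule order_trans[OF fam[OF Suc.prems]]) (auto intro!: sum_mono mult_left_mono Nk_Suc_ge_fam)
      fix n \<E> assume n: "n \<ge> 1" "adm (G n) \<E>"
      have "(\<Sum>E\<in>\<E>. Nk k (restr E (\<lambda>t. \<Sum>i\<in>I. a i * x i t))) \<le> (\<Sum>E\<in>\<E>. \<Sum>i\<in>I. \<bar>a i\<bar> * Nk k (restr E (x i)))"
        unfolding restr_lincomb using Suc.IH Suc.prems by (intro sum_mono) auto
      also have "\<dots> = (\<Sum>i\<in>I. \<bar>a i\<bar> * (\<Sum>E\<in>\<E>. Nk k (restr E (x i))))"
        by (subst sum.swap) (simp add: sum_distrib_left)
      finally have "\<theta> n * (\<Sum>E\<in>\<E>. Nk k (restr E (\<lambda>t. \<Sum>i\<in>I. a i * x i t))) \<le>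
          \<theta> n * (\<Sum>i\<in>I. \<bar>a i\<bar> * (\<Sum>E\<in>\<E>. Nk k (restr E (x i))))"
        using \<theta>[OF n(1)] by (intro mult_left_mono) auto
      also have "\<dots> = (\<Sum>i\<in>I. \<bar>a i\<bar> * (\<theta> n * (\<Sum>E\<in>\<E>. Nk k (restr E (x i)))))"
        by (simp add: sum_distrib_left mult.left_commute)
      also have "\<dots> \<le> (\<Sum>i\<in>I. \<bar>a i\<bar> * Nk (Suc k) (x i))"
        using Nk_Suc_ge[OF Suc.prems n] by (intro sum_mono mult_left_mono) auto
      finally show "\<theta> n * (\<Sum>E\<in>\<E>. Nk k (restr E (\<lambda>t. \<Sum>i\<in>I. a i * x i t))) \<le> (\<Sum>i\<in>I. \<bar>a i\<bar> * Nk (Suc k) (x i))" .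
    qed
  }
qed

lemma N_lincomb:
  assumes "finite I" "\<And>i. i \<in> I \<Longrightarrow> x i \<in> c00"
  shows "N (\<lambda>t. \<Sum>i\<in>I. a i * x i t) \<le> (\<Sum>i\<in>I. \<bar>a i\<bar> * N (x i))"
  by (rule N_least, rule order_trans[OF Nk_lincomb[OF assms]])
     (use assms(2) Nk_le_N in \<open>auto intro!: sum_mono mult_left_mono\<close>)

lemma scale_c00: "x \<in> c00 \<Longrightarrow> (\<lambda>t. c * x t) \<in> c00"
  by (auto simp: c00_def elim: rev_finite_subset)

lemma N_scale: "x \<in> c00 \<Longrightarrow> N (\<lambda>t. c * x t) = \<bar>c\<bar> * N x"
proof -
  have le: "N (\<lambda>t. c * x t) \<le> \<bar>c\<bar> * N x" if "x \<in> c00" for c x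
    using N_lincomb[of "{()}" "\<lambda>_. x" "\<lambda>_. c"] that by simp
  assume x: "x \<in> c00"
  show ?thesis
  proof (cases "c = 0")
    case True
    then show ?thesis using le[OF x, of 0] N_nonneg[OF scale_c00[OF x], of 0] by simp
  next
    case False
    have "\<bar>c\<bar> * N x \<le> N (\<lambda>t. c * x t)"
      using le[OF scale_c00[OF x], of "1/c" c] False by (simp add: field_simps)
    then show ?thesis using le[OF x, of c] by simp
  qed
qed

end

section \<open>Block sequences and admissible sets\<close>

text \<open>Blocks are represented by the right end of their support, because spreading moves points
  only to the right.\<close>

definition qmax :: "(nat \<Rightarrow> real) \<Rightarrow> nat" where
  "qmax x = Max (supp x)"

definition bset :: "(nat \<Rightarrow> real) set \<Rightarrow> bool" where
  "bset Y \<longleftrightarrow> finite Y \<and> (\<forall>y\<in>Y. y \<in> c00 \<and> supp y \<noteq> {}) \<and>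
    (\<forall>y\<in>Y. \<forall>z\<in>Y. y \<noteq> z \<longrightarrow> qmax y < Min (supp z) \<or> qmax z < Min (supp y))"

text \<open>The weights sit on natural numbers, the right ends of the blocks, since
  \<open>averaging\<close> produces them there.\<close>

definition comb :: "(nat \<Rightarrow> real) \<Rightarrow> (nat \<Rightarrow> real) set \<Rightarrow> nat \<Rightarrow> real" where
  "comb w Y = (\<lambda>t. \<Sum>y\<in>Y. w (qmax y) * y t)"

lemma bsetD:
  assumes "bset Y" "y \<in> Y"
  shows "y \<in> c00" "finite (supp y)" "qmax y \<in> supp y" "\<And>n. n \<in> supp y \<Longrightarrow> Min (supp y) \<le> n \<and> n \<le> qmax y"
  using assms c00_finite[of y] unfolding bset_def qmax_def by auto

lemma bset_less:
  assumes "bset Y" "y \<in> Y" "z \<in> Y" "m \<in> supp y" "n \<in> supp z" "m \<le> n" "y \<noteq> z"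
  shows "qmax y < Min (supp z)"
  using assms bsetD(4)[OF assms(1,2,4)] bsetD(4)[OF assms(1,3,5)] unfolding bset_def
  by (meson leD order_le_less_trans order_trans)

lemma bset_less_qmax:
  assumes "bset Y" "y \<in> Y" "z \<in> Y" "m \<in> supp y" "n \<in> supp z" "m \<le> n" "y \<noteq> z"
  shows "qmax y < qmax z"
  using bset_less[OF assms] bsetD(4)[OF assms(1,3,5)] by linarith

lemma bset_disjoint:
  assumes "bset Y" "y \<in> Y" "z \<in> Y" "m \<in> supp y" "m \<in> supp z"
  shows "y = z"
  using bset_less[OF assms order_refl] bsetD(4)[OF assms(1,2,4)] bsetD(4)[OF assms(1,3,5)] by fastforce

lemma bset_inj: "bset Y \<Longrightarrow> inj_on qmax Y"
  by (rule inj_onI) (metis bsetD(3) bset_disjoint)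

lemma bset_subset: "bset Y \<Longrightarrow> Z \<subseteq> Y \<Longrightarrow> bset Z"
  unfolding bset_def by (meson finite_subset subsetD)

lemma bset_finite: "bset Y \<Longrightarrow> finite Y"
  by (simp add: bset_def)

lemma bset_sum: "bset Y \<Longrightarrow> sum w (qmax ` Y) = (\<Sum>y\<in>Y. w (qmax y))"
  by (simp add: sum.reindex bset_inj)

lemma comb_c00: "bset Y \<Longrightarrow> comb w Y \<in> c00"
  unfolding comb_def by (rule lincomb_c00) (auto simp: bset_def)

lemma qmax_pos: "bset Y \<Longrightarrow> y \<in> Y \<Longrightarrow> qmax y \<ge> 1"
  using bsetD(1,3)[of Y y] by (auto simp: c00_def supp_def Suc_le_eq intro: gr0I)

text \<open>Blocks inside whose range some member of \<E> begins. A block that meets two members is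
  of this kind, since the later one begins inside it.\<close>

definition bad :: "(nat \<Rightarrow> real) set \<Rightarrow> nat set set \<Rightarrow> (nat \<Rightarrow> real) set" where
  "bad Y \<E> = {y\<in>Y. \<exists>E\<in>\<E>. \<exists>a\<in>supp y. a \<le> Min E \<and> Min E \<le> qmax y}"

text \<open>Assigning to each such block a member of \<E> that begins inside it is injective and
  preserves the order, and the right end of the block is no smaller than that minimum, so spreading
  applies.\<close>

lemma bad_admissible:
  assumes Y: "bset Y" and F: "hereditary F" "spreading F" and \<E>: "adm F \<E>" and H: "H \<subseteq> bad Y \<E>"
  shows "qmax ` H \<in> F"
proof -
  have "\<exists>E a. E \<in> \<E> \<and> a \<in> supp y \<and> a \<le> Min E \<and> Min E \<le> qmax y" if "y \<in> H" for y
    using that H unfolding bad_def by blast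
  then obtain e a where e: "\<And>y. y \<in> H \<Longrightarrow> e y \<in> \<E>" "\<And>y. y \<in> H \<Longrightarrow> a y \<in> supp y"
    "\<And>y. y \<in> H \<Longrightarrow> a y \<le> Min (e y)" "\<And>y. y \<in> H \<Longrightarrow> Min (e y) \<le> qmax y" by metis
  have HY: "y \<in> Y" if "y \<in> H" for y using that H by (auto simp: bad_def)
  have key: "y = z \<or> qmax y < qmax z" if yz: "y \<in> H" "z \<in> H" and le: "Min (e y) \<le> Min (e z)" for y z
  proof -
    have "a y \<le> qmax z" using e(3)[OF yz(1)] le e(4)[OF yz(2)] by linarith
    then show ?thesis
      using bset_less_qmax[OF Y HY[OF yz(1)] HY[OF yz(2)] e(2)[OF yz(1)] bsetD(3)[OF Y HY[OF yz(2)]]] by blast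
  qed
  show ?thesis
  proof (rule spread_image[OF F, of "Min ` \<E>" "\<lambda>y. Min (e y)"])
    show "Min ` \<E> \<in> F" using \<E> by (simp add: adm_def)
    show "(\<lambda>y. Min (e y)) ` H \<subseteq> Min ` \<E>" using e(1) by blast
    fix y z assume yz: "y \<in> H" "z \<in> H"
    show "Min (e y) < Min (e z) \<Longrightarrow> qmax y < qmax z" using key[OF yz] by fastforce
    show "Min (e y) = Min (e z) \<Longrightarrow> qmax y = qmax z" using key[OF yz] key[OF yz(2,1)] by fastforce
  qed (use e in auto)
qed

lemma not_bad_unique:
  assumes Y: "bset Y" and \<E>: "succ_sets \<E>" and y: "y \<in> Y" "y \<notin> bad Y \<E>"
    and E: "E \<in> \<E>" "E' \<in> \<E>" "E \<inter> supp y \<noteq> {}" "E' \<inter> supp y \<noteq> {}"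
  shows "E = E'"
proof -
  have no: False if *: "E \<in> \<E>" "E' \<in> \<E>" "E \<inter> supp y \<noteq> {}" "E' \<inter> supp y \<noteq> {}" "Max E < Min E'" for E E'
  proof -
    obtain e e' where e: "e \<in> E" "e \<in> supp y" "e' \<in> E'" "e' \<in> supp y" using * by blast
    have "e \<le> Max E" "Min E' \<le> e'" using e succ_setsD(1)[OF \<E>] *(1,2) by auto
    moreover have "e' \<le> qmax y" using bsetD(4)[OF Y y(1) e(4)] by simp
    ultimately have "e \<le> Min E'" "Min E' \<le> qmax y" using *(5) by linarith+
    then show False using y *(2) e(2) unfolding bad_def by blast
  qed
  have "E = E' \<or> Max E < Min E' \<or> Max E' < Min E"
    using \<E> E(1,2) unfolding succ_sets_def by blast
  then show ?thesis using no[OF E] no[OF E(2,1,4,3)] by blast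
qed

lemma not_bad_sum:
  assumes Y: "bset Y" and \<E>: "succ_sets \<E>" and y: "y \<in> Y" "y \<notin> bad Y \<E>"
    and h: "\<And>E. E \<in> \<E> \<Longrightarrow> E \<inter> supp y = {} \<Longrightarrow> h E = 0" "\<And>E. E \<in> \<E> \<Longrightarrow> h E \<le> B" and B: "0 \<le> (B::real)"
  shows "(\<Sum>E\<in>\<E>. h E) \<le> B"
proof (cases "\<exists>E\<in>\<E>. E \<inter> supp y \<noteq> {}")
  case True
  then obtain E0 where E0: "E0 \<in> \<E>" "E0 \<inter> supp y \<noteq> {}" by blast
  have "(\<Sum>E\<in>\<E>. h E) = (\<Sum>E\<in>{E0}. h E)"
  proof (rule sum.mono_neutral_right)
    show "finite \<E>" using \<E> by (simp add: succ_sets_def)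
    show "\<forall>E\<in>\<E> - {E0}. h E = 0" using h(1) not_bad_unique[OF Y \<E> y _ E0(1) _ E0(2)] by blast
  qed (use E0 in simp)
  then show ?thesis using h(2)[OF E0(1)] by simp
next
  case False
  then have "(\<Sum>E\<in>\<E>. h E) = 0" using h(1) by (intro sum.neutral) blast
  then show ?thesis using B by simp
qed

lemma restr_disjoint: "E \<inter> supp y = {} \<Longrightarrow> restr E y = (\<lambda>_. 0)"
  unfolding restr_def supp_def by fastforce

section \<open>Averages to which a single weight contributes little, and the cut norming
  tree\<close>

locale tsirelson_null = tsirelson +
  assumes \<theta>_le: "\<And>n. n \<ge> 1 \<Longrightarrow> \<theta> n \<le> \<theta> 1" and \<theta>_null: "\<theta> \<longlonglongrightarrow> 0"
begin

lemma Nk_zero [simp]: "Nk k (\<lambda>_. 0) = 0"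
proof -
  have "(\<lambda>_. 0) \<in> c00" by (simp add: c00_def)
  then show ?thesis using Nk_nonneg[of "\<lambda>_. 0" k] Nk_le_l1[of "\<lambda>_. 0" k] by (simp add: l1norm_def)
qed

lemma N_zero [simp]: "N (\<lambda>_. 0) = 0"
  unfolding tnorm_def by simp

text \<open>Such an \<open>\<O>\<close> replaces \<open>G m\<close> in the upper bound. The second alternative of the theorem
  is the one in which, for all large \<open>m\<close>, the rank of \<open>\<O>\<close> stays below one ordinal smaller than \<open>\<omega>\<^sup>\<omega>\<^sup>\<xi>\<close>.\<close>

definition splits :: "nat \<Rightarrow> nat set set \<Rightarrow> real \<Rightarrow> bool" where
  "splits m \<O> \<epsilon> \<longleftrightarrow> (\<forall>\<E>. adm (G m) \<E> \<longrightarrow> (\<exists>\<F>. adm \<O> \<F> \<and> (\<forall>E\<in>\<E>. \<exists>F\<in>\<F>. E \<subseteq> F) \<and>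
     (\<forall>F\<in>\<F>. \<forall>x\<in>c00. \<theta> m * (\<Sum>E | E \<in> \<E> \<and> E \<subseteq> F. N (restr E x)) \<le> \<epsilon> * N x)))"

definition good :: "real \<Rightarrow> (nat \<Rightarrow> real) \<Rightarrow> nat \<Rightarrow> bool" where
  "good \<delta> y m \<longleftrightarrow> (\<forall>\<E>. adm (G m) \<E> \<longrightarrow> \<theta> m * (\<Sum>E\<in>\<E>. N (restr E y)) \<le> \<delta>)"

text \<open>Each interval is its own group, so monotonicity under restriction gives the constant
  \<open>\<theta> m\<close>.\<close>

lemma splits_trivial: "m \<ge> 1 \<Longrightarrow> splits m (G m) (\<theta> m)"
  unfolding splits_def
proof (intro allI impI)
  fix \<E> assume m: "m \<ge> 1" and \<E>: "adm (G m) \<E>"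
  have S: "succ_sets \<E>" using \<E> by (simp add: adm_def)
  have "{E. E \<in> \<E> \<and> E \<subseteq> F} = {F}" if "F \<in> \<E>" for F
  proof -
    have "E = F" if "E \<in> \<E>" "E \<subseteq> F" for E
      using succ_sets_disjoint[OF S that(1) \<open>F \<in> \<E>\<close>] succ_setsD(3)[OF S that(1)] that(2) by blast
    then show ?thesis using that by blast
  qed
  then show "\<exists>\<F>. adm (G m) \<F> \<and> (\<forall>E\<in>\<E>. \<exists>F\<in>\<F>. E \<subseteq> F) \<and>
     (\<forall>F\<in>\<F>. \<forall>x\<in>c00. \<theta> m * (\<Sum>E | E \<in> \<E> \<and> E \<subseteq> F. N (restr E x)) \<le> \<theta> m * N x)"
    using \<E> m \<theta>(1) N_restr by (intro exI[of _ \<E>]) (auto intro!: mult_left_mono less_imp_le)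
qed

lemma weighted_sum_le:
  assumes X: "finite X" "\<And>x. x \<in> X \<Longrightarrow> x \<in> c00" and w: "\<And>x. 0 \<le> w x" and n: "n \<ge> 1"
    and f: "\<And>E x. x \<in> X \<Longrightarrow> f E x \<in> c00"
  shows "\<theta> n * (\<Sum>E\<in>\<E>. N (\<lambda>t. \<Sum>x\<in>X. w x * f E x t)) \<le> (\<Sum>x\<in>X. w x * (\<theta> n * (\<Sum>E\<in>\<E>. N (f E x))))"
proof -
  have "(\<Sum>E\<in>\<E>. N (\<lambda>t. \<Sum>x\<in>X. w x * f E x t)) \<le> (\<Sum>E\<in>\<E>. \<Sum>x\<in>X. w x * N (f E x))"
    using N_lincomb[OF X(1), of "f _" w] f w by (intro sum_mono) simp
  also have "\<dots> = (\<Sum>x\<in>X. w x * (\<Sum>E\<in>\<E>. N (f E x)))"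
    by (subst sum.swap) (simp add: sum_distrib_left)
  finally have "\<theta> n * (\<Sum>E\<in>\<E>. N (\<lambda>t. \<Sum>x\<in>X. w x * f E x t)) \<le> \<theta> n * (\<Sum>x\<in>X. w x * (\<Sum>E\<in>\<E>. N (f E x)))"
    using \<theta>[OF n] by (intro mult_left_mono) auto
  then show ?thesis by (simp add: sum_distrib_left mult.left_commute)
qed

lemma restr_comb: "restr E (comb w X) = (\<lambda>t. \<Sum>x\<in>X. w (qmax x) * restr E x t)"
  unfolding comb_def by (rule restr_lincomb)

text \<open>\<E> is grouped by \<F>. A block in which no group begins meets at most one group and
  contributes at most \<epsilon> by \<open>splits\<close>; the other blocks contribute at most 1
  each, and their right ends form a set of \<O>, of mass at most \<kappa>.\<close>

lemma average_good:
  assumes X: "bset X" "\<And>x. x \<in> X \<Longrightarrow> N x \<le> 1" and w: "\<And>i. 0 \<le> w i" "(\<Sum>x\<in>X. w (qmax x)) \<le> 1"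
    and \<O>: "hereditary \<O>" "spreading \<O>" and m: "m \<ge> 1" "splits m \<O> \<epsilon>" and \<epsilon>: "0 \<le> \<epsilon>"
    and \<kappa>: "\<And>H. H \<subseteq> X \<Longrightarrow> qmax ` H \<in> \<O> \<Longrightarrow> (\<Sum>x\<in>H. w (qmax x)) \<le> \<kappa>"
  shows "good (\<kappa> + \<epsilon>) (comb w X) m"
  unfolding good_def
proof (intro allI impI)
  fix \<E> assume \<E>: "adm (G m) \<E>"
  then obtain \<F> where \<F>: "adm \<O> \<F>" "\<forall>E\<in>\<E>. \<exists>F\<in>\<F>. E \<subseteq> F"
    "\<And>F x. F \<in> \<F> \<Longrightarrow> x \<in> c00 \<Longrightarrow> \<theta> m * (\<Sum>E | E \<in> \<E> \<and> E \<subseteq> F. N (restr E x)) \<le> \<epsilon> * N x"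
    using m(2) unfolding splits_def by meson
  have S: "succ_sets \<F>" using \<F>(1) by (simp add: adm_def)
  have fin: "finite X" "finite \<E>" using X(1) bset_finite adm_finite[OF \<E>] by auto
  define v where "v x = \<theta> m * (\<Sum>E\<in>\<E>. N (restr E x))" for x
  have v1: "v x \<le> 1" if "x \<in> X" for x
    using N_adm[OF bsetD(1)[OF X(1) that] m(1) \<E>] X(2)[OF that] by (simp add: v_def)
  have v2: "v x \<le> \<epsilon>" if x: "x \<in> X" "x \<notin> bad X \<F>" for x
  proof (cases "\<exists>F\<in>\<F>. F \<inter> supp x \<noteq> {}")
    case True
    then obtain F where F: "F \<in> \<F>" "F \<inter> supp x \<noteq> {}" by blast
    have "E \<subseteq> F" if E: "E \<in> \<E>" "E \<inter> supp x \<noteq> {}" for E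
    proof -
      obtain F' where "F' \<in> \<F>" "E \<subseteq> F'" using \<F>(2) E(1) by blast
      moreover from this have "F' \<inter> supp x \<noteq> {}" using E(2) by blast
      ultimately show ?thesis using not_bad_unique[OF X(1) S x F(1) _ F(2), of F'] by simp
    qed
    then have "(\<Sum>E\<in>\<E>. N (restr E x)) = (\<Sum>E | E \<in> \<E> \<and> E \<subseteq> F. N (restr E x))"
    proof (intro sum.mono_neutral_right)
      show "\<forall>E\<in>\<E> - {E \<in> \<E>. E \<subseteq> F}. N (restr E x) = 0"
      proof
        fix E assume "E \<in> \<E> - {E \<in> \<E>. E \<subseteq> F}"
        then have "E \<inter> supp x = {}" using \<open>\<And>E. E \<in> \<E> \<Longrightarrow> E \<inter> supp x \<noteq> {} \<Longrightarrow> E \<subseteq> F\<close> by blast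
        then show "N (restr E x) = 0" by (simp add: restr_disjoint)
      qed
    qed (use fin(2) in auto)
    then have "v x \<le> \<epsilon> * N x" using \<F>(3)[OF F(1) bsetD(1)[OF X(1) x(1)]] by (simp add: v_def)
    also have "\<dots> \<le> \<epsilon>" using \<epsilon> X(2)[OF x(1)] by (simp add: mult_left_le)
    finally show ?thesis .
  next
    case False
    then have "E \<inter> supp x = {}" if "E \<in> \<E>" for E using \<F>(2) that by blast
    then have "v x = 0" unfolding v_def using restr_disjoint by simp
    then show ?thesis using \<epsilon> by simp
  qed
  have "\<theta> m * (\<Sum>E\<in>\<E>. N (restr E (comb w X))) \<le> (\<Sum>x\<in>X. w (qmax x) * v x)"
    unfolding restr_comb v_def
    using bsetD(1)[OF X(1)] fin(1) w m(1) by (intro weighted_sum_le) auto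
  also have "\<dots> \<le> (\<Sum>x\<in>X. (if x \<in> bad X \<F> then w (qmax x) else 0) + w (qmax x) * \<epsilon>)"
  proof (rule sum_mono)
    fix x assume x: "x \<in> X"
    show "w (qmax x) * v x \<le> (if x \<in> bad X \<F> then w (qmax x) else 0) + w (qmax x) * \<epsilon>"
      using mult_left_mono[OF v1[OF x] w(1)[of "qmax x"]] mult_left_mono[OF v2[OF x] w(1)[of "qmax x"]] mult_nonneg_nonneg[OF w(1)[of "qmax x"] \<epsilon>]
      by (cases "x \<in> bad X \<F>") auto
  qed
  also have "\<dots> = (\<Sum>x\<in>bad X \<F>. w (qmax x)) + (\<Sum>x\<in>X. w (qmax x)) * \<epsilon>"
  proof -
    have "X \<inter> bad X \<F> = bad X \<F>" by (auto simp: bad_def)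
    then show ?thesis using fin(1) by (simp add: sum.distrib sum.inter_restrict[symmetric] sum_distrib_right)
  qed
  also have "\<dots> \<le> \<kappa> + \<epsilon>"
  proof (rule add_mono)
    show "(\<Sum>x\<in>bad X \<F>. w (qmax x)) \<le> \<kappa>"
      by (rule \<kappa>) (use bad_admissible[OF X(1) \<O> \<F>(1)] in \<open>auto simp: bad_def\<close>)
    show "(\<Sum>x\<in>X. w (qmax x)) * \<epsilon> \<le> \<epsilon>" using w(2) \<epsilon> by (simp add: mult_left_le_one_le sum_nonneg w(1))
  qed
  finally show "\<theta> m * (\<Sum>E\<in>\<E>. N (restr E (comb w X))) \<le> \<kappa> + \<epsilon>" .
qed

text \<open>Exceptional blocks of a norming tree with at most \<open>d\<close> successive branchings
  of index up to \<open>p\<close>: those met by a set of \<open>F0\<close> at a leaf and those split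
  at a node. \<open>G n\<close> itself occurs because the blocks split at one node are already a set
  of \<open>G n\<close>.\<close>

primrec cutfam :: "nat \<Rightarrow> nat \<Rightarrow> nat set set" where
  "cutfam p 0 = F0 \<union> (\<Union>n\<in>{1..p}. G n)"
| "cutfam p (Suc d) = (F0 \<union> (\<Union>n\<in>{1..p}. G n)) \<union> (\<Union>n\<in>{1..p}. fam_comp (G n) (cutfam p d))"

lemma cutfam_F0: "F0 \<subseteq> cutfam p d" and cutfam_G: "n \<in> {1..p} \<Longrightarrow> G n \<subseteq> cutfam p d"
  by (cases d; auto)+

lemma cutfam_fin_pos: "cutfam p d \<subseteq> fin_pos_sets"
proof (induction d)
  case 0
  then show ?case using F0(1) G(1) by fastforce
next
  case (Suc d)
  then show ?case using F0(1) G(1) fam_comp_fin_pos[OF Suc] by fastforce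
qed

lemma Nk_add: "x \<in> c00 \<Longrightarrow> y \<in> c00 \<Longrightarrow> Nk k (\<lambda>t. x t + y t) \<le> Nk k x + Nk k y"
  using Nk_lincomb[of "{True, False}" "\<lambda>b. if b then x else y" k "\<lambda>_. 1"] by simp

definition hit :: "nat set \<Rightarrow> (nat \<Rightarrow> real) set \<Rightarrow> (nat \<Rightarrow> real) set" where
  "hit A Y = {y\<in>Y. supp y \<inter> A \<noteq> {}}"

lemma restr_comb_hit:
  assumes "finite Y"
  shows "restr A (comb w Y) = (\<lambda>t. \<Sum>y\<in>hit A Y. w (qmax y) * restr A y t)"
proof
  fix t
  have "(\<Sum>y\<in>Y. w (qmax y) * restr A y t) = (\<Sum>y\<in>hit A Y. w (qmax y) * restr A y t)"
    by (rule sum.mono_neutral_right) (use assms in \<open>auto simp: hit_def restr_def supp_def\<close>)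
  then show "restr A (comb w Y) t = (\<Sum>y\<in>hit A Y. w (qmax y) * restr A y t)"
    by (simp add: restr_comb)
qed

text \<open>The norm of a weighted sum of blocks is estimated by cutting the norming tree at the
  nodes of weight below \<open>\<tau>\<close>. At a cut node whose branching index exceeds \<open>p\<close> all blocks but one are
  good; the cut nodes and the split blocks are then recorded by the family \<open>cutfam\<close>.\<close>

lemma cut_estimate:
  assumes Y: "bset Y" "\<And>y. y \<in> Y \<Longrightarrow> N y \<le> 1" and w: "\<And>i. 0 \<le> w i" and \<delta>: "0 \<le> \<delta>"
    and g: "\<And>m y z. m > p \<Longrightarrow> y \<in> Y \<Longrightarrow> z \<in> Y \<Longrightarrow> \<not> good \<delta> y m \<Longrightarrow> \<not> good \<delta> z m \<Longrightarrow> y = z"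
  shows "Z \<subseteq> Y \<Longrightarrow> \<theta> 1 ^ d \<le> \<tau> \<Longrightarrow> 0 < \<tau> \<Longrightarrow>
    \<exists>H\<subseteq>hit A Z. qmax ` H \<in> cutfam p d \<and>
     Nk k (restr A (comb w Z)) \<le> (\<tau> + \<delta>) * (\<Sum>y\<in>hit A Z. w (qmax y)) + (real d + 1) * (\<Sum>y\<in>H. w (qmax y))"
proof (induction d arbitrary: Z A k \<tau>)
  \<comment> \<open>Base case and induction step share this argument. The induction hypothesis
    enters as \<open>IH\<close>, with \<tau> divided by the weight \<open>\<theta> n\<close> of the
    node just passed.\<close>
  have main: "\<exists>H\<subseteq>hit A Z. qmax ` H \<in> cutfam p d \<and>
     Nk k (restr A (comb w Z)) \<le> (\<tau> + \<delta>) * (\<Sum>y\<in>hit A Z. w (qmax y)) + (real d + 1) * (\<Sum>y\<in>H. w (qmax y))"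
    if ZY: "Z \<subseteq> Y" and \<tau>: "\<theta> 1 ^ d \<le> \<tau>" "0 < \<tau>"
      and IH: "\<And>d' n Z A k. d = Suc d' \<Longrightarrow> n \<in> {1..p} \<Longrightarrow> \<tau> < \<theta> n \<Longrightarrow> Z \<subseteq> Y \<Longrightarrow>
        \<exists>H\<subseteq>hit A Z. qmax ` H \<in> cutfam p d' \<and>
          Nk k (restr A (comb w Z)) \<le> (\<tau> / \<theta> n + \<delta>) * (\<Sum>y\<in>hit A Z. w (qmax y)) + (real d' + 1) * (\<Sum>y\<in>H. w (qmax y))"
    for d Z A k \<tau>
  proof -
    define W where "W S = (\<Sum>y\<in>S. w (qmax y))" for S
    define J where "J = hit A Z"
    have JZ: "J \<subseteq> Z" by (auto simp: J_def hit_def)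
    then have JY: "J \<subseteq> Y" using ZY by blast
    have Z: "bset Z" and J: "bset J" using bset_subset[OF Y(1)] ZY JY by auto
    have fin: "finite Z" "finite J" using Z J bset_finite by auto
    have W0: "0 \<le> W S" for S unfolding W_def using w by (simp add: sum_nonneg)
    \<comment> \<open>\<open>H\<close> will have the greatest mass among the recordable sets. It is
      fixed before the supremum over all nodes is taken, and every exceptional set met below is
      bounded by the same \<open>W H\<close>.\<close>
    define C where "C = W ` {H. H \<subseteq> J \<and> qmax ` H \<in> cutfam p d}"
    have finC: "finite C" unfolding C_def using fin(2) by (intro finite_imageI) simp
    have "{} \<in> cutfam p d" using cutfam_F0 F0_empty by blast
    then have "W {} \<in> C" by (auto simp: C_def)
    then have "Max C \<in> C" using finC by (intro Max_in) auto
    then obtain H where H: "H \<subseteq> J" "qmax ` H \<in> cutfam p d" "W H = Max C" by (auto simp: C_def)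
    have WH: "W H' \<le> W H" if "H' \<subseteq> J" "qmax ` H' \<in> cutfam p d" for H'
      unfolding H(3) using finC that by (intro Max_ge) (auto simp: C_def)
    define B where "B = (\<tau> + \<delta>) * W J + (real d + 1) * W H"
    have BH: "W H \<le> B" "W H + \<tau> * W J \<le> B" "W H + \<delta> * W J \<le> B"
      using W0[of H] W0[of J] \<tau>(2) \<delta> by (auto simp: B_def algebra_simps intro: add_nonneg_nonneg mult_nonneg_nonneg)
    have JN: "N y \<le> 1" "y \<in> c00" if "y \<in> J" for y using that JY Y bsetD(1)[OF Y(1)] by auto
    have fam: "fam_norm F0 (restr A (comb w Z)) \<le> W H"
    proof (rule fam_norm_least[OF F0_empty])
      fix D assume D: "D \<in> F0"
      \<comment> \<open>A set of \<open>F0\<close> picks a point from each block that it meets;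
        moving these points to the right ends is a spreading.\<close>
      define H' where "H' = {y\<in>J. supp y \<inter> (D \<inter> A) \<noteq> {}}"
      have "\<exists>n. n \<in> supp y \<inter> (D \<inter> A)" if "y \<in> H'" for y using that by (auto simp: H'_def)
      then obtain f where f: "\<And>y. y \<in> H' \<Longrightarrow> f y \<in> supp y \<inter> (D \<inter> A)" by metis
      have key: "y = z \<or> qmax y < qmax z" if "y \<in> H'" "z \<in> H'" "f y \<le> f z" for y z
        using bset_less_qmax[OF J, of y z "f y" "f z"] f that by (auto simp: H'_def)
      have "qmax ` H' \<in> F0"
      proof (rule spread_image[OF F0(2,3) D, of f])
        fix y z assume yz: "y \<in> H'" "z \<in> H'"
        show "f y < f z \<Longrightarrow> qmax y < qmax z" using key[OF yz] by fastforce
        show "f y = f z \<Longrightarrow> qmax y = qmax z" using key[OF yz] key[OF yz(2,1)] by fastforce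
        show "f y \<le> qmax y" using bsetD(4)[OF J, of y "f y"] f[OF yz(1)] yz(1) by (auto simp: H'_def)
      qed (use f in blast)
      then have H': "W H' \<le> W H" using cutfam_F0 by (intro WH) (auto simp: H'_def)
      have finD: "finite D" using D F0(1) by (auto simp: fin_pos_sets_def)
      have "(\<Sum>n\<in>D. \<bar>restr A (comb w Z) n\<bar>) \<le> (\<Sum>n\<in>D. \<Sum>y\<in>J. w (qmax y) * \<bar>restr A y n\<bar>)"
        unfolding restr_comb_hit[OF fin(1)] J_def[symmetric]
        by (intro sum_mono order_trans[OF sum_abs]) (simp add: abs_mult w)
      also have "\<dots> = (\<Sum>y\<in>J. w (qmax y) * (\<Sum>n\<in>D. \<bar>restr A y n\<bar>))"
        by (subst sum.swap) (simp add: sum_distrib_left)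
      also have "\<dots> = (\<Sum>y\<in>H'. w (qmax y) * (\<Sum>n\<in>D. \<bar>restr A y n\<bar>))"
      proof (rule sum.mono_neutral_right)
        show "\<forall>y\<in>J - H'. w (qmax y) * (\<Sum>n\<in>D. \<bar>restr A y n\<bar>) = 0"
        proof
          fix y assume "y \<in> J - H'"
          then have "n \<notin> supp y \<or> n \<notin> A" if "n \<in> D" for n using that by (auto simp: H'_def)
          then have "restr A y n = 0" if "n \<in> D" for n using that by (auto simp: restr_def supp_def)
          then show "w (qmax y) * (\<Sum>n\<in>D. \<bar>restr A y n\<bar>) = 0" by simp
        qed
      qed (use fin in \<open>auto simp: H'_def\<close>)
      also have "\<dots> \<le> (\<Sum>y\<in>H'. w (qmax y) * 1)"
      proof (intro sum_mono mult_left_mono w)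
        fix y assume "y \<in> H'"
        then have y: "y \<in> J" by (simp add: H'_def)
        have "(\<Sum>n\<in>D. \<bar>restr A y n\<bar>) \<le> N (restr A y)"
          using fam_norm_upper[OF F0(1) _ D] N_ge_fam restr_c00 JN(2)[OF y] order_trans by blast
        also have "\<dots> \<le> 1" using N_restr[OF JN(2)[OF y]] JN(1)[OF y] order_trans by blast
        finally show "(\<Sum>n\<in>D. \<bar>restr A y n\<bar>) \<le> 1" .
      qed
      finally show "(\<Sum>n\<in>D. \<bar>restr A (comb w Z) n\<bar>) \<le> W H" using H' by (simp add: W_def)
    qed
    have "Nk k (restr A (comb w Z)) \<le> B"
    proof (cases k)
      case 0
      then show ?thesis using fam BH(1) by simp
    next
      case (Suc k')
      show ?thesis
        unfolding Suc
      proof (rule Nk_Suc_le)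
        show "fam_norm F0 (restr A (comb w Z)) \<le> B" using fam BH(1) by linarith
        fix n \<E> assume n: "n \<ge> 1" and \<E>: "adm (G n) \<E>"
        have S: "succ_sets \<E>" using \<E> by (simp add: adm_def)
        have fin\<E>: "finite \<E>" using adm_finite[OF \<E>] .
        define v where "v y = \<theta> n * (\<Sum>E\<in>\<E>. N (restr E (restr A y)))" for y
        have v1: "v y \<le> 1" if "y \<in> J" for y
        proof -
          have "v y \<le> N (restr A y)" unfolding v_def using N_adm[OF restr_c00[OF JN(2)[OF that]] n \<E>] .
          also have "\<dots> \<le> 1" using N_restr[OF JN(2)[OF that]] JN(1)[OF that] order_trans by blast
          finally show ?thesis .
        qed
        have v0: "0 \<le> v y" if "y \<in> J" for y
          unfolding v_def using \<theta>(1)[OF n] N_nonneg restr_c00 JN(2)[OF that]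
          by (intro mult_nonneg_nonneg sum_nonneg) auto
        have vsum: "\<theta> n * (\<Sum>E\<in>\<E>. Nk k' (restr E (restr A (comb w S')))) \<le> (\<Sum>y\<in>S'. w (qmax y) * v y)"
          if S': "S' \<subseteq> J" for S'
        proof -
          have fS: "finite S'" using S' fin(2) finite_subset by blast
          have c: "y \<in> c00" if "y \<in> S'" for y using that S' JN(2) by blast
          have eq: "restr E (restr A (comb w S')) = (\<lambda>t. \<Sum>y\<in>S'. w (qmax y) * restr E (restr A y) t)" for E
            unfolding restr_comb restr_lincomb ..
          have "bset S'" using bset_subset[OF J S'] .
          then have "Nk k' (restr E (restr A (comb w S'))) \<le> N (restr E (restr A (comb w S')))" for E
            by (intro Nk_le_N restr_c00 comb_c00)
          then have "\<theta> n * (\<Sum>E\<in>\<E>. Nk k' (restr E (restr A (comb w S')))) \<le> \<theta> n * (\<Sum>E\<in>\<E>. N (restr E (restr A (comb w S'))))"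
            using \<theta>(1)[OF n] by (intro mult_left_mono sum_mono) auto
          also have "\<dots> \<le> (\<Sum>y\<in>S'. w (qmax y) * v y)"
            unfolding eq v_def using c by (intro weighted_sum_le) (use fS w n in auto)
          finally show ?thesis .
        qed
        have hitcomb: "restr A (comb w Z) = restr A (comb w J)"
          by (subst restr_comb_hit[OF fin(1)]) (simp only: restr_comb J_def)
        show "\<theta> n * (\<Sum>E\<in>\<E>. Nk k' (restr E (restr A (comb w Z)))) \<le> B"
        proof (cases "n > p")
          case True
          \<comment> \<open>At most one block fails here, and a singleton is recordable through
            \<open>F0\<close>.\<close>
          define H' where "H' = {y\<in>J. \<not> good \<delta> y n}"
          have vg: "v y \<le> \<delta>" if y: "y \<in> J" "y \<notin> H'" for y
          proof -
            have "v y \<le> \<theta> n * (\<Sum>E\<in>\<E>. N (restr E y))"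
            proof -
              have "N (restr E (restr A y)) \<le> N (restr E y)" for E
                using N_restr[of "restr E y" A] JN(2)[OF y(1)] by (simp add: restr_restr Int_commute)
              then show ?thesis unfolding v_def using \<theta>(1)[OF n] by (intro mult_left_mono sum_mono) auto
            qed
            also have "\<dots> \<le> \<delta>" using y \<E> by (auto simp: H'_def good_def)
            finally show ?thesis .
          qed
          have "qmax ` H' \<in> F0"
          proof (cases "H' = {}")
            case False
            then obtain y where y: "y \<in> H'" by blast
            have "H' = {y}" using g[OF True] y JY by (auto simp: H'_def)
            then show ?thesis using F0_single[of "qmax y"] qmax_pos[OF J, of y] y by (auto simp: H'_def)
          qed (simp add: F0_empty)
          then have H': "W H' \<le> W H" using cutfam_F0 by (intro WH) (auto simp: H'_def)
          have "\<theta> n * (\<Sum>E\<in>\<E>. Nk k' (restr E (restr A (comb w Z)))) \<le> (\<Sum>y\<in>J. w (qmax y) * v y)"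
            unfolding hitcomb by (rule vsum) simp
          also have "\<dots> \<le> (\<Sum>y\<in>J. (if y \<in> H' then w (qmax y) else 0) + \<delta> * w (qmax y))"
          proof (rule sum_mono)
            fix y assume y: "y \<in> J"
            have "0 \<le> \<delta> * w (qmax y)" using w \<delta> by simp
            then show "w (qmax y) * v y \<le> (if y \<in> H' then w (qmax y) else 0) + \<delta> * w (qmax y)"
              using mult_left_mono[OF v1[OF y] w[of "qmax y"]] mult_left_mono[OF vg[OF y] w[of "qmax y"]]
              by (cases "y \<in> H'") (auto simp: mult.commute[of \<delta>])
          qed
          also have "\<dots> = W H' + \<delta> * W J"
          proof -
            have "J \<inter> H' = H'" by (auto simp: H'_def)
            then show ?thesis using fin(2)
              by (simp add: W_def sum.distrib sum.inter_restrict[symmetric] sum_distrib_left)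
          qed
          finally show ?thesis using H' BH(3) by linarith
        next
          case False
          then have np: "n \<in> {1..p}" using n by simp
          \<comment> \<open>The blocks split at this node are paid for by one \<open>W H\<close>,
            the extra 1 in the factor d + 1. Each remaining block meets at most one
            interval.\<close>
          define H0 where "H0 = bad J \<E>"
          define Z' where "Z' = J - H0"
          have H0J: "H0 \<subseteq> J" by (auto simp: H0_def bad_def)
          have "qmax ` H0 \<in> G n" unfolding H0_def by (rule bad_admissible[OF J G(2,3)[OF n] \<E> order_refl])
          then have WH0: "W H0 \<le> W H" using cutfam_G[OF np] H0J by (intro WH) auto
          have comb_eq: "comb w J = (\<lambda>t. comb w H0 t + comb w Z' t)"
            unfolding comb_def Z'_def using fin(2) H0J by (auto simp: sum.subset_diff[of H0 J] add.commute)
          have bs: "bset H0" "bset Z'" using bset_subset[OF J] H0J by (auto simp: Z'_def)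
          have "Nk k' (restr E (restr A (comb w Z))) \<le>
              Nk k' (restr E (restr A (comb w H0))) + Nk k' (restr E (restr A (comb w Z')))" for E
          proof -
            have "restr E (restr A (comb w Z)) = (\<lambda>t. restr E (restr A (comb w H0)) t + restr E (restr A (comb w Z')) t)"
              unfolding hitcomb comb_eq by (auto simp: restr_def)
            then show ?thesis using Nk_add comb_c00 bs restr_c00 by metis
          qed
          then have "(\<Sum>E\<in>\<E>. Nk k' (restr E (restr A (comb w Z)))) \<le>
              (\<Sum>E\<in>\<E>. Nk k' (restr E (restr A (comb w H0))) + Nk k' (restr E (restr A (comb w Z'))))"
            by (intro sum_mono) 
          then have "\<theta> n * (\<Sum>E\<in>\<E>. Nk k' (restr E (restr A (comb w Z)))) \<le>
              \<theta> n * (\<Sum>E\<in>\<E>. Nk k' (restr E (restr A (comb w H0))) + Nk k' (restr E (restr A (comb w Z'))))"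
            using \<theta>(1)[OF n] by (intro mult_left_mono) auto
          also have "\<dots> = \<theta> n * (\<Sum>E\<in>\<E>. Nk k' (restr E (restr A (comb w H0)))) +
              \<theta> n * (\<Sum>E\<in>\<E>. Nk k' (restr E (restr A (comb w Z'))))"
            by (simp add: sum.distrib distrib_left)
          finally have split: "\<theta> n * (\<Sum>E\<in>\<E>. Nk k' (restr E (restr A (comb w Z)))) \<le>
              \<theta> n * (\<Sum>E\<in>\<E>. Nk k' (restr E (restr A (comb w H0)))) +
              \<theta> n * (\<Sum>E\<in>\<E>. Nk k' (restr E (restr A (comb w Z'))))" .
          have first: "\<theta> n * (\<Sum>E\<in>\<E>. Nk k' (restr E (restr A (comb w H0)))) \<le> W H0"
          proof -
            have "\<theta> n * (\<Sum>E\<in>\<E>. Nk k' (restr E (restr A (comb w H0)))) \<le> (\<Sum>y\<in>H0. w (qmax y) * v y)"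
              by (rule vsum[OF H0J])
            also have "\<dots> \<le> (\<Sum>y\<in>H0. w (qmax y) * 1)"
              using v1 H0J w by (intro sum_mono mult_left_mono) auto
            finally show ?thesis by (simp add: W_def)
          qed
          have Z'J: "Z' \<subseteq> J" by (simp add: Z'_def)
          have nb: "y \<in> J" "y \<notin> bad J \<E>" if "y \<in> Z'" for y using that by (auto simp: Z'_def H0_def)
          show ?thesis
          proof (cases "\<theta> n \<le> \<tau>")
            \<comment> \<open>The branch is cut here: an unsplit block has its norm multiplied by
              \<open>\<theta> n\<close>, which is at most \<tau>.\<close>
            case True
            have vt: "v y \<le> \<tau>" if y: "y \<in> Z'" for y
            proof -
              have "(\<Sum>E\<in>\<E>. N (restr E (restr A y))) \<le> 1"
              proof (rule not_bad_sum[OF J S nb[OF y]])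
                show "N (restr E (restr A y)) = 0" if "E \<inter> supp y = {}" for E
                proof -
                  have "E \<inter> supp (restr A y) = {}" using that by (auto simp: supp_restr)
                  then show ?thesis by (simp add: restr_disjoint)
                qed
                show "N (restr E (restr A y)) \<le> 1" for E
                  using N_restr[OF restr_c00[OF JN(2)[OF nb(1)[OF y]]], of E A] N_restr[OF JN(2)[OF nb(1)[OF y]], of A]
                    JN(1)[OF nb(1)[OF y]] by linarith
              qed simp
              then have "v y \<le> \<theta> n" unfolding v_def using \<theta>(1)[OF n] by (simp add: mult_left_le)
              then show ?thesis using True by linarith
            qed
            have "\<theta> n * (\<Sum>E\<in>\<E>. Nk k' (restr E (restr A (comb w Z')))) \<le> (\<Sum>y\<in>Z'. w (qmax y) * v y)"
              by (rule vsum[OF Z'J])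
            also have "\<dots> \<le> (\<Sum>y\<in>Z'. w (qmax y) * \<tau>)"
              using vt w by (intro sum_mono mult_left_mono) auto
            also have "\<dots> = \<tau> * W Z'" by (simp add: W_def sum_distrib_right[symmetric])
            also have "\<dots> \<le> \<tau> * W J"
              unfolding W_def using \<tau>(2) fin(2) w Z'J by (intro mult_left_mono sum_mono2) auto
            finally show ?thesis using split first WH0 BH(2) by linarith
          next
            case False
            \<comment> \<open>For d = 0 the assumption on \<tau> would give 1 \<le> \<tau> <
              \<open>\<theta> n\<close>.\<close>
            have "d \<noteq> 0" using False \<tau>(1) \<theta>(2)[OF n] by (cases d) auto
            then obtain d' where d: "d = Suc d'" using not0_implies_Suc by blast
            have "\<exists>H\<subseteq>hit (E \<inter> A) Z'. qmax ` H \<in> cutfam p d' \<and>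
              Nk k' (restr (E \<inter> A) (comb w Z')) \<le> (\<tau> / \<theta> n + \<delta>) * (\<Sum>y\<in>hit (E \<inter> A) Z'. w (qmax y)) + (real d' + 1) * (\<Sum>y\<in>H. w (qmax y))" for E
              by (rule IH[OF d np]) (use False Z'J JY in auto)
            then obtain h where h: "\<And>E. h E \<subseteq> hit (E \<inter> A) Z'" "\<And>E. qmax ` h E \<in> cutfam p d'"
              "\<And>E. Nk k' (restr (E \<inter> A) (comb w Z')) \<le> (\<tau> / \<theta> n + \<delta>) * W (hit (E \<inter> A) Z') + (real d' + 1) * W (h E)"
              unfolding W_def by metis
            have hitE: "y \<in> Z' \<and> (\<exists>e. e \<in> E \<and> e \<in> supp y)" if "y \<in> hit (E \<inter> A) Z'" for y E
              using that by (auto simp: hit_def)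
            have uniq: "E = E'" if "E \<in> \<E>" "E' \<in> \<E>" "y \<in> hit (E \<inter> A) Z'" "y \<in> hit (E' \<inter> A) Z'" for E E' y
              using not_bad_unique[OF J S nb that(1,2)] hitE[OF that(3)] hitE[OF that(4)] by blast
            have finh: "finite (hit B Z')" for B using fin(2) Z'J by (auto simp: hit_def intro: finite_subset)
            have finh': "finite (h E)" for E using h(1) finh finite_subset by blast
            have sumW: "(\<Sum>E\<in>\<E>. W (f E)) = W (\<Union>E\<in>\<E>. f E)"
              if f: "\<And>E. E \<in> \<E> \<Longrightarrow> f E \<subseteq> hit (E \<inter> A) Z'" for f
              unfolding W_def
              by (rule sum.UNION_disjoint[symmetric])
                 (use fin\<E> f finh uniq in \<open>blast intro: finite_subset\<close>)+
            have sum1: "(\<Sum>E\<in>\<E>. W (hit (E \<inter> A) Z')) \<le> W J"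
            proof -
              have "(\<Sum>E\<in>\<E>. W (hit (E \<inter> A) Z')) = W (\<Union>E\<in>\<E>. hit (E \<inter> A) Z')" by (rule sumW) simp
              also have "\<dots> \<le> W J" unfolding W_def
                by (rule sum_mono2) (use fin(2) hitE Z'J w in auto)
              finally show ?thesis .
            qed
            \<comment> \<open>The sets recorded for different intervals are successive and begin no
              earlier than their intervals, so by spreading their union lies in
              \<open>fam_comp (G n) (cutfam p d')\<close>.\<close>
            have sum2: "(\<Sum>E\<in>\<E>. W (h E)) \<le> W H"
            proof -
              define \<E>' where "\<E>' = {E\<in>\<E>. h E \<noteq> {}}"
              define u where "u E = qmax ` h E" for E
              have lt: "qmax y < qmax z" if EE: "E \<in> \<E>" "E' \<in> \<E>" "Max E < Min E'" and yz: "y \<in> h E" "z \<in> h E'" for E E' y z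
              proof -
                obtain e e' where e: "e \<in> E" "e \<in> supp y" "e' \<in> E'" "e' \<in> supp z" "y \<in> Z'" "z \<in> Z'"
                  using hitE[OF subsetD[OF h(1) yz(1)]] hitE[OF subsetD[OF h(1) yz(2)]] by blast
                have "e \<le> Max E" "Min E' \<le> e'" using e succ_setsD(1)[OF S] EE(1,2) by auto
                then have "e \<le> e'" using EE(3) by linarith
                moreover have "y \<noteq> z"
                proof
                  assume "y = z"
                  then have "E = E'" using uniq[OF EE(1,2) subsetD[OF h(1) yz(1)]] subsetD[OF h(1) yz(2)] by simp
                  then show False using EE(3) succ_setsD(5)[OF S EE(1)] by simp
                qed
                ultimately show ?thesis using bset_less_qmax[OF bs(2) e(5,6,2,4)] by blast
              qed
              have u: "finite (u E)" "u E \<noteq> {}" if "E \<in> \<E>'" for E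
                using that finh' by (auto simp: u_def \<E>'_def)
              have ult: "Max (u E) < Min (u E')" if "E \<in> \<E>'" "E' \<in> \<E>'" "Max E < Min E'" for E E'
              proof -
                have "Max (u E) \<in> u E" "Min (u E') \<in> u E'" using u that by auto
                then show ?thesis using lt that by (auto simp: u_def \<E>'_def)
              qed
              have "succ_sets (u ` \<E>')"
                unfolding succ_sets_def
              proof (intro conjI ballI impI)
                fix U V assume "U \<in> u ` \<E>'" "V \<in> u ` \<E>'" "U \<noteq> V"
                then obtain E E' where E: "E \<in> \<E>'" "E' \<in> \<E>'" "U = u E" "V = u E'" "E \<noteq> E'" by blast
                then have "Max E < Min E' \<or> Max E' < Min E" using S unfolding succ_sets_def \<E>'_def by blast
                then show "Max U < Min V \<or> Max V < Min U" using ult E by blast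
              qed (use fin\<E> u in \<open>auto simp: \<E>'_def\<close>)
              moreover have "(\<lambda>E. Min (u E)) ` \<E>' \<in> G n"
              proof (rule spread_image[OF G(2,3)[OF n], of "Min ` \<E>" Min])
                show "Min ` \<E> \<in> G n" using \<E> by (simp add: adm_def)
                fix E E' assume E: "E \<in> \<E>'" "E' \<in> \<E>'"
                have E\<E>: "E \<in> \<E>" "E' \<in> \<E>" using E by (auto simp: \<E>'_def)
                show "Min E < Min E' \<Longrightarrow> Min (u E) < Min (u E')"
                proof -
                  assume "Min E < Min E'"
                  then have "Max E < Min E'" by (rule succ_sets_Min_less[OF S E\<E>])
                  then have "Max (u E) < Min (u E')" by (rule ult[OF E])
                  moreover have "Min (u E) \<le> Max (u E)" using u[OF E(1)] by (meson Max_ge Min_in)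
                  ultimately show "Min (u E) < Min (u E')" by linarith
                qed
                show "Min E = Min E' \<Longrightarrow> Min (u E) = Min (u E')"
                  using succ_sets_Min_eq[OF S E\<E>] by simp
                have "Min (u E) \<in> u E" using u[OF E(1)] by simp
                then obtain y where y: "y \<in> h E" "Min (u E) = qmax y" by (auto simp: u_def)
                then obtain e where e: "e \<in> E" "e \<in> supp y" "y \<in> Z'" 
                  using hitE[OF subsetD[OF h(1) y(1)]] by blast
                have "Min E \<le> e" using succ_setsD(1)[OF S E\<E>(1)] e by simp
                also have "e \<le> qmax y" using bsetD(4)[OF bs(2) e(3,2)] by simp
                finally show "Min E \<le> Min (u E)" using y by simp
              qed (auto simp: \<E>'_def)
              moreover have "qmax ` (\<Union>E\<in>\<E>. h E) = \<Union>(u ` \<E>')" by (auto simp: u_def \<E>'_def)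
              moreover have "u ` \<E>' \<subseteq> cutfam p d'" using h(2) by (auto simp: u_def)
              ultimately have "qmax ` (\<Union>E\<in>\<E>. h E) \<in> fam_comp (G n) (cutfam p d')"
                unfolding fam_comp_iff[OF cutfam_fin_pos] by (metis image_image)
              then have "qmax ` (\<Union>E\<in>\<E>. h E) \<in> cutfam p d" using np by (auto simp: d)
              moreover have "(\<Union>E\<in>\<E>. h E) \<subseteq> J" using hitE[OF subsetD[OF h(1)]] Z'J by blast
              ultimately have "W (\<Union>E\<in>\<E>. h E) \<le> W H" by (intro WH)
              then show ?thesis using sumW[of h] h(1) by simp
            qed
            have "\<theta> n * (\<Sum>E\<in>\<E>. Nk k' (restr E (restr A (comb w Z')))) \<le>
               \<theta> n * (\<Sum>E\<in>\<E>. (\<tau> / \<theta> n + \<delta>) * W (hit (E \<inter> A) Z') + (real d' + 1) * W (h E))"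
              unfolding restr_restr using \<theta>(1)[OF n] h(3) by (intro mult_left_mono sum_mono) auto
            also have "\<dots> = (\<tau> + \<theta> n * \<delta>) * (\<Sum>E\<in>\<E>. W (hit (E \<inter> A) Z')) + \<theta> n * (real d' + 1) * (\<Sum>E\<in>\<E>. W (h E))"
            proof -
              have "(\<Sum>E\<in>\<E>. (\<tau> / \<theta> n + \<delta>) * W (hit (E \<inter> A) Z') + (real d' + 1) * W (h E)) =
                  (\<tau> / \<theta> n + \<delta>) * (\<Sum>E\<in>\<E>. W (hit (E \<inter> A) Z')) + (real d' + 1) * (\<Sum>E\<in>\<E>. W (h E))"
                by (simp only: sum.distrib sum_distrib_left)
              then show ?thesis using \<theta>(1)[OF n] by (simp add: field_simps)
            qed
            also have "\<dots> \<le> (\<tau> + \<delta>) * W J + (real d' + 1) * W H"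
            proof (intro add_mono mult_mono sum1 sum2)
              show "\<theta> n * \<delta> \<le> \<delta>" using \<theta>[OF n] \<delta> by (simp add: mult_left_le_one_le less_imp_le)
              have "\<theta> n * (real d' + 1) \<le> 1 * (real d' + 1)" using \<theta>[OF n] by (intro mult_right_mono) auto
              then show "\<theta> n * (real d' + 1) \<le> real d' + 1" by simp
            qed (use \<tau>(2) \<delta> W0 in \<open>auto intro: sum_nonneg\<close>)
            finally show ?thesis using split first WH0 by (simp add: B_def d algebra_simps)
          qed
        qed
      qed
    qed
    then show ?thesis using H(1,2) by (intro exI[of _ H]) (simp add: B_def W_def J_def)
  qed
  {
    case 0
    show ?case by (rule main) (use 0 in auto)
  next
    case (Suc d)
    show ?case
    proof (rule main[OF Suc.prems])
      fix d' n Z A k assume d: "Suc d = Suc d'" and n: "n \<in> {1..p}" "\<tau> < \<theta> n" and "Z \<subseteq> Y"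
      have "\<theta> 1 ^ d * \<theta> n \<le> \<theta> 1 ^ d * \<theta> 1"
        using n \<theta>(1)[of 1] \<theta>_le[of n] by (intro mult_left_mono) auto
      also have "\<dots> \<le> \<tau>" using Suc.prems(2) by (simp add: mult.commute)
      finally have "\<theta> 1 ^ d \<le> \<tau> / \<theta> n" using \<theta>(1)[of n] n by (simp add: le_divide_eq)
      moreover have "0 < \<tau> / \<theta> n" using \<theta>(1)[of n] n Suc.prems(3) by simp
      ultimately show "\<exists>H\<subseteq>hit A Z. qmax ` H \<in> cutfam p d' \<and>
          Nk k (restr A (comb w Z)) \<le> (\<tau> / \<theta> n + \<delta>) * (\<Sum>y\<in>hit A Z. w (qmax y)) + (real d' + 1) * (\<Sum>y\<in>H. w (qmax y))"
        using Suc.IH[OF \<open>Z \<subseteq> Y\<close>] d by auto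
    qed
  }
qed

end

section \<open>Upper bounds for the order of block trees\<close>

definition before :: "(nat \<Rightarrow> real) \<Rightarrow> (nat \<Rightarrow> real) \<Rightarrow> bool" where
  "before x y \<longleftrightarrow> (\<forall>p\<in>supp x. \<forall>r\<in>supp y. p < r)"

lemma before_bset:
  assumes "sorted_wrt before t" "\<And>y. y \<in> set t \<Longrightarrow> y \<in> c00 \<and> supp y \<noteq> {}"
  shows "bset (set t)" "distinct t" "sorted_wrt (<) (map qmax t)"
proof -
  have fin: "finite (supp y)" "supp y \<noteq> {}" if "y \<in> set t" for y
    using assms(2)[OF that] c00_finite by auto
  have lt: "qmax y < Min (supp z)" "qmax y < qmax z" if "y \<in> set t" "z \<in> set t" "before y z" for y z
    using fin that by (auto simp: qmax_def before_def)
  have ne: "y \<noteq> z" if "y \<in> set t" "before y z" for y z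
    using fin(2)[OF that(1)] that(2) by (auto simp: before_def)
  have nth: "before (t ! i) (t ! j)" if "i < j" "j < length t" for i j
    using assms(1) that by (simp add: sorted_wrt_iff_nth_less)
  show "distinct t"
    unfolding distinct_conv_nth using nth ne nth_mem by (metis linorder_neqE_nat)
  show "sorted_wrt (<) (map qmax t)"
    unfolding sorted_wrt_map using assms(1) lt(2) by (rule sorted_wrt_mono_rel[rotated])
  show "bset (set t)"
    unfolding bset_def
  proof (intro conjI ballI impI)
    fix y z assume "y \<in> set t" "z \<in> set t" "y \<noteq> z"
    then obtain i j where ij: "i < length t" "j < length t" "y = t ! i" "z = t ! j" "i \<noteq> j"
      by (metis in_set_conv_nth)
    then consider "before y z" | "before z y" using nth by (metis linorder_neqE_nat)
    then show "qmax y < Min (supp z) \<or> qmax z < Min (supp y)"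
      using lt(1) \<open>y \<in> set t\<close> \<open>z \<in> set t\<close> by cases auto
  qed (use assms(2) in auto)
qed

context tsirelson_null
begin

text \<open>The largest block tree with constant \<open>K\<close>, so the index can be read off from
  \<open>TK K\<close> alone.\<close>

definition TK :: "real \<Rightarrow> (nat \<Rightarrow> real) list set" where
  "TK K = {xs. xs \<noteq> [] \<and> l1_block_seq N K xs}"

lemma TK_D:
  assumes "t \<in> TK K"
  shows "t \<noteq> []" "sorted_wrt before t" "\<And>x. x \<in> set t \<Longrightarrow> x \<in> c00 \<and> supp x \<noteq> {} \<and> N x = 1"
    "bset (set t)" "distinct t" "sorted_wrt (<) (map qmax t)"
proof -
  have "t \<noteq> []" and l1: "l1_block_seq N K t" using assms by (simp_all add: TK_def)
  note t = l1[unfolded l1_block_seq_def]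
  show "t \<noteq> []" by fact
  show 1: "sorted_wrt before t"
    unfolding sorted_wrt_iff_nth_less before_def
  proof (intro allI impI ballI)
    fix i j p q assume "i < j" "j < length t" "p \<in> supp (t ! i)" "q \<in> supp (t ! j)"
    then show "p < q" using t[THEN conjunct2, THEN conjunct1, rule_format, of i j p q] by blast
  qed
  show 2: "x \<in> c00 \<and> supp x \<noteq> {} \<and> N x = 1" if "x \<in> set t" for x
  proof -
    have "supp x \<noteq> {}"
    proof
      assume "supp x = {}"
      then have "x = (\<lambda>_. 0)" by (auto simp: supp_def)
      then show False using t[THEN conjunct1] that N_zero by fastforce
    qed
    then show ?thesis using t[THEN conjunct1] that by simp
  qed
  show "bset (set t)" "distinct t" "sorted_wrt (<) (map qmax t)"
    using before_bset[OF 1] 2 by blast+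
qed

lemma TK_lower:
  assumes "t \<in> TK K"
  shows "(\<Sum>x\<in>set t. \<bar>a x\<bar>) / K \<le> N (\<lambda>s. \<Sum>x\<in>set t. a x * x s)"
proof -
  have d: "distinct t" by (rule TK_D(5)[OF assms])
  have *: "(\<Sum>i<length t. f (t ! i)) = (\<Sum>x\<in>set t. f x)" for f :: "(nat \<Rightarrow> real) \<Rightarrow> real"
  proof -
    have "(\<Sum>i<length t. f (t ! i)) = sum_list (map f t)"
      by (simp add: sum_list_sum_nth atLeast0LessThan)
    then show ?thesis using d by (simp add: sum_list_distinct_conv_sum_set)
  qed
  have "N (\<lambda>s. \<Sum>i<length t. (\<lambda>i. a (t ! i)) i * (t ! i) s) \<ge> (\<Sum>i<length t. \<bar>(\<lambda>i. a (t ! i)) i\<bar>) / K"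
  proof -
    have "l1_block_seq N K t" using assms by (simp add: TK_def)
    then show ?thesis
      unfolding l1_block_seq_def by (elim conjE) (drule spec, assumption)
  qed
  then show ?thesis using *[of "\<lambda>x. \<bar>a x\<bar>"] *[of "\<lambda>x. a x * x _"] by simp
qed

lemma N_pos_supp: "x \<in> c00 \<Longrightarrow> 0 < N x \<Longrightarrow> supp x \<noteq> {}"
  using N_le_l1[of x] by (auto simp: l1norm_def)

text \<open>\<open>averaging\<close> handles finitely many families, here those belonging to p < m
  \<le> M. The bound \<open>M\<close> is free and will be chosen from the preceding blocks.\<close>

lemma level_one:
  assumes K: "K \<ge> 1" and \<kappa>: "0 < \<kappa>" and \<epsilon>: "0 \<le> \<epsilon>"
    and sp: "\<And>m. m > p \<Longrightarrow> \<exists>\<O> b. rkfam \<O> b \<and> b < cpow \<eta> \<and> splits m \<O> \<epsilon>"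
    and t: "rk (TK K) (s + cpow \<eta>) t"
  shows "\<exists>xs a. rk (TK K) s (t @ xs) \<and> xs \<noteq> [] \<and> (\<forall>x. 0 \<le> a x) \<and> (\<Sum>x\<in>set xs. a x) = (1::real) \<and>
      (\<forall>m. p < m \<and> m \<le> M \<longrightarrow> good (\<kappa> + \<epsilon>) (\<lambda>u. \<Sum>x\<in>set xs. a x * x u) m)"
proof -
  have "\<exists>\<O> \<rho>. rkfam \<O> (\<rho> {}) \<and> famrk \<O> \<rho> \<and> \<rho> {} < cpow \<eta> \<and> splits m \<O> \<epsilon>" if m: "m > p" for m
  proof -
    obtain \<O> b where O: "rkfam \<O> b" "b < cpow \<eta>" "splits m \<O> \<epsilon>" using sp[OF m] by blast
    obtain \<rho> where \<rho>: "famrk \<O> \<rho>" "\<rho> {} \<le> b" using rkfamD(5)[OF O(1)] by blast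
    have "rkfam \<O> (\<rho> {})" using rkfamD(1-4)[OF O(1)] \<rho>(1) unfolding rkfam_def by blast
    then show ?thesis using O \<rho> order_le_less_trans by blast
  qed
  then obtain \<O> \<rho> where O: "\<And>m. m > p \<Longrightarrow> rkfam (\<O> m) (\<rho> m {})" "\<And>m. m > p \<Longrightarrow> famrk (\<O> m) (\<rho> m)"
    "\<And>m. m > p \<Longrightarrow> \<rho> m {} < cpow \<eta>" "\<And>m. m > p \<Longrightarrow> splits m (\<O> m) \<epsilon>" by metis
  define Z where "Z = (\<lambda>m. (\<O> m, \<rho> m)) ` {p<..M}"
  have "\<exists>xs w. rk (TK K) s (t @ xs) \<and> xs \<noteq> [] \<and> (\<forall>i. 0 \<le> w i) \<and> sum w (qmax ` set xs) = 1 \<and>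
      (\<forall>F \<rho> E. (F, \<rho>) \<in> Z \<longrightarrow> E \<in> F \<longrightarrow> E \<subseteq> qmax ` set xs \<longrightarrow> sum w E \<le> \<kappa>)"
  proof (rule averaging[of "rk (TK K)" qmax Z \<eta> \<kappa> s t])
    show "sorted_wrt (<) (map qmax t)" if "rk (TK K) s t" for s t using TK_D(6)[OF rk_mem[OF that]] .
  qed (use \<kappa> t O rk_antimono in \<open>auto simp: Z_def\<close>)
  then obtain xs w where xs: "rk (TK K) s (t @ xs)" "xs \<noteq> []" and w: "\<And>i. 0 \<le> w i" "sum w (qmax ` set xs) = 1"
    and wZ: "\<forall>F \<rho> E. (F, \<rho>) \<in> Z \<longrightarrow> E \<in> F \<longrightarrow> E \<subseteq> qmax ` set xs \<longrightarrow> sum w E \<le> \<kappa>"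
    by blast
  have wE: "sum w E \<le> \<kappa>" if "p < m" "m \<le> M" "E \<in> \<O> m" "E \<subseteq> qmax ` set xs" for m E
  proof -
    have "(\<O> m, \<rho> m) \<in> Z" using that by (simp add: Z_def)
    then show ?thesis using wZ that by blast
  qed
  have ts: "t @ xs \<in> TK K" by (rule rk_mem[OF xs(1)])
  have X: "bset (set xs)" by (rule bset_subset[OF TK_D(4)[OF ts]]) simp
  have "good (\<kappa> + \<epsilon>) (comb w (set xs)) m" if m: "p < m" "m \<le> M" for m
  proof (rule average_good[OF X _ w(1)])
    show "N x \<le> 1" if "x \<in> set xs" for x using TK_D(3)[OF ts, of x] that by simp
    show "(\<Sum>x\<in>set xs. w (qmax x)) \<le> 1" using w(2) bset_sum[OF X, of w] by simp
    show "hereditary (\<O> m)" "spreading (\<O> m)" using rkfamD[OF O(1)[OF m(1)]] by auto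
    show "m \<ge> 1" using m by simp
    show "splits m (\<O> m) \<epsilon>" by (rule O(4)[OF m(1)])
    fix H assume H: "H \<subseteq> set xs" "qmax ` H \<in> \<O> m"
    have "(\<Sum>x\<in>H. w (qmax x)) = sum w (qmax ` H)" using bset_sum[OF bset_subset[OF X H(1)], of w] by simp
    also have "\<dots> \<le> \<kappa>" by (rule wE[OF m H(2)]) (use H in auto)
    finally show "(\<Sum>x\<in>H. w (qmax x)) \<le> \<kappa>" .
  qed (rule \<epsilon>)
  then show ?thesis using xs w bset_sum[OF X, of w]
    by (intro exI[of _ xs] exI[of _ "\<lambda>x. w (qmax x)"]) (auto simp: comb_def)
qed

lemma finite_max_exponent:
  assumes "finite I" "\<And>n. n \<in> I \<Longrightarrow> b n < (c::cord)" "a < c"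
  shows "\<exists>g<c. a \<le> g \<and> (\<forall>n\<in>I. b n \<le> g)"
  using assms
proof (induction I rule: finite_induct)
  case (insert n I)
  then obtain g where "g < c" "a \<le> g" "\<forall>n\<in>I. b n \<le> g" by auto
  then show ?case using insert.prems(1)[of n] by (intro exI[of _ "max g (b n)"]) (auto simp: le_max_iff_disj)
qed auto

text \<open>Exponents add under composition, and sums of ordinals below \<open>cpow \<xi>\<close>
  stay below it. For \<open>F0\<close> the bound \<open>a0\<close> is first rounded up to a power of
  \<omega>.\<close>

lemma cutfam_rank:
  assumes F0r: "rkfam F0 a0" "a0 < cpow (cpow \<xi>)" and \<xi>: "\<xi> \<noteq> 0"
    and Gr: "\<And>n. n \<ge> 1 \<Longrightarrow> \<exists>b<cpow \<xi>. rkfam (G n) (cpow b)"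
  shows "\<exists>g<cpow \<xi>. rkfam (cutfam p d) (cpow g)"
proof -
  obtain b where b: "\<And>n. n \<ge> 1 \<Longrightarrow> b n < cpow \<xi>" "\<And>n. n \<ge> 1 \<Longrightarrow> rkfam (G n) (cpow (b n))"
    using Gr by metis
  have "cpow \<xi> \<noteq> 0" using cpow_pos cord_pos_iff by blast
  then obtain e c where e: "e < cpow \<xi>" "a0 < cpow e * cnat c" using less_cpow_ex[OF F0r(2)] by blast
  have "cpow 0 < cpow \<xi>" using \<xi> by (simp only: cpow_less_iff cord_pos_iff not_False_eq_True)
  then have "e + 1 < cpow \<xi>" using e(1) by (intro add_less_cpow) simp_all
  then have e1: "csuc e < cpow \<xi>" by (simp add: csuc_eq)
  have "a0 \<le> cpow (csuc e)" using e(2) cpow_mul_cnat_le[of e "csuc e" c] by simp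
  then have F1: "rkfam F0 (cpow (csuc e))" using rkfam_mono[OF F0r(1)] by blast
  have base: "\<exists>g0<cpow \<xi>. csuc e \<le> g0 \<and> (\<forall>n\<in>{1..p}. b n \<le> g0)"
    using finite_max_exponent[of "{1..p}" b "cpow \<xi>" "csuc e"] b(1) e1 by auto
  then obtain g0 where g0: "g0 < cpow \<xi>" "csuc e \<le> g0" "\<forall>n\<in>{1..p}. b n \<le> g0" by blast
  have M0: "rkfam (F0 \<union> (\<Union>n\<in>{1..p}. G n)) (cpow g)" if "g0 \<le> g" for g
  proof (rule rkfam_UNION)
    show "rkfam F0 (cpow g)" using rkfam_mono[OF F1] g0(2) that by (meson cpow_le_iff order_trans)
    show "rkfam (G n) (cpow g)" if "n \<in> {1..p}" for n
      using rkfam_mono[OF b(2)] g0(3) that \<open>g0 \<le> g\<close> by (meson atLeastAtMost_iff cpow_le_iff order_trans)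
  qed simp
  show ?thesis
  proof (induction d)
    case 0
    then show ?case using M0[OF order_refl] g0(1) by auto
  next
    case (Suc d)
    then obtain g where g: "g < cpow \<xi>" "rkfam (cutfam p d) (cpow g)" by blast
    obtain g1 where g1: "g1 < cpow \<xi>" "g0 \<le> g1" "\<forall>n\<in>{1..p}. g + b n \<le> g1"
      using finite_max_exponent[of "{1..p}" "\<lambda>n. g + b n" "cpow \<xi>" g0] b(1) g(1) g0(1) add_less_cpow by auto
    have "rkfam (fam_comp (G n) (cutfam p d)) (cpow g1)" if "n \<in> {1..p}" for n
    proof -
      have "rkfam (fam_comp (G n) (cutfam p d)) (cpow g * cpow (b n))"
        using rkfam_fam_comp[OF g(2) b(2)] that by simp
      then show ?thesis using rkfam_mono g1(3) that by (metis cpow_add cpow_le_iff)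
    qed
    then have "rkfam (cutfam p (Suc d)) (cpow g1)"
      unfolding cutfam.simps by (intro rkfam_UNION M0 g1(2)) auto
    then show ?case using g1(1) by blast
  qed
qed

text \<open>State of the second averaging: blocks \<open>ys\<close> formed from the branch
  \<open>t\<close>. The third clause transfers the lower l1 estimate from \<open>t\<close> to
  averages of \<open>ys\<close>; the last one leaves at most one exceptional block for each m >
  p.\<close>

definition blocked :: "nat \<Rightarrow> real \<Rightarrow> (nat \<Rightarrow> real) list \<Rightarrow> (nat \<Rightarrow> real) list \<Rightarrow> bool" where
  "blocked p \<delta> t ys \<longleftrightarrow> sorted_wrt before ys \<and>
     (\<forall>y\<in>set ys. y \<in> c00 \<and> supp y \<noteq> {} \<and> N y \<le> 1 \<and> supp y \<subseteq> (\<Union>x\<in>set t. supp x)) \<and>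
     (\<forall>c. (\<forall>y. 0 \<le> c y) \<longrightarrow> (\<exists>a. (\<forall>x. 0 \<le> a x) \<and> (\<Sum>x\<in>set t. a x) = (\<Sum>y\<in>set ys. c y) \<and>
        (\<forall>u. (\<Sum>y\<in>set ys. c y * y u) = (\<Sum>x\<in>set t. a x * x u)))) \<and>
     (\<forall>m>p. \<forall>y\<in>set ys. \<forall>z\<in>set ys. \<not> good \<delta> y m \<longrightarrow> \<not> good \<delta> z m \<longrightarrow> y = z)"

lemma blocked_rep:
  assumes "blocked p \<delta> t ys" "\<And>y. 0 \<le> c y"
  shows "\<exists>a. (\<forall>x. 0 \<le> a x) \<and> (\<Sum>x\<in>set t. a x) = (\<Sum>y\<in>set ys. c y) \<and>
        (\<forall>u. (\<Sum>y\<in>set ys. c y * y u) = (\<Sum>x\<in>set t. a x * x u))"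
  using assms(1)[unfolded blocked_def, THEN conjunct2, THEN conjunct2, THEN conjunct1, rule_format, of c] assms(2)
  by blast

text \<open>The term with index \<open>m\<close> is at most \<open>\<theta> m\<close> times the l1
  norm, and the weights tend to 0.\<close>

lemma eventually_good:
  assumes "finite Y" "Y \<subseteq> c00" "0 < \<delta>"
  shows "\<exists>M. \<forall>m>M. m \<ge> 1 \<longrightarrow> (\<forall>y\<in>Y. good \<delta> y m)"
proof -
  define L where "L = (\<Sum>y\<in>Y. l1norm y) + 1"
  have L: "L > 0" by (simp add: L_def sum_nonneg add_nonneg_pos)
  have "\<forall>\<^sub>F m in sequentially. \<theta> m < \<delta> / L"
    using \<theta>_null divide_pos_pos[OF assms(3) L] by (rule order_tendstoD(2))
  then obtain M where M: "\<And>m. m \<ge> M \<Longrightarrow> \<theta> m < \<delta> / L" by (auto simp: eventually_sequentially)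
  have "good \<delta> y m" if m: "m > M" "m \<ge> 1" and y: "y \<in> Y" for m y
    unfolding good_def
  proof (intro allI impI)
    fix \<E> assume \<E>: "adm (G m) \<E>"
    have yc: "y \<in> c00" using y assms(2) by blast
    have "(\<Sum>E\<in>\<E>. N (restr E y)) \<le> (\<Sum>E\<in>\<E>. l1norm (restr E y))"
      using yc by (intro sum_mono N_le_l1) simp
    also have "\<dots> \<le> l1norm y" using \<E> by (intro sum_l1norm_restr_le yc) (simp add: adm_def)
    also have "\<dots> \<le> L" unfolding L_def using member_le_sum[OF y, of l1norm] assms(1) by simp
    finally have "\<theta> m * (\<Sum>E\<in>\<E>. N (restr E y)) \<le> \<theta> m * L"
      using \<theta>(1)[OF m(2)] by (intro mult_left_mono) auto
    also have "\<dots> \<le> \<delta>" using M[of m] m(1) L by (simp add: less_divide_eq less_imp_le)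
    finally show "\<theta> m * (\<Sum>E\<in>\<E>. N (restr E y)) \<le> \<delta>" .
  qed
  then show ?thesis by blast
qed

text \<open>The old blocks are good beyond some \<open>M\<close> and the new average is good up to
  \<open>M\<close>, so for no m > p do an old block and the new one fail together.\<close>

lemma blocked_step:
  assumes K: "K \<ge> 1" and \<kappa>: "0 < \<kappa>" and \<epsilon>: "0 \<le> \<epsilon>"
    and sp: "\<And>m. m > p \<Longrightarrow> \<exists>\<O> b. rkfam \<O> b \<and> b < cpow \<eta> \<and> splits m \<O> \<epsilon>"
    and t: "rk (TK K) (s + cpow \<eta>) (t0 @ t)" and bl: "blocked p (\<kappa> + \<epsilon>) t ys"
  shows "\<exists>xs y. rk (TK K) s (t0 @ t @ xs) \<and> blocked p (\<kappa> + \<epsilon>) (t @ xs) (ys @ [y])"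
proof -
  have ys: "sorted_wrt before ys" "\<And>y. y \<in> set ys \<Longrightarrow> y \<in> c00 \<and> supp y \<noteq> {} \<and> N y \<le> 1"
    "\<And>y. y \<in> set ys \<Longrightarrow> supp y \<subseteq> (\<Union>x\<in>set t. supp x)"
    and rep: "\<And>c. \<forall>y. 0 \<le> c y \<Longrightarrow> \<exists>a. (\<forall>x. 0 \<le> a x) \<and> (\<Sum>x\<in>set t. a x) = (\<Sum>y\<in>set ys. c y) \<and>
        (\<forall>u. (\<Sum>y\<in>set ys. c y * y u) = (\<Sum>x\<in>set t. a x * x u))"
    and gd: "\<And>m y z. m > p \<Longrightarrow> y \<in> set ys \<Longrightarrow> z \<in> set ys \<Longrightarrow> \<not> good (\<kappa> + \<epsilon>) y m \<Longrightarrow> \<not> good (\<kappa> + \<epsilon>) z m \<Longrightarrow> y = z"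
    using bl unfolding blocked_def by blast+
  have "set ys \<subseteq> c00" "0 < \<kappa> + \<epsilon>" using ys(2) \<kappa> \<epsilon> by auto
  then obtain M where M: "\<And>m y. m > M \<Longrightarrow> m \<ge> 1 \<Longrightarrow> y \<in> set ys \<Longrightarrow> good (\<kappa> + \<epsilon>) y m"
    using eventually_good[OF finite_set] by meson
  obtain xs a where xs: "rk (TK K) s ((t0 @ t) @ xs)" "xs \<noteq> []" and a: "\<And>x. 0 \<le> a x" "(\<Sum>x\<in>set xs. a x) = 1"
    and ga: "\<And>m. p < m \<and> m \<le> M \<Longrightarrow> good (\<kappa> + \<epsilon>) (\<lambda>u. \<Sum>x\<in>set xs. a x * x u) m"
    using level_one[where p = p and M = M, OF K \<kappa> \<epsilon> sp t] by blast
  define y where "y = (\<lambda>u. \<Sum>x\<in>set xs. a x * x u)"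
  define t' where "t' = (t0 @ t) @ xs"
  have t': "t' \<in> TK K" using rk_mem[OF xs(1)] by (simp add: t'_def)
  have dist: "set t \<inter> set xs = {}" using TK_D(5)[OF t'] by (auto simp: t'_def)
  have xc: "x \<in> c00 \<and> N x = 1" if "x \<in> set xs" for x using TK_D(3)[OF t', of x] that by (simp add: t'_def)
  have yc: "y \<in> c00" unfolding y_def using xc by (intro lincomb_c00) auto
  have Ny: "N y \<le> 1"
  proof -
    have "N y \<le> (\<Sum>x\<in>set xs. \<bar>a x\<bar> * N x)" unfolding y_def using xc by (intro N_lincomb) auto
    also have "\<dots> = (\<Sum>x\<in>set xs. a x)" using xc a(1) by (intro sum.cong) auto
    finally show ?thesis using a(2) by simp
  qed
  have "0 < N y"
  proof -
    \<comment> \<open>Coefficients are extended by 0 to the whole branch, where the lower estimate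
      of \<open>TK K\<close> holds; it shows that the average does not vanish.\<close>
    define c where "c x = (if x \<in> set xs then a x else 0)" for x
    have sub: "set t' \<inter> set xs = set xs" by (auto simp: t'_def)
    have "(\<Sum>x\<in>set t'. \<bar>c x\<bar>) = (\<Sum>x\<in>set t' \<inter> set xs. a x)"
      unfolding sum.inter_restrict[OF finite_set] c_def using a(1) by (intro sum.cong) auto
    then have 1: "(\<Sum>x\<in>set t'. \<bar>c x\<bar>) = 1" using a(2) by (simp only: sub)
    have "(\<Sum>x\<in>set t'. c x * x u) = (\<Sum>x\<in>set t' \<inter> set xs. a x * x u)" for u
      unfolding sum.inter_restrict[OF finite_set] c_def by (intro sum.cong) auto
    then have "(\<lambda>u. \<Sum>x\<in>set t'. c x * x u) = y" by (simp only: sub y_def)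
    then have "1 / K \<le> N y" using TK_lower[OF t', of c] 1 by simp
    moreover have "0 < 1 / K" using K by simp
    ultimately show ?thesis by linarith
  qed
  then have sy: "supp y \<noteq> {}" by (rule N_pos_supp[OF yc])
  have suppy: "supp y \<subseteq> (\<Union>x\<in>set xs. supp x)"
  proof
    fix u assume "u \<in> supp y"
    then have "(\<Sum>x\<in>set xs. a x * x u) \<noteq> 0" by (simp add: supp_def y_def)
    then obtain x where "x \<in> set xs" "a x * x u \<noteq> 0" 
      using sum.neutral[of "set xs" "\<lambda>x. a x * x u"] by blast
    then show "u \<in> (\<Union>x\<in>set xs. supp x)" by (auto simp: supp_def)
  qed
  have bef: "before z y" if z: "z \<in> set ys" for z
    unfolding before_def
  proof (intro ballI)
    fix u v assume "u \<in> supp z" "v \<in> supp y"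
    then obtain x x' where "x \<in> set t" "u \<in> supp x" "x' \<in> set xs" "v \<in> supp x'"
      using ys(3)[OF z] suppy by blast
    moreover have "before x x'" using TK_D(2)[OF t'] \<open>x \<in> set t\<close> \<open>x' \<in> set xs\<close>
      by (auto simp: t'_def sorted_wrt_append)
    ultimately show "u < v" by (auto simp: before_def)
  qed
  have yn: "y \<notin> set ys" using bef[of y] sy by (auto simp: before_def)
  have gy: "good (\<kappa> + \<epsilon>) y m" if "p < m" "m \<le> M" for m using ga that by (simp add: y_def)
  have "blocked p (\<kappa> + \<epsilon>) (t @ xs) (ys @ [y])"
    unfolding blocked_def
  proof (intro conjI allI impI ballI)
    show "sorted_wrt before (ys @ [y])" using ys(1) bef by (simp add: sorted_wrt_append)
    show "z \<in> c00" "supp z \<noteq> {}" "N z \<le> 1" "supp z \<subseteq> (\<Union>x\<in>set (t @ xs). supp x)" if "z \<in> set (ys @ [y])" for z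
      using that ys(2,3) yc sy Ny suppy by fastforce+
  next
    fix c :: "(nat \<Rightarrow> real) \<Rightarrow> real" assume c: "\<forall>y. 0 \<le> c y"
    obtain a' where a': "\<forall>x. 0 \<le> a' x" "(\<Sum>x\<in>set t. a' x) = (\<Sum>y\<in>set ys. c y)"
      "\<forall>u. (\<Sum>y\<in>set ys. c y * y u) = (\<Sum>x\<in>set t. a' x * x u)" using rep[OF c] by blast
    define b where "b x = (if x \<in> set xs then c y * a x else a' x)" for x
    have split: "(\<Sum>x\<in>set (t @ xs). b x * f x) = (\<Sum>x\<in>set t. a' x * f x) + c y * (\<Sum>x\<in>set xs. a x * f x)" for f
    proof -
      have "(\<Sum>x\<in>set (t @ xs). b x * f x) = (\<Sum>x\<in>set t. b x * f x) + (\<Sum>x\<in>set xs. b x * f x)"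
        using dist by (simp add: sum.union_disjoint)
      also have "(\<Sum>x\<in>set t. b x * f x) = (\<Sum>x\<in>set t. a' x * f x)"
        using dist by (intro sum.cong) (auto simp: b_def)
      also have "(\<Sum>x\<in>set xs. b x * f x) = c y * (\<Sum>x\<in>set xs. a x * f x)"
        unfolding sum_distrib_left by (intro sum.cong) (auto simp: b_def)
      finally show ?thesis .
    qed
    show "\<exists>a. (\<forall>x. 0 \<le> a x) \<and> (\<Sum>x\<in>set (t @ xs). a x) = (\<Sum>y\<in>set (ys @ [y]). c y) \<and>
        (\<forall>u. (\<Sum>y\<in>set (ys @ [y]). c y * y u) = (\<Sum>x\<in>set (t @ xs). a x * x u))"
    proof (intro exI[of _ b] conjI allI)
      show "0 \<le> b x" for x using a'(1) c a(1) by (simp add: b_def)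
      show "(\<Sum>x\<in>set (t @ xs). b x) = (\<Sum>y\<in>set (ys @ [y]). c y)"
        using split[of "\<lambda>_. 1"] a'(2) a(2) yn by simp
      show "(\<Sum>z\<in>set (ys @ [y]). c z * z u) = (\<Sum>x\<in>set (t @ xs). b x * x u)" for u
        using split[of "\<lambda>x. x u"] a'(3) yn by (simp add: y_def)
    qed
  next
    fix m z z' assume "m > p" "z \<in> set (ys @ [y])" "z' \<in> set (ys @ [y])"
      "\<not> good (\<kappa> + \<epsilon>) z m" "\<not> good (\<kappa> + \<epsilon>) z' m"
    then show "z = z'" using gd[of m z z'] gy[of m] M[of m] by (cases "m \<le> M") auto
  qed
  then show ?thesis using xs(1) by auto
qed

text \<open>A tree of this rank would allow a second averaging, over blocks, that makes
  \<open>cutfam p d\<close> negligible. Then \<open>cut_estimate\<close> bounds an average of the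
  branch by 2 * \<tau> + (d + 1) * \<kappa> = 3 * \<tau>, whereas the l1 estimate gives at least 1 /
  K = 4 * \<tau>.\<close>

proposition upper_bound:
  assumes K: "K \<ge> 1" and \<xi>: "\<xi> \<noteq> 0"
    and F0r: "rkfam F0 a0" "a0 < cpow (cpow \<xi>)"
    and Gr: "\<And>n. n \<ge> 1 \<Longrightarrow> \<exists>b<cpow \<xi>. rkfam (G n) (cpow b)"
    and sp: "\<And>m. m > p \<Longrightarrow> \<exists>\<O> b. rkfam \<O> b \<and> b < cpow \<eta> \<and> splits m \<O> (1 / (8 * K))"
  shows "\<exists>g<cpow \<xi>. \<forall>t. \<not> rk (TK K) (cpow \<eta> * cpow g) t"
proof -
  define \<tau> where "\<tau> = 1 / (4 * K)"
  have \<tau>: "0 < \<tau>" using K by (simp add: \<tau>_def)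
  obtain d where d: "\<theta> 1 ^ d \<le> \<tau>"
    using real_arch_pow_inv[OF \<tau> \<theta>(2)[of 1]] less_imp_le by auto
  define \<kappa> where "\<kappa> = \<tau> / (real d + 1)"
  have \<kappa>: "0 < \<kappa>" using \<tau> by (simp add: \<kappa>_def)
  obtain g where g: "g < cpow \<xi>" "rkfam (cutfam p d) (cpow g)" using cutfam_rank[OF F0r \<xi> Gr] by blast
  obtain \<rho> where \<rho>: "famrk (cutfam p d) \<rho>" "\<rho> {} \<le> cpow g" using rkfamD(5)[OF g(2)] by blast
  have "cpow 0 < cpow \<xi>" using \<xi> by (simp only: cpow_less_iff cord_pos_iff not_False_eq_True)
  then have "g + 1 < cpow \<xi>" using g(1) by (intro add_less_cpow) simp_all
  \<comment> \<open>One exponent higher, because \<open>averaging\<close> asks for ranks strictly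
    below the power that it consumes.\<close>
  then have g1: "csuc g < cpow \<xi>" by (simp add: csuc_eq)
  have "cpow g < cpow (csuc g)" by (simp only: cpow_less_iff less_csuc_iff order_refl)
  then have \<rho>': "\<rho> {} < cpow (csuc g)" using \<rho>(2) by (rule order_le_less_trans[rotated])
  have eq: "1 / (8 * K) + 1 / (8 * K) = \<tau>" by (simp add: \<tau>_def)
  have "False" if t0: "rk (TK K) (cpow \<eta> * cpow (csuc g)) t0" for t0
  proof -
    \<comment> \<open>One tick of the outer clock \<sigma> pays \<open>cpow \<eta>\<close> of the
      rank in \<open>TK K\<close>, the price of a new block in \<open>blocked_step\<close>.\<close>
    define P where "P \<sigma> ys \<longleftrightarrow> (\<exists>t. rk (TK K) (cpow \<eta> * \<sigma>) (t0 @ t) \<and> blocked p \<tau> t ys)" for \<sigma> ys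
    have K8: "0 < 1 / (8 * K)" "0 \<le> 1 / (8 * K)" using K by simp_all
    have "clock P"
      unfolding clock_def
    proof (intro allI impI)
      fix \<sigma> ys \<sigma>' assume "P \<sigma> ys" "\<sigma>' < (\<sigma>::cord)"
      then obtain t where t: "rk (TK K) (cpow \<eta> * \<sigma>) (t0 @ t)" "blocked p \<tau> t ys" unfolding P_def by blast
      have "cpow \<eta> * csuc \<sigma>' \<le> cpow \<eta> * \<sigma>" using \<open>\<sigma>' < \<sigma>\<close> by (intro cord_mul_le_mono_right) simp
      then have "rk (TK K) (cpow \<eta> * \<sigma>' + cpow \<eta>) (t0 @ t)" using rk_antimono[OF t(1)] by simp
      then show "\<exists>y. P \<sigma>' (ys @ [y])"
        using blocked_step[where p = p and s = "cpow \<eta> * \<sigma>'" and ?t0.0 = t0 and t = t and ys = ys, OF K K8 sp] t(2)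
        unfolding P_def eq by blast
    qed
    moreover have "P \<sigma>' ys" if "P \<sigma> ys" "\<sigma>' \<le> \<sigma>" for \<sigma> \<sigma>' ys
      using that rk_antimono cord_mul_le_mono_right unfolding P_def by blast
    moreover have ysP: "bset (set ys) \<and> sorted_wrt (<) (map qmax ys)" if "P \<sigma> ys" for \<sigma> ys
      using that before_bset[of ys] unfolding P_def blocked_def by blast
    moreover have "P (0 + cpow (csuc g)) []"
      unfolding P_def using t0 by (intro exI[of _ "[]"]) (auto simp: blocked_def intro!: exI[of _ "\<lambda>_. 0"])
    ultimately obtain ys w where ys: "P 0 ([] @ ys)" and w: "\<forall>i. 0 \<le> w i" "sum w (qmax ` set ys) = 1"
      and wE: "\<forall>F \<rho>' E. (F, \<rho>') \<in> {(cutfam p d, \<rho>)} \<longrightarrow> E \<in> F \<longrightarrow> E \<subseteq> qmax ` set ys \<longrightarrow> sum w E \<le> \<kappa>"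
      using averaging[of P qmax "{(cutfam p d, \<rho>)}" "csuc g" \<kappa> 0 "[]"] \<rho>(1) \<rho>' \<kappa> by auto
    have Y: "bset (set ys)" using ysP ys by simp
    obtain t where t: "t0 @ t \<in> TK K" "blocked p \<tau> t ys" using ys rk_mem unfolding P_def by auto
    then have N1: "\<And>y. y \<in> set ys \<Longrightarrow> N y \<le> 1"
      and gd: "\<And>m y z. m > p \<Longrightarrow> y \<in> set ys \<Longrightarrow> z \<in> set ys \<Longrightarrow> \<not> good \<tau> y m \<Longrightarrow> \<not> good \<tau> z m \<Longrightarrow> y = z"
      unfolding blocked_def by blast+
    have "\<exists>a. (\<forall>x. 0 \<le> a x) \<and> (\<Sum>x\<in>set t. a x) = (\<Sum>y\<in>set ys. w (qmax y)) \<and>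
        (\<forall>u. (\<Sum>y\<in>set ys. w (qmax y) * y u) = (\<Sum>x\<in>set t. a x * x u))"
      by (rule blocked_rep[OF t(2)]) (use w(1) in blast)
    then obtain a where a: "\<forall>x. 0 \<le> a x" "(\<Sum>x\<in>set t. a x) = 1"
        "\<And>u. (\<Sum>y\<in>set ys. w (qmax y) * y u) = (\<Sum>x\<in>set t. a x * x u)"
      using w(2) bset_sum[OF Y, of w] by auto
    have lower: "1 / K \<le> N (comb w (set ys))"
    proof -
      define t' where "t' = t0 @ t"
      define c where "c x = (if x \<in> set t then a x else 0)" for x
      have sub: "set t' \<inter> set t = set t" by (auto simp: t'_def)
      have "(\<Sum>x\<in>set t'. \<bar>c x\<bar>) = (\<Sum>x\<in>set t' \<inter> set t. a x)"
        unfolding sum.inter_restrict[OF finite_set] c_def using a(1) by (intro sum.cong) auto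
      then have 1: "(\<Sum>x\<in>set t'. \<bar>c x\<bar>) = 1" using a(2) by (simp only: sub)
      have "(\<Sum>x\<in>set t'. c x * x u) = (\<Sum>x\<in>set t' \<inter> set t. a x * x u)" for u
        unfolding sum.inter_restrict[OF finite_set] c_def by (intro sum.cong) auto
      then have "(\<lambda>u. \<Sum>x\<in>set t'. c x * x u) = comb w (set ys)" by (simp only: sub comb_def a(3))
      then show ?thesis using TK_lower[OF t(1)[folded t'_def], of c] 1 by simp
    qed
    have "N (comb w (set ys)) \<le> 3 * \<tau>"
    proof (rule N_least)
      fix k
      have "\<exists>H\<subseteq>hit UNIV (set ys). qmax ` H \<in> cutfam p d \<and>
        Nk k (restr UNIV (comb w (set ys))) \<le> (\<tau> + \<tau>) * (\<Sum>y\<in>hit UNIV (set ys). w (qmax y)) + (real d + 1) * (\<Sum>y\<in>H. w (qmax y))"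
        by (rule cut_estimate[OF Y N1 _ _ gd order_refl d \<tau>]) (use w \<tau> in auto)
      moreover have "hit UNIV (set ys) = set ys" using Y by (auto simp: hit_def bset_def)
      moreover have "restr UNIV (comb w (set ys)) = comb w (set ys)" by (simp add: restr_def)
      ultimately obtain H where H: "H \<subseteq> set ys" "qmax ` H \<in> cutfam p d"
        "Nk k (comb w (set ys)) \<le> (\<tau> + \<tau>) * (\<Sum>y\<in>set ys. w (qmax y)) + (real d + 1) * (\<Sum>y\<in>H. w (qmax y))" by auto
      have "(\<Sum>y\<in>H. w (qmax y)) = sum w (qmax ` H)" using bset_sum[OF bset_subset[OF Y H(1)], of w] by simp
      also have "\<dots> \<le> \<kappa>" using wE H(1,2) by auto
      finally have "(real d + 1) * (\<Sum>y\<in>H. w (qmax y)) \<le> (real d + 1) * \<kappa>" by (intro mult_left_mono) auto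
      also have "\<dots> = \<tau>" by (simp add: \<kappa>_def)
      finally show "Nk k (comb w (set ys)) \<le> 3 * \<tau>" using H(3) w(2) bset_sum[OF Y, of w] by simp
    qed
    moreover have "3 * \<tau> < 1 / K" using K by (simp add: \<tau>_def field_simps)
    ultimately show False using lower by linarith
  qed
  then show ?thesis using g1 by blast
qed

end

context tsirelson_null
begin

section \<open>Block trees of large order\<close>

lemma TK_I:
  assumes "t \<noteq> []" and bf: "sorted_wrt before t" and x: "\<And>x. x \<in> set t \<Longrightarrow> x \<in> c00 \<and> N x = 1"
    and low: "\<And>a. (\<Sum>x\<in>set t. \<bar>a x\<bar>) / K \<le> N (\<lambda>s. \<Sum>x\<in>set t. a x * x s)"
  shows "t \<in> TK K"
proof -
  have ne: "supp y \<noteq> {}" if "y \<in> set t" for y using x[OF that] N_pos_supp by simp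
  have d: "distinct t" by (rule before_bset(2)[OF bf]) (use x ne in blast)
  have "l1_block_seq N K t"
    unfolding l1_block_seq_def
  proof (intro conjI allI impI)
    show "\<forall>x\<in>set t. x \<in> c00 \<and> N x = 1" using x by blast
    show "\<forall>p\<in>supp (t ! i). \<forall>q\<in>supp (t ! j). p < q" if "i < j \<and> j < length t" for i j
    proof -
      have "before (t ! i) (t ! j)" using bf that by (simp add: sorted_wrt_iff_nth_less)
      then show ?thesis by (simp add: before_def)
    qed
    fix a :: "nat \<Rightarrow> real"
    \<comment> \<open>The entries are distinct, so coefficients by position become coefficients by
      vector.\<close>
    define a' where "a' x = a (SOME i. i < length t \<and> t ! i = x)" for x
    have a': "a' (t ! i) = a i" if "i < length t" for i
    proof -
      have "(SOME j. j < length t \<and> t ! j = t ! i) = i"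
        by (rule some_equality) (use that d nth_eq_iff_index_eq in auto)
      then show ?thesis by (simp add: a'_def)
    qed
    have *: "(\<Sum>x\<in>set t. f (a' x) x) = (\<Sum>i<length t. f (a i) (t ! i))" for f :: "real \<Rightarrow> (nat \<Rightarrow> real) \<Rightarrow> real"
    proof -
      have "(\<Sum>x\<in>set t. f (a' x) x) = sum_list (map (\<lambda>x. f (a' x) x) t)"
        using d by (simp add: sum_list_distinct_conv_sum_set)
      also have "\<dots> = (\<Sum>i<length t. f (a' (t ! i)) (t ! i))"
        by (simp add: sum_list_sum_nth atLeast0LessThan)
      also have "\<dots> = (\<Sum>i<length t. f (a i) (t ! i))" by (rule sum.cong) (simp_all add: a')
      finally show ?thesis .
    qed
    show "(\<Sum>i<length t. \<bar>a i\<bar>) / K \<le> N (\<lambda>s. \<Sum>i<length t. a i * (t ! i) s)"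
      using low[of a'] *[of "\<lambda>c x. \<bar>c\<bar>"] *[of "\<lambda>c x. c * x _"] by simp
  qed
  then show ?thesis using assms(1) by (simp add: TK_def)
qed

lemma TK_prefix:
  assumes "t \<in> TK K" "u \<noteq> []" "prefix u t"
  shows "u \<in> TK K"
proof (rule TK_I[OF assms(2)])
  obtain v where t: "t = u @ v" using assms(3) by (auto simp: prefix_def)
  show "sorted_wrt before u" using TK_D(2)[OF assms(1)] by (simp add: t sorted_wrt_append)
  show "x \<in> c00 \<and> N x = 1" if "x \<in> set u" for x using TK_D(3)[OF assms(1), of x] that by (simp add: t)
  fix a :: "(nat \<Rightarrow> real) \<Rightarrow> real"
  define c where "c x = (if x \<in> set u then a x else 0)" for x
  have sub: "set t \<inter> set u = set u" by (auto simp: t)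
  have "(\<Sum>x\<in>set t. \<bar>c x\<bar>) = (\<Sum>x\<in>set t \<inter> set u. \<bar>a x\<bar>)"
    unfolding sum.inter_restrict[OF finite_set] c_def by (intro sum.cong) auto
  moreover have "(\<Sum>x\<in>set t. c x * x s) = (\<Sum>x\<in>set t \<inter> set u. a x * x s)" for s
    unfolding sum.inter_restrict[OF finite_set] c_def by (intro sum.cong) auto
  ultimately show "(\<Sum>x\<in>set u. \<bar>a x\<bar>) / K \<le> N (\<lambda>s. \<Sum>x\<in>set u. a x * x s)"
    using TK_lower[OF assms(1), of c] by (simp only: sub)
qed

lemma adm_sum_coord:
  assumes "x \<in> c00" "n \<ge> 1" "A \<in> G n"
  shows "\<theta> n * (\<Sum>k\<in>A. \<bar>x k\<bar>) \<le> N x"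
proof -
  have A: "finite A" "\<And>k. k \<in> A \<Longrightarrow> k \<ge> 1"
    using G(1)[OF assms(2)] assms(3) by (auto simp: fin_pos_sets_def Suc_le_eq intro: gr0I)
  define \<E> where "\<E> = (\<lambda>k. {k}) ` A"
  have "adm (G n) \<E>"
    using A assms(3) by (auto simp: adm_def succ_sets_def \<E>_def image_image)
  then have "\<theta> n * (\<Sum>E\<in>\<E>. N (restr E x)) \<le> N x" by (rule N_adm[OF assms(1,2)])
  moreover have "(\<Sum>E\<in>\<E>. N (restr E x)) = (\<Sum>k\<in>A. N (restr {k} x))"
    unfolding \<E>_def by (subst sum.reindex) (auto simp: inj_on_def)
  moreover have "(\<Sum>k\<in>A. \<bar>x k\<bar>) \<le> (\<Sum>k\<in>A. N (restr {k} x))"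
    using N_ge_coord[OF restr_c00[OF assms(1)]] A(2) by (intro sum_mono) (metis restr_def singletonI)
  ultimately show ?thesis using \<theta>(1)[OF assms(2)] by (smt (verit) mult_left_mono)
qed

text \<open>The supports together form one set of \<open>G m\<close>, so the norm dominates
  \<open>\<theta> m\<close> times the l1 norm, and each vector loses at most the factor
  \<open>K\<close> there.\<close>

lemma flat_TK:
  assumes "us \<noteq> []" "sorted_wrt before us" and u: "\<And>u. u \<in> set us \<Longrightarrow> u \<in> c00 \<and> N u = 1 \<and> 1 / K \<le> \<theta> m * l1norm u"
    and m: "m \<ge> 1" "(\<Union>u\<in>set us. supp u) \<in> G m"
  shows "us \<in> TK K"
proof (rule TK_I[OF assms(1,2)])
  show "x \<in> c00 \<and> N x = 1" if "x \<in> set us" for x using u[OF that] by blast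
  fix a :: "(nat \<Rightarrow> real) \<Rightarrow> real"
  have ne: "supp y \<noteq> {}" if "y \<in> set us" for y using u[OF that] N_pos_supp by simp
  have B: "bset (set us)" by (rule before_bset(1)[OF assms(2)]) (use u ne in blast)
  define v where "v = (\<lambda>s. \<Sum>x\<in>set us. a x * x s)"
  have vc: "v \<in> c00" unfolding v_def using u by (intro lincomb_c00) auto
  have vx: "v s = a x * x s" if "x \<in> set us" "s \<in> supp x" for x s
  proof -
    have "v s = (\<Sum>y\<in>{x}. a y * y s)"
      unfolding v_def
    proof (intro sum.mono_neutral_right)
      show "\<forall>y\<in>set us - {x}. a y * y s = 0"
      proof
        fix y assume "y \<in> set us - {x}"
        then have "s \<notin> supp y" using bset_disjoint[OF B _ that(1) _ that(2), of y] by blast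
        then show "a y * y s = 0" by (simp add: supp_def)
      qed
    qed (use that in auto)
    then show ?thesis by simp
  qed
  have "(\<Sum>k\<in>(\<Union>u\<in>set us. supp u). \<bar>v k\<bar>) = (\<Sum>x\<in>set us. \<Sum>k\<in>supp x. \<bar>v k\<bar>)"
    using bsetD(2)[OF B] bset_disjoint[OF B] by (intro sum.UNION_disjoint) auto
  also have "\<dots> = (\<Sum>x\<in>set us. \<bar>a x\<bar> * l1norm x)"
    unfolding l1norm_def sum_distrib_left by (intro sum.cong refl) (simp add: vx abs_mult)
  finally have 1: "\<theta> m * (\<Sum>x\<in>set us. \<bar>a x\<bar> * l1norm x) \<le> N v"
    using adm_sum_coord[OF vc m] by simp
  have "(\<Sum>x\<in>set us. \<bar>a x\<bar>) / K = (\<Sum>x\<in>set us. \<bar>a x\<bar> * (1 / K))"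
    by (simp add: sum_divide_distrib)
  also have "\<dots> \<le> (\<Sum>x\<in>set us. \<bar>a x\<bar> * (\<theta> m * l1norm x))"
    using u by (intro sum_mono mult_left_mono) auto
  also have "\<dots> = \<theta> m * (\<Sum>x\<in>set us. \<bar>a x\<bar> * l1norm x)"
    by (simp add: sum_distrib_left mult.left_commute)
  finally show "(\<Sum>x\<in>set us. \<bar>a x\<bar>) / K \<le> N (\<lambda>s. \<Sum>x\<in>set us. a x * x s)"
    using 1 by (simp add: v_def)
qed

definition uvec :: "nat \<Rightarrow> nat \<Rightarrow> real" where
  "uvec k = (\<lambda>i. if i = k then 1 else 0)"

lemma uvec: "k \<ge> 1 \<Longrightarrow> uvec k \<in> c00 \<and> supp (uvec k) = {k} \<and> l1norm (uvec k) = 1 \<and> N (uvec k) = 1"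
proof -
  assume k: "k \<ge> 1"
  have 1: "uvec k \<in> c00" "supp (uvec k) = {k}" using k by (auto simp: uvec_def c00_def supp_def)
  then have 2: "l1norm (uvec k) = 1" by (simp add: l1norm_def uvec_def)
  have "N (uvec k) = 1" using N_le_l1[OF 1(1)] N_ge_coord[OF 1(1) k] 2 by (simp add: uvec_def)
  then show ?thesis using 1 2 by blast
qed

text \<open>Unit vectors have l1 norm 1 and are thus flat with constant
  \<open>1 / \<theta> n\<close>. The strict inequality s < \<mu> pays for the first vector, as block
  trees omit the empty sequence.\<close>

lemma unit_vector_tree:
  assumes n: "n \<ge> 1" and r: "rk (ltree (G n) 0) \<mu> []" and s: "s < \<mu>"
  shows "\<exists>u. rk (TK (1 / \<theta> n)) s u"
proof -
  define P where "P s us \<longleftrightarrow> (\<exists>t. rk (ltree (G n) 0) s t \<and> t \<noteq> [] \<and> us = map uvec t)" for s us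
  have "clock P"
    unfolding clock_def
  proof (intro allI impI)
    fix s us s' assume "P s us" "s' < s"
    then obtain t where "rk (ltree (G n) 0) s t" "t \<noteq> []" "us = map uvec t" unfolding P_def by blast
    then obtain x where "rk (ltree (G n) 0) s' (t @ [x])" using rk_ext \<open>s' < s\<close> by blast
    then show "\<exists>x. P s' (us @ [x])" unfolding P_def using \<open>us = map uvec t\<close> by fastforce
  qed
  moreover have "us \<in> TK (1 / \<theta> n)" if P: "P s us" for s us
  proof -
    from P obtain t where t: "t \<in> ltree (G n) 0" "t \<noteq> []" "us = map uvec t"
      unfolding P_def using rk_mem by blast
    have pos: "k \<ge> 1" if "k \<in> set t" for k using t(1) that by (auto simp: ltree_def Suc_le_eq)
    show ?thesis
    proof (rule flat_TK[OF _ _ _ n])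
      show "us \<noteq> []" using t by simp
      show "sorted_wrt before us"
        unfolding t(3) sorted_wrt_map
        by (rule sorted_wrt_mono_rel[of _ "(<)"]) (use t(1) pos uvec in \<open>auto simp: ltree_def before_def\<close>)
      show "u \<in> c00 \<and> N u = 1 \<and> 1 / (1 / \<theta> n) \<le> \<theta> n * l1norm u" if "u \<in> set us" for u
        using that uvec pos by (auto simp: t(3))
      have "(\<Union>u\<in>set us. supp u) = set t" using uvec pos by (auto simp: t(3))
      then show "(\<Union>u\<in>set us. supp u) \<in> G n" using t(1) by (simp add: ltree_def)
    qed
  qed
  moreover obtain x where "rk (ltree (G n) 0) s ([] @ [x])" using rk_ext[OF r s] by blast
  then have "P s [uvec x]" unfolding P_def by (intro exI[of _ "[x]"]) simp
  ultimately show ?thesis using clock_imp_rk by blast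
qed

text \<open>The bound \<open>q\<close> allows a new inner tree to start to the right of everything
  built before.\<close>

definition TKq :: "real \<Rightarrow> nat \<Rightarrow> (nat \<Rightarrow> real) list set" where
  "TKq K q = {t\<in>TK K. \<forall>x\<in>set t. \<forall>p\<in>supp x. q < p}"

text \<open>An average \<open>v\<close> over a set of \<open>G m\<close> on which \<open>W\<close>
  carries mass at most \<open>\<theta> m\<close> has norm between \<open>\<theta> m\<close> and
  \<open>\<theta> m * (1 + 1 / \<epsilon>)\<close>. Normalized, such averages are flat with a
  constant independent of \<open>m\<close>; each costs \<open>cpow \<Gamma>\<close> of the
  rank.\<close>

lemma averaged_tree:
  assumes m: "m \<ge> 1" and \<epsilon>: "0 < \<epsilon>" and W: "rkfam W r" "r < cpow \<Gamma>"
    and NW: "\<And>x. x \<in> c00 \<Longrightarrow> N x \<le> fam_norm W x + \<theta> m / \<epsilon> * l1norm x"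
    and rG: "rk (ltree (G m) q) (cpow \<Gamma> * \<sigma>) []" and s: "s < \<sigma>"
  shows "\<exists>u. rk (TKq (1 + 1 / \<epsilon>) q) s [u]"
proof -
  have \<theta>m: "0 < \<theta> m" by (rule \<theta>(1)[OF m])
  define K where "K = 1 + 1 / \<epsilon>"
  have K: "K > 0" using \<epsilon> by (simp add: K_def add_pos_pos)
  obtain \<rho> where \<rho>: "famrk W \<rho>" "\<rho> {} \<le> r" using rkfamD(5)[OF W(1)] by blast
  define P where "P s us \<longleftrightarrow> (\<exists>t. rk (ltree (G m) q) (cpow \<Gamma> * s) t \<and> sorted_wrt before us \<and>
     (\<forall>u\<in>set us. u \<in> c00 \<and> N u = 1 \<and> 1 / K \<le> \<theta> m * l1norm u \<and> supp u \<subseteq> set t))" for s us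
  have clock: "clock P"
    unfolding clock_def
  proof (intro allI impI)
    fix s us s' assume "P s us" "s' < (s::cord)"
    then obtain t where t: "rk (ltree (G m) q) (cpow \<Gamma> * s) t" "sorted_wrt before us"
      "\<And>u. u \<in> set us \<Longrightarrow> u \<in> c00 \<and> N u = 1 \<and> 1 / K \<le> \<theta> m * l1norm u \<and> supp u \<subseteq> set t"
      unfolding P_def by blast
    have "cpow \<Gamma> * csuc s' \<le> cpow \<Gamma> * s" using \<open>s' < s\<close> by (intro cord_mul_le_mono_right) simp
    then have t': "rk (ltree (G m) q) (cpow \<Gamma> * s' + cpow \<Gamma>) t" using rk_antimono[OF t(1)] by simp
    have "\<exists>xs w. rk (ltree (G m) q) (cpow \<Gamma> * s') (t @ xs) \<and> xs \<noteq> [] \<and> (\<forall>i. 0 \<le> w i) \<and> sum w ((\<lambda>x. x) ` set xs) = 1 \<and>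
      (\<forall>F \<rho>' E. (F, \<rho>') \<in> {(W, \<rho>)} \<longrightarrow> E \<in> F \<longrightarrow> E \<subseteq> (\<lambda>x. x) ` set xs \<longrightarrow> sum w E \<le> \<theta> m)"
    proof (rule averaging[where P = "rk (ltree (G m) q)" and q = "\<lambda>x. x"])
      show "sorted_wrt (<) (map (\<lambda>x. x) t)" if "rk (ltree (G m) q) s t" for s t
        using rk_mem[OF that] by (simp add: ltree_def)
    qed (use \<rho> W(2) \<theta>m t' rk_antimono in \<open>auto intro: order_le_less_trans\<close>)
    then obtain xs w where xs: "rk (ltree (G m) q) (cpow \<Gamma> * s') (t @ xs)" "xs \<noteq> []"
      and w: "\<And>i. 0 \<le> w i" "sum w (set xs) = 1"
      and wE: "\<And>E. E \<in> W \<Longrightarrow> E \<subseteq> set xs \<Longrightarrow> sum w E \<le> \<theta> m" by auto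
    have txs: "sorted_wrt (<) (t @ xs)" "set (t @ xs) \<in> G m" "\<forall>x\<in>set (t @ xs). q < x"
      using rk_mem[OF xs(1)] by (auto simp: ltree_def)
    define v where "v i = (if i \<in> set xs then w i else 0)" for i
    have v: "v \<in> c00" "supp v \<subseteq> set xs"
      using txs(3) by (auto simp: c00_def v_def supp_def intro: finite_subset[of _ "set xs"])
    have "(\<Sum>n\<in>set xs. \<bar>v n\<bar>) = sum w (set xs)" using w(1) by (intro sum.cong) (auto simp: v_def)
    then have l1: "l1norm v = 1" using l1norm_eq[OF finite_set v(2)] w(2) by simp
    have "fam_norm W v \<le> \<theta> m"
    proof -
      obtain A where A: "A \<in> W" "A \<subseteq> supp v" "fam_norm W v = (\<Sum>k\<in>A. \<bar>v k\<bar>)"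
        using fam_norm_attained[OF rkfamD(1,2,4)[OF W(1)] v(1)] by blast
      have "(\<Sum>k\<in>A. \<bar>v k\<bar>) = sum w A" using A(2) v(2) w(1) by (intro sum.cong) (auto simp: v_def)
      also have "\<dots> \<le> \<theta> m" using wE A(1,2) v(2) by blast
      finally show ?thesis using A(3) by simp
    qed
    then have Nv: "N v \<le> \<theta> m * K" using NW[OF v(1)] l1 by (simp add: K_def algebra_simps)
    have "set xs \<in> G m" using hereditaryD[OF G(2)[OF m] txs(2)] by simp
    then have Nv': "\<theta> m \<le> N v"
      using adm_sum_coord[OF v(1) m] \<open>(\<Sum>n\<in>set xs. \<bar>v n\<bar>) = sum w (set xs)\<close> w(2) by fastforce
    define u where "u = (\<lambda>i. (1 / N v) * v i)"
    have Npos: "0 < N v" using Nv' \<theta>m by linarith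
    have u: "u \<in> c00" "N u = 1" "supp u = supp v"
      unfolding u_def using scale_c00[OF v(1), of "1 / N v"] N_scale[OF v(1), of "1 / N v"] Npos
      by (simp_all add: supp_def)
    have "l1norm u = 1 / N v"
      unfolding l1norm_def u(3) using l1 Npos
      by (simp add: u_def abs_mult l1norm_def sum_divide_distrib[symmetric])
    moreover have "1 / K \<le> \<theta> m * (1 / N v)" using Nv Npos K by (simp add: field_simps)
    ultimately have "1 / K \<le> \<theta> m * l1norm u" by simp
    moreover have "before z u" if z: "z \<in> set us" for z
    proof -
      have "a < b" if "a \<in> set t" "b \<in> set xs" for a b using txs(1) that by (auto simp: sorted_wrt_append)
      then show ?thesis using t(3)[OF z] u(3) v(2) unfolding before_def by blast
    qed
    ultimately have "P s' (us @ [u])"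
      unfolding P_def using t(2,3) u v(2) xs(1)
      by (intro exI[of _ "t @ xs"]) (auto simp: sorted_wrt_append)
    then show "\<exists>x. P s' (us @ [x])" by blast
  qed
  \<comment> \<open>The clock starts at the empty sequence, which block trees exclude.\<close>
  define P' where "P' s us \<longleftrightarrow> P s us \<and> us \<noteq> []" for s us
  have "clock P'" using clock unfolding clock_def P'_def by blast
  moreover have "us \<in> TKq K q" if P': "P' s us" for s us
  proof -
    from P' obtain t where t: "t \<in> ltree (G m) q" "sorted_wrt before us" "us \<noteq> []"
      "\<And>u. u \<in> set us \<Longrightarrow> u \<in> c00 \<and> N u = 1 \<and> 1 / K \<le> \<theta> m * l1norm u \<and> supp u \<subseteq> set t"
      unfolding P_def P'_def using rk_mem by blast
    have "(\<Union>u\<in>set us. supp u) \<subseteq> set t" using t(4) by blast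
    then have "(\<Union>u\<in>set us. supp u) \<in> G m"
      using t(1) hereditaryD[OF G(2)[OF m]] by (auto simp: ltree_def)
    then have "us \<in> TK K" using flat_TK[OF t(3,2) _ m] t(4) by blast
    moreover have "\<forall>x\<in>set us. \<forall>p\<in>supp x. q < p" using t(1,4) by (auto simp: ltree_def)
    ultimately show ?thesis by (simp add: TKq_def)
  qed
  moreover have "P \<sigma> []" unfolding P_def using rG by (intro exI[of _ "[]"]) simp
  then obtain u where "P s ([] @ [u])" using clockD[OF clock _ s] by blast
  then have "P' s [u]" by (simp add: P'_def)
  ultimately show ?thesis unfolding K_def[symmetric] using clock_imp_rk by blast
qed

text \<open>Everything from the last point on is translated by the same amount; spreading keeps the
  sets in the family, and all continuations are carried along.\<close>

lemma rk_shift: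
  assumes F: "spreading F" and r: "rk (ltree F m) s (t @ [x])" and x: "x \<le> x'"
  shows "rk (ltree F m) s (t @ [x'])"
proof -
  define sh where "sh y = y + (x' - x)" for y
  define P where "P s v \<longleftrightarrow> (\<exists>u. rk (ltree F m) s (t @ x # u) \<and> v = t @ map sh (x # u))" for s v
  have "clock P"
    unfolding clock_def
  proof (intro allI impI)
    fix s v s' assume "P s v" "s' < s"
    then obtain u where u: "rk (ltree F m) s (t @ x # u)" "v = t @ map sh (x # u)" unfolding P_def by blast
    then obtain y where "rk (ltree F m) s' ((t @ x # u) @ [y])" using rk_ext[OF _ \<open>s' < s\<close>] by blast
    then have "P s' (v @ [sh y])" unfolding P_def using u(2) by (intro exI[of _ "u @ [y]"]) simp
    then show "\<exists>x. P s' (v @ [x])" by blast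
  qed
  moreover have "v \<in> ltree F m" if P: "P s v" for s v
  proof -
    from P obtain u where u: "t @ x # u \<in> ltree F m" "v = t @ map sh (x # u)"
      unfolding P_def using rk_mem by blast
    define g where "g y = (if y \<in> set t then y else sh y)" for y
    have srt: "sorted_wrt (<) (t @ x # u)" and inF: "set (t @ x # u) \<in> F" and gt: "\<forall>y\<in>set (t @ x # u). m < y"
      using u(1) by (auto simp: ltree_def)
    have lt: "a < b" if "a \<in> set t" "b \<in> set (x # u)" for a b using srt that by (auto simp: sorted_wrt_append)
    have v: "v = map g (t @ x # u)"
    proof -
      have "map g t = t" by (rule map_idI) (simp add: g_def)
      moreover have "map g (x # u) = map sh (x # u)"
        by (rule map_cong[OF refl]) (use lt in \<open>force simp: g_def\<close>)
      ultimately show ?thesis unfolding u(2) by simp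
    qed
    have g: "strict_mono_on (set (t @ x # u)) g" "\<And>y. y \<le> g y"
    proof -
      show "y \<le> g y" for y by (simp add: g_def sh_def)
      show "strict_mono_on (set (t @ x # u)) g"
      proof (rule strict_mono_onI)
        fix a b assume ab: "a \<in> set (t @ x # u)" "b \<in> set (t @ x # u)" "a < b"
        show "g a < g b"
        proof (cases "b \<in> set t")
          case True
          then have "a \<in> set t" using ab lt[of b a] by fastforce
          then show ?thesis using True ab(3) by (simp add: g_def)
        qed (use ab(3) in \<open>simp add: g_def sh_def\<close>)
      qed
    qed
    have "g ` set (t @ x # u) \<in> F" using spreadingD[OF F inF g(1)] g(2) by blast
    then have "set v \<in> F" unfolding v set_map .
    moreover have "sorted_wrt (<) v"
      unfolding v sorted_wrt_map
      by (rule sorted_wrt_mono_rel[OF _ srt]) (use g(1) in \<open>auto dest: strict_mono_onD\<close>)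
    moreover have "\<forall>y\<in>set v. m < y" using gt g(2) unfolding v by (auto intro: order_less_le_trans)
    ultimately show ?thesis by (simp add: ltree_def)
  qed
  moreover have "P s (t @ [x'])" unfolding P_def using r x by (intro exI[of _ "[]"]) (simp add: sh_def)
  ultimately show ?thesis using clock_imp_rk by blast
qed

text \<open>A pair consists of a point \<open>q\<close> of the outer tree and an inner sequence
  supported beyond \<open>q\<close>. By spreading, the unions of the supports of the inner sequences
  are \<open>G n\<close>-admissible, and one use of \<open>N_adm\<close> costs the factor
  \<open>\<theta> n\<close>.\<close>

lemma TKq_concat:
  assumes n: "n \<ge> 1" and K: "K > 0" and qs: "map fst ps \<in> ltree (G n) 0"
    and inner: "\<And>q v. (q, v) \<in> set ps \<Longrightarrow> v \<in> TKq K q"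
    and srt: "sorted_wrt (\<lambda>(q, v) (q', v'). \<forall>x\<in>set v. \<forall>p\<in>supp x. p \<le> q') ps" and ne: "ps \<noteq> []"
  shows "concat (map snd ps) \<in> TK (K / \<theta> n)"
proof -
  define us where "us = concat (map snd ps)"
  have set_us: "set us = (\<Union>p\<in>set ps. set (snd p))" by (auto simp: us_def)
  have inTK: "snd p \<in> TK K" "\<And>x k. x \<in> set (snd p) \<Longrightarrow> k \<in> supp x \<Longrightarrow> fst p < k" if "p \<in> set ps" for p
    using inner[of "fst p" "snd p"] that by (auto simp: TKq_def)
  have usx: "x \<in> c00 \<and> supp x \<noteq> {} \<and> N x = 1" if "x \<in> set us" for x
    using that TK_D(3)[OF inTK(1)] unfolding set_us by blast
  have "sorted_wrt before us"
    unfolding us_def using srt inner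
  proof (induction ps)
    case (Cons p ps)
    obtain q v where p: "p = (q, v)" by fastforce
    have "sorted_wrt before v" using Cons.prems(2)[of q v] TK_D(2) by (auto simp: p TKq_def)
    moreover have "sorted_wrt before (concat (map snd ps))" using Cons by auto
    moreover have "before x y" if xy: "x \<in> set v" "y \<in> set (concat (map snd ps))" for x y
    proof -
      obtain q' v' where q': "(q', v') \<in> set ps" "y \<in> set v'" using xy(2) by fastforce
      have "\<forall>a\<in>supp x. a \<le> q'" using Cons.prems(1) q'(1) xy(1) by (auto simp: p)
      moreover have "\<forall>b\<in>supp y. q' < b" using Cons.prems(2)[of q' v'] q' by (auto simp: TKq_def)
      ultimately show ?thesis unfolding before_def by (meson order_le_less_trans)
    qed
    ultimately show ?case by (simp add: p sorted_wrt_append)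
  qed simp
  moreover have "us \<noteq> []"
    using ne inTK(1) TK_D(1) unfolding us_def by (metis concat_eq_Nil_conv image_eqI last_in_set set_map)
  moreover have "(\<Sum>x\<in>set us. \<bar>a x\<bar>) / (K / \<theta> n) \<le> N (\<lambda>s. \<Sum>x\<in>set us. a x * x s)" for a
  proof -
    define E where "E p = (\<Union>x\<in>set (snd p). supp x)" for p :: "nat \<times> (nat \<Rightarrow> real) list"
    have E: "finite (E p)" "E p \<noteq> {}" "\<And>k. k \<in> E p \<Longrightarrow> fst p < k" if "p \<in> set ps" for p
    proof -
      show "finite (E p)" using TK_D(3)[OF inTK(1)[OF that]] c00_finite by (auto simp: E_def)
      show "E p \<noteq> {}" using TK_D(1,3)[OF inTK(1)[OF that]] by (auto simp: E_def)
      show "fst p < k" if "k \<in> E p" for k using inTK(2)[OF \<open>p \<in> set ps\<close>] that by (auto simp: E_def)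
    qed
    have fst_sorted: "sorted_wrt (<) (map fst ps)" and fst_G: "set (map fst ps) \<in> G n" using qs by (auto simp: ltree_def)
    have nth: "fst (ps ! i) < fst (ps ! j)" "Max (E (ps ! i)) \<le> fst (ps ! j)" if ij: "i < j" "j < length ps" for i j
    proof -
      show "fst (ps ! i) < fst (ps ! j)" using fst_sorted ij by (simp add: sorted_wrt_map sorted_wrt_iff_nth_less)
      have "\<forall>x\<in>set (snd (ps ! i)). \<forall>p\<in>supp x. p \<le> fst (ps ! j)"
        using srt ij by (auto simp: sorted_wrt_iff_nth_less case_prod_beta)
      moreover have "Max (E (ps ! i)) \<in> E (ps ! i)" using E(1,2)[of "ps ! i"] ij by simp
      ultimately show "Max (E (ps ! i)) \<le> fst (ps ! j)" by (auto simp: E_def)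
    qed
    have tri: "p = p' \<or> (fst p < fst p' \<and> Max (E p) < Min (E p')) \<or> (fst p' < fst p \<and> Max (E p') < Min (E p))"
      if pp: "p \<in> set ps" "p' \<in> set ps" for p p'
    proof -
      have *: "Max (E (ps ! i)) < Min (E (ps ! j))" if ij: "i < j" "j < length ps" for i j
      proof -
        have "Min (E (ps ! j)) \<in> E (ps ! j)" using E(1,2)[of "ps ! j"] ij by simp
        then show ?thesis using E(3)[of "ps ! j"] nth(2)[OF ij] ij(2) by (meson nth_mem order_le_less_trans)
      qed
      obtain i j where "p = ps ! i" "p' = ps ! j" "i < length ps" "j < length ps"
        using pp by (metis in_set_conv_nth)
      then show ?thesis using *[of i j] *[of j i] nth(1)[of i j] nth(1)[of j i] by (metis linorder_neqE_nat)
    qed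
    have MinMax: "Min (E p) \<le> Max (E p)" if "p \<in> set ps" for p
      using E(1,2)[OF that] by (meson Max_ge Min_in)
    have injE: "inj_on E (set ps)"
      by (rule inj_onI) (use tri MinMax in \<open>metis leD\<close>)
    have adm: "adm (G n) (E ` set ps)"
      unfolding adm_def
    proof
      show "succ_sets (E ` set ps)"
        unfolding succ_sets_def
      proof (intro conjI ballI impI)
        fix U V assume "U \<in> E ` set ps" "V \<in> E ` set ps" "U \<noteq> V"
        then obtain p p' where "p \<in> set ps" "p' \<in> set ps" "U = E p" "V = E p'" "p \<noteq> p'" by blast
        then show "Max U < Min V \<or> Max V < Min U" using tri[of p p'] by blast
      qed (use E in auto)
      have "(\<lambda>p. Min (E p)) ` set ps \<in> G n"
      proof (rule spread_image[OF G(2,3)[OF n] fst_G, of fst])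
        fix p p' assume pp: "p \<in> set ps" "p' \<in> set ps"
        show "Min (E p) < Min (E p')" if "fst p < fst p'"
          using tri[OF pp] that MinMax[OF pp(1)] by auto
        show "Min (E p) = Min (E p')" if "fst p = fst p'"
          using tri[OF pp] that by auto
        have "Min (E p) \<in> E p" using E[OF pp(1)] by simp
        then show "fst p \<le> Min (E p)" using E(3)[OF pp(1)] less_imp_le by blast
      qed simp
      then show "Min ` E ` set ps \<in> G n" by (simp add: image_image)
    qed
    define y where "y = (\<lambda>s. \<Sum>x\<in>set us. a x * x s)"
    have yc: "y \<in> c00" unfolding y_def using usx by (intro lincomb_c00) auto
    have disjE: "p = p'" if "p \<in> set ps" "p' \<in> set ps" "k \<in> E p" "k \<in> E p'" for p p' k
      using tri[OF that(1,2)] that E(1) by (meson Max_ge Min_le leD order_le_less_trans)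
    have xE: "supp x \<subseteq> E p" if "x \<in> set (snd p)" for x p using that by (auto simp: E_def)
    have disj: "set (snd p) \<inter> set (snd p') = {}" if pp: "p \<in> set ps" "p' \<in> set ps" "p \<noteq> p'" for p p'
    proof (rule ccontr)
      assume "\<not> ?thesis"
      then obtain x where x: "x \<in> set (snd p)" "x \<in> set (snd p')" by blast
      then obtain k where "k \<in> supp x" using TK_D(3)[OF inTK(1)[OF pp(1)]] by blast
      then show False using disjE[OF pp(1,2), of k] xE x pp(3) by blast
    qed
    have restrE: "restr (E p) y = (\<lambda>s. \<Sum>x\<in>set (snd p). a x * x s)" if p: "p \<in> set ps" for p
    proof
      fix s
      have "restr (E p) y s = (\<Sum>x\<in>set us. a x * restr (E p) x s)"
        unfolding y_def by (subst restr_lincomb) simp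
      also have "\<dots> = (\<Sum>x\<in>set (snd p). a x * restr (E p) x s)"
      proof (rule sum.mono_neutral_right)
        show "\<forall>x\<in>set us - set (snd p). a x * restr (E p) x s = 0"
        proof
          fix x assume x: "x \<in> set us - set (snd p)"
          then obtain p' where p': "p' \<in> set ps" "x \<in> set (snd p')" unfolding set_us by blast
          then have "p' \<noteq> p" using x by blast
          then have "s \<notin> E p \<or> s \<notin> supp x" using disjE[OF p p'(1)] xE[OF p'(2)] by blast
          then show "a x * restr (E p) x s = 0" by (auto simp: restr_def supp_def)
        qed
      qed (use p in \<open>auto simp: set_us\<close>)
      also have "\<dots> = (\<Sum>x\<in>set (snd p). a x * x s)"
      proof (intro sum.cong refl)
        fix x assume "x \<in> set (snd p)"
        then show "a x * restr (E p) x s = a x * x s"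
          using xE[of x p] by (cases "s \<in> E p") (auto simp: restr_def supp_def)
      qed
      finally show "restr (E p) y s = (\<Sum>x\<in>set (snd p). a x * x s)" .
    qed
    have "(\<Sum>x\<in>set us. \<bar>a x\<bar>) = (\<Sum>p\<in>set ps. \<Sum>x\<in>set (snd p). \<bar>a x\<bar>)"
      unfolding set_us by (rule sum.UNION_disjoint) (use disj in auto)
    then have "(\<Sum>x\<in>set us. \<bar>a x\<bar>) / K = (\<Sum>p\<in>set ps. (\<Sum>x\<in>set (snd p). \<bar>a x\<bar>) / K)"
      by (simp add: sum_divide_distrib)
    also have "\<dots> \<le> (\<Sum>p\<in>set ps. N (restr (E p) y))"
      using TK_lower[OF inTK(1)] by (intro sum_mono) (simp add: restrE)
    also have "\<dots> = (\<Sum>D\<in>E ` set ps. N (restr D y))" by (simp add: sum.reindex[OF injE])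
    finally have "\<theta> n * ((\<Sum>x\<in>set us. \<bar>a x\<bar>) / K) \<le> \<theta> n * (\<Sum>D\<in>E ` set ps. N (restr D y))"
      using \<theta>(1)[OF n] by (intro mult_left_mono) auto
    also have "\<dots> \<le> N y" by (rule N_adm[OF yc n adm])
    finally show ?thesis by (simp add: y_def mult.commute)
  qed
  ultimately show ?thesis unfolding us_def[symmetric] using usx by (intro TK_I) auto
qed

text \<open>An outer clock on \<open>ltree (G n) 0\<close> and inner clocks running below \<Lambda>
  combine by \<open>clock_compose\<close>, which multiplies the orders.\<close>

lemma composed_tree:
  assumes n: "n \<ge> 1" and K: "K > 0"
    and inner: "\<And>q \<rho>. \<rho> < \<Lambda> \<Longrightarrow> \<exists>u. rk (TKq K q) \<rho> [u]"
    and outer: "rk (ltree (G n) 0) \<mu> []" and s: "s < \<Lambda> * \<mu>"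
  shows "\<exists>u. rk (TK (K / \<theta> n)) s u"
proof -
  define Q where "Q \<tau> us \<longleftrightarrow> (\<exists>ps. rk (ltree (G n) 0) \<tau> (map fst ps) \<and> us = concat (map snd ps) \<and>
     (\<forall>(q, v)\<in>set ps. v \<in> TKq K q) \<and> sorted_wrt (\<lambda>(q, v) (q', v'). \<forall>x\<in>set v. \<forall>p\<in>supp x. p \<le> q') ps)" for \<tau> us
  have step: "\<exists>x R. clock R \<and> R \<rho> (us @ [x]) \<and> (\<forall>\<rho> s. R \<rho> s \<longrightarrow> Q \<tau>' s)"
    if Qus: "Q \<tau> us" and lt: "\<tau>' < \<tau>" "\<rho> < \<Lambda>" for \<tau> us \<tau>' \<rho>
  proof -
    from Qus obtain ps where ps: "rk (ltree (G n) 0) \<tau> (map fst ps)" "us = concat (map snd ps)"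
      "\<And>q v. (q, v) \<in> set ps \<Longrightarrow> v \<in> TKq K q"
      "sorted_wrt (\<lambda>(q, v) (q', v'). \<forall>x\<in>set v. \<forall>p\<in>supp x. p \<le> q') ps"
      unfolding Q_def by blast
    obtain q0 where q0: "rk (ltree (G n) 0) \<tau>' (map fst ps @ [q0])" using rk_ext[OF ps(1) lt(1)] by blast
    define S where "S = (\<Union>x\<in>set us. supp x)"
    have usc: "x \<in> c00" if "x \<in> set us" for x
    proof -
      have "\<exists>p\<in>set ps. x \<in> set (snd p)" using that ps(2) by auto
      then obtain p where "p \<in> set ps" "x \<in> set (snd p)" by blast
      then show ?thesis using ps(3)[of "fst p" "snd p"] TK_D(3) by (auto simp: TKq_def)
    qed
    have finS: "finite S" using usc c00_finite by (auto simp: S_def)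
    \<comment> \<open>The outer point is moved past all supports used so far, so that the next inner
      sequence follows them; \<open>rk_shift\<close> preserves the remaining outer rank.\<close>
    define q where "q = Max (insert q0 S)"
    have q: "q0 \<le> q" "\<And>k. k \<in> S \<Longrightarrow> k \<le> q" using finS by (auto simp: q_def)
    have q1: "rk (ltree (G n) 0) \<tau>' (map fst ps @ [q])" by (rule rk_shift[OF G(3)[OF n] q0 q(1)])
    obtain u where u: "rk (TKq K q) \<rho> [u]" using inner[OF lt(2)] by blast
    define R where "R \<rho> s \<longleftrightarrow> (\<exists>v. s = us @ v \<and> rk (TKq K q) \<rho> v)" for \<rho> s
    have "clock R"
      unfolding clock_def
    proof (intro allI impI)
      fix s v s' assume "R s v" "s' < s"
      then obtain u where "v = us @ u" "rk (TKq K q) s u" unfolding R_def by blast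
      then show "\<exists>x. R s' (v @ [x])" using rk_ext[OF _ \<open>s' < s\<close>] unfolding R_def by fastforce
    qed
    moreover have "R \<rho> (us @ [u])" unfolding R_def using u by blast
    moreover have "Q \<tau>' w" if Rw: "R s w" for s w
    proof -
      from Rw obtain v where v: "w = us @ v" "v \<in> TKq K q" unfolding R_def using rk_mem by blast
      have "\<forall>x\<in>set v'. \<forall>p\<in>supp x. p \<le> q" if "(q', v') \<in> set ps" for q' v'
        using that q(2) by (fastforce simp: S_def ps(2))
      then show ?thesis
        unfolding Q_def using ps(3,4) v q1
        by (intro exI[of _ "ps @ [(q, v)]"]) (auto simp: ps(2) sorted_wrt_append)
    qed
    ultimately show ?thesis by blast
  qed
  obtain P where P: "clock P" "\<And>\<tau> t. Q \<tau> t \<Longrightarrow> P (\<Lambda> * \<tau>) t" "\<And>s t. P s t \<Longrightarrow> \<exists>\<tau>. Q \<tau> t"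
    using clock_compose[of Q \<Lambda>] step by metis
  define P' where "P' s t \<longleftrightarrow> P s t \<and> t \<noteq> []" for s t
  have "clock P'" using P(1) unfolding clock_def P'_def by blast
  moreover have "t \<in> TK (K / \<theta> n)" if Pt: "P' s t" for s t
  proof -
    from Pt obtain \<tau> where "Q \<tau> t" "t \<noteq> []" using P(3) unfolding P'_def by blast
    then obtain ps where ps: "map fst ps \<in> ltree (G n) 0" "t = concat (map snd ps)"
      "\<And>q v. (q, v) \<in> set ps \<Longrightarrow> v \<in> TKq K q"
      "sorted_wrt (\<lambda>(q, v) (q', v'). \<forall>x\<in>set v. \<forall>p\<in>supp x. p \<le> q') ps"
      unfolding Q_def using rk_mem by blast
    have "ps \<noteq> []" using \<open>t \<noteq> []\<close> ps(2) by auto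
    then show ?thesis unfolding ps(2) by (intro TKq_concat n K ps)
  qed
  moreover have "Q \<mu> []" unfolding Q_def using outer by (intro exI[of _ "[]"]) simp
  then obtain u where "P s ([] @ [u])" using clockD[OF P(1) P(2) s] by blast
  then have "P' s [u]" by (simp add: P'_def)
  ultimately show ?thesis using clock_imp_rk by blast
qed

end

section \<open>Products of weights\<close>

text \<open>The first letter is added last: it is the outermost family of a branch of the norming
  tree, and under composition the outer exponent stands on the right.\<close>

primrec gword :: "cord \<Rightarrow> (nat \<Rightarrow> cord) \<Rightarrow> nat list \<Rightarrow> cord" where
  "gword \<sigma> b [] = \<sigma>"
| "gword \<sigma> b (n # ns) = gword \<sigma> b ns + b n"

lemma abs_gamma_term: "abs_cord (gamma_term l \<beta> ns) = gword (abs_cord l) (\<lambda>n. abs_cord (\<beta> n)) ns"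
  by (induction ns) (simp_all add: gamma_term_def abs_oadd)

definition words :: "(nat \<Rightarrow> real) \<Rightarrow> real \<Rightarrow> nat list set" where
  "words \<theta> \<tau> = {ns. (\<forall>n\<in>set ns. n \<ge> 1) \<and> (\<Prod>n\<leftarrow>ns. \<theta> n) > \<tau>}"

lemma fam_norm_mono:
  assumes "F \<subseteq> F'" "{} \<in> F" "F' \<subseteq> fin_pos_sets" "x \<in> c00"
  shows "fam_norm F x \<le> fam_norm F' x"
  by (rule fam_norm_least[OF assms(2)], rule fam_norm_upper[OF assms(3,4)]) (use assms(1) in blast)

context tsirelson_null
begin

lemma finite_large_weights: "0 < \<tau> \<Longrightarrow> finite {n. n \<ge> 1 \<and> \<theta> n > \<tau>}"
proof -
  assume "0 < \<tau>"
  then have "\<forall>\<^sub>F n in sequentially. \<theta> n < \<tau>" using \<theta>_null by (rule order_tendstoD(2)[rotated])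
  then obtain M where M: "\<And>n. n \<ge> M \<Longrightarrow> \<theta> n < \<tau>" by (auto simp: eventually_sequentially)
  have "{n. n \<ge> 1 \<and> \<theta> n > \<tau>} \<subseteq> {..<M}"
  proof
    fix n assume "n \<in> {n. n \<ge> 1 \<and> \<theta> n > \<tau>}"
    then show "n \<in> {..<M}" using M[of n] by (cases "n < M") auto
  qed
  then show ?thesis by (rule finite_subset) simp
qed

lemma weights_prod:
  assumes "\<forall>n\<in>set ns. n \<ge> 1"
  shows "0 < (\<Prod>n\<leftarrow>ns. \<theta> n) \<and> (\<Prod>n\<leftarrow>ns. \<theta> n) \<le> 1 \<and> (\<Prod>n\<leftarrow>ns. \<theta> n) \<le> \<theta> 1 ^ length ns \<and>
    (\<forall>n\<in>set ns. (\<Prod>n\<leftarrow>ns. \<theta> n) \<le> \<theta> n)"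
  using assms
proof (induction ns)
  case (Cons k ns)
  define p where "p = (\<Prod>n\<leftarrow>ns. \<theta> n)"
  have p: "0 < p" "p \<le> 1" "p \<le> \<theta> 1 ^ length ns" "\<forall>n\<in>set ns. p \<le> \<theta> n"
    using Cons unfolding p_def by auto
  have k: "0 < \<theta> k" "\<theta> k < 1" "\<theta> k \<le> \<theta> 1" using \<theta> \<theta>_le Cons.prems by auto
  have kp: "\<theta> k * p \<le> p" "\<theta> k * p \<le> \<theta> k" using p k by (simp_all add: mult_left_le_one_le mult_right_le_one_le)
  have "\<theta> k * p \<le> \<theta> 1 * \<theta> 1 ^ length ns" using p k by (intro mult_mono) auto
  moreover have "\<theta> k * p \<le> 1" using kp p by linarith
  moreover have "\<forall>n\<in>set (k # ns). \<theta> k * p \<le> \<theta> n" using kp p(4) by fastforce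
  moreover have "0 < \<theta> k * p" using p k by simp
  moreover have "(\<Prod>n\<leftarrow>k # ns. \<theta> n) = \<theta> k * p" by (simp add: p_def)
  ultimately show ?case by (simp only: length_Cons power_Suc)
qed simp

text \<open>A product above \<tau> bounds the length, as every factor is at most
  \<open>\<theta> 1\<close> < 1, and leaves finitely many letters, as the weights tend to 0. Hence
  the maximum defining \<gamma> exists.\<close>

lemma finite_words: "0 < \<tau> \<Longrightarrow> finite (words \<theta> \<tau>)"
proof -
  assume \<tau>: "0 < \<tau>"
  obtain D where D: "\<theta> 1 ^ D < \<tau>" using real_arch_pow_inv[OF \<tau> \<theta>(2)[of 1]] by auto
  have "length ns \<le> D \<and> set ns \<subseteq> {n. n \<ge> 1 \<and> \<theta> n > \<tau>}" if "ns \<in> words \<theta> \<tau>" for ns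
  proof
    have ns: "\<forall>n\<in>set ns. n \<ge> 1" "(\<Prod>n\<leftarrow>ns. \<theta> n) > \<tau>" using that by (auto simp: words_def)
    show "length ns \<le> D"
    proof (rule ccontr)
      assume "\<not> length ns \<le> D"
      then have "\<theta> 1 ^ length ns \<le> \<theta> 1 ^ D" using \<theta>[of 1] by (intro power_decreasing) auto
      then show False using weights_prod[OF ns(1)] ns(2) D by linarith
    qed
    show "set ns \<subseteq> {n. n \<ge> 1 \<and> \<theta> n > \<tau>}" using weights_prod[OF ns(1)] ns by fastforce
  qed
  then have "words \<theta> \<tau> \<subseteq> {ns. set ns \<subseteq> {n. n \<ge> 1 \<and> \<theta> n > \<tau>} \<and> length ns \<le> D}" by blast
  then show ?thesis using finite_lists_length_le[OF finite_large_weights[OF \<tau>]] finite_subset by blast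
qed

text \<open>Nodes with accumulated weight at most \<tau> are estimated by the l1 norm, all others
  are recorded in \<open>W\<close>. The indices on a recorded branch form a word, whose families
  compose to a rank of order \<open>cpow (gword \<sigma> b ns)\<close>; the successor of \<Gamma>
  makes room for finite coefficients.\<close>

lemma weighted_family:
  assumes F0r: "rkfam F0 a0" "a0 < cpow (csuc \<sigma>)"
    and Gr: "\<And>n. n \<ge> 1 \<Longrightarrow> rkfam (G n) (cpow (b n))"
  shows "0 < \<tau> \<Longrightarrow> \<theta> 1 ^ d \<le> \<tau> \<Longrightarrow> \<sigma> \<le> \<Gamma> \<Longrightarrow> (\<And>ns. ns \<in> words \<theta> \<tau> \<Longrightarrow> ns \<noteq> [] \<Longrightarrow> gword \<sigma> b ns \<le> \<Gamma>) \<Longrightarrow>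
    \<exists>W r. rkfam W r \<and> r < cpow (csuc \<Gamma>) \<and> (\<forall>k. \<forall>x\<in>c00. Nk k x \<le> fam_norm W x + \<tau> * l1norm x)"
proof (induction d arbitrary: \<tau> \<Gamma>)
  have main: "\<exists>W r. rkfam W r \<and> r < cpow (csuc \<Gamma>) \<and> (\<forall>k. \<forall>x\<in>c00. Nk k x \<le> fam_norm W x + \<tau> * l1norm x)"
    if \<tau>: "0 < \<tau>" and \<Gamma>: "\<sigma> \<le> \<Gamma>"
      and IH: "\<And>n. n \<ge> 1 \<Longrightarrow> \<theta> n > \<tau> \<Longrightarrow> \<exists>g W r. g + b n \<le> \<Gamma> \<and> rkfam W r \<and> r < cpow (csuc g) \<and>
        (\<forall>k. \<forall>x\<in>c00. Nk k x \<le> fam_norm W x + \<tau> / \<theta> n * l1norm x)" for \<tau> \<Gamma>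
  proof -
    define I where "I = {n. n \<ge> 1 \<and> \<theta> n > \<tau>}"
    have I: "finite I" "\<And>n. n \<in> I \<Longrightarrow> n \<ge> 1" unfolding I_def using finite_large_weights[OF \<tau>] by auto
    obtain g V r where V: "\<And>n. n \<in> I \<Longrightarrow> g n + b n \<le> \<Gamma>" "\<And>n. n \<in> I \<Longrightarrow> rkfam (V n) (r n)"
      "\<And>n. n \<in> I \<Longrightarrow> r n < cpow (csuc (g n))"
      "\<And>n k x. n \<in> I \<Longrightarrow> x \<in> c00 \<Longrightarrow> Nk k x \<le> fam_norm (V n) x + \<tau> / \<theta> n * l1norm x"
    proof -
      have "\<forall>n\<in>I. \<exists>z. fst z + b n \<le> \<Gamma> \<and> rkfam (fst (snd z)) (snd (snd z)) \<and> snd (snd z) < cpow (csuc (fst z)) \<and>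
        (\<forall>k. \<forall>x\<in>c00. Nk k x \<le> fam_norm (fst (snd z)) x + \<tau> / \<theta> n * l1norm x)"
        using IH unfolding I_def by fastforce
      from bchoice[OF this] obtain f where "\<forall>n\<in>I. fst (f n) + b n \<le> \<Gamma> \<and>
        rkfam (fst (snd (f n))) (snd (snd (f n))) \<and> snd (snd (f n)) < cpow (csuc (fst (f n))) \<and>
        (\<forall>k. \<forall>x\<in>c00. Nk k x \<le> fam_norm (fst (snd (f n))) x + \<tau> / \<theta> n * l1norm x)" ..
      then show ?thesis
        using that[of "\<lambda>n. fst (f n)" "\<lambda>n. fst (snd (f n))" "\<lambda>n. snd (snd (f n))"] by simp
    qed
    have rank: "\<exists>r'<cpow (csuc \<Gamma>). rkfam (fam_comp (G n) (V n)) r'" if n: "n \<in> I" for n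
    proof -
      have "r n < cpow (g n) * comega" using V(3)[OF n] by simp
      then obtain c where c: "r n < cpow (g n) * cnat c" by (auto simp: comega_def)
      then have "rkfam (V n) (cpow (g n) * cnat c)" using rkfam_mono[OF V(2)[OF n]] less_imp_le by blast
      then have r: "rkfam (fam_comp (G n) (V n)) (cpow (g n) * cnat c * cpow (b n))"
        using rkfam_fam_comp[OF _ Gr] I(2)[OF n] by blast
      have "cpow (g n) * cnat c * cpow (b n) < cpow (csuc \<Gamma>)"
      \<comment> \<open>The coefficient \<open>c\<close> stands to the left of
        \<open>cpow (b n)\<close> and is absorbed unless this power is 1; then it fits below the
        next power of \<omega>.\<close>
      proof (cases "b n = 0")
        case True
        then have "g n < csuc \<Gamma>" using V(1)[OF n] by simp
        then show ?thesis using cpow_mul_cnat_less[of "g n" "csuc \<Gamma>" c] True by simp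
      next
        case False
        have "cpow (g n) * cnat c * cpow (b n) \<le> cpow (g n) * cpow (b n)"
          using cnat_mul_cpow[OF False] unfolding cord_mul_assoc by (rule cord_mul_le_mono_right)
        also have "\<dots> = cpow (g n + b n)" by (simp add: cpow_add)
        also have "\<dots> < cpow (csuc \<Gamma>)" using V(1)[OF n] by (simp only: cpow_less_iff less_csuc_iff)
        finally show ?thesis .
      qed
      then show ?thesis using r by blast
    qed
    then obtain r' where r': "\<And>n. n \<in> I \<Longrightarrow> r' n < cpow (csuc \<Gamma>)"
      "\<And>n. n \<in> I \<Longrightarrow> rkfam (fam_comp (G n) (V n)) (r' n)" by metis
    have "a0 < cpow (csuc \<Gamma>)"
      using F0r(2) \<Gamma> by (meson cpow_le_iff csuc_le_mono order_less_le_trans)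
    then obtain R where R: "R < cpow (csuc \<Gamma>)" "a0 \<le> R" "\<forall>n\<in>I. r' n \<le> R"
      using finite_max_exponent[of I r' "cpow (csuc \<Gamma>)" a0] I(1) r'(1) by blast
    define W where "W = F0 \<union> (\<Union>n\<in>I. fam_comp (G n) (V n))"
    have W: "rkfam W R"
      unfolding W_def using rkfam_mono[OF F0r(1) R(2)] rkfam_mono[OF r'(2)] R(3) by (intro rkfam_UNION I(1)) auto
    have "Nk k x \<le> fam_norm W x + \<tau> * l1norm x" if x: "x \<in> c00" for k x
    proof -
      have l0: "0 \<le> \<tau> * l1norm x" using \<tau> by simp
      have fam: "fam_norm F0 x \<le> fam_norm W x"
        by (rule fam_norm_mono[OF _ F0_empty rkfamD(1)[OF W] x]) (auto simp: W_def)
      show ?thesis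
      proof (cases k)
        case 0
        then show ?thesis using fam l0 by simp
      next
        case (Suc k')
        show ?thesis
          unfolding Suc
        proof (rule Nk_Suc_le)
          show "fam_norm F0 x \<le> fam_norm W x + \<tau> * l1norm x" using fam l0 by linarith
          fix n \<E> assume n: "n \<ge> 1" and \<E>: "adm (G n) \<E>"
          have S: "succ_sets \<E>" using \<E> by (simp add: adm_def)
          have l1: "(\<Sum>E\<in>\<E>. l1norm (restr E x)) \<le> l1norm x" by (rule sum_l1norm_restr_le[OF S x])
          show "\<theta> n * (\<Sum>E\<in>\<E>. Nk k' (restr E x)) \<le> fam_norm W x + \<tau> * l1norm x"
          proof (cases "\<theta> n \<le> \<tau>")
            case True
            have "\<theta> n * (\<Sum>E\<in>\<E>. Nk k' (restr E x)) \<le> \<tau> * l1norm x"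
            proof (rule mult_mono[OF True])
              have "(\<Sum>E\<in>\<E>. Nk k' (restr E x)) \<le> (\<Sum>E\<in>\<E>. l1norm (restr E x))"
                using x by (intro sum_mono Nk_le_l1) simp
              then show "(\<Sum>E\<in>\<E>. Nk k' (restr E x)) \<le> l1norm x" using l1 by linarith
            qed (use \<tau> x Nk_nonneg in \<open>auto intro: sum_nonneg\<close>)
            moreover have "0 \<le> fam_norm W x" using fam fam_norm_nonneg[OF x] by linarith
            ultimately show ?thesis by linarith
          next
            case False
            then have nI: "n \<in> I" using n by (simp add: I_def)
            have "\<exists>A. A \<in> V n \<and> A \<subseteq> supp (restr E x) \<and> fam_norm (V n) (restr E x) = (\<Sum>k\<in>A. \<bar>restr E x k\<bar>)" for E
              using fam_norm_attained[OF rkfamD(1,2,4)[OF V(2)[OF nI]] restr_c00[OF x]] by blast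
            then obtain A where A: "\<And>E. A E \<in> V n" "\<And>E. A E \<subseteq> supp (restr E x)"
              "\<And>E. fam_norm (V n) (restr E x) = (\<Sum>k\<in>A E. \<bar>restr E x k\<bar>)" by metis
            have AE: "A E \<subseteq> E" "finite (A E)" for E
              using A(2)[of E] c00_finite[OF x] by (auto simp: supp_restr intro: finite_subset)
            have sumA: "(\<Sum>E\<in>\<E>. fam_norm (V n) (restr E x)) \<le> fam_norm W x"
            proof -
              define \<E>' where "\<E>' = {E\<in>\<E>. A E \<noteq> {}}"
              have MM: "Min E \<le> Min (A E)" "Max (A E) \<le> Max E" "Min (A E) \<le> Max (A E)" if "E \<in> \<E>'" for E
              proof -
                have "E \<in> \<E>" "A E \<noteq> {}" using that by (auto simp: \<E>'_def)
                then show "Min E \<le> Min (A E)" "Max (A E) \<le> Max E" "Min (A E) \<le> Max (A E)"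
                  using AE[of E] succ_setsD(1)[OF S] by (auto intro!: Min_antimono Max_mono)
              qed
              have lt: "Max (A E) < Min (A E')" if "E \<in> \<E>'" "E' \<in> \<E>'" "Max E < Min E'" for E E'
                using MM[OF that(1)] MM[OF that(2)] that(3) by linarith
              have "succ_sets (A ` \<E>')"
                unfolding succ_sets_def
              proof (intro conjI ballI impI)
                fix U U' assume "U \<in> A ` \<E>'" "U' \<in> A ` \<E>'" "U \<noteq> U'"
                then obtain E E' where E: "E \<in> \<E>'" "E' \<in> \<E>'" "U = A E" "U' = A E'" "E \<noteq> E'" by blast
                then have "Max E < Min E' \<or> Max E' < Min E" using S unfolding succ_sets_def \<E>'_def by blast
                then show "Max U < Min U' \<or> Max U' < Min U" using lt E by blast
              qed (use S AE in \<open>auto simp: \<E>'_def succ_sets_def\<close>)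
              moreover have "(\<lambda>E. Min (A E)) ` \<E>' \<in> G n"
              proof (rule spread_image[OF G(2,3)[OF n], of "Min ` \<E>" Min])
                fix E E' assume E: "E \<in> \<E>'" "E' \<in> \<E>'"
                have E\<E>: "E \<in> \<E>" "E' \<in> \<E>" using E by (auto simp: \<E>'_def)
                show "Min E < Min E' \<Longrightarrow> Min (A E) < Min (A E')"
                  using lt[OF E] succ_sets_Min_less[OF S E\<E>] MM(3)[OF E(1)] by linarith
                show "Min E = Min E' \<Longrightarrow> Min (A E) = Min (A E')" using succ_sets_Min_eq[OF S E\<E>] by simp
              qed (use \<E> MM in \<open>auto simp: adm_def \<E>'_def\<close>)
              ultimately have "\<Union>(A ` \<E>') \<in> fam_comp (G n) (V n)"
                unfolding fam_comp_iff[OF rkfamD(1)[OF V(2)[OF nI]]] using A(1)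
                by (intro exI[of _ "A ` \<E>'"]) (auto simp: image_image)
              moreover have "\<Union>(A ` \<E>') = (\<Union>E\<in>\<E>. A E)" by (auto simp: \<E>'_def)
              ultimately have "(\<Union>E\<in>\<E>. A E) \<in> W" using nI by (auto simp: W_def)
              then have "(\<Sum>k\<in>(\<Union>E\<in>\<E>. A E). \<bar>x k\<bar>) \<le> fam_norm W x"
                by (rule fam_norm_upper[OF rkfamD(1)[OF W] x])
              moreover have "(\<Sum>k\<in>(\<Union>E\<in>\<E>. A E). \<bar>x k\<bar>) = (\<Sum>E\<in>\<E>. \<Sum>k\<in>A E. \<bar>x k\<bar>)"
              proof (rule sum.UNION_disjoint)
                show "\<forall>E\<in>\<E>. \<forall>E'\<in>\<E>. E \<noteq> E' \<longrightarrow> A E \<inter> A E' = {}"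
                  using succ_sets_disjoint[OF S] AE(1) by blast
              qed (use S AE in \<open>auto simp: succ_sets_def\<close>)
              moreover have "(\<Sum>k\<in>A E. \<bar>x k\<bar>) = fam_norm (V n) (restr E x)" for E
                unfolding A(3) using AE(1)[of E] by (intro sum.cong) (auto simp: restr_def)
              ultimately show ?thesis by simp
            qed
            have "\<theta> n * (\<Sum>E\<in>\<E>. Nk k' (restr E x)) \<le>
                \<theta> n * (\<Sum>E\<in>\<E>. fam_norm (V n) (restr E x) + \<tau> / \<theta> n * l1norm (restr E x))"
              using V(4)[OF nI] x \<theta>(1)[OF n] by (intro mult_left_mono sum_mono) auto
            also have "(\<Sum>E\<in>\<E>. fam_norm (V n) (restr E x) + \<tau> / \<theta> n * l1norm (restr E x)) =
                (\<Sum>E\<in>\<E>. fam_norm (V n) (restr E x)) + \<tau> / \<theta> n * (\<Sum>E\<in>\<E>. l1norm (restr E x))"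
              by (simp only: sum.distrib sum_distrib_left)
            also have "\<theta> n * \<dots> = \<theta> n * (\<Sum>E\<in>\<E>. fam_norm (V n) (restr E x)) + \<tau> * (\<Sum>E\<in>\<E>. l1norm (restr E x))"
              using \<theta>(1)[OF n] by (simp add: field_simps)
            also have "\<dots> \<le> fam_norm W x + \<tau> * l1norm x"
            proof (rule add_mono)
              have "\<theta> n * (\<Sum>E\<in>\<E>. fam_norm (V n) (restr E x)) \<le> \<theta> n * fam_norm W x"
                using sumA \<theta>(1)[OF n] by (intro mult_left_mono) auto
              also have "\<dots> \<le> fam_norm W x"
                using \<theta>[OF n] fam fam_norm_nonneg[OF x] by (intro mult_left_le_one_le) auto
              finally show "\<theta> n * (\<Sum>E\<in>\<E>. fam_norm (V n) (restr E x)) \<le> fam_norm W x" .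
            qed (use l1 \<tau> in simp)
            finally show ?thesis .
          qed
        qed
      qed
    qed
    then show ?thesis using W R(1) by blast
  qed
  {
    case 0
    show ?case
    proof (rule main)
      fix n :: nat assume "n \<ge> 1" "\<theta> n > \<tau>"
      then show "\<exists>g W r. g + b n \<le> \<Gamma> \<and> rkfam W r \<and> r < cpow (csuc g) \<and>
        (\<forall>k. \<forall>x\<in>c00. Nk k x \<le> fam_norm W x + \<tau> / \<theta> n * l1norm x)"
        using 0(2) \<theta>(2)[of n] by simp
    qed (use 0 in auto)
  next
    case (Suc d)
    show ?case
    proof (rule main)
      fix n :: nat assume n: "n \<ge> 1" "\<theta> n > \<tau>"
      have \<theta>n: "0 < \<theta> n" by (rule \<theta>(1)[OF n(1)])
      define \<tau>' where "\<tau>' = \<tau> / \<theta> n"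
      have \<tau>': "0 < \<tau>'" using Suc.prems(1) \<theta>n by (simp add: \<tau>'_def)
      have "\<theta> 1 ^ d * \<theta> n \<le> \<theta> 1 ^ d * \<theta> 1"
        using n \<theta>(1)[of 1] \<theta>_le[of n] by (intro mult_left_mono) auto
      also have "\<dots> \<le> \<tau>" using Suc.prems(2) by (simp add: mult.commute)
      finally have d: "\<theta> 1 ^ d \<le> \<tau>'" using \<theta>n by (simp add: le_divide_eq \<tau>'_def)
      \<comment> \<open>The bound for the rest of a branch is the maximum over the words that may
        follow \<open>n\<close>, including the empty one. By finiteness it is attained, so adding
        \<open>b n\<close> stays within \<Gamma>.\<close>
      define C where "C = gword \<sigma> b ` insert [] (words \<theta> \<tau>')"
      have C: "finite C" "C \<noteq> {}" using finite_words[OF \<tau>'] by (auto simp: C_def)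
      then have "Max C \<in> C" by simp
      then have "\<exists>ns\<in>insert [] (words \<theta> \<tau>'). Max C = gword \<sigma> b ns" using C_def by blast
      then obtain ns where ns: "ns = [] \<or> ns \<in> words \<theta> \<tau>'" "Max C = gword \<sigma> b ns" by blast
      have "n # ns \<in> words \<theta> \<tau>"
        using ns(1) n \<theta>n by (auto simp: words_def \<tau>'_def divide_less_eq mult.commute)
      then have "Max C + b n \<le> \<Gamma>" using Suc.prems(4)[of "n # ns"] ns(2) by simp
      moreover have "\<exists>W r. rkfam W r \<and> r < cpow (csuc (Max C)) \<and> (\<forall>k. \<forall>x\<in>c00. Nk k x \<le> fam_norm W x + \<tau>' * l1norm x)"
      proof (rule Suc.IH[OF \<tau>' d])
        have "gword \<sigma> b [] \<le> Max C" using C(1) by (intro Max_ge) (auto simp: C_def)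
        then show "\<sigma> \<le> Max C" by simp
        show "gword \<sigma> b ns \<le> Max C" if "ns \<in> words \<theta> \<tau>'" for ns
          using C(1) that by (intro Max_ge) (auto simp: C_def)
      qed
      ultimately show "\<exists>g W r. g + b n \<le> \<Gamma> \<and> rkfam W r \<and> r < cpow (csuc g) \<and>
        (\<forall>k. \<forall>x\<in>c00. Nk k x \<le> fam_norm W x + \<tau> / \<theta> n * l1norm x)" unfolding \<tau>'_def by blast
    qed (use Suc.prems in auto)
  }
qed

lemma splits_mono: "splits m \<O> \<epsilon> \<Longrightarrow> \<epsilon> \<le> \<epsilon>' \<Longrightarrow> splits m \<O> \<epsilon>'"
  unfolding splits_def
proof (intro allI impI)
  fix \<E>
  assume le: "\<epsilon> \<le> \<epsilon>'" and "adm (G m) \<E>" and *: "\<forall>\<E>. adm (G m) \<E> \<longrightarrow> (\<exists>\<F>. adm \<O> \<F> \<and> (\<forall>E\<in>\<E>. \<exists>F\<in>\<F>. E \<subseteq> F) \<and>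
     (\<forall>F\<in>\<F>. \<forall>x\<in>c00. \<theta> m * (\<Sum>E | E \<in> \<E> \<and> E \<subseteq> F. N (restr E x)) \<le> \<epsilon> * N x))"
  from *[rule_format, OF \<open>adm (G m) \<E>\<close>] obtain \<F> where \<F>: "adm \<O> \<F>" "\<forall>E\<in>\<E>. \<exists>F\<in>\<F>. E \<subseteq> F"
    "\<forall>F\<in>\<F>. \<forall>x\<in>c00. \<theta> m * (\<Sum>E | E \<in> \<E> \<and> E \<subseteq> F. N (restr E x)) \<le> \<epsilon> * N x" by blast
  have "\<theta> m * (\<Sum>E | E \<in> \<E> \<and> E \<subseteq> F. N (restr E x)) \<le> \<epsilon>' * N x" if "F \<in> \<F>" "x \<in> c00" for F x
    using \<F>(3) that mult_right_mono[OF le N_nonneg[OF that(2)]] by fastforce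
  then show "\<exists>\<F>. adm \<O> \<F> \<and> (\<forall>E\<in>\<E>. \<exists>F\<in>\<F>. E \<subseteq> F) \<and>
     (\<forall>F\<in>\<F>. \<forall>x\<in>c00. \<theta> m * (\<Sum>E | E \<in> \<E> \<and> E \<subseteq> F. N (restr E x)) \<le> \<epsilon>' * N x)"
    using \<F>(1,2) by blast
qed

text \<open>Every l1-\<open>K\<close> block tree lies in \<open>TK K\<close>, which is one itself,
  so both halves of the index concern ranks in \<open>TK K\<close>. A tree has an order as soon as
  some rank is not attained: the least such rank.\<close>

lemma Ib_is_I:
  assumes up: "\<And>K. K \<ge> 1 \<Longrightarrow> \<exists>g\<le>abs_cord \<alpha>. \<forall>t. \<not> rk (TK K) g t"
    and low: "\<And>s. s < abs_cord \<alpha> \<Longrightarrow> \<exists>K\<ge>1. \<exists>t. rk (TK K) s t"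
  shows "Ib_is N \<alpha>"
proof -
  have ord: "\<exists>\<beta>. tree_order T \<beta> \<and> ole \<beta> \<alpha>" if K: "K \<ge> 1" and T: "l1_block_tree N K T" for K T
  proof -
    note T' = T[unfolded l1_block_tree_def]
    have ne: "\<forall>xs\<in>T. xs \<noteq> []" and sub: "T \<subseteq> TK K"
      using T'[THEN conjunct1] by (auto simp: TK_def)
    note cl = T'[THEN conjunct2]
    note iff = tree_deriv_iter_rk[OF ne cl]
    obtain g where g: "g \<le> abs_cord \<alpha>" "\<forall>t. \<not> rk (TK K) g t" using up[OF K] by blast
    define h where "h = (LEAST h. \<forall>t. \<not> rk T h t)"
    have gT: "\<forall>t. \<not> rk T g t" using g(2) rk_subset[OF _ sub] by blast
    have h: "\<forall>t. \<not> rk T h t" unfolding h_def by (rule LeastI) (rule gT)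
    have "h \<le> g" unfolding h_def by (rule Least_le) (rule gT)
    have "tree_order T (rep_cord h)"
      unfolding tree_order_def
    proof (intro conjI allI impI)
      show "tree_deriv_iter (rep_cord h) T = {}" using iff h by auto
      fix \<gamma> assume "olt \<gamma> (rep_cord h)"
      then have "abs_cord \<gamma> < h" by (simp add: olt_iff)
      then obtain t where "rk T (abs_cord \<gamma>) t" unfolding h_def using not_less_Least by blast
      then show "tree_deriv_iter \<gamma> T \<noteq> {}" using iff by blast
    qed
    moreover have "ole (rep_cord h) \<alpha>" using \<open>h \<le> g\<close> g(1) by (simp add: ole_iff)
    ultimately show ?thesis by blast
  qed
  have "\<exists>K\<ge>1. \<exists>T \<beta>. l1_block_tree N K T \<and> tree_order T \<beta> \<and> olt \<alpha>' \<beta>" if \<alpha>': "olt \<alpha>' \<alpha>" for \<alpha>'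
  proof -
    obtain K t where K: "K \<ge> 1" and t: "rk (TK K) (abs_cord \<alpha>') t" using low[of "abs_cord \<alpha>'"] \<alpha>' by (auto simp: olt_iff)
    have T: "l1_block_tree N K (TK K)"
      unfolding l1_block_tree_def
    proof (intro conjI ballI allI impI)
      fix xs ys assume "xs \<in> TK K" "ys \<noteq> [] \<and> prefix ys xs"
      then show "ys \<in> TK K" using TK_prefix by blast
    qed (simp_all add: TK_def)
    obtain \<beta> where \<beta>: "tree_order (TK K) \<beta>" using ord[OF K T] by blast
    have "olt \<alpha>' \<beta>"
    proof (rule ccontr)
      assume "\<not> olt \<alpha>' \<beta>"
      then have "abs_cord \<beta> \<le> abs_cord \<alpha>'" by (simp add: olt_iff)
      then have "rk (TK K) (abs_cord \<beta>) t" by (rule rk_antimono[OF t])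
      then have "t \<in> tree_deriv_iter \<beta> (TK K)"
        using tree_deriv_iter_rk[of "TK K" t \<beta>] T unfolding l1_block_tree_def by blast
      then show False using \<beta> by (simp add: tree_order_def)
    qed
    then show ?thesis using K T \<beta> by blast
  qed
  then show ?thesis unfolding Ib_is_def using ord by blast
qed

end

section \<open>The index of the space\<close>

lemma absorb_less_cpow: "r < cpow \<zeta> \<Longrightarrow> r + cpow \<zeta> \<le> cpow \<zeta>"
proof (rule ccontr)
  assume r: "r < cpow \<zeta>" and "\<not> r + cpow \<zeta> \<le> cpow \<zeta>"
  then have "cpow \<zeta> < r + cpow \<zeta>" by simp
  from cord_add_sup_split[OF this] obtain z where "z < cpow \<zeta>" "cpow \<zeta> = r + z"
    using r less_asym by blast
  then show False using add_less_cpow[OF r, of z] by simp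
qed

text \<open>The remainder of \<open>x\<close> is absorbed by the next copy of
  \<open>cpow \<zeta>\<close>; if there is none, the two remainders add up to less than
  \<open>cpow \<zeta>\<close>. So coefficients add although ordinal addition does not
  commute.\<close>

lemma cpow_coefficient_add:
  assumes "x < cpow \<zeta> * cnat (Suc i)" "y < cpow \<zeta> * cnat (Suc j)"
  shows "x + y < cpow \<zeta> * cnat (Suc (i + j))"
proof -
  have dec: "\<exists>k\<le>n. \<exists>r<cpow \<zeta>. w = cpow \<zeta> * cnat k + r" if w: "w < cpow \<zeta> * cnat (Suc n)" for w n
    using cord_mul_division[OF w] less_cnat_ex by (metis less_Suc_eq_le)
  have abs: "r + (cpow \<zeta> * cnat k + r') < cpow \<zeta> * cnat (Suc k)" if r: "r < cpow \<zeta>" "r' < cpow \<zeta>" for r r' k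
  proof (cases k)
    case 0
    then show ?thesis using add_less_cpow[OF r] by (simp add: abs_cord_OS)
  next
    case (Suc k')
    have k: "cnat k = 1 + cnat k'" using cnat_add[of 1 k'] cnat_Suc0 by (simp add: Suc)
    have "r + (cpow \<zeta> * cnat k + r') = (r + cpow \<zeta>) + (cpow \<zeta> * cnat k' + r')"
      by (simp only: k cord_distrib cord_add_assoc cord_mul_one)
    also have "\<dots> \<le> cpow \<zeta> + (cpow \<zeta> * cnat k' + r')"
      by (rule cord_add_le_mono_left[OF absorb_less_cpow[OF r(1)]])
    also have "\<dots> = cpow \<zeta> * cnat k + r'" by (simp only: k cord_distrib cord_add_assoc cord_mul_one)
    also have "\<dots> < cpow \<zeta> * cnat (Suc k)" using r(2) by (simp add: abs_cord_OS)
    finally show ?thesis .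
  qed
  obtain i' r where x: "i' \<le> i" "r < cpow \<zeta>" "x = cpow \<zeta> * cnat i' + r" using dec[OF assms(1)] by blast
  obtain j' r' where y: "j' \<le> j" "r' < cpow \<zeta>" "y = cpow \<zeta> * cnat j' + r'" using dec[OF assms(2)] by blast
  have "x + y < cpow \<zeta> * cnat i' + cpow \<zeta> * cnat (Suc j')"
    unfolding x(3) y(3) cord_add_assoc using abs[OF x(2) y(2)] by (rule cord_add_less_mono_right)
  also have "\<dots> = cpow \<zeta> * cnat (Suc (i' + j'))" by (simp only: cnat_add[symmetric] cord_distrib[symmetric] add_Suc_right)
  also have "\<dots> \<le> cpow \<zeta> * cnat (Suc (i + j))" using x(1) y(1) by (intro cord_mul_le_mono_right cnat_mono) simp
  finally show ?thesis .
qed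

lemma (in schreier_families) Sc_single: "n \<ge> 1 \<Longrightarrow> {n} \<in> Sc c"
proof (induction c rule: less_induct)
  case (less c)
  show ?case
  proof (cases c rule: cord_cases)
    case 1
    then show ?thesis using less.prems by (simp add: Sc_zero schreier0_def)
  next
    case (2 b)
    have "{n} \<in> Sc b" using less 2 by simp
    then show ?thesis unfolding 2 Sc_suc fam_comp_iff[OF Sc_fin_pos] using less.prems
      by (intro exI[of _ "{{n}}"]) (auto simp: succ_sets_def schreier1_def fin_pos_sets_def)
  next
    case (3 \<eta> \<mu>)
    then have "{n} \<in> Sc (cpow \<eta> * \<mu> + hat \<eta> 1)" using less hat_sum_less by simp
    then show ?thesis unfolding 3(2) Sc_limit[OF 3(1)] using less.prems by (auto intro!: exI[of _ 1])
  qed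
qed

text \<open>Schreier families are in general not monotone in the index. From a multiple of
  \<open>cpow \<zeta>\<close> upwards, within the range of \<open>Sc_add\<close>, inclusion is exact
  because the factor \<open>Sc \<alpha>\<close> contains the singletons.\<close>

lemma (in schreier_families) Sc_multiple_subset:
  assumes "cpow \<zeta> * \<kappa> \<le> c" "c < cpow (csuc \<zeta>)"
  shows "Sc (cpow \<zeta> * \<kappa>) \<subseteq> Sc c"
proof
  obtain \<alpha> where \<alpha>: "c = cpow \<zeta> * \<kappa> + \<alpha>" using cord_le_ex_add[OF assms(1)] by blast
  have "\<alpha> \<le> c" unfolding \<alpha> by (rule cord_le_add2)
  then have "\<alpha> < cpow (csuc \<zeta>)" using assms(2) by (rule order_le_less_trans)
  then have eq: "Sc c = fam_comp (Sc \<alpha>) (Sc (cpow \<zeta> * \<kappa>))" unfolding \<alpha> by (rule Sc_add)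
  fix A assume A: "A \<in> Sc (cpow \<zeta> * \<kappa>)"
  have "A \<in> fam_comp schreier0 (Sc (cpow \<zeta> * \<kappa>))" using A by (simp add: fam_comp_schreier0[OF Sc_fin_pos Sc_empty])
  then obtain \<F> where F: "succ_sets \<F>" "\<F> \<subseteq> Sc (cpow \<zeta> * \<kappa>)" "Min ` \<F> \<in> schreier0" "A = \<Union>\<F>"
    using fam_compE[OF _ Sc_fin_pos] by metis
  have "schreier0 \<subseteq> Sc \<alpha>" using Sc_single Sc_empty by (auto simp: schreier0_def)
  then show "A \<in> Sc c" unfolding eq fam_comp_iff[OF Sc_fin_pos] using F by blast
qed

locale schreier_tsirelson = schreier_families Sc hat + tsirelson_null F0 \<theta> "\<lambda>n. Sc (b n)"
  for Sc hat F0 \<theta> and b :: "nat \<Rightarrow> cord"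
begin

text \<open>Induction on the word. Through \<open>Sc_add\<close> the first letter takes off as many
  copies of \<open>cpow \<zeta>\<close> as \<open>b n\<close> contains, or as are left, and
  \<open>N_adm\<close> pays for them with the weight \<open>\<theta> n\<close>; the remaining word
  treats each group.\<close>

lemma word_bound:
  assumes kk: "\<And>n. n \<ge> 1 \<Longrightarrow> cpow \<zeta> * cnat (kk n) \<le> b n" "\<And>n. n \<ge> 1 \<Longrightarrow> b n < cpow (csuc \<zeta>)"
  shows "\<forall>n\<in>set ns. n \<ge> 1 \<Longrightarrow> a \<le> (\<Sum>n\<leftarrow>ns. kk n) \<Longrightarrow> adm (Sc (cpow \<zeta> * cnat a)) \<E> \<Longrightarrow> x \<in> c00 \<Longrightarrow>
    (\<Prod>n\<leftarrow>ns. \<theta> n) * (\<Sum>E\<in>\<E>. N (restr E x)) \<le> N x"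
proof (induction ns arbitrary: a \<E> x)
  case Nil
  then have "a = 0" by simp
  then have \<E>: "succ_sets \<E>" "Min ` \<E> \<in> schreier0" using Nil.prems(3) by (simp_all add: adm_def Sc_zero)
  then consider "\<E> = {}" | E where "\<E> = {E}"
  proof -
    have "E = E'" if "E \<in> \<E>" "E' \<in> \<E>" for E E'
    proof (rule succ_sets_Min_eq[OF \<E>(1) that])
      obtain n where "Min ` \<E> \<subseteq> {n}" using \<E>(2) unfolding schreier0_def by blast
      then show "Min E = Min E'" using that by blast
    qed
    then show ?thesis using that by blast
  qed
  then show ?case using N_restr[OF Nil.prems(4)] N_nonneg[OF Nil.prems(4)] by cases auto
next
  case (Cons n ns)
  define a1 where "a1 = min a (kk n)"
  define a2 where "a2 = a - a1"
  have a: "a = a2 + a1" "a1 \<le> kk n" "a2 \<le> (\<Sum>n\<leftarrow>ns. kk n)" using Cons.prems(2) by (auto simp: a1_def a2_def)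
  have n: "n \<ge> 1" using Cons.prems(1) by simp
  have lt: "cpow \<zeta> * cnat a1 < cpow (csuc \<zeta>)" by (rule cpow_mul_cnat_less) simp
  have "Sc (cpow \<zeta> * cnat a) = fam_comp (Sc (cpow \<zeta> * cnat a1)) (Sc (cpow \<zeta> * cnat a2))"
    using Sc_add[OF lt, of "cnat a2"] by (simp only: a(1) cnat_add cord_distrib)
  then have S: "succ_sets \<E>" "Min ` \<E> \<in> fam_comp (Sc (cpow \<zeta> * cnat a1)) (Sc (cpow \<zeta> * cnat a2))"
    using Cons.prems(3) by (simp_all add: adm_def)
  obtain \<U> where U: "succ_sets \<U>" "Min ` \<U> \<in> Sc (cpow \<zeta> * cnat a1)" "\<And>E. E \<in> \<E> \<Longrightarrow> \<exists>U\<in>\<U>. E \<subseteq> U"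
    "\<And>U. U \<in> \<U> \<Longrightarrow> Min ` {E\<in>\<E>. E \<subseteq> U} \<in> Sc (cpow \<zeta> * cnat a2) \<and> U = \<Union>{E\<in>\<E>. E \<subseteq> U}"
    using succ_sets_group[OF S Sc_fin_pos] by blast
  have "cpow \<zeta> * cnat a1 \<le> b n"
    using kk(1)[OF n] cnat_mono[OF a(2)] cord_mul_le_mono_right order_trans by blast
  then have "adm (Sc (b n)) \<U>" using U(1,2) Sc_multiple_subset[OF _ kk(2)[OF n]] by (auto simp: adm_def)
  then have 1: "\<theta> n * (\<Sum>U\<in>\<U>. N (restr U x)) \<le> N x" by (rule N_adm[OF Cons.prems(4) n])
  define p where "p = (\<Prod>n\<leftarrow>ns. \<theta> n)"
  have p: "0 < p" unfolding p_def using weights_prod[of ns] Cons.prems(1) by simp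
  have 2: "p * (\<Sum>E | E \<in> \<E> \<and> E \<subseteq> U. N (restr E x)) \<le> N (restr U x)" if "U \<in> \<U>" for U
  proof -
    have "adm (Sc (cpow \<zeta> * cnat a2)) {E \<in> \<E>. E \<subseteq> U}"
      using U(4)[OF that] succ_sets_subset[OF S(1), of "{E \<in> \<E>. E \<subseteq> U}"] by (auto simp: adm_def)
    then have "p * (\<Sum>E | E \<in> \<E> \<and> E \<subseteq> U. N (restr E (restr U x))) \<le> N (restr U x)"
      unfolding p_def using Cons.IH[OF _ a(3)] Cons.prems(1,4) by simp
    moreover have "restr E (restr U x) = restr E x" if "E \<subseteq> U" for E
      using that by (simp add: restr_restr Int_absorb2)
    ultimately show ?thesis by simp
  qed
  have "(\<Sum>E\<in>\<E>. N (restr E x)) = (\<Sum>E\<in>(\<Union>U\<in>\<U>. {E\<in>\<E>. E \<subseteq> U}). N (restr E x))"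
    by (rule sum.cong) (use U(3) in auto)
  also have "\<dots> = (\<Sum>U\<in>\<U>. \<Sum>E\<in>{E\<in>\<E>. E \<subseteq> U}. N (restr E x))"
  proof (rule sum.UNION_disjoint)
    show "\<forall>U\<in>\<U>. \<forall>V\<in>\<U>. U \<noteq> V \<longrightarrow> {E\<in>\<E>. E \<subseteq> U} \<inter> {E\<in>\<E>. E \<subseteq> V} = {}"
      using succ_sets_disjoint[OF U(1)] succ_setsD(3)[OF S(1)] by blast
  qed (use U(1) S(1) in \<open>auto simp: succ_sets_def\<close>)
  finally have "(\<Prod>n\<leftarrow>n # ns. \<theta> n) * (\<Sum>E\<in>\<E>. N (restr E x)) =
      \<theta> n * (\<Sum>U\<in>\<U>. p * (\<Sum>E | E \<in> \<E> \<and> E \<subseteq> U. N (restr E x)))"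
    by (simp add: p_def sum_distrib_left mult.assoc)
  also have "\<dots> \<le> \<theta> n * (\<Sum>U\<in>\<U>. N (restr U x))"
    using 2 \<theta>(1)[OF n] by (intro mult_left_mono sum_mono) auto
  finally show ?case using 1 by linarith
qed

text \<open>\<open>b m\<close> is written as \<open>cpow \<zeta> * cnat a + \<alpha>\<close> with
  \<open>a\<close> at most the number of copies of \<open>cpow \<zeta>\<close> in the word. The
  inner factor is paid for by \<open>word_bound\<close>, as the product of weights is at least
  \<open>\<theta> m / \<epsilon>\<close>; the outer factor \<open>Sc \<alpha>\<close> serves as
  \<O>, with a bound depending on \<open>k0\<close> only.\<close>

lemma splits_of_words:
  assumes kk: "\<And>n. n \<ge> 1 \<Longrightarrow> cpow \<zeta> * cnat (kk n) \<le> b n" "\<And>n. n \<ge> 1 \<Longrightarrow> b n < cpow \<zeta> * cnat (Suc (kk n))"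
    and m: "m \<ge> 1" and \<epsilon>: "0 < \<epsilon>" and ns: "\<forall>n\<in>set ns. n \<ge> 1" "\<theta> m \<le> \<epsilon> * (\<Prod>n\<leftarrow>ns. \<theta> n)"
    and bm: "b m < cpow \<zeta> * cnat (Suc ((\<Sum>n\<leftarrow>ns. kk n) + k0))"
  shows "\<exists>\<O> r. rkfam \<O> r \<and> r < cpow (cpow \<zeta> * cnat (Suc k0)) \<and> splits m \<O> \<epsilon>"
proof -
  define a0 where "a0 = (\<Sum>n\<leftarrow>ns. kk n)"
  have kk': "b n < cpow (csuc \<zeta>)" if "n \<ge> 1" for n
    using kk(2)[OF that] cpow_mul_cnat_less[of \<zeta> "csuc \<zeta>" "Suc (kk n)"] by (meson less_csuc_iff order_less_trans order_refl)
  have "\<exists>a\<le>a0. \<exists>\<alpha><cpow \<zeta> * cnat (Suc k0). b m = cpow \<zeta> * cnat a + \<alpha>"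
  proof (cases "cpow \<zeta> * cnat a0 \<le> b m")
    case True
    then obtain \<alpha> where \<alpha>: "b m = cpow \<zeta> * cnat a0 + \<alpha>" using cord_le_ex_add by blast
    have "cpow \<zeta> * cnat a0 + \<alpha> < cpow \<zeta> * cnat a0 + cpow \<zeta> * cnat (Suc k0)"
      using bm unfolding \<alpha> by (simp only: cnat_add[symmetric] cord_distrib[symmetric] add_Suc_right a0_def)
    then have "\<alpha> < cpow \<zeta> * cnat (Suc k0)" by (simp only: cord_add_less_cancel)
    then show ?thesis using \<alpha> by blast
  next
    \<comment> \<open>If \<open>b m\<close> has no more copies than the word offers, all of its own
      copies are split off and the remainder is below \<open>cpow \<zeta>\<close>.\<close>
    case False
    obtain \<alpha> where \<alpha>: "b m = cpow \<zeta> * cnat (kk m) + \<alpha>" using cord_le_ex_add[OF kk(1)[OF m]] by blast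
    have "kk m \<le> a0"
    proof (rule ccontr)
      assume "\<not> kk m \<le> a0"
      then have "cpow \<zeta> * cnat a0 \<le> cpow \<zeta> * cnat (kk m)" by (intro cord_mul_le_mono_right cnat_mono) simp
      then show False using False kk(1)[OF m] order_trans by blast
    qed
    have "cpow \<zeta> * cnat (kk m) + \<alpha> < cpow \<zeta> * cnat (kk m) + cpow \<zeta>"
      using kk(2)[OF m] unfolding \<alpha> by (simp only: cnat_Suc cord_mul_suc)
    then have "\<alpha> < cpow \<zeta>" by (simp only: cord_add_less_cancel)
    also have "cpow \<zeta> \<le> cpow \<zeta> * cnat (Suc k0)" by (simp only: cnat_Suc cord_mul_suc cord_le_add2)
    finally show ?thesis using \<alpha> \<open>kk m \<le> a0\<close> by blast
  qed
  then obtain a \<alpha> where a: "a \<le> a0" "\<alpha> < cpow \<zeta> * cnat (Suc k0)" "b m = cpow \<zeta> * cnat a + \<alpha>" by blast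
  have "\<alpha> \<le> b m" unfolding a(3) by (rule cord_le_add2)
  then have "\<alpha> < cpow (csuc \<zeta>)" using kk'[OF m] by (rule order_le_less_trans)
  then have eq: "Sc (b m) = fam_comp (Sc \<alpha>) (Sc (cpow \<zeta> * cnat a))" unfolding a(3) by (rule Sc_add)
  have "splits m (Sc \<alpha>) \<epsilon>"
    unfolding splits_def
  proof (intro allI impI)
    fix \<E> assume "adm (Sc (b m)) \<E>"
    then have S: "succ_sets \<E>" "Min ` \<E> \<in> fam_comp (Sc \<alpha>) (Sc (cpow \<zeta> * cnat a))" by (simp_all add: adm_def eq)
    obtain \<U> where U: "succ_sets \<U>" "Min ` \<U> \<in> Sc \<alpha>" "\<And>E. E \<in> \<E> \<Longrightarrow> \<exists>U\<in>\<U>. E \<subseteq> U"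
      "\<And>U. U \<in> \<U> \<Longrightarrow> Min ` {E\<in>\<E>. E \<subseteq> U} \<in> Sc (cpow \<zeta> * cnat a) \<and> U = \<Union>{E\<in>\<E>. E \<subseteq> U}"
      using succ_sets_group[OF S Sc_fin_pos] by blast
    have "\<theta> m * (\<Sum>E | E \<in> \<E> \<and> E \<subseteq> U. N (restr E x)) \<le> \<epsilon> * N x" if Ux: "U \<in> \<U>" "x \<in> c00" for U x
    proof -
      have "adm (Sc (cpow \<zeta> * cnat a)) {E\<in>\<E>. E \<subseteq> U}"
        using U(4)[OF Ux(1)] succ_sets_subset[OF S(1), of "{E \<in> \<E>. E \<subseteq> U}"] by (auto simp: adm_def)
      then have "(\<Prod>n\<leftarrow>ns. \<theta> n) * (\<Sum>E | E \<in> \<E> \<and> E \<subseteq> U. N (restr E x)) \<le> N x"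
        using word_bound[of \<zeta> kk ns a "{E\<in>\<E>. E \<subseteq> U}" x] kk(1) kk' ns(1) a(1) Ux(2) by (simp add: a0_def)
      then have "\<epsilon> * ((\<Prod>n\<leftarrow>ns. \<theta> n) * (\<Sum>E | E \<in> \<E> \<and> E \<subseteq> U. N (restr E x))) \<le> \<epsilon> * N x"
        using \<epsilon> by (intro mult_left_mono) auto
      moreover have "\<theta> m * (\<Sum>E | E \<in> \<E> \<and> E \<subseteq> U. N (restr E x)) \<le>
          (\<epsilon> * (\<Prod>n\<leftarrow>ns. \<theta> n)) * (\<Sum>E | E \<in> \<E> \<and> E \<subseteq> U. N (restr E x))"
        using ns(2) Ux(2) N_nonneg by (intro mult_right_mono sum_nonneg) auto
      ultimately show ?thesis by (simp add: mult.assoc)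
    qed
    then show "\<exists>\<F>. adm (Sc \<alpha>) \<F> \<and> (\<forall>E\<in>\<E>. \<exists>F\<in>\<F>. E \<subseteq> F) \<and>
      (\<forall>F\<in>\<F>. \<forall>x\<in>c00. \<theta> m * (\<Sum>E | E \<in> \<E> \<and> E \<subseteq> F. N (restr E x)) \<le> \<epsilon> * N x)"
      using U(1,2,3) by (intro exI[of _ \<U>]) (auto simp: adm_def)
  qed
  moreover have "cpow \<alpha> < cpow (cpow \<zeta> * cnat (Suc k0))" using a(2) by (simp only: cpow_less_iff)
  ultimately show ?thesis using rkfam_Sc by blast
qed

lemma gword_coefficient:
  assumes "\<sigma> < cpow \<zeta> * cnat (Suc i)" "\<And>n. n \<ge> 1 \<Longrightarrow> b n < cpow \<zeta> * cnat (Suc (kk n))" "\<forall>n\<in>set ns. n \<ge> 1"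
  shows "gword \<sigma> b ns < cpow \<zeta> * cnat (Suc (i + (\<Sum>n\<leftarrow>ns. kk n)))"
  using assms(3)
proof (induction ns)
  case (Cons n ns)
  then have "gword \<sigma> b ns < cpow \<zeta> * cnat (Suc (i + (\<Sum>n\<leftarrow>ns. kk n)))" by simp
  from cpow_coefficient_add[OF this assms(2)[of n]] Cons.prems show ?case
    by (simp add: add.commute add.left_commute del: nat_ord.simps)
qed (use assms(1) in simp)

end

text \<open>The choice in \<open>lead_exp\<close> is controlled only through its defining
  inequalities; the ordinal 0, with value 0, is treated separately.\<close>

lemma lead_exp_bounds:
  assumes "\<xi> \<noteq> 0" "abs_cord \<eta> < cpow (cpow \<xi>)"
  shows "abs_cord \<eta> < cpow (csuc (abs_cord (lead_exp \<eta>)))" "abs_cord (lead_exp \<eta>) < cpow \<xi>"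
proof -
  define \<sigma> where "\<sigma> = lead_exp \<eta>"
  have "abs_cord \<eta> < cpow (csuc (abs_cord \<sigma>)) \<and> (abs_cord \<eta> = 0 \<and> abs_cord \<sigma> = 0 \<or> cpow (abs_cord \<sigma>) \<le> abs_cord \<eta>)"
  proof (cases "abs_cord \<eta> = 0")
    case True
    then show ?thesis using cpow_pos[of "csuc 0"] by (simp add: \<sigma>_def lead_exp_def oeq_iff del: cpow_suc)
  next
    case False
    then have eq: "\<sigma> = (SOME \<delta>. ole (opow \<delta>) \<eta> \<and> olt \<eta> (opow (OS \<delta>)))" by (simp add: \<sigma>_def lead_exp_def oeq_iff)
    obtain d where "cpow d \<le> abs_cord \<eta>" "abs_cord \<eta> < cpow (csuc d)" using cpow_bracket[OF False] by blast
    then have "ole (opow (rep_cord d)) \<eta> \<and> olt \<eta> (opow (OS (rep_cord d)))"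
      by (simp add: ole_iff olt_iff abs_opow abs_cord_OS del: opow.simps cpow_suc)
    then have "ole (opow \<sigma>) \<eta> \<and> olt \<eta> (opow (OS \<sigma>))" unfolding eq by (rule someI)
    then show ?thesis by (simp add: ole_iff olt_iff abs_opow abs_cord_OS del: opow.simps cpow_suc)
  qed
  then show "abs_cord \<eta> < cpow (csuc (abs_cord (lead_exp \<eta>)))" "abs_cord (lead_exp \<eta>) < cpow \<xi>"
    using assms(2) cpow_pos[of \<xi>] unfolding \<sigma>_def[symmetric]
    by (metis, metis cpow_less_iff order_le_less_trans)
qed

lemma less_cpow_cpow_ex:
  assumes "s < cpow (cpow \<xi>)" "\<And>e. e < cpow \<xi> \<Longrightarrow> \<exists>n\<ge>1. e < b n"
  shows "\<exists>n\<ge>(1::nat). s < cpow (b n)"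
proof -
  have "cpow \<xi> \<noteq> 0" using cpow_pos[of \<xi>] cord_pos_iff by metis
  then obtain e c where e: "e < cpow \<xi>" "s < cpow e * cnat c" using less_cpow_ex[OF assms(1)] by blast
  obtain n where "n \<ge> 1" "e < b n" using assms(2)[OF e(1)] by blast
  then show ?thesis using order_less_le_trans[OF e(2) cpow_mul_cnat_le] by blast
qed

lemma less_cpow_square_ex:
  assumes "s < cpow (cpow \<xi>) * cpow (cpow \<xi>)" "\<And>e. e < cpow \<xi> \<Longrightarrow> \<exists>n\<ge>1. e < b n"
  shows "\<exists>n\<ge>(1::nat). s < cpow (cpow \<xi>) * cpow (b n)"
proof -
  have s: "s < cpow (cpow \<xi> + cpow \<xi>)" using assms(1) by (simp add: cpow_add)
  have pos: "0 < cpow \<xi>" by (rule cpow_pos)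
  then have "cpow \<xi> + cpow \<xi> \<noteq> 0" using cord_le_add1[of "cpow \<xi>" "cpow \<xi>"] by (metis leD)
  then obtain e c where e: "e < cpow \<xi> + cpow \<xi>" "s < cpow e * cnat c" using less_cpow_ex[OF s] by blast
  have "\<exists>n\<ge>1. e < cpow \<xi> + b n"
    using cord_add_sup_split[OF e(1)]
  proof
    assume "e < cpow \<xi>"
    then have "e < cpow \<xi> + b n" for n using cord_le_add1 order_less_le_trans by blast
    then show ?thesis by blast
  next
    assume "\<exists>z<cpow \<xi>. e = cpow \<xi> + z"
    then show ?thesis using assms(2) by auto
  qed
  then obtain n where n: "n \<ge> 1" "e < cpow \<xi> + b n" by blast
  show ?thesis using order_less_le_trans[OF e(2) cpow_mul_cnat_le[OF n(2)]] n(1) by (auto simp: cpow_add)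
qed

theorem theorem26:
  fixes \<xi> :: bord and \<beta> :: "nat \<Rightarrow> bord" and F0 :: "nat set set"
    and \<theta> :: "nat \<Rightarrow> real" and fs :: "bord \<Rightarrow> nat \<Rightarrow> bord" and S :: "bord \<Rightarrow> nat set set"
  assumes xi_succ: "is_succ_ord \<xi>"
    and beta_mono: "\<forall>n\<ge>1. ole (\<beta> n) (\<beta> (Suc n))"
    and beta_lt: "\<forall>n\<ge>1. olt (\<beta> n) (opow \<xi>)"
    and beta_sup: "\<forall>\<alpha>. olt \<alpha> (opow \<xi>) \<longrightarrow> (\<exists>n\<ge>1. olt \<alpha> (\<beta> n))"
    and F0_reg: "regular_family F0"
    and F0_S0: "schreier0 \<subseteq> F0"
    and alpha0: "olt (cb_index F0) (opow (opow \<xi>))"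
    and theta_range: "\<forall>n\<ge>1. 0 < \<theta> n \<and> \<theta> n < 1"
    and theta_mono: "\<forall>n\<ge>1. \<theta> (Suc n) \<le> \<theta> n"
    and theta_null: "\<theta> \<longlonglongrightarrow> 0"
    and fs: "fund_seqs fs"
    and S: "schreier_system fs S"
  shows "(if (\<exists>\<epsilon>>0. \<forall>\<beta>'. olt \<beta>' (opow \<xi>) \<longrightarrow>
              (\<exists>m\<ge>1. olt (oadd (oadd (gamma (lead_exp (cb_index F0)) \<beta> \<theta> \<epsilon> m) two_ord) \<beta>')
                          (\<beta> m)))
         then Ib_is (tnorm F0 \<theta> (\<lambda>n. S (\<beta> n))) (opow (omul (opow \<xi>) two_ord))
         else Ib_is (tnorm F0 \<theta> (\<lambda>n. S (\<beta> n))) (opow (opow \<xi>)))"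
proof -
  obtain \<zeta> where \<zeta>: "abs_cord \<xi> = csuc \<zeta>" using xi_succ by (auto simp: is_succ_iff)
  have \<xi>0: "abs_cord \<xi> \<noteq> 0" by (metis \<zeta> cord_not_less_zero less_csuc_iff order_refl)
  define X where "X = cpow (abs_cord \<xi>)"
  have absX: "abs_cord (opow \<xi>) = X" by (simp add: abs_opow X_def)
  have X\<zeta>: "X = cpow (csuc \<zeta>)" by (simp only: X_def \<zeta>)
  define b where "b n = abs_cord (\<beta> n)" for n
  have b_less: "b n < X" if "n \<ge> 1" for n using beta_lt that by (simp add: b_def olt_iff absX)
  have b_cofinal: "\<exists>n\<ge>1. e < b n" if "e < X" for e
    using beta_sup[rule_format, of "rep_cord e"] that by (simp add: b_def olt_iff absX)
  have b_mono: "b m \<le> b n" if "1 \<le> m" "m \<le> n" for m n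
    using that(2,1)
  proof (induction rule: dec_induct)
    case (step k)
    then have "b k \<le> b (Suc k)" using beta_mono by (simp add: b_def ole_iff)
    then show ?case using step order_trans by blast
  qed simp
  obtain Sc hat where Sch: "schreier_families Sc hat" and SSc: "\<And>c. S c = Sc (abs_cord c)"
    using schreier_system_cord[OF S fs] by blast
  interpret schreier_families Sc hat by (rule Sch)
  have \<theta>1: "\<theta> n \<le> \<theta> 1" if "n \<ge> 1" for n
    using that
  proof (induction rule: dec_induct)
    case (step k)
    then show ?case using theta_mono by (meson order_trans)
  qed simp
  interpret schreier_tsirelson Sc hat F0 \<theta> b
  proof
    show "F0 \<subseteq> fin_pos_sets" "hereditary F0" "spreading F0" using F0_reg by (auto simp: regular_family_def)
  qed (use F0_S0 Sc_fin_pos Sc_hereditary Sc_spreading Sc_empty theta_range \<theta>1 theta_null in auto)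
  have N_eq: "tnorm F0 \<theta> (\<lambda>n. S (\<beta> n)) = tnorm F0 \<theta> (\<lambda>n. Sc (b n))" by (simp add: SSc b_def)
  define a0 where "a0 = abs_cord (cb_index F0)"
  have a0_less: "a0 < cpow X" using alpha0 by (simp add: a0_def olt_iff abs_opow X_def)
  have F0r: "rkfam F0 a0"
    using regular_rank_exists[OF F0_reg F0_empty] F0 F0_empty unfolding rkfam_def a0_def by force
  define \<sigma> where "\<sigma> = abs_cord (lead_exp (cb_index F0))"
  have \<sigma>: "a0 < cpow (csuc \<sigma>)" "\<sigma> < X"
    using lead_exp_bounds[OF \<xi>0, of "cb_index F0"] a0_less unfolding a0_def \<sigma>_def X_def by auto
  have Gr: "\<exists>c<cpow (abs_cord \<xi>). rkfam (Sc (b n)) (cpow c)" if "n \<ge> 1" for n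
    using rkfam_Sc b_less[OF that] unfolding X_def by blast
  define \<gamma> where "\<gamma> \<epsilon> m = abs_cord (gamma (lead_exp (cb_index F0)) \<beta> \<theta> \<epsilon> m)" for \<epsilon> m
  \<comment> \<open>The condition \<open>\<theta> m < \<epsilon> * \<theta> 1\<close> admits the
    word [1], so the maximum is over a nonempty finite set and \<open>gamma\<close> attains it up to
    \<open>oeq\<close>.\<close>
  have gamma: "(\<exists>ns\<in>words \<theta> (\<theta> m / \<epsilon>). \<gamma> \<epsilon> m = gword \<sigma> b ns) \<and> (\<forall>ns\<in>words \<theta> (\<theta> m / \<epsilon>). ns \<noteq> [] \<longrightarrow> gword \<sigma> b ns \<le> \<gamma> \<epsilon> m) \<and> \<sigma> \<le> \<gamma> \<epsilon> m"
    if \<epsilon>: "\<epsilon> > 0" "\<theta> m < \<epsilon> * \<theta> 1" and m: "m \<ge> 1" for \<epsilon> m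
  proof -
    define \<Gamma> where "\<Gamma> = gamma_set (lead_exp (cb_index F0)) \<beta> \<theta> \<epsilon> m"
    define V where "V = {ns \<in> words \<theta> (\<theta> m / \<epsilon>). ns \<noteq> []}"
    have \<Gamma>: "\<Gamma> = gamma_term (lead_exp (cb_index F0)) \<beta> ` V"
      unfolding \<Gamma>_def gamma_set_def V_def words_def using \<epsilon>(1) by (auto simp: divide_less_eq mult.commute)
    have abs_g: "abs_cord (gamma_term (lead_exp (cb_index F0)) \<beta> ns) = gword \<sigma> b ns" for ns
      by (simp add: abs_gamma_term \<sigma>_def b_def[abs_def])
    have "0 < \<theta> m / \<epsilon>" using \<epsilon>(1) \<theta>(1)[OF m] by simp
    then have finV: "finite V" unfolding V_def using finite_words by simp
    have "[1] \<in> V" using \<epsilon> by (simp add: V_def words_def divide_less_eq mult.commute)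
    then have ne: "gword \<sigma> b ` V \<noteq> {}" by blast
    have "Max (gword \<sigma> b ` V) \<in> gword \<sigma> b ` V" using finV ne by (intro Max_in) auto
    then obtain ns where ns: "ns \<in> V" "Max (gword \<sigma> b ` V) = gword \<sigma> b ns" by (rule imageE) simp
    have ns_max: "gword \<sigma> b ns' \<le> gword \<sigma> b ns" if "ns' \<in> V" for ns'
      using Max_ge[OF finite_imageI[OF finV] imageI[OF that, of "gword \<sigma> b"]] ns(2) by simp
    have "gamma_term (lead_exp (cb_index F0)) \<beta> ns \<in> \<Gamma> \<and> (\<forall>h\<in>\<Gamma>. ole h (gamma_term (lead_exp (cb_index F0)) \<beta> ns))"
      using ns(1) ns_max by (auto simp: \<Gamma> ole_iff abs_g)
    then have "\<exists>g. (\<Gamma> = {} \<and> oeq g OZ) \<or> (g \<in> \<Gamma> \<and> (\<forall>h\<in>\<Gamma>. ole h g))" by blast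
    from someI_ex[OF this] have "gamma (lead_exp (cb_index F0)) \<beta> \<theta> \<epsilon> m \<in> \<Gamma> \<and>
        (\<forall>h\<in>\<Gamma>. ole h (gamma (lead_exp (cb_index F0)) \<beta> \<theta> \<epsilon> m))"
      unfolding gamma_def \<Gamma>_def[symmetric] using \<Gamma> \<open>[1] \<in> V\<close> by blast
    then have g: "\<gamma> \<epsilon> m \<in> gword \<sigma> b ` V" "\<And>ns. ns \<in> V \<Longrightarrow> gword \<sigma> b ns \<le> \<gamma> \<epsilon> m"
      unfolding \<gamma>_def \<Gamma> by (auto simp: ole_iff abs_g)
    have "\<sigma> \<le> gword \<sigma> b ns" for ns
      by (induction ns) (auto intro: order_trans)
    then show ?thesis using g by (auto simp: V_def)
  qed
  have weights_small: "\<exists>p. \<forall>m>p. \<theta> m < c" if "c > 0" for c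
    using order_tendstoD(2)[OF theta_null that] by (auto simp: eventually_sequentially intro: less_imp_le)
  show ?thesis
  proof (cases "\<exists>\<epsilon>>0. \<forall>\<beta>'. olt \<beta>' (opow \<xi>) \<longrightarrow>
              (\<exists>m\<ge>1. olt (oadd (oadd (gamma (lead_exp (cb_index F0)) \<beta> \<theta> \<epsilon> m) two_ord) \<beta>') (\<beta> m))")
    case True
    then obtain \<epsilon> where \<epsilon>: "\<epsilon> > 0" and cond: "\<And>\<beta>'. olt \<beta>' (opow \<xi>) \<Longrightarrow>
      \<exists>m\<ge>1. olt (oadd (oadd (gamma (lead_exp (cb_index F0)) \<beta> \<theta> \<epsilon> m) two_ord) \<beta>') (\<beta> m)" by blast
    then have dagger: "\<exists>m\<ge>1. \<gamma> \<epsilon> m + (1 + 1) + e < b m" if "e < X" for e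
    proof -
      have "olt (rep_cord e) (opow \<xi>)" using that by (simp add: olt_iff absX)
      then obtain m where "m \<ge> 1"
        "olt (oadd (oadd (gamma (lead_exp (cb_index F0)) \<beta> \<theta> \<epsilon> m) two_ord) (rep_cord e)) (\<beta> m)"
        using cond by blast
      then show ?thesis unfolding olt_iff abs_oadd abs_two \<gamma>_def b_def abs_rep_cord by blast
    qed
    have target: "abs_cord (opow (omul (opow \<xi>) two_ord)) = cpow X * cpow X"
      by (simp add: abs_opow abs_omul cord_mul_two cpow_add X_def)
    have "Ib_is N (opow (omul (opow \<xi>) two_ord))"
    proof (rule Ib_is_I)
      fix K :: real assume K: "K \<ge> 1"
      obtain p where p: "\<And>m. m > p \<Longrightarrow> \<theta> m < 1 / (8 * K)" using weights_small[of "1 / (8 * K)"] K by auto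
      \<comment> \<open>For large \<open>m\<close> the weight itself is small enough for the trivial
        splitting, at the price of the full exponent \<eta> = \<open>X\<close>.\<close>
      have "\<exists>\<O> c. rkfam \<O> c \<and> c < cpow X \<and> splits m \<O> (1 / (8 * K))" if "m > p" for m
      proof -
        have m: "m \<ge> 1" using that by simp
        have "splits m (Sc (b m)) (1 / (8 * K))" using splits_mono[OF splits_trivial[OF m]] p[OF that] by simp
        moreover have "cpow (b m) < cpow X" using b_less[OF m] by simp
        ultimately show ?thesis using rkfam_Sc by blast
      qed
      from upper_bound[OF K \<xi>0 F0r a0_less[unfolded X_def] Gr this]
      obtain g where g: "g < X" "\<forall>t. \<not> rk (TK K) (cpow X * cpow g) t" unfolding X_def by blast
      moreover have "cpow X * cpow g \<le> cpow X * cpow X" using g(1) by (intro cord_mul_le_mono_right) simp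
      ultimately show "\<exists>g\<le>abs_cord (opow (omul (opow \<xi>) two_ord)). \<forall>t. \<not> rk (TK K) g t" unfolding target by blast
    next
      fix s assume "s < abs_cord (opow (omul (opow \<xi>) two_ord))"
      then obtain n where n: "n \<ge> 1" "s < cpow X * cpow (b n)"
        unfolding target using less_cpow_square_ex[of s "abs_cord \<xi>" b] b_cofinal unfolding X_def by blast
      obtain p where p: "\<And>m. m > p \<Longrightarrow> \<theta> m < \<epsilon> * \<theta> 1" using weights_small[of "\<epsilon> * \<theta> 1"] \<epsilon> \<theta>(1)[of 1] by auto
      have "\<exists>u. rk (TKq (1 + 1 / \<epsilon>) q) \<rho> [u]" if \<rho>: "\<rho> < cpow X" for q \<rho>
      proof -
        obtain k where k: "k \<ge> 1" "\<rho> < cpow (b k)"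
          using less_cpow_cpow_ex[of \<rho> "abs_cord \<xi>" b] \<rho> b_cofinal unfolding X_def by blast
        \<comment> \<open>The first entry leaves room for the required rank \<rho>, the second
          forces m > p, where \<open>gamma\<close> is a genuine maximum.\<close>
        define e where "e = max (b k) (b (max p 1))"
        have "e < X" using b_less k(1) by (simp add: e_def)
        then obtain m where m: "m \<ge> 1" "\<gamma> \<epsilon> m + (1 + 1) + e < b m" using dagger by blast
        have "e < b m" using m(2) cord_le_add2 order_le_less_trans by blast
        have "m > p"
        proof (rule ccontr)
          assume "\<not> m > p"
          then have "b m \<le> b (max p 1)" using b_mono m(1) by simp
          also have "\<dots> \<le> e" by (simp add: e_def)
          finally show False using \<open>e < b m\<close> by simp
        qed
        note g = gamma[OF \<epsilon> p[OF this] m(1)]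
        define \<tau> where "\<tau> = \<theta> m / \<epsilon>"
        have \<tau>: "0 < \<tau>" using \<epsilon> \<theta>(1)[OF m(1)] by (simp add: \<tau>_def)
        obtain d where d: "\<theta> 1 ^ d \<le> \<tau>" using real_arch_pow_inv[OF \<tau> \<theta>(2)[of 1]] less_imp_le by auto
        obtain W r where W: "rkfam W r" "r < cpow (csuc (\<gamma> \<epsilon> m))"
          "\<And>k x. x \<in> c00 \<Longrightarrow> Nk k x \<le> fam_norm W x + \<tau> * l1norm x"
          using weighted_family[OF F0r \<sigma>(1) rkfam_Sc \<tau> d, of "\<gamma> \<epsilon> m"] g unfolding \<tau>_def by blast
        have NW: "N x \<le> fam_norm W x + \<theta> m / \<epsilon> * l1norm x" if "x \<in> c00" for x
          using N_least[OF W(3)[OF that]] by (simp add: \<tau>_def)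
        \<comment> \<open>The successor demanded by \<open>weighted_family\<close> is taken from the
          summand 2 of the condition.\<close>
        have "csuc (\<gamma> \<epsilon> m) + b k \<le> b m"
        proof -
          have "csuc (\<gamma> \<epsilon> m) + b k = \<gamma> \<epsilon> m + (1 + b k)" by (simp add: csuc_eq cord_add_assoc)
          also have "\<dots> \<le> \<gamma> \<epsilon> m + ((1 + 1) + e)"
            by (intro cord_add_le_mono_right cord_add_mono) (simp_all add: e_def)
          finally show ?thesis using m(2) by (simp add: cord_add_assoc)
        qed
        then have "cpow (csuc (\<gamma> \<epsilon> m)) * cpow (b k) \<le> cpow (b m)" by (simp only: cpow_add[symmetric] cpow_le_iff)
        then have "rk (ltree (Sc (b m)) q) (cpow (csuc (\<gamma> \<epsilon> m)) * cpow (b k)) []" using rk_antimono[OF rk_Sc] by blast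
        from averaged_tree[OF m(1) \<epsilon> W(1,2) NW this k(2)] show ?thesis .
      qed
      moreover have "1 + 1 / \<epsilon> > 0" using \<epsilon> by (simp add: add_pos_pos)
      ultimately obtain u where "rk (TK ((1 + 1 / \<epsilon>) / \<theta> n)) s u"
        using composed_tree[OF n(1) _ _ rk_Sc n(2)] by blast
      moreover have "(1 + 1 / \<epsilon>) / \<theta> n \<ge> 1"
      proof -
        have "\<theta> n \<le> 1 + 1 / \<epsilon>" using \<theta>(2)[OF n(1)] \<epsilon> by (simp add: add_increasing2 less_imp_le)
        then show ?thesis using \<theta>(1)[OF n(1)] by simp
      qed
      ultimately show "\<exists>K\<ge>1. \<exists>t. rk (TK K) s t" by blast
    qed
    then show ?thesis unfolding N_eq using True by simp
  next
    case False
    have target: "abs_cord (opow (opow \<xi>)) = cpow X" by (simp add: abs_opow X_def)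
    have "Ib_is N (opow (opow \<xi>))"
    proof (rule Ib_is_I)
      fix K :: real assume K: "K \<ge> 1"
      \<comment> \<open>The failing condition is used for the \<epsilon> that
        \<open>upper_bound\<close> requires at this \<open>K\<close>; so \<beta>', and with it
        \<eta>, may depend on \<open>K\<close>, but \<eta> stays below \<open>X\<close>.\<close>
      define \<epsilon> where "\<epsilon> = 1 / (8 * K)"
      have \<epsilon>: "\<epsilon> > 0" using K by (simp add: \<epsilon>_def)
      obtain \<beta>' where \<beta>': "olt \<beta>' (opow \<xi>)"
        "\<forall>m\<ge>1. \<not> olt (oadd (oadd (gamma (lead_exp (cb_index F0)) \<beta> \<theta> \<epsilon> m) two_ord) \<beta>') (\<beta> m)"
        using False \<epsilon> by blast
      define e where "e = abs_cord \<beta>'"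
      have e: "e < X" using \<beta>'(1) by (simp add: e_def olt_iff absX)
      have le: "b m \<le> \<gamma> \<epsilon> m + ((1 + 1) + e)" if "m \<ge> 1" for m
        using \<beta>'(2) that by (auto simp: olt_iff abs_oadd abs_two e_def b_def \<gamma>_def cord_add_assoc not_less)
      have coef: "\<exists>k. x < cpow \<zeta> * cnat (Suc k)" if "x < X" for x
      proof -
        have "\<exists>k. x < cpow \<zeta> * cnat k"
          using that unfolding X\<zeta> cpow_suc comega_def cord_mul_sup less_csup_iff .
        then obtain k where "x < cpow \<zeta> * cnat k" by blast
        also have "cpow \<zeta> * cnat k \<le> cpow \<zeta> * cnat (Suc k)" by (intro cord_mul_le_mono_right cnat_mono) simp
        finally show ?thesis by blast
      qed
      have "\<exists>k. cpow \<zeta> * cnat k \<le> b n \<and> b n < cpow \<zeta> * cnat (Suc k)" if n: "n \<ge> 1" for n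
      proof -
        have "b n < cpow \<zeta> * comega" using b_less[OF n] by (simp add: X\<zeta>)
        then obtain z r where z: "z < comega" "r < cpow \<zeta>" "b n = cpow \<zeta> * z + r" using cord_mul_division by blast
        obtain k where "z = cnat k" using less_comega_ex[OF z(1)] by blast
        then show ?thesis using z(2,3) by (intro exI[of _ k]) (simp add: abs_cord_OS)
      qed
      then obtain kk where kk: "\<And>n. n \<ge> 1 \<Longrightarrow> cpow \<zeta> * cnat (kk n) \<le> b n"
        "\<And>n. n \<ge> 1 \<Longrightarrow> b n < cpow \<zeta> * cnat (Suc (kk n))" by metis
      obtain i where i: "\<sigma> < cpow \<zeta> * cnat (Suc i)" using coef[OF \<sigma>(2)] by blast
      have "1 < X" unfolding X_def using \<xi>0 by (metis cord_pos_iff cpow_less_iff cpow_zero)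
      then have "(1 + 1) + e < X" using e unfolding X_def by (intro add_less_cpow)
      then obtain j where j: "(1 + 1) + e < cpow \<zeta> * cnat (Suc j)" using coef by blast
      obtain p where p: "\<And>m. m > p \<Longrightarrow> \<theta> m < \<epsilon> * \<theta> 1" using weights_small[of "\<epsilon> * \<theta> 1"] \<epsilon> \<theta>(1)[of 1] by auto
      \<comment> \<open>The part of \<open>b m\<close> not covered by the letters of a word:
        \<open>i\<close> copies come from the leading exponent for \<open>F0\<close> and
        \<open>j\<close> from 2 + \<beta>', both independent of \<open>m\<close>.\<close>
      define \<eta> where "\<eta> = cpow \<zeta> * cnat (Suc (i + j))"
      have "\<exists>\<O> c. rkfam \<O> c \<and> c < cpow \<eta> \<and> splits m \<O> (1 / (8 * K))" if "m > p" for m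
      proof -
        have m: "m \<ge> 1" using that by simp
        note g = gamma[OF \<epsilon> p[OF that] m]
        obtain ns where ns: "ns \<in> words \<theta> (\<theta> m / \<epsilon>)" "\<gamma> \<epsilon> m = gword \<sigma> b ns"
          using g by blast
        then have ns': "\<forall>n\<in>set ns. n \<ge> 1" "\<theta> m \<le> \<epsilon> * (\<Prod>n\<leftarrow>ns. \<theta> n)"
          using \<epsilon> by (auto simp: words_def divide_less_eq mult.commute less_imp_le)
        have "b m < cpow \<zeta> * cnat (Suc ((i + (\<Sum>n\<leftarrow>ns. kk n)) + j))"
          using le[OF m] cpow_coefficient_add[OF gword_coefficient[OF i kk(2) ns'(1)] j]
          unfolding ns(2) by (rule order_le_less_trans)
        then have "b m < cpow \<zeta> * cnat (Suc ((\<Sum>n\<leftarrow>ns. kk n) + (i + j)))" by (simp only: ac_simps)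
        then show ?thesis unfolding \<eta>_def \<epsilon>_def[symmetric] using splits_of_words[OF kk m \<epsilon> ns'] by blast
      qed
      from upper_bound[OF K \<xi>0 F0r a0_less[unfolded X_def] Gr this]
      obtain g where g: "g < X" "\<forall>t. \<not> rk (TK K) (cpow \<eta> * cpow g) t" unfolding X_def by blast
      have "\<eta> < X" unfolding \<eta>_def X\<zeta> by (rule cpow_mul_cnat_less) simp
      then have "\<eta> + g < X" using g(1) unfolding X_def by (rule add_less_cpow)
      then have "cpow \<eta> * cpow g \<le> cpow X" by (simp only: cpow_add[symmetric] cpow_le_iff less_imp_le)
      then show "\<exists>g\<le>abs_cord (opow (opow \<xi>)). \<forall>t. \<not> rk (TK K) g t" unfolding target using g(2) by blast
    next
      fix s assume "s < abs_cord (opow (opow \<xi>))"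
      then obtain n where n: "n \<ge> 1" "s < cpow (b n)"
        unfolding target using less_cpow_cpow_ex[of s "abs_cord \<xi>" b] b_cofinal unfolding X_def by blast
      have "1 / \<theta> n \<ge> 1" using \<theta>[OF n(1)] by simp
      then show "\<exists>K\<ge>1. \<exists>t. rk (TK K) s t" using unit_vector_tree[OF n(1) rk_Sc n(2)] by blast
    qed
    then show ?thesis unfolding N_eq using False by (simp only: if_False)
  qed
qed

end
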